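(* Let $m\in\frac12\mathbb{Z}_{>0}$ and $s,s'\in\frac12\mathbb{Z}$. Suppose that $m>\frac12$, and that, if $m=1$, at least one of $s,s'$ is not an integer. Then $$\mathcal{F}^{[m;s,s']}=\mathbb{C}\,\tilde\varphi^{+[m,s]}\ \text{ if } s'\in\mathbb{Z},\qquad \mathcal{F}^{[m;s,s']}=\mathbb{C}\,\tilde\varphi^{-[m,s]}\ \text{ if } s'\in\tfrac12+\mathbb{Z}.$$
   Context: **Domain and theta functions.** $X=\{(\tau,u,v,t)\in\mathbb{C}^4 : \operatorname{Im}\tau>0\}$, $q=e^{2\pi i\tau}$, $q^r=e^{2\pi i r\tau}$, $y=\operatorname{Im}\tau$. For $m\in\frac12\mathbb{Z}_{>0}$, $j\in\frac12\mathbb{Z}$, $$\Theta^{\pm}_{j,m}(\tau,z)=\sum_{n\in\mathbb{Z}}(\pm1)^n q^{m(n+\frac{j}{2m})^2}e^{2\pi i m(n+\frac{j}{2m})z},\qquad \vartheta_{11}(\tau,z)=i\,\Theta^-_{\frac12,\frac12}(\tau,2z).$$ **Differential operators.** Write $v=a\tau-b$ with $a,b\in\mathbb{R}$, so $a=\operatorname{Im}v/\operatorname{Im}\tau=\frac{v-\bar v}{\tau-\bar\tau}$. The partial derivatives $\partial/\partial\tau,\partial/\partial\bar\tau,\partial/\partial v,\partial/\partial\bar v$ are with respect to the coordinates $(\tau,\bar\tau,v,\bar v)$; $D_{\bar\tau}$ is the partial derivative with respect to $\bar\tau$ in the coordinates $(\tau,\bar\tau,a,b)$, i.e. $D_{\bar\tau}=\frac{\partial}{\partial\bar\tau}+a\frac{\partial}{\partial\bar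 v}$. Put $$D=4\frac{\partial}{\partial t}\frac{\partial}{\partial\tau}+\Big(\frac{\partial}{\partial v}\Big)^2-\Big(\frac{\partial}{\partial u}\Big)^2,\quad \bar D=4\frac{\partial}{\partial t}D_{\bar\tau}+\Big(\frac{\partial}{\partial\bar v}\Big)^2,\quad \Delta=2a\frac{\partial}{\partial t}\frac{\partial}{\partial\bar v}-\frac{\partial}{\partial v}\frac{\partial}{\partial\bar v}.$$ **The space $\mathcal{F}^{[m;s,s']}$** ($m\in\frac12\mathbb{Z}_{>0}$, $s,s'\in\frac12\mathbb{Z}$) is the vector space of functions $F(\tau,u,v,t)$ on $X$ (possibly singular along the zeros of $\vartheta_{11}(\tau,v-u)\vartheta_{11}(\tau,v+u)$, as allowed by (F2)) such that: (F1) $F(\tau,u,v,t)=e^{2\pi i m t}F(\tau,u,v,0)$; (F2) $\vartheta_{11}(\tau,v-u)\vartheta_{11}(\tau,v+u)F(\tau,u,v,t)$ is holomorphic in $u$ and real analytic in $\tau$ and $v$; and $\frac{\partial F}{\partial\bar v}$ is (extends to) a real analytic function in all variables; (F3) for all $j,k\in\mathbb{Z}$: (i) $F(\tau,u+j,v+k,t)=e^{2\pi i s(j+k)}F(\tau,u,v,t)$; (ii) $F(\tau,u+j\tau,v+k\tau,t)=e^{2\pi i(s'(j+k)+2m(kv-ju))}q^{m(k^2-j^2)}F(\tau,u,v,t)$; (F4) for all $k\in\mathbb{Z}$: (i) $F(\tau,u+\frac{k}{2m},v+\frac{k}{2m},t)=F(\tau,u,v,t)$; (ii) $F(\tau,u+\frac{k\tau}{2m},v+\frac{k\tau}{2m},t)=e^{2\pi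 i k(v-u)}F(\tau,u,v,t)$; (F5) $DF=0$, $\bar DF=0$, $\Delta F=0$. **Modified mock theta functions.** For $m\in\frac12\mathbb{Z}_{>0}$, $s\in\frac12\mathbb{Z}$ let $$\Phi^{\pm[m,s]}(\tau,z_1,z_2,t)=e^{2\pi i mt}\sum_{n\in\mathbb{Z}}(\pm1)^n\frac{q^{mn^2+ns}e^{2\pi i(mn(z_1+z_2)+sz_1)}}{1-e^{2\pi i z_1}q^n}.$$ Let $E(x)=2\int_0^x e^{-\pi w^2}dw$ for $x\in\mathbb{R}$, $\psi_{m,n}(\tau,z)=\big(n-2m\frac{\operatorname{Im}z}{\operatorname{Im}\tau}\big)\sqrt{\operatorname{Im}\tau/m}$, and for $j\in\frac12\mathbb{Z}$ $$R^{\pm}_{j,m}(\tau,z)=\sum_{n\in\frac12\mathbb{Z},\ n\equiv j\bmod 2m}(\pm1)^{\frac{n-j}{2m}}\Big(\operatorname{sign}(n-\tfrac12-j+2m)-E(\psi_{m,n}(\tau,z))\Big)e^{-\frac{\pi i n^2}{2m}\tau+2\pi i nz},$$ where $n\equiv j \bmod 2m$ means $n-j\in2m\mathbb{Z}$. Put $$\Phi^{\pm[m,s]}_{\mathrm{add}}(\tau,z_1,z_2,t)=e^{2\pi i mt}\sum_{j\in s+\mathbb{Z},\ s\le j<s+2m}R^{\pm}_{j,m}\Big(\tau,\frac{z_1-z_2}{2}\Big)\Theta^{\pm}_{j,m}(\tau,z_1+z_2),$$ $\tilde\Phi^{\pm[m,s]}=\Phi^{\pm[m,s]}-\frac12\Phi^{\pm[m,s]}_{\mathrm{add}}$,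 and $\tilde\varphi^{\pm[m,s]}(\tau,u,v,t)=\tilde\Phi^{\pm[m,s]}(\tau,v-u,-v-u,t)$. *)

theory Defs
  imports "HOL-Analysis.Analysis"
begin

definition half_ints :: "real set" where
  "half_ints = {x. 2 * x \<in> \<int>}"

definition qpow :: "complex \<Rightarrow> real \<Rightarrow> complex" where
  "qpow \<tau> r = exp (2 * of_real pi * \<i> * of_real r * \<tau>)"

definition e2pi :: "complex \<Rightarrow> complex" where
  "e2pi z = exp (2 * of_real pi * \<i> * z)"

definition X :: "(complex \<times> complex \<times> complex \<times> complex) set" where
  "X = {(\<tau>, u, v, t). Im \<tau> > 0}"


section \<open>Theta functions\<close>

text \<open>The superscript \<open>\<plusminus>\<close> of the paper is the parameter \<open>\<epsilon>\<close>, which is only used with the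
  values \<open>1\<close> and \<open>-1\<close>.\<close>

definition Theta :: "complex \<Rightarrow> real \<Rightarrow> real \<Rightarrow> complex \<Rightarrow> complex \<Rightarrow> complex" where
  "Theta \<epsilon> j m \<tau> z =
     (\<Sum>\<^sub>\<infinity>n\<in>(UNIV :: int set). \<epsilon> powi n * qpow \<tau> (m * (of_int n + j / (2 * m))\<^sup>2)
        * e2pi (of_real (m * (of_int n + j / (2 * m))) * z))"

definition theta11 :: "complex \<Rightarrow> complex \<Rightarrow> complex" where
  "theta11 \<tau> z = \<i> * Theta (-1) (1/2) (1/2) \<tau> (2 * z)"

text \<open>The part of \<open>X\<close> on which elements of the function space are genuine functions. It is not
  invariant under the shifts \<open>(u, v) \<mapsto> (u + k/(2m), v + k/(2m))\<close> of condition (F4).\<close>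

definition regular :: "(complex \<times> complex \<times> complex \<times> complex) set" where
  "regular = {(\<tau>, u, v, t). (\<tau>, u, v, t) \<in> X \<and> theta11 \<tau> (v - u) * theta11 \<tau> (v + u) \<noteq> 0}"


section \<open>Real analyticity and differential operators\<close>

text \<open>Local expansion into an unconditionally convergent multivariate power series in the real
  coordinates; \<open>\<alpha>\<close> ranges over multi-indices. Intended for open \<open>S\<close>.\<close>

definition real_analytic_on :: "('a::euclidean_space \<Rightarrow> 'b::real_normed_vector) \<Rightarrow> 'a set \<Rightarrow> bool"
  where
  "real_analytic_on f S \<longleftrightarrow>
     (\<forall>x\<in>S. \<exists>r>0. \<exists>c :: ('a \<Rightarrow> nat) \<Rightarrow> 'b. \<forall>y\<in>ball x r.
        ((\<lambda>\<alpha>. (\<Prod>b\<in>Basis. ((y - x) \<bullet> b) ^ \<alpha> b) *\<^sub>R c \<alpha>) has_sum f y)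
          (Basis \<rightarrow>\<^sub>E (UNIV :: nat set)))"

text \<open>Wirtinger derivatives \<open>(\<partial>\<^sub>x - i\<partial>\<^sub>y)/2\<close> and \<open>(\<partial>\<^sub>x + i\<partial>\<^sub>y)/2\<close> of a real differentiable function.\<close>

definition wirt :: "(complex \<Rightarrow> complex) \<Rightarrow> complex \<Rightarrow> complex" where
  "wirt f z = (frechet_derivative f (at z) 1 - \<i> * frechet_derivative f (at z) \<i>) / 2"

definition wirt_bar :: "(complex \<Rightarrow> complex) \<Rightarrow> complex \<Rightarrow> complex" where
  "wirt_bar f z = (frechet_derivative f (at z) 1 + \<i> * frechet_derivative f (at z) \<i>) / 2"

type_synonym fun4 = "complex \<Rightarrow> complex \<Rightarrow> complex \<Rightarrow> complex \<Rightarrow> complex"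

definition d_tau :: "fun4 \<Rightarrow> fun4" where
  "d_tau F \<tau> u v t = wirt (\<lambda>w. F w u v t) \<tau>"

definition d_taubar :: "fun4 \<Rightarrow> fun4" where
  "d_taubar F \<tau> u v t = wirt_bar (\<lambda>w. F w u v t) \<tau>"

definition d_v :: "fun4 \<Rightarrow> fun4" where
  "d_v F \<tau> u v t = wirt (\<lambda>w. F \<tau> u w t) v"

definition d_vbar :: "fun4 \<Rightarrow> fun4" where
  "d_vbar F \<tau> u v t = wirt_bar (\<lambda>w. F \<tau> u w t) v"

text \<open>At regular points, functions in the space are holomorphic in \<open>u\<close> and \<open>t\<close>, hence the complex derivative.\<close>

definition d_u :: "fun4 \<Rightarrow> fun4" where
  "d_u F \<tau> u v t = deriv (\<lambda>w. F \<tau> w v t) u"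

definition d_t :: "fun4 \<Rightarrow> fun4" where
  "d_t F \<tau> u v t = deriv (\<lambda>w. F \<tau> u v w) t"

text \<open>Writing \<open>v = a\<tau> - b\<close> with real \<open>a\<close>, \<open>b\<close>, one has \<open>a = Im v / Im \<tau>\<close>. The operator \<open>Dtaubar\<close>
  is the derivative with respect to the conjugate of \<open>\<tau>\<close> at constant \<open>a\<close> and \<open>b\<close>.\<close>

definition acoord :: "complex \<Rightarrow> complex \<Rightarrow> complex" where
  "acoord \<tau> v = of_real (Im v / Im \<tau>)"

definition Dtaubar :: "fun4 \<Rightarrow> fun4" where
  "Dtaubar F \<tau> u v t = d_taubar F \<tau> u v t + acoord \<tau> v * d_vbar F \<tau> u v t"

definition opD :: "fun4 \<Rightarrow> fun4" where
  "opD F \<tau> u v t =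
     4 * d_t (d_tau F) \<tau> u v t + d_v (d_v F) \<tau> u v t - d_u (d_u F) \<tau> u v t"

definition opDbar :: "fun4 \<Rightarrow> fun4" where
  "opDbar F \<tau> u v t = 4 * d_t (Dtaubar F) \<tau> u v t + d_vbar (d_vbar F) \<tau> u v t"

definition opDelta :: "fun4 \<Rightarrow> fun4" where
  "opDelta F \<tau> u v t =
     2 * acoord \<tau> v * d_t (d_vbar F) \<tau> u v t - d_v (d_vbar F) \<tau> u v t"


section \<open>The space of functions\<close>

definition F1 :: "real \<Rightarrow> fun4 \<Rightarrow> bool" where
  "F1 m F \<longleftrightarrow>
     (\<forall>\<tau> u v t. (\<tau>, u, v, t) \<in> regular \<longrightarrow> F \<tau> u v t = e2pi (of_real m * t) * F \<tau> u v 0)"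

text \<open>Both parts assert the existence of an extension from the regular points to all of \<open>X\<close>.\<close>

definition F2 :: "fun4 \<Rightarrow> bool" where
  "F2 F \<longleftrightarrow>
     (\<exists>G :: fun4.
        (\<forall>\<tau> u v t. (\<tau>, u, v, t) \<in> regular \<longrightarrow>
           G \<tau> u v t = theta11 \<tau> (v - u) * theta11 \<tau> (v + u) * F \<tau> u v t) \<and>
        (\<forall>\<tau> v t. Im \<tau> > 0 \<longrightarrow> (\<lambda>u. G \<tau> u v t) holomorphic_on UNIV) \<and>
        real_analytic_on (\<lambda>(\<tau>, u, v, t). G \<tau> u v t) X) \<and>
     (\<exists>H :: fun4.
        (\<forall>\<tau> u v t. (\<tau>, u, v, t) \<in> regular \<longrightarrow> H \<tau> u v t = d_vbar F \<tau> u v t) \<and>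
        real_analytic_on (\<lambda>(\<tau>, u, v, t). H \<tau> u v t) X)"

definition F3 :: "real \<Rightarrow> real \<Rightarrow> real \<Rightarrow> fun4 \<Rightarrow> bool" where
  "F3 m s s' F \<longleftrightarrow>
     (\<forall>\<tau> u v t. \<forall>j k :: int. (\<tau>, u, v, t) \<in> regular \<longrightarrow>
        F \<tau> (u + of_int j) (v + of_int k) t
          = e2pi (of_real (s * of_int (j + k))) * F \<tau> u v t \<and>
        F \<tau> (u + of_int j * \<tau>) (v + of_int k * \<tau>) t
          = e2pi (of_real (s' * of_int (j + k)) + 2 * of_real m * (of_int k * v - of_int j * u))
            * qpow \<tau> (m * of_int (k\<^sup>2 - j\<^sup>2)) * F \<tau> u v t)"

text \<open>Equalities of possibly singular functions are required wherever both sides are defined.\<close>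

definition F4 :: "real \<Rightarrow> fun4 \<Rightarrow> bool" where
  "F4 m F \<longleftrightarrow>
     (\<forall>\<tau> u v t. \<forall>k :: int. (\<tau>, u, v, t) \<in> regular \<longrightarrow>
        (let h = of_real (of_int k / (2 * m)) in
           (\<tau>, u + h, v + h, t) \<in> regular \<longrightarrow> F \<tau> (u + h) (v + h) t = F \<tau> u v t) \<and>
        (let h = of_real (of_int k / (2 * m)) * \<tau> in
           (\<tau>, u + h, v + h, t) \<in> regular \<longrightarrow>
             F \<tau> (u + h) (v + h) t = e2pi (of_int k * (v - u)) * F \<tau> u v t))"

definition F5 :: "fun4 \<Rightarrow> bool" where
  "F5 F \<longleftrightarrow>
     (\<forall>\<tau> u v t. (\<tau>, u, v, t) \<in> regular \<longrightarrow>
        opD F \<tau> u v t = 0 \<and> opDbar F \<tau> u v t = 0 \<and> opDelta F \<tau> u v t = 0)"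

text \<open>A function on the regular points is represented by its extension by \<open>0\<close>, so that two
  elements of the space are equal iff they agree at all regular points.\<close>

definition restrict_regular :: "fun4 \<Rightarrow> fun4" where
  "restrict_regular F = (\<lambda>\<tau> u v t. if (\<tau>, u, v, t) \<in> regular then F \<tau> u v t else 0)"

definition Fspace :: "real \<Rightarrow> real \<Rightarrow> real \<Rightarrow> fun4 set" where
  "Fspace m s s' =
     {F. F = restrict_regular F \<and> F1 m F \<and> F2 F \<and> F3 m s s' F \<and> F4 m F \<and> F5 F}"

definition complex_line :: "fun4 \<Rightarrow> fun4 set" where
  "complex_line \<phi> = range (\<lambda>c :: complex. restrict_regular (\<lambda>\<tau> u v t. c * \<phi> \<tau> u v t))"


section \<open>Modified mock theta functions\<close>

definition Phi :: "complex \<Rightarrow> real \<Rightarrow> real \<Rightarrow> fun4" where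
  "Phi \<epsilon> m s \<tau> z1 z2 t =
     e2pi (of_real m * t) *
     (\<Sum>\<^sub>\<infinity>n\<in>(UNIV :: int set). \<epsilon> powi n *
        (qpow \<tau> (m * (of_int n)\<^sup>2 + of_int n * s)
          * e2pi (of_real (m * of_int n) * (z1 + z2) + of_real s * z1))
        / (1 - e2pi z1 * qpow \<tau> (of_int n)))"

text \<open>The interval integral is oriented, so this is the paper's function for negative \<open>x\<close> too.\<close>

definition E :: "real \<Rightarrow> real" where
  "E x = 2 * (LBINT w=ereal 0..ereal x. exp (- pi * w\<^sup>2))"

definition psi :: "real \<Rightarrow> real \<Rightarrow> complex \<Rightarrow> complex \<Rightarrow> real" where
  "psi m n \<tau> z = (n - 2 * m * (Im z / Im \<tau>)) * sqrt (Im \<tau> / m)"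

text \<open>On the index set the argument of the floor function is an integer.\<close>

definition R :: "complex \<Rightarrow> real \<Rightarrow> real \<Rightarrow> complex \<Rightarrow> complex \<Rightarrow> complex" where
  "R \<epsilon> j m \<tau> z =
     (\<Sum>\<^sub>\<infinity>n\<in>{n. n \<in> half_ints \<and> (n - j) / (2 * m) \<in> \<int>}.
        \<epsilon> powi \<lfloor>(n - j) / (2 * m)\<rfloor>
        * of_real (sgn (n - 1/2 - j + 2 * m) - E (psi m n \<tau> z))
        * exp (- (of_real (pi * n\<^sup>2 / (2 * m)) * \<i> * \<tau>) + of_real (2 * pi * n) * \<i> * z))"

definition Phi_add :: "complex \<Rightarrow> real \<Rightarrow> real \<Rightarrow> fun4" where
  "Phi_add \<epsilon> m s \<tau> z1 z2 t =
     e2pi (of_real m * t) *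
     (\<Sum>j\<in>{j. j - s \<in> \<int> \<and> s \<le> j \<and> j < s + 2 * m}.
        R \<epsilon> j m \<tau> ((z1 - z2) / 2) * Theta \<epsilon> j m \<tau> (z1 + z2))"

definition Phi_tilde :: "complex \<Rightarrow> real \<Rightarrow> real \<Rightarrow> fun4" where
  "Phi_tilde \<epsilon> m s \<tau> z1 z2 t = Phi \<epsilon> m s \<tau> z1 z2 t - 1/2 * Phi_add \<epsilon> m s \<tau> z1 z2 t"

definition phi_tilde :: "complex \<Rightarrow> real \<Rightarrow> real \<Rightarrow> fun4" where
  "phi_tilde \<epsilon> m s \<tau> u v t = Phi_tilde \<epsilon> m s \<tau> (v - u) (- v - u) t"

end

theory Submission
 imports Defs "HOL-Complex_Analysis.Complex_Analysis" "HOL-Probability.Distributions"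
begin

text \<open>Existence. The terms of the Appell-Lerch sum \<open>Phi\<close> have the form g(v - u +
  n tau) times an exponential, and the terms of \<open>Phi_add\<close> are error functions times
  exponentials. A direct computation shows that each such term is annihilated by the three operators
  of (F5) (\<open>H_term_solves\<close>, \<open>E_term_solves\<close>). Both series converge
  normally on complexified neighbourhoods, \<open>Phi\<close> after multiplication by theta11(v - u)
  where it has poles, so the sums are real analytic and may be differentiated term by term
  (\<open>normal_ra_frechet\<close>, \<open>solves_fsum\<close>). Most shift laws hold for both
  parts separately. Only under the joint shift of u and v by tau/(2m) does each part leave an extra
  multiple of \<open>Theta\<close> with index s - 1, and these cancel in \<open>Phi\<close> - 1/2
  \<open>Phi_add\<close> (\<open>PhiF_shift_tau\<close>, \<open>AddF_shift_tau\<close>). This gives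
  \<open>scaled_phi_in_Fspace\<close>.

  Uniqueness, tau and t = 0 being fixed. Let G extend theta11(v - u) theta11(v + u) F and let H
  extend dF/dvbar. On the lines v = u and v = -u the function G is entire in v. (F3) and (F4) make
  G(z/2, z/2) a multiple of theta11(z) (\<open>N_eq\<close>) and make G(-z/2, z/2) vanish
  (\<open>K_eq\<close>); the second claim is where m = 1 with s and s' both integral must be
  excluded. For phi tilde the diagonal value is a nonzero multiple of theta11(2v)
  (\<open>phiG_diag\<close>), so for a suitable r the difference f = F - r phi has no poles in v for
  generic u. Then f is a continuous section of a line bundle of degree -2m on the elliptic curve
  with periods 1 and tau. Writing H for df/dvbar, the equation Delta f = 0 says that cnj(H) exp(4 pi
  m (Im v)^2 / Im tau) is holomorphic in v. Its product with f is doubly periodic and has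
  vbar-derivative |H|^2 exp(4 pi m (Im v)^2 / Im tau) >= 0. By Stokes the integral of this over a
  period parallelogram is 0, hence H = 0 (\<open>H_zero\<close>). So f is a holomorphic section of a
  bundle of negative degree and vanishes by Liouville (\<open>G_zero\<close>).

  Dependence on tau. Now F = r(tau) phi on all regular points. Since D and Dbar annihilate both F
  and phi, both Wirtinger derivatives of r vanish (\<open>scaling_factor_deriv\<close>), so r is
  constant (\<open>Fspace_eq_line\<close>).\<close>

section \<open>Sums of holomorphic functions and Taylor remainders in one variable\<close>

lemma holomorphic_on_uniform_limit:
 assumes "open A" and lim: "uniform_limit A f g F" and hol: "eventually (\<lambda>n. f n holomorphic_on A) F"
  and "F \<noteq> bot"
 shows "g holomorphic_on A"
proof -
 have "g field_differentiable (at z)" if z: "z \<in> A" for z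
 proof -
  obtain r where r: "r > 0" "cball z r \<subseteq> A" using \<open>open A\<close> z by (meson open_contains_cball)
  have ev: "eventually (\<lambda>n. continuous_on (cball z r) (f n) \<and> f n holomorphic_on ball z r) F" using hol
  proof eventually_elim
   case (elim n)
   have "f n holomorphic_on cball z r" using elim r holomorphic_on_subset by blast
   thus ?case using holomorphic_on_imp_continuous_on holomorphic_on_subset ball_subset_cball by blast
  qed
  have "uniform_limit (cball z r) f g F" using lim r(2) uniform_limit_on_subset by blast
  then have "g holomorphic_on ball z r" using holomorphic_uniform_limit[OF ev _ \<open>F \<noteq> bot\<close>] by blast
  thus ?thesis using r(1) holomorphic_on_imp_differentiable_at by fastforce
 qed
 thus ?thesis by (simp add: \<open>open A\<close> holomorphic_on_open field_differentiable_def)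
qed

lemma holomorphic_on_infsum:
 fixes f :: "'i \<Rightarrow> complex \<Rightarrow> complex"
 assumes "open A" and hol: "\<And>i. i \<in> I \<Longrightarrow> f i holomorphic_on A"
  and le: "\<And>i z. i \<in> I \<Longrightarrow> z \<in> A \<Longrightarrow> norm (f i z) \<le> M i" and M: "M summable_on I"
 shows "(\<lambda>z. \<Sum>\<^sub>\<infinity>i\<in>I. f i z) holomorphic_on A"
proof (rule holomorphic_on_uniform_limit[OF \<open>open A\<close>])
 show "uniform_limit A (\<lambda>J z. \<Sum>i\<in>J. f i z) (\<lambda>z. \<Sum>\<^sub>\<infinity>i\<in>I. f i z) (finite_subsets_at_top I)"
  using le M by (rule Weierstrass_m_test_general)
 show "\<forall>\<^sub>F J in finite_subsets_at_top I. (\<lambda>z. \<Sum>i\<in>J. f i z) holomorphic_on A"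
  by (rule eventually_finite_subsets_at_top_weakI) (use hol in \<open>auto intro!: holomorphic_on_sum\<close>)
qed simp

text \<open>Weierstrass' theorem on derivatives of uniform limits, applied to the net of finite
  partial sums. All termwise differentiation goes back to it through
  \<open>normal_ra_frechet\<close>.\<close>

lemma has_sum_deriv_infsum:
 fixes f :: "'i \<Rightarrow> complex \<Rightarrow> complex"
 assumes "open A" and hol: "\<And>i. i \<in> I \<Longrightarrow> f i holomorphic_on A"
  and le: "\<And>i z. i \<in> I \<Longrightarrow> z \<in> A \<Longrightarrow> norm (f i z) \<le> M i" and M: "M summable_on I"
  and w: "w \<in> A"
 shows "((\<lambda>i. deriv (f i) w) has_sum deriv (\<lambda>z. \<Sum>\<^sub>\<infinity>i\<in>I. f i z) w) I"
proof -
 have "((\<lambda>J. deriv (\<lambda>z. \<Sum>i\<in>J. f i z) w) \<longlongrightarrow> deriv (\<lambda>z. \<Sum>\<^sub>\<infinity>i\<in>I. f i z) w) (finite_subsets_at_top I)"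
 proof (rule deriv_complex_uniform_limit[OF _ _ _ \<open>open A\<close> w])
  show "uniform_limit A (\<lambda>J z. \<Sum>i\<in>J. f i z) (\<lambda>z. \<Sum>\<^sub>\<infinity>i\<in>I. f i z) (finite_subsets_at_top I)"
   using le M by (rule Weierstrass_m_test_general)
  show "\<forall>\<^sub>F J in finite_subsets_at_top I. (\<lambda>z. \<Sum>i\<in>J. f i z) holomorphic_on A"
   by (rule eventually_finite_subsets_at_top_weakI) (use hol in \<open>auto intro!: holomorphic_on_sum\<close>)
 qed simp
 moreover have "\<forall>\<^sub>F J in finite_subsets_at_top I. deriv (\<lambda>z. \<Sum>i\<in>J. f i z) w = (\<Sum>i\<in>J. deriv (f i) w)"
 proof (rule eventually_finite_subsets_at_top_weakI)
  fix J assume J: "finite J" "J \<subseteq> I"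
  have "(f i has_field_derivative deriv (f i) w) (at w)" if "i \<in> J" for i
   using J that hol holomorphic_derivI[OF hol \<open>open A\<close> w] by blast
  thus "deriv (\<lambda>z. \<Sum>i\<in>J. f i z) w = (\<Sum>i\<in>J. deriv (f i) w)" by (intro DERIV_imp_deriv DERIV_sum)
 qed
 ultimately show ?thesis unfolding has_sum_def by (rule Lim_transform_eventually)
qed

text \<open>The Cauchy inequality wants a closed disc, while the bound is only given on the open
  one; it is applied at radii rho < r, and rho tends to r.\<close>

lemma bounded_taylor_coeff_le:
 assumes hol: "f holomorphic_on ball c r" and r: "r > 0"
  and le: "\<And>z. z \<in> ball c r \<Longrightarrow> norm (f z) \<le> M"
 shows "norm ((deriv ^^ k) f c / fact k) \<le> M / r ^ k"
proof -
 have *: "norm ((deriv ^^ k) f c / fact k) \<le> M / rho ^ k" if "0 < rho" "rho < r" for rho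
 proof -
  have sub: "cball c rho \<subseteq> ball c r" using that by auto
  have "norm ((deriv ^^ k) f c) \<le> fact k * M / rho ^ k"
  proof (rule Cauchy_inequality)
   show "f holomorphic_on ball c rho" using hol sub ball_subset_cball holomorphic_on_subset by blast
   show "continuous_on (cball c rho) f" using hol sub holomorphic_on_subset holomorphic_on_imp_continuous_on by blast
   show "norm (f x) \<le> M" if "norm (c - x) = rho" for x using that \<open>rho < r\<close> by (intro le) (auto simp: dist_norm)
  qed fact
  thus ?thesis by (simp add: norm_divide field_simps)
 qed
 have "((\<lambda>rho. M / rho ^ k) \<longlongrightarrow> M / r ^ k) (at_left r)" using r by (intro tendsto_intros) auto
 moreover have "eventually (\<lambda>rho. norm ((deriv ^^ k) f c / fact k) \<le> M / rho ^ k) (at_left r)"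
  using eventually_at_left_real[OF r] by eventually_elim (use * in auto)
 ultimately show ?thesis by (intro tendsto_lowerbound[where F = "at_left r"]) auto
qed

lemma bounded_taylor_has_sum:
 assumes hol: "f holomorphic_on ball c r" and r: "r > 0"
  and le: "\<And>z. z \<in> ball c r \<Longrightarrow> norm (f z) \<le> M" and z: "z \<in> ball c r"
 shows "((\<lambda>k. (deriv ^^ k) f c / fact k * (z - c) ^ k) has_sum f z) UNIV"
proof (rule norm_summable_imp_has_sum)
 show "(\<lambda>k. (deriv ^^ k) f c / fact k * (z - c) ^ k) sums f z" using hol z by (rule holomorphic_power_series)
 have t: "norm (z - c) / r < 1" using z r by (simp add: dist_norm norm_minus_commute)
 show "summable (\<lambda>k. norm ((deriv ^^ k) f c / fact k * (z - c) ^ k))"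
 proof (rule summable_comparison_test')
  show "summable (\<lambda>k. M * (norm (z - c) / r) ^ k)" using t r by (intro summable_mult summable_geometric) auto
  show "norm (norm ((deriv ^^ k) f c / fact k * (z - c) ^ k)) \<le> M * (norm (z - c) / r) ^ k" for k
  proof -
   have "norm ((deriv ^^ k) f c / fact k * (z - c) ^ k) \<le> M / r ^ k * norm (z - c) ^ k" unfolding norm_mult norm_power
    by (intro mult_right_mono bounded_taylor_coeff_le[OF hol r le]) auto
   also have "\<dots> = M * (norm (z - c) / r) ^ k" by (simp add: power_divide)
   finally show ?thesis by simp
  qed
 qed
qed

text \<open>The tail of the power series is dominated by a geometric series of ratio |h|/r <= 1/2,
  whence the factor 2. The explicit rate makes the quotients in \<open>sep_holo_taylor_coeff\<close>
  converge uniformly.\<close>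

lemma bounded_taylor_remainder:
 assumes hol: "f holomorphic_on ball c r" and r: "r > 0"
  and le: "\<And>z. z \<in> ball c r \<Longrightarrow> norm (f z) \<le> M" and h: "norm h \<le> r / 2"
 shows "norm (f (c + h) - (\<Sum>i<n. (deriv ^^ i) f c / fact i * h ^ i)) \<le> 2 * M * (norm h / r) ^ n"
proof -
 define a where "a = (\<lambda>k. (deriv ^^ k) f c / fact k)"
 have "c + h \<in> ball c r" using h r by (simp add: dist_norm)
 from bounded_taylor_has_sum[OF hol r le this]
 have S: "(\<lambda>k. a k * h ^ k) sums f (c + h)" unfolding a_def by (auto dest: has_sum_imp_sums)
 have S': "(\<lambda>k. a (k + n) * h ^ (k + n)) sums (f (c + h) - (\<Sum>i<n. a i * h ^ i))"
  using sums_split_initial_segment[OF S] .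
 define t where "t = norm h / r"
 have t: "0 \<le> t" "t \<le> 1/2" using h r by (auto simp: t_def field_simps)
 have M0: "M \<ge> 0" using le[of c] r norm_ge_zero order_trans by (metis centre_in_ball)
 have b: "norm (a (k + n) * h ^ (k + n)) \<le> M * t ^ n * t ^ k" for k
 proof -
  have "norm (a (k + n) * h ^ (k + n)) \<le> M / r ^ (k + n) * norm h ^ (k + n)" unfolding norm_mult norm_power a_def
   by (intro mult_right_mono bounded_taylor_coeff_le[OF hol r le]) auto
  also have "\<dots> = M * t ^ n * t ^ k" by (simp add: t_def power_divide power_add mult_ac)
  finally show ?thesis .
 qed
 have sg: "(\<lambda>k. M * t ^ n * t ^ k) sums (M * t ^ n * (1 / (1 - t)))" using t by (intro sums_mult geometric_sums) auto
 have "norm (f (c + h) - (\<Sum>i<n. a i * h ^ i)) \<le> (\<Sum>k. M * t ^ n * t ^ k)"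
  unfolding sums_unique[OF S'] using sg by (intro norm_suminf_le b) (rule sums_summable)
 also have "\<dots> = M * t ^ n * (1 / (1 - t))" using sums_unique[OF sg] by simp
 also have "\<dots> \<le> M * t ^ n * 2" using t M0 by (intro mult_left_mono) (auto simp: field_simps)
 finally show ?thesis by (simp add: a_def t_def mult_ac)
qed

section \<open>Separately holomorphic functions on polydiscs\<close>

definition polydisc :: "'v set \<Rightarrow> ('v \<Rightarrow> complex) \<Rightarrow> real \<Rightarrow> ('v \<Rightarrow> complex) set" where
 "polydisc B c r = (\<Pi>\<^sub>E b\<in>B. ball (c b) r)"

text \<open>Every function to which this is applied also carries a bound on the polydisc, and that
  bound replaces joint continuity when the multivariate power series is derived.\<close>

definition sep_holo :: "'v set \<Rightarrow> ('v \<Rightarrow> complex) \<Rightarrow> real \<Rightarrow> (('v \<Rightarrow> complex) \<Rightarrow> complex) \<Rightarrow> bool" where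
 "sep_holo B c r Psi \<longleftrightarrow>
   (\<forall>zeta\<in>polydisc B c r. \<forall>b\<in>B. (\<lambda>z. Psi (zeta(b := z))) holomorphic_on ball (c b) r)"

lemma polydisc_memD: "zeta \<in> polydisc B c r \<Longrightarrow> b \<in> B \<Longrightarrow> zeta b \<in> ball (c b) r" by (auto simp: polydisc_def)

lemma polydisc_upd: "zeta \<in> polydisc B c r \<Longrightarrow> b \<in> B \<Longrightarrow> z \<in> ball (c b) r \<Longrightarrow> zeta(b := z) \<in> polydisc B c r"
 by (auto simp: polydisc_def PiE_def extensional_def)

lemma polydisc_insert: "zeta \<in> polydisc B c r \<Longrightarrow> z \<in> ball (c b) r \<Longrightarrow> zeta(b := z) \<in> polydisc (insert b B) c r"
 by (auto simp: polydisc_def PiE_def extensional_def)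

lemma polydisc_mono: "r' \<le> r \<Longrightarrow> polydisc B c r' \<subseteq> polydisc B c r" unfolding polydisc_def by (intro PiE_mono) auto

lemma sep_holo_mono: "sep_holo B c r Psi \<Longrightarrow> r' \<le> r \<Longrightarrow> sep_holo B c r' Psi"
 unfolding sep_holo_def by (meson holomorphic_on_subset polydisc_mono subset_ball subsetD)

lemma sep_holo_const: "sep_holo B c r (\<lambda>_. k)" by (simp add: sep_holo_def)

lemma sep_holo_coord: "sep_holo B c r (\<lambda>zeta. zeta a)"
proof -
 have "(\<lambda>z. (zeta(b := z)) a) holomorphic_on S" for zeta :: "'a \<Rightarrow> complex" and b S by (cases "a = b") auto
 thus ?thesis by (simp add: sep_holo_def del: fun_upd_apply)
qed

lemma sep_holo_add: "sep_holo B c r f \<Longrightarrow> sep_holo B c r g \<Longrightarrow> sep_holo B c r (\<lambda>zeta. f zeta + g zeta)"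
 by (auto simp: sep_holo_def intro!: holomorphic_intros)

lemma sep_holo_diff: "sep_holo B c r f \<Longrightarrow> sep_holo B c r g \<Longrightarrow> sep_holo B c r (\<lambda>zeta. f zeta - g zeta)"
 by (auto simp: sep_holo_def intro!: holomorphic_intros)

lemma sep_holo_mult: "sep_holo B c r f \<Longrightarrow> sep_holo B c r g \<Longrightarrow> sep_holo B c r (\<lambda>zeta. f zeta * g zeta)"
 by (auto simp: sep_holo_def intro!: holomorphic_intros)

lemma sep_holo_power: "sep_holo B c r f \<Longrightarrow> sep_holo B c r (\<lambda>zeta. f zeta ^ n)"
 by (auto simp: sep_holo_def intro!: holomorphic_intros)

lemma sep_holo_compose:
 assumes f: "sep_holo B c r f" and g: "g holomorphic_on U"
  and sub: "\<And>zeta. zeta \<in> polydisc B c r \<Longrightarrow> f zeta \<in> U"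
 shows "sep_holo B c r (\<lambda>zeta. g (f zeta))" unfolding sep_holo_def
proof (intro ballI)
 fix zeta b assume z: "zeta \<in> polydisc B c r" "b \<in> B"
 have "(\<lambda>z. f (zeta(b := z))) holomorphic_on ball (c b) r" using f z by (simp add: sep_holo_def)
 moreover have "(\<lambda>z. f (zeta(b := z))) ` ball (c b) r \<subseteq> U" using sub[OF polydisc_upd[OF z]] by blast
 ultimately show "(\<lambda>z. g (f (zeta(b := z)))) holomorphic_on ball (c b) r"
  using holomorphic_on_compose_gen[OF _ g] unfolding o_def by blast
qed

lemma sep_holo_exp: "sep_holo B c r f \<Longrightarrow> sep_holo B c r (\<lambda>zeta. exp (f zeta))"
 by (rule sep_holo_compose[where U = UNIV]) (auto intro: holomorphic_intros)

lemma sep_holo_divide: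
 assumes "sep_holo B c r f" "sep_holo B c r g" and nz: "\<And>zeta. zeta \<in> polydisc B c r \<Longrightarrow> g zeta \<noteq> 0"
 shows "sep_holo B c r (\<lambda>zeta. f zeta / g zeta)"
proof -
 have "sep_holo B c r (\<lambda>zeta. inverse (g zeta))"
  by (rule sep_holo_compose[OF assms(2), where U = "- {0}"]) (auto simp: nz intro!: holomorphic_intros)
 from sep_holo_mult[OF assms(1) this] show ?thesis by (simp add: divide_inverse)
qed

lemma sep_holo_prod: "(\<And>i. i \<in> I \<Longrightarrow> sep_holo B c r (f i)) \<Longrightarrow> sep_holo B c r (\<lambda>zeta. \<Prod>i\<in>I. f i zeta)"
 by (auto simp: sep_holo_def intro!: holomorphic_on_prod)

lemma sep_holo_infsum:
 assumes "\<And>i. i \<in> I \<Longrightarrow> sep_holo B c r (Psi i)"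
  and "\<And>i zeta. i \<in> I \<Longrightarrow> zeta \<in> polydisc B c r \<Longrightarrow> norm (Psi i zeta) \<le> M i" and "M summable_on I"
 shows "sep_holo B c r (\<lambda>zeta. \<Sum>\<^sub>\<infinity>i\<in>I. Psi i zeta)" unfolding sep_holo_def
proof (intro ballI)
 fix zeta b assume z: "zeta \<in> polydisc B c r" "b \<in> B"
 show "(\<lambda>z. \<Sum>\<^sub>\<infinity>i\<in>I. Psi i (zeta(b := z))) holomorphic_on ball (c b) r"
 proof (rule holomorphic_on_infsum[OF open_ball _ _ assms(3)])
  show "(\<lambda>z. Psi i (zeta(b := z))) holomorphic_on ball (c b) r" if "i \<in> I" for i
   using assms(1)[OF that] z by (simp add: sep_holo_def)
  show "norm (Psi i (zeta(b := w))) \<le> M i" if "i \<in> I" "w \<in> ball (c b) r" for i w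
   using assms(2) that polydisc_upd[OF z] by blast
 qed
qed

text \<open>Induction on \<open>k\<close>: the coefficient is the limit for h -> 0 of
  \<open>Psi\<close> at \<open>c b + h\<close> minus its Taylor polynomial of degree below
  \<open>k\<close>, divided by h^k. By \<open>bounded_taylor_remainder\<close> the limit is uniform
  in the other coordinates, and each quotient is holomorphic in them by the induction
  hypothesis.\<close>

lemma sep_holo_taylor_coeff:
 assumes sh: "sep_holo (insert b B) c r Psi" and b: "b \<notin> B" and r: "r > 0"
  and le: "\<And>zeta. zeta \<in> polydisc (insert b B) c r \<Longrightarrow> norm (Psi zeta) \<le> M"
 shows "sep_holo B c r (\<lambda>zeta. (deriv ^^ k) (\<lambda>z. Psi (zeta(b := z))) (c b) / fact k)"
proof (induction k rule: less_induct)
 case (less k)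
 define a where "a = (\<lambda>i zeta. (deriv ^^ i) (\<lambda>z. Psi (zeta(b := z))) (c b) / fact i)"
 have hol: "(\<lambda>z. Psi (zeta(b := z))) holomorphic_on ball (c b) r" if "zeta \<in> polydisc B c r" for zeta
  using sh polydisc_insert[OF that, of "c b" b] r unfolding sep_holo_def by fastforce
 have bd: "norm (Psi (zeta(b := z))) \<le> M" if "zeta \<in> polydisc B c r" "z \<in> ball (c b) r" for zeta z
  by (rule le[OF polydisc_insert[OF that]])
 have ds: "dist (c b) (c b + h) = norm h" for h by (simp add: dist_norm)
 show ?case unfolding sep_holo_def
 proof (intro ballI)
  fix zeta b' assume z: "zeta \<in> polydisc B c r" and b': "b' \<in> B"
  define Q where "Q = (\<lambda>h w. (Psi ((zeta(b' := w))(b := c b + h)) - (\<Sum>i<k. a i (zeta(b' := w)) * h ^ i)) / h ^ k)"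
  have "uniform_limit (ball (c b') r) Q (\<lambda>w. a k (zeta(b' := w))) (at 0)"
  proof (rule uniform_limitI)
   fix e :: real assume e: "e > 0"
   define C where "C = 2 * M / r ^ Suc k"
   have M0: "M \<ge> 0" using bd[OF z, of "c b"] r norm_ge_zero order_trans by (metis centre_in_ball)
   then have C0: "C \<ge> 0" using r by (simp add: C_def)
   have "norm (Q h w - a k (zeta(b' := w))) < e"
    if h: "h \<noteq> 0" "norm h < min (r/2) (e / (C + 1))" and w: "w \<in> ball (c b') r" for h w
   proof -
    let ?xi = "zeta(b' := w)"
    have x: "?xi \<in> polydisc B c r" using z b' w by (rule polydisc_upd)
    have "norm (Psi (?xi(b := c b + h)) - (\<Sum>i<Suc k. a i ?xi * h ^ i)) \<le> 2 * M * (norm h / r) ^ Suc k"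
     unfolding a_def using h by (intro bounded_taylor_remainder[OF hol[OF x] r bd[OF x]]) auto
    moreover have "Psi (?xi(b := c b + h)) - (\<Sum>i<Suc k. a i ?xi * h ^ i) = (Q h w - a k ?xi) * h ^ k"
     using h by (simp add: Q_def field_simps)
    ultimately have "norm (Q h w - a k ?xi) * norm h ^ k \<le> (C * norm h) * norm h ^ k"
     by (simp add: norm_mult norm_power power_divide C_def)
    hence "norm (Q h w - a k ?xi) \<le> C * norm h" using h by (simp add: mult_le_cancel_right)
    also have "\<dots> \<le> (C + 1) * norm h" by (simp add: mult_right_mono)
    also have "\<dots> < (C + 1) * (e / (C + 1))" using h C0 by (intro mult_strict_left_mono) auto
    also have "\<dots> = e" using C0 by simp
    finally show ?thesis .
   qed
   moreover have "min (r/2) (e / (C + 1)) > 0" using r e C0 by simp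
   ultimately show "\<forall>\<^sub>F h in at 0. \<forall>w\<in>ball (c b') r. dist (Q h w) (a k (zeta(b' := w))) < e"
    unfolding eventually_at by (intro exI[of _ "min (r/2) (e / (C + 1))"]) (auto simp: dist_norm)
  qed
  moreover have "eventually (\<lambda>h. Q h holomorphic_on ball (c b') r) (at 0)" unfolding eventually_at
  proof (intro exI[of _ r] conjI ballI impI)
   fix h :: complex assume h: "h \<noteq> 0 \<and> dist h 0 < r"
   have nb: "b' \<noteq> b" using b b' by auto
   have "(\<lambda>w. Psi ((zeta(b := c b + h))(b' := w))) holomorphic_on ball (c b') r"
    using sh polydisc_insert[OF z, of "c b + h" b] h b' unfolding sep_holo_def
    by (simp add: dist_norm del: fun_upd_apply)
   moreover have "(\<lambda>w. a i (zeta(b' := w))) holomorphic_on ball (c b') r" if "i < k" for i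
    using less.IH[OF that] z b' unfolding sep_holo_def a_def by blast
   ultimately show "Q h holomorphic_on ball (c b') r"
    unfolding Q_def using h nb by (auto intro!: holomorphic_intros simp: fun_upd_twist)
  qed fact
  ultimately have "(\<lambda>w. a k (zeta(b' := w))) holomorphic_on ball (c b') r"
   by (intro holomorphic_on_uniform_limit) auto
  thus "(\<lambda>w. (deriv ^^ k) (\<lambda>z. Psi ((zeta(b' := w))(b := z))) (c b) / fact k) holomorphic_on ball (c b') r"
   by (simp add: a_def)
 qed
qed

lemma has_sum_PiE_insert:
 assumes "b \<notin> B"
 shows "(f has_sum s) (insert b B \<rightarrow>\<^sub>E (UNIV :: nat set)) \<longleftrightarrow>
  ((\<lambda>(k, alpha). f (alpha(b := k))) has_sum s) (UNIV \<times> (B \<rightarrow>\<^sub>E UNIV))"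
 by (subst PiE_insert_eq, subst has_sum_reindex[OF inj_combinator[OF assms]]) (simp add: o_def case_prod_unfold)

lemma summable_on_PiE_insert:
 assumes "b \<notin> B"
 shows "f summable_on (insert b B \<rightarrow>\<^sub>E (UNIV :: nat set)) \<longleftrightarrow>
  (\<lambda>(k, alpha). f (alpha(b := k))) summable_on (UNIV \<times> (B \<rightarrow>\<^sub>E UNIV))"
 unfolding summable_on_def has_sum_PiE_insert[OF assms] ..

lemma summable_on_multi_geometric:
 fixes t :: "'v \<Rightarrow> real"
 assumes "finite B" and "\<And>b. b \<in> B \<Longrightarrow> 0 \<le> t b \<and> t b < 1"
 shows "(\<lambda>alpha. \<Prod>b\<in>B. t b ^ alpha b) summable_on (B \<rightarrow>\<^sub>E (UNIV :: nat set))" using assms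
proof (induction B)
 case empty
 then show ?case by simp
next
 case (insert b B)
 have eq: "(\<Prod>b'\<in>insert b B. t b' ^ (alpha(b := k)) b') = t b ^ k * (\<Prod>b'\<in>B. t b' ^ alpha b')" for alpha k
 proof -
  have "(\<Prod>b'\<in>B. t b' ^ (alpha(b := k)) b') = (\<Prod>b'\<in>B. t b' ^ alpha b')" using insert.hyps by (intro prod.cong) auto
  thus ?thesis using insert.hyps by simp
 qed
 have s: "(\<lambda>alpha. \<Prod>b\<in>B. t b ^ alpha b) summable_on (B \<rightarrow>\<^sub>E (UNIV :: nat set))" using insert by simp
 have "(\<lambda>(k, alpha). t b ^ k * (\<Prod>b'\<in>B. t b' ^ alpha b')) summable_on (UNIV \<times> (B \<rightarrow>\<^sub>E (UNIV :: nat set)))"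
 proof (rule summable_on_SigmaI)
  show "((\<lambda>y. case (k, y) of (k, alpha) \<Rightarrow> t b ^ k * (\<Prod>b'\<in>B. t b' ^ alpha b')) has_sum
      t b ^ k * infsum (\<lambda>alpha. \<Prod>b\<in>B. t b ^ alpha b) (B \<rightarrow>\<^sub>E (UNIV :: nat set))) (B \<rightarrow>\<^sub>E UNIV)" for k
   using s by (auto intro!: has_sum_cmult_right)
  have "(\<lambda>k. t b ^ k) summable_on (UNIV :: nat set)"
   using insert.prems[of b] by (intro norm_summable_imp_summable_on) (simp add: summable_geometric)
  thus "(\<lambda>k. t b ^ k * infsum (\<lambda>alpha. \<Prod>b\<in>B. t b ^ alpha b) (B \<rightarrow>\<^sub>E (UNIV :: nat set))) summable_on UNIV"
   by (rule summable_on_cmult_left)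
  show "0 \<le> (case (x, y) of (k, alpha) \<Rightarrow> t b ^ k * (\<Prod>b'\<in>B. t b' ^ alpha b'))" for x and y :: "'v \<Rightarrow> nat"
   using insert.prems by (auto intro!: mult_nonneg_nonneg prod_nonneg)
 qed
 then show ?case unfolding summable_on_PiE_insert[OF insert.hyps(2)] eq .
qed

text \<open>Induction on the coordinates: expand in \<open>b\<close>, whose coefficients are
  separately holomorphic in \<open>B\<close> and bounded by M / r^k, and expand those in turn. The
  double series converges absolutely by comparison with a product of geometric series, so it may be
  summed over multi-indices.\<close>

lemma sep_holo_power_series:
 assumes "finite B" and r: "r > 0" and "sep_holo B c r Psi"
  and "\<And>zeta. zeta \<in> polydisc B c r \<Longrightarrow> norm (Psi zeta) \<le> M"
 shows "\<exists>a. (\<forall>alpha\<in>B \<rightarrow>\<^sub>E UNIV. norm (a alpha) \<le> M / r ^ (\<Sum>b\<in>B. alpha b)) \<and>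
   (\<forall>zeta\<in>polydisc B c r. ((\<lambda>alpha. a alpha * (\<Prod>b\<in>B. (zeta b - c b) ^ alpha b)) has_sum Psi zeta)
    (B \<rightarrow>\<^sub>E (UNIV :: nat set)))" using assms(1,3,4)
proof (induction B arbitrary: Psi M)
 case empty
 have "((\<lambda>alpha. Psi (\<lambda>_. undefined)) has_sum Psi (\<lambda>_. undefined)) {\<lambda>_::'a. undefined :: nat}"
  by (rule has_sum_finiteI) auto
 thus ?case using empty(2) by (intro exI[of _ "\<lambda>_. Psi (\<lambda>_. undefined)"]) (simp add: polydisc_def)
next
 case (insert b B)
 define Psic where "Psic = (\<lambda>k zeta. (deriv ^^ k) (\<lambda>z. Psi (zeta(b := z))) (c b) / fact k)"
 have hol: "(\<lambda>z. Psi (zeta(b := z))) holomorphic_on ball (c b) r" if "zeta \<in> polydisc B c r" for zeta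
  using insert.prems(1) polydisc_insert[OF that, of "c b" b] r unfolding sep_holo_def by fastforce
 have bd: "norm (Psi (zeta(b := z))) \<le> M" if "zeta \<in> polydisc B c r" "z \<in> ball (c b) r" for zeta z
  by (rule insert.prems(2)[OF polydisc_insert[OF that]])
 have "\<exists>a. (\<forall>alpha\<in>B \<rightarrow>\<^sub>E UNIV. norm (a alpha) \<le> (M / r ^ k) / r ^ (\<Sum>b\<in>B. alpha b)) \<and>
   (\<forall>zeta\<in>polydisc B c r. ((\<lambda>alpha. a alpha * (\<Prod>b\<in>B. (zeta b - c b) ^ alpha b)) has_sum Psic k zeta)
    (B \<rightarrow>\<^sub>E (UNIV :: nat set)))" for k
 proof (rule insert.IH)
  show "sep_holo B c r (Psic k)" unfolding Psic_def
   using insert.prems insert.hyps(2) r by (intro sep_holo_taylor_coeff) auto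
  show "norm (Psic k zeta) \<le> M / r ^ k" if "zeta \<in> polydisc B c r" for zeta
   unfolding Psic_def by (rule bounded_taylor_coeff_le[OF hol[OF that] r bd[OF that]])
 qed
 then have "\<forall>k. \<exists>a. (\<forall>alpha\<in>B \<rightarrow>\<^sub>E UNIV. norm (a alpha) \<le> (M / r ^ k) / r ^ (\<Sum>b\<in>B. alpha b)) \<and>
   (\<forall>zeta\<in>polydisc B c r. ((\<lambda>alpha. a alpha * (\<Prod>b\<in>B. (zeta b - c b) ^ alpha b)) has_sum Psic k zeta)
    (B \<rightarrow>\<^sub>E (UNIV :: nat set)))" ..
 from choice[OF this] obtain A where
  A': "\<forall>k. (\<forall>alpha\<in>B \<rightarrow>\<^sub>E UNIV. norm (A k alpha) \<le> (M / r ^ k) / r ^ (\<Sum>b\<in>B. alpha b)) \<and>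
   (\<forall>zeta\<in>polydisc B c r. ((\<lambda>alpha. A k alpha * (\<Prod>b\<in>B. (zeta b - c b) ^ alpha b)) has_sum Psic k zeta)
    (B \<rightarrow>\<^sub>E (UNIV :: nat set)))" ..
 have A: "\<And>k alpha. alpha \<in> B \<rightarrow>\<^sub>E UNIV \<Longrightarrow> norm (A k alpha) \<le> (M / r ^ k) / r ^ (\<Sum>b\<in>B. alpha b)"
  and AS: "\<And>k zeta. zeta \<in> polydisc B c r \<Longrightarrow>
    ((\<lambda>alpha. A k alpha * (\<Prod>b\<in>B. (zeta b - c b) ^ alpha b)) has_sum Psic k zeta) (B \<rightarrow>\<^sub>E (UNIV :: nat set))"
  using A' by simp_all
 \<comment> \<open>A multi-index on \<open>insert b B\<close> is split into its entry at
   \<open>b\<close> and its restriction to \<open>B\<close>; the restriction must be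
   \<open>undefined\<close> at \<open>b\<close> to be extensional.\<close>
 define a where "a = (\<lambda>alpha. A (alpha b) (alpha(b := undefined)))"
 have prodB: "(\<Prod>b'\<in>B. g b' ((alpha(b := k)) b')) = (\<Prod>b'\<in>B. g b' (alpha b'))"
  for g :: "_ \<Rightarrow> nat \<Rightarrow> 'z :: comm_monoid_mult" and alpha :: "_ \<Rightarrow> nat" and k using insert.hyps by (intro prod.cong) auto
 have aupd: "a (alpha(b := k)) = A k alpha" if "alpha \<in> B \<rightarrow>\<^sub>E UNIV" for alpha k
 proof -
  have "alpha(b := undefined) = alpha" using that insert.hyps(2) by (auto simp: PiE_def extensional_def)
  thus ?thesis by (simp add: a_def)
 qed
 show ?case
 proof (intro exI[of _ a] conjI ballI)
  fix alpha :: "_ \<Rightarrow> nat" assume alpha: "alpha \<in> insert b B \<rightarrow>\<^sub>E UNIV"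
  have "alpha(b := undefined) \<in> B \<rightarrow>\<^sub>E UNIV" using alpha by (auto simp: PiE_def extensional_def)
  from A[OF this, of "alpha b"] have "norm (a alpha) \<le> M / r ^ alpha b / r ^ (\<Sum>b'\<in>B. (alpha(b := undefined)) b')"
   by (simp add: a_def)
  also have "(\<Sum>b'\<in>B. (alpha(b := undefined)) b') = (\<Sum>b'\<in>B. alpha b')" using insert.hyps by (intro sum.cong) auto
  finally show "norm (a alpha) \<le> M / r ^ (\<Sum>b\<in>insert b B. alpha b)" using insert.hyps by (simp add: power_add)
 next
  fix zeta assume z: "zeta \<in> polydisc (insert b B) c r"
  define xi where "xi = zeta(b := undefined)"
  have xi: "xi \<in> polydisc B c r" using z insert.hyps(2) by (auto simp: xi_def polydisc_def PiE_iff extensional_def)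
  have zb: "zeta b \<in> ball (c b) r" using z by (rule polydisc_memD) simp
  have xiz: "xi(b := zeta b) = zeta" by (simp add: xi_def)
  have pe: "(\<Prod>b\<in>B. (xi b - c b) ^ alpha b) = (\<Prod>b\<in>B. (zeta b - c b) ^ alpha b)" for alpha :: "_ \<Rightarrow> nat"
   using insert.hyps by (intro prod.cong) (auto simp: xi_def)
  define t where "t = (\<lambda>b'. norm (zeta b' - c b') / r)"
  have t: "0 \<le> t b' \<and> t b' < 1" if "b' \<in> insert b B" for b'
   using polydisc_memD[OF z that] r by (auto simp: t_def dist_norm norm_minus_commute)
  have le: "norm (A k alpha * (\<Prod>b\<in>B. (zeta b - c b) ^ alpha b) * (zeta b - c b) ^ k) \<le>
    M * (\<Prod>b'\<in>insert b B. t b' ^ (alpha(b := k)) b')" if "alpha \<in> B \<rightarrow>\<^sub>E UNIV" for k alpha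
  proof -
   have "norm (A k alpha * (\<Prod>b\<in>B. (zeta b - c b) ^ alpha b) * (zeta b - c b) ^ k)
    = norm (A k alpha) * ((\<Prod>b\<in>B. norm (zeta b - c b) ^ alpha b) * norm (zeta b - c b) ^ k)"
    by (simp add: norm_mult norm_power flip: prod_norm)
   also have "\<dots> \<le> (M / r ^ k) / r ^ (\<Sum>b\<in>B. alpha b) * ((\<Prod>b\<in>B. norm (zeta b - c b) ^ alpha b) * norm (zeta b - c b) ^ k)"
    by (intro mult_right_mono A that mult_nonneg_nonneg prod_nonneg) auto
   also have "\<dots> = M * (t b ^ k * (\<Prod>b'\<in>B. t b' ^ alpha b'))"
    by (simp add: t_def power_divide prod_dividef power_sum mult_ac)
   also have "(\<Prod>b'\<in>B. t b' ^ alpha b') = (\<Prod>b'\<in>B. t b' ^ (alpha(b := k)) b')"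
    by (rule prodB[symmetric, of "\<lambda>b' n. t b' ^ n"])
   finally show ?thesis using insert.hyps by simp
  qed
  have "(\<lambda>(k, alpha). A k alpha * (\<Prod>b\<in>B. (zeta b - c b) ^ alpha b) * (zeta b - c b) ^ k)
    summable_on (UNIV \<times> (B \<rightarrow>\<^sub>E (UNIV :: nat set)))"
  proof (rule abs_summable_summable, rule Infinite_Sum.abs_summable_on_comparison_test')
   have "(\<lambda>alpha. \<Prod>b\<in>insert b B. t b ^ alpha b) summable_on (insert b B \<rightarrow>\<^sub>E (UNIV :: nat set))"
    using insert.hyps t by (intro summable_on_multi_geometric) auto
   then show "(\<lambda>(k, alpha). M * (\<Prod>b'\<in>insert b B. t b' ^ (alpha(b := k)) b')) summable_on (UNIV \<times> (B \<rightarrow>\<^sub>E (UNIV :: nat set)))"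
    unfolding summable_on_PiE_insert[OF insert.hyps(2)] case_prod_unfold by (rule summable_on_cmult_right)
  qed (use le in auto)
  then have "((\<lambda>(k, alpha). A k alpha * (\<Prod>b\<in>B. (zeta b - c b) ^ alpha b) * (zeta b - c b) ^ k)
    has_sum Psi zeta) (UNIV \<times> (B \<rightarrow>\<^sub>E (UNIV :: nat set)))"
  proof (rule has_sum_SigmaI[rotated 2])
   show "((\<lambda>k. Psic k xi * (zeta b - c b) ^ k) has_sum Psi zeta) UNIV"
    using bounded_taylor_has_sum[OF hol[OF xi] r bd[OF xi] zb] by (simp add: Psic_def xiz)
   show "((\<lambda>alpha. case (k, alpha) of (k, alpha) \<Rightarrow> A k alpha * (\<Prod>b\<in>B. (zeta b - c b) ^ alpha b) * (zeta b - c b) ^ k) has_sum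
       Psic k xi * (zeta b - c b) ^ k) (B \<rightarrow>\<^sub>E UNIV)" for k
    using has_sum_cmult_left[OF AS[OF xi, of k], of "(zeta b - c b) ^ k"] by (simp add: pe)
  qed
  also have "?this \<longleftrightarrow> ((\<lambda>(k, alpha). a (alpha(b := k)) * (\<Prod>b'\<in>insert b B. (zeta b' - c b') ^ (alpha(b := k)) b'))
    has_sum Psi zeta) (UNIV \<times> (B \<rightarrow>\<^sub>E (UNIV :: nat set)))"
  proof (rule has_sum_cong, clarify)
   fix k :: nat and alpha :: "'a \<Rightarrow> nat" assume alpha: "alpha \<in> B \<rightarrow>\<^sub>E UNIV"
   have "(\<Prod>b'\<in>insert b B. (zeta b' - c b') ^ (alpha(b := k)) b') = (zeta b - c b) ^ k * (\<Prod>b\<in>B. (zeta b - c b) ^ alpha b)"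
    using insert.hyps prodB[of "\<lambda>b' n. (zeta b' - c b') ^ n" alpha k] by simp
   thus "A k alpha * (\<Prod>b\<in>B. (zeta b - c b) ^ alpha b) * (zeta b - c b) ^ k =
     a (alpha(b := k)) * (\<Prod>b'\<in>insert b B. (zeta b' - c b') ^ (alpha(b := k)) b')"
    by (simp only: aupd[OF alpha] mult_ac)
  qed
  finally show "((\<lambda>alpha. a alpha * (\<Prod>b\<in>insert b B. (zeta b - c b) ^ alpha b)) has_sum Psi zeta)
    (insert b B \<rightarrow>\<^sub>E (UNIV :: nat set))" unfolding has_sum_PiE_insert[OF insert.hyps(2)] .
 qed
qed

text \<open>Recentring the polydisc at \<open>zeta b\<close> turns the derivative into a first
  Taylor coefficient, covered by \<open>sep_holo_taylor_coeff\<close> and the Cauchy estimate.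
  Halving the radius leaves room for a disc of radius r/2 about \<open>zeta b\<close>.\<close>

lemma sep_holo_partial_deriv:
 assumes sh: "sep_holo B c r Psi" and r: "r > 0" and b: "b \<in> B"
  and le: "\<And>zeta. zeta \<in> polydisc B c r \<Longrightarrow> norm (Psi zeta) \<le> M"
 shows "sep_holo B c (r/2) (\<lambda>zeta. deriv (\<lambda>z. Psi (zeta(b := z))) (zeta b))" (is ?th1)
  and "\<And>zeta. zeta \<in> polydisc B c (r/2) \<Longrightarrow> norm (deriv (\<lambda>z. Psi (zeta(b := z))) (zeta b)) \<le> 2 * M / r"
proof -
 have sub: "ball w (r/2) \<subseteq> ball (c b) r" if "w \<in> ball (c b) (r/2)" for w
  using that by (intro subsetI) (simp, smt (verit) dist_triangle field_sum_of_halves)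
 have hol: "(\<lambda>z. Psi (zeta(b := z))) holomorphic_on ball (c b) r" if "zeta \<in> polydisc B c (r/2)" for zeta
  using sh b that polydisc_mono[of "r/2" r B c] r unfolding sep_holo_def by fastforce
 have bd: "norm (Psi (zeta(b := z))) \<le> M" if "zeta \<in> polydisc B c (r/2)" "z \<in> ball (c b) r" for zeta z
  using that polydisc_mono[of "r/2" r B c] r b by (intro le polydisc_upd) auto
 have r2: "r / 2 > 0" using r by simp
 show "norm (deriv (\<lambda>z. Psi (zeta(b := z))) (zeta b)) \<le> 2 * M / r" if z: "zeta \<in> polydisc B c (r/2)" for zeta
 proof -
  have s: "ball (zeta b) (r/2) \<subseteq> ball (c b) r" by (rule sub[OF polydisc_memD[OF z b]])
  have "norm ((deriv ^^ 1) (\<lambda>z. Psi (zeta(b := z))) (zeta b) / fact 1) \<le> M / (r/2) ^ 1"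
  proof (rule bounded_taylor_coeff_le)
   show "(\<lambda>z. Psi (zeta(b := z))) holomorphic_on ball (zeta b) (r/2)" by (rule holomorphic_on_subset[OF hol[OF z] s])
   show "norm (Psi (zeta(b := w))) \<le> M" if "w \<in> ball (zeta b) (r/2)" for w by (rule bd[OF z]) (use that s in blast)
  qed fact
  thus ?thesis by (simp add: mult_ac)
 qed
 show ?th1 unfolding sep_holo_def
 proof (intro ballI)
  fix zeta b' assume z: "zeta \<in> polydisc B c (r/2)" and b': "b' \<in> B"
  show "(\<lambda>w. deriv (\<lambda>z. Psi ((zeta(b' := w))(b := z))) ((zeta(b' := w)) b)) holomorphic_on ball (c b') (r / 2)"
  proof (cases "b' = b")
   case True
   have "deriv (\<lambda>z. Psi (zeta(b := z))) holomorphic_on ball (c b) r" using hol[OF z] by (intro holomorphic_deriv) auto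
   hence "deriv (\<lambda>z. Psi (zeta(b := z))) holomorphic_on ball (c b) (r/2)"
    by (rule holomorphic_on_subset) (use r in auto)
   thus ?thesis using True by simp
  next
   case False
   define B' where "B' = B - {b}"
   define c' where "c' = c(b := zeta b)"
   define xi where "xi = zeta(b := undefined)"
   have Bi: "insert b B' = B" using b by (auto simp: B'_def)
   have pd: "polydisc (insert b B') c' (r/2) \<subseteq> polydisc B c r"
   proof
    fix x assume x: "x \<in> polydisc (insert b B') c' (r/2)"
    have "x i \<in> ball (c i) r" if "i \<in> B" for i
    proof (cases "i = b")
     case True
     have "x b \<in> ball (zeta b) (r/2)" using polydisc_memD[OF x, of b] by (simp add: c'_def)
     thus ?thesis using sub[OF polydisc_memD[OF z b]] True by blast
    next
     case False
     have "x i \<in> ball (c i) (r/2)" using polydisc_memD[OF x, of i] False that by (simp add: c'_def B'_def)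
     thus ?thesis using r by auto
    qed
    thus "x \<in> polydisc B c r" using x unfolding Bi by (auto simp: polydisc_def PiE_def)
   qed
   have "sep_holo B' c' (r/2) (\<lambda>zeta. (deriv ^^ 1) (\<lambda>z. Psi (zeta(b := z))) (c' b) / fact 1)"
   proof (rule sep_holo_taylor_coeff[where M = M])
    show "sep_holo (insert b B') c' (r/2) Psi" unfolding sep_holo_def
    proof (intro ballI)
     fix x i assume x: "x \<in> polydisc (insert b B') c' (r / 2)" and i: "i \<in> insert b B'"
     have h: "(\<lambda>z. Psi (x(i := z))) holomorphic_on ball (c i) r" using sh pd x i Bi unfolding sep_holo_def by blast
     have "ball (c' i) (r/2) \<subseteq> ball (c i) r" using sub[OF polydisc_memD[OF z b]] r by (auto simp: c'_def)
     with h show "(\<lambda>z. Psi (x(i := z))) holomorphic_on ball (c' i) (r / 2)" by (rule holomorphic_on_subset)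
    qed
   qed (use pd le r in \<open>auto simp: B'_def\<close>)
   moreover have "xi \<in> polydisc B' c' (r/2)"
    using z r by (auto simp: xi_def B'_def c'_def polydisc_def PiE_iff extensional_def)
   moreover have "b' \<in> B'" using b' False by (simp add: B'_def)
   ultimately have "(\<lambda>w. deriv (\<lambda>z. Psi ((xi(b' := w))(b := z))) (c' b)) holomorphic_on ball (c' b') (r/2)"
    unfolding sep_holo_def by simp
   moreover have "(xi(b' := w))(b := z) = (zeta(b' := w))(b := z)" for w z using False by (auto simp: xi_def)
   ultimately show ?thesis using False by (simp add: c'_def)
  qed
 qed
qed

section \<open>Real analyticity through complexification\<close>

definition emb :: "'a::euclidean_space \<Rightarrow> 'a \<Rightarrow> complex" where
 "emb y = (\<lambda>b\<in>Basis. complex_of_real (y \<bullet> b))"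

lemma emb_Basis [simp]: "b \<in> Basis \<Longrightarrow> emb y b = of_real (y \<bullet> b)" by (simp add: emb_def)

lemma emb_in_polydisc_iff: "emb y \<in> polydisc Basis (emb x) r \<longleftrightarrow> (\<forall>b\<in>Basis. \<bar>(y - x) \<bullet> b\<bar> < r)"
 by (auto simp: polydisc_def emb_def PiE_iff dist_norm inner_diff_left abs_minus_commute
   simp flip: of_real_diff)

lemma emb_in_polydisc: "y \<in> ball x r \<Longrightarrow> emb y \<in> polydisc Basis (emb x) r" unfolding emb_in_polydisc_iff
 by (auto simp: dist_norm norm_minus_commute intro: le_less_trans[OF Basis_le_norm])

lemma emb_add: "b \<in> Basis \<Longrightarrow> emb (y + t *\<^sub>R b) = (emb y)(b := of_real (y \<bullet> b + t))"
 by (auto simp: emb_def fun_eq_iff inner_add_left inner_Basis)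

text \<open>A whole family is complexified on one common polydisc with summable bounds
  \<open>M\<close>. This encodes real analyticity and normal convergence at once; bounds at complex
  points, rather than only real ones, are what permits termwise differentiation.\<close>

definition complexifies :: "'i set \<Rightarrow> ('i \<Rightarrow> 'a::euclidean_space \<Rightarrow> complex) \<Rightarrow> 'a \<Rightarrow> real \<Rightarrow>
  ('i \<Rightarrow> ('a \<Rightarrow> complex) \<Rightarrow> complex) \<Rightarrow> ('i \<Rightarrow> real) \<Rightarrow> bool" where
 "complexifies I f x r Psi M \<longleftrightarrow> r > 0 \<and> (\<forall>i\<in>I. sep_holo Basis (emb x) r (Psi i) \<and>
    (\<forall>zeta\<in>polydisc Basis (emb x) r. norm (Psi i zeta) \<le> M i) \<and>
    (\<forall>y. emb y \<in> polydisc Basis (emb x) r \<longrightarrow> f i y = Psi i (emb y))) \<and> M summable_on I"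

lemma complexifiesD:
 assumes "complexifies I f x r Psi M"
 shows "r > 0" "\<And>i. i \<in> I \<Longrightarrow> sep_holo Basis (emb x) r (Psi i)"
  "\<And>i zeta. i \<in> I \<Longrightarrow> zeta \<in> polydisc Basis (emb x) r \<Longrightarrow> norm (Psi i zeta) \<le> M i"
  "\<And>i y. i \<in> I \<Longrightarrow> emb y \<in> polydisc Basis (emb x) r \<Longrightarrow> f i y = Psi i (emb y)"
  "M summable_on I" using assms unfolding complexifies_def by simp_all

definition normal_ra :: "'i set \<Rightarrow> ('i \<Rightarrow> 'a::euclidean_space \<Rightarrow> complex) \<Rightarrow> 'a \<Rightarrow> bool" where
 "normal_ra I f x \<longleftrightarrow> (\<exists>r Psi M. complexifies I f x r Psi M)"

definition ranalytic :: "('a::euclidean_space \<Rightarrow> complex) \<Rightarrow> 'a \<Rightarrow> bool" where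
 "ranalytic f x \<longleftrightarrow> normal_ra {()} (\<lambda>_. f) x"

lemma normal_raI:
 assumes "r > 0" "\<And>i. i \<in> I \<Longrightarrow> sep_holo Basis (emb x) r (Psi i)"
  "\<And>i zeta. i \<in> I \<Longrightarrow> zeta \<in> polydisc Basis (emb x) r \<Longrightarrow> norm (Psi i zeta) \<le> M i"
  "\<And>i y. i \<in> I \<Longrightarrow> emb y \<in> polydisc Basis (emb x) r \<Longrightarrow> f i y = Psi i (emb y)"
  "M summable_on I"
 shows "normal_ra I f x" unfolding normal_ra_def complexifies_def using assms by blast

lemma normal_raE:
 assumes "normal_ra I f x"
 obtains r Psi M where "complexifies I f x r Psi M" using assms unfolding normal_ra_def by (elim exE) (rule that)

lemma ranalyticI:
 assumes "r > 0" "sep_holo Basis (emb x) r Psi"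
  "\<And>zeta. zeta \<in> polydisc Basis (emb x) r \<Longrightarrow> norm (Psi zeta) \<le> M"
  "\<And>y. emb y \<in> polydisc Basis (emb x) r \<Longrightarrow> f y = Psi (emb y)"
 shows "ranalytic f x" unfolding ranalytic_def by (rule normal_raI[of r _ _ "\<lambda>_. Psi" "\<lambda>_. M"]) (use assms in auto)

lemma ranalyticE:
 assumes "ranalytic f x"
 obtains r Psi M where "r > 0" "sep_holo Basis (emb x) r Psi"
  "\<And>zeta. zeta \<in> polydisc Basis (emb x) r \<Longrightarrow> norm (Psi zeta) \<le> M"
  "\<And>y. emb y \<in> polydisc Basis (emb x) r \<Longrightarrow> f y = Psi (emb y)"
proof -
 obtain r Psi M where "complexifies {()} (\<lambda>_. f) x r Psi M" using assms unfolding ranalytic_def by (rule normal_raE)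
 note * = complexifiesD[OF this]
 show ?thesis by (rule that[of r "Psi ()" "M ()"]) (use * in auto)
qed

lemma normal_ra_imp_ranalytic: "normal_ra I f x \<Longrightarrow> i \<in> I \<Longrightarrow> ranalytic (f i) x"
proof -
 assume "normal_ra I f x" and i: "i \<in> I"
 then obtain r Psi M where "complexifies I f x r Psi M" by (elim normal_raE)
 note * = complexifiesD[OF this]
 show ?thesis by (rule ranalyticI[OF *(1) *(2)[OF i] *(3)[OF i] *(4)[OF i]])
qed

lemma normal_ra_infsum:
 assumes "normal_ra I f x"
 shows "ranalytic (\<lambda>y. \<Sum>\<^sub>\<infinity>i\<in>I. f i y) x" using assms
proof (rule normal_raE)
 fix r Psi M
 assume "complexifies I f x r Psi M"
 note * = complexifiesD[OF this]
 show ?thesis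
 proof (rule ranalyticI[OF *(1)])
  show "sep_holo Basis (emb x) r (\<lambda>zeta. \<Sum>\<^sub>\<infinity>i\<in>I. Psi i zeta)" using * by (intro sep_holo_infsum[where M = M]) auto
  show "norm (\<Sum>\<^sub>\<infinity>i\<in>I. Psi i zeta) \<le> infsum M I" if z: "zeta \<in> polydisc Basis (emb x) r" for zeta
  proof -
   have s: "(\<lambda>i. norm (Psi i zeta)) summable_on I"
    using *(5) *(3)[OF _ z] by (rule Infinite_Sum.abs_summable_on_comparison_test')
   show ?thesis by (rule norm_infsum_le[OF has_sum_infsum[OF abs_summable_summable[OF s]] has_sum_infsum[OF *(5)]])
      (rule *(3)[OF _ z])
  qed
  show "(\<Sum>\<^sub>\<infinity>i\<in>I. f i y) = (\<Sum>\<^sub>\<infinity>i\<in>I. Psi i (emb y))" if "emb y \<in> polydisc Basis (emb x) r" for y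
   using *(4) that by (intro infsum_cong) auto
 qed
qed

lemma normal_ra_summable:
 assumes "normal_ra I f x" shows "(\<lambda>i. f i x) summable_on I" using assms
proof (rule normal_raE)
 fix r Psi M
 assume "complexifies I f x r Psi M"
 note * = complexifiesD(1,3-5)[OF this]
 have x: "emb x \<in> polydisc Basis (emb x) r" using *(1) by (intro emb_in_polydisc) auto
 show ?thesis by (rule abs_summable_summable, rule Infinite_Sum.abs_summable_on_comparison_test'[OF *(4)])
    (use *(2)[OF _ x] *(3)[OF _ x] in auto)
qed

lemma normal_ra_cong:
 fixes f g :: "'i \<Rightarrow> 'a::euclidean_space \<Rightarrow> complex"
 assumes "normal_ra I f x" and "open U" "x \<in> U"
  and "\<And>i y. i \<in> I \<Longrightarrow> y \<in> U \<Longrightarrow> f i y = g i y"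
 shows "normal_ra I g x" using assms(1)
proof (rule normal_raE)
 fix r Psi M
 assume "complexifies I f x r Psi M"
 note * = complexifiesD[OF this]
 obtain e where e: "e > 0" "ball x e \<subseteq> U" using assms(2,3) open_contains_ball by blast
 \<comment> \<open>By the comparison of the euclidean norm with the sum of the coordinates, real
   points of the polydisc of radius e / DIM lie in the ball of radius e.\<close>
 define r' where "r' = min r (e / DIM('a))"
 have r': "r' > 0" "r' \<le> r" using *(1) e by (auto simp: r'_def)
 have U: "y \<in> U" if "emb y \<in> polydisc Basis (emb x) r'" for y
 proof -
  have "norm (y - x) \<le> (\<Sum>b\<in>Basis. \<bar>(y - x) \<bullet> b\<bar>)" by (rule norm_le_l1)
  also have "\<dots> < (\<Sum>b\<in>(Basis :: 'a set). r')" using that unfolding emb_in_polydisc_iff by (intro sum_strict_mono) auto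
  also have "\<dots> \<le> e" using e by (simp add: r'_def min_def field_simps)
  finally show ?thesis using e(2) by (auto simp: dist_norm norm_minus_commute)
 qed
 show ?thesis
 proof (rule normal_raI[OF r'(1), of _ _ Psi M])
  show "sep_holo Basis (emb x) r' (Psi i)" if "i \<in> I" for i using *(2)[OF that] r'(2) by (rule sep_holo_mono)
  show "norm (Psi i zeta) \<le> M i" if "i \<in> I" "zeta \<in> polydisc Basis (emb x) r'" for i zeta
   using *(3)[OF that(1)] polydisc_mono[OF r'(2)] that(2) by blast
  show "g i y = Psi i (emb y)" if "i \<in> I" "emb y \<in> polydisc Basis (emb x) r'" for i y
   using *(4)[OF that(1), of y] polydisc_mono[OF r'(2)] that(2) assms(4)[OF that(1) U[OF that(2)]] by force
 qed fact
qed

lemma normal_ra_open: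
 assumes "normal_ra I f x"
 shows "\<exists>U. open U \<and> x \<in> U \<and> (\<forall>y\<in>U. normal_ra I f y)" using assms
proof (rule normal_raE)
 fix r Psi M
 assume "complexifies I f x r Psi M"
 note * = complexifiesD[OF this]
 show ?thesis
 proof (intro exI[of _ "ball x (r/2)"] conjI ballI)
  fix y assume y: "y \<in> ball x (r/2)"
  have yb: "ball (emb y b) (r/2) \<subseteq> ball (emb x b) r" if "b \<in> Basis" for b
  proof -
   have "dist (emb x b) (emb y b) < r/2" using polydisc_memD[OF emb_in_polydisc[OF y] that] by simp
   thus ?thesis by (intro subsetI) (simp, smt (verit) dist_triangle field_sum_of_halves)
  qed
  have sub: "polydisc Basis (emb y) (r/2) \<subseteq> polydisc Basis (emb x) r"
   unfolding polydisc_def using yb by (intro PiE_mono)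
  show "normal_ra I f y"
  proof (rule normal_raI[of "r/2" _ _ Psi M])
   show "sep_holo Basis (emb y) (r/2) (Psi i)" if "i \<in> I" for i using *(2)[OF that] sub yb unfolding sep_holo_def
    by (meson holomorphic_on_subset subsetD)
  qed (use * sub in auto)
 qed (use *(1) in auto)
qed

lemma ranalytic_cong:
 assumes "ranalytic f x" and "open U" "x \<in> U" and "\<And>y. y \<in> U \<Longrightarrow> f y = g y"
 shows "ranalytic g x" using assms unfolding ranalytic_def by (auto intro: normal_ra_cong)

lemma ranalytic_power_series:
 fixes f :: "'a::euclidean_space \<Rightarrow> complex"
 assumes "ranalytic f x"
 obtains r M a where "r > 0"
  "\<And>alpha. alpha \<in> Basis \<rightarrow>\<^sub>E UNIV \<Longrightarrow> norm (a alpha) \<le> M / r ^ (\<Sum>b\<in>Basis. alpha b)"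
  "\<And>y. y \<in> ball x r \<Longrightarrow> ((\<lambda>alpha. (\<Prod>b\<in>Basis. ((y - x) \<bullet> b) ^ alpha b) *\<^sub>R a alpha) has_sum f y)
     (Basis \<rightarrow>\<^sub>E (UNIV :: nat set))"
proof -
 obtain r Psi M where *: "r > 0" "sep_holo Basis (emb x) r Psi"
  "\<And>zeta. zeta \<in> polydisc Basis (emb x) r \<Longrightarrow> norm (Psi zeta) \<le> M"
  "\<And>y. emb y \<in> polydisc Basis (emb x) r \<Longrightarrow> f y = Psi (emb y)" using ranalyticE[OF assms] by blast
 obtain a where a: "\<And>alpha. alpha \<in> Basis \<rightarrow>\<^sub>E UNIV \<Longrightarrow> norm (a alpha) \<le> M / r ^ (\<Sum>b\<in>Basis. alpha b)"
  and S: "\<And>zeta. zeta \<in> polydisc Basis (emb x) r \<Longrightarrow>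
   ((\<lambda>alpha. a alpha * (\<Prod>b\<in>Basis. (zeta b - emb x b) ^ alpha b)) has_sum Psi zeta) (Basis \<rightarrow>\<^sub>E (UNIV :: nat set))"
  using sep_holo_power_series[OF finite_Basis *(1-3)] by blast
 show ?thesis
 proof (rule that[OF *(1) a])
  fix y assume y: "y \<in> ball x r"
  have "(\<Prod>b\<in>Basis. (emb y b - emb x b) ^ alpha b) = of_real (\<Prod>b\<in>Basis. ((y - x) \<bullet> b) ^ alpha b)"
   for alpha :: "'a \<Rightarrow> nat" by (simp add: inner_diff_left)
  hence eq: "(\<Prod>b\<in>Basis. ((y - x) \<bullet> b) ^ alpha b) *\<^sub>R a alpha = a alpha * (\<Prod>b\<in>Basis. (emb y b - emb x b) ^ alpha b)"
   for alpha :: "'a \<Rightarrow> nat" by (simp add: scaleR_conv_of_real)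
  show "((\<lambda>alpha. (\<Prod>b\<in>Basis. ((y - x) \<bullet> b) ^ alpha b) *\<^sub>R a alpha) has_sum f y) (Basis \<rightarrow>\<^sub>E (UNIV :: nat set))"
   unfolding eq *(4)[OF emb_in_polydisc[OF y]] by (rule S[OF emb_in_polydisc[OF y]])
 qed
qed

lemma ranalytic_imp_real_analytic_on:
 fixes f :: "'a::euclidean_space \<Rightarrow> complex"
 assumes "\<And>x. x \<in> S \<Longrightarrow> ranalytic f x"
 shows "real_analytic_on f S" unfolding real_analytic_on_def
proof
 fix x assume "x \<in> S"
 obtain r M c where "r > 0"
  "\<And>alpha. alpha \<in> Basis \<rightarrow>\<^sub>E UNIV \<Longrightarrow> norm (c alpha) \<le> M / r ^ (\<Sum>b\<in>Basis. alpha b)"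
  and "\<And>y. y \<in> ball x r \<Longrightarrow> ((\<lambda>alpha. (\<Prod>b\<in>Basis. ((y - x) \<bullet> b) ^ alpha b) *\<^sub>R c alpha) has_sum f y)
     (Basis \<rightarrow>\<^sub>E (UNIV :: nat set))" by (rule ranalytic_power_series[OF assms[OF \<open>x \<in> S\<close>]]) (rule that)
 thus "\<exists>r>0. \<exists>c. \<forall>y\<in>ball x r. ((\<lambda>alpha. (\<Prod>b\<in>Basis. ((y - x) \<bullet> b) ^ alpha b) *\<^sub>R c alpha) has_sum f y)
    (Basis \<rightarrow>\<^sub>E UNIV)" by (intro exI[of _ r] conjI exI[of _ c] ballI)
qed

text \<open>Unconditional convergence at the single real point \<open>y0\<close>, all of whose
  coordinates are displaced by \<open>rho\<close>, is absolute convergence there. It therefore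
  dominates the terms on the complex polydisc of radius \<open>rho\<close>.\<close>

lemma real_analytic_on_imp_ranalytic:
 fixes f :: "'a::euclidean_space \<Rightarrow> complex"
 assumes "real_analytic_on f S" "x \<in> S"
 shows "ranalytic f x"
proof -
 obtain r c where r: "r > 0" and S: "\<And>y. y \<in> ball x r \<Longrightarrow>
   ((\<lambda>alpha. (\<Prod>b\<in>Basis. ((y - x) \<bullet> b) ^ alpha b) *\<^sub>R c alpha) has_sum f y) (Basis \<rightarrow>\<^sub>E (UNIV :: nat set))"
  using assms unfolding real_analytic_on_def by blast
 \<comment> \<open>Small enough for the cube of half-width \<open>rho\<close> to lie inside the ball
   of radius r.\<close>
 define rho where "rho = r / (2 * DIM('a))"
 have rho: "rho > 0" using r by (simp add: rho_def)
 have D0: "real DIM('a) \<ge> 1" using DIM_positive[where 'a='a] by linarith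
 have inball: "y \<in> ball x r" if "\<And>b. b \<in> Basis \<Longrightarrow> \<bar>(y - x) \<bullet> b\<bar> \<le> rho" for y
 proof -
  have "norm (y - x) \<le> (\<Sum>b\<in>Basis. \<bar>(y - x) \<bullet> b\<bar>)" by (rule norm_le_l1)
  also have "\<dots> \<le> (\<Sum>b\<in>(Basis :: 'a set). rho)" using that by (intro sum_mono)
  also have "\<dots> < r" using r D0 by (simp add: rho_def)
  finally show ?thesis by (simp add: dist_norm norm_minus_commute)
 qed
 define y0 where "y0 = x + (\<Sum>b\<in>Basis. rho *\<^sub>R b)"
 have y0b: "(y0 - x) \<bullet> b = rho" if "b \<in> Basis" for b
  using that by (simp add: y0_def inner_sum_left inner_Basis if_distrib sum.delta cong: if_cong)
 have "y0 \<in> ball x r" using rho by (intro inball) (simp add: y0b)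
 from S[OF this] have "(\<lambda>alpha. (\<Prod>b\<in>Basis. ((y0 - x) \<bullet> b) ^ alpha b) *\<^sub>R c alpha) summable_on (Basis \<rightarrow>\<^sub>E UNIV)"
  by (rule has_sum_imp_summable)
 hence "(\<lambda>alpha. norm ((\<Prod>b\<in>Basis. ((y0 - x) \<bullet> b) ^ alpha b) *\<^sub>R c alpha)) summable_on (Basis \<rightarrow>\<^sub>E UNIV)"
  by (simp add: summable_on_iff_abs_summable_on_complex)
 hence sm: "(\<lambda>alpha. (\<Prod>b\<in>(Basis :: 'a set). rho ^ alpha b) * norm (c alpha)) summable_on (Basis \<rightarrow>\<^sub>E UNIV)"
  using rho by (simp add: y0b abs_prod)
 define \<psi> where "\<psi> = (\<lambda>alpha zeta. c alpha * (\<Prod>b\<in>Basis. (zeta b - emb x b) ^ alpha b))"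
 have "normal_ra (Basis \<rightarrow>\<^sub>E UNIV) (\<lambda>alpha y. (\<Prod>b\<in>Basis. ((y - x) \<bullet> b) ^ alpha b) *\<^sub>R c alpha) x"
 proof (rule normal_raI[OF rho, of _ _ \<psi> "\<lambda>alpha. (\<Prod>b\<in>(Basis :: 'a set). rho ^ alpha b) * norm (c alpha)"])
  show "sep_holo Basis (emb x) rho (\<psi> alpha)" for alpha unfolding \<psi>_def
   by (intro sep_holo_mult sep_holo_prod sep_holo_power sep_holo_diff sep_holo_coord sep_holo_const)
  show "norm (\<psi> alpha zeta) \<le> (\<Prod>b\<in>(Basis :: 'a set). rho ^ alpha b) * norm (c alpha)"
   if z: "zeta \<in> polydisc Basis (emb x) rho" for alpha zeta
  proof -
   have "norm (\<psi> alpha zeta) = (\<Prod>b\<in>(Basis :: 'a set). norm (zeta b - emb x b) ^ alpha b) * norm (c alpha)"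
    by (simp add: \<psi>_def norm_mult norm_power mult.commute flip: prod_norm)
   also have "\<dots> \<le> (\<Prod>b\<in>(Basis :: 'a set). rho ^ alpha b) * norm (c alpha)" using polydisc_memD[OF z]
    by (intro mult_right_mono prod_mono conjI power_mono) (auto simp: dist_norm norm_minus_commute less_imp_le)
   finally show ?thesis .
  qed
  show "(\<Prod>b\<in>Basis. ((y - x) \<bullet> b) ^ alpha b) *\<^sub>R c alpha = \<psi> alpha (emb y)" for alpha y
   by (simp add: \<psi>_def scaleR_conv_of_real inner_diff_left)
 qed fact
 from normal_ra_infsum[OF this] show ?thesis
 proof (rule ranalytic_cong)
  show "open {y. \<forall>b\<in>Basis. \<bar>(y - x) \<bullet> b\<bar> < rho}" unfolding Ball_def[symmetric] Collect_ball_eq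
   by (intro open_INT finite_Basis ballI open_Collect_less continuous_intros)
 qed (use rho in \<open>auto intro!: infsumI S inball less_imp_le\<close>)
qed

text \<open>The monomials with all exponents at most 1 form a polynomial \<open>p\<close>. Every
  other multi-index has an exponent of at least 2, so f - p is O(|y - x|^2) and has derivative 0 at
  x.\<close>

lemma ranalytic_imp_differentiable:
 fixes f :: "'a::euclidean_space \<Rightarrow> complex"
 assumes "ranalytic f x"
 shows "f differentiable (at x)"
proof -
 obtain r M a where r: "r > 0"
  and a: "\<And>alpha. alpha \<in> Basis \<rightarrow>\<^sub>E UNIV \<Longrightarrow> norm (a alpha) \<le> M / r ^ (\<Sum>b\<in>Basis. alpha b)"
  and S: "\<And>y. y \<in> ball x r \<Longrightarrow> ((\<lambda>alpha. (\<Prod>b\<in>Basis. ((y - x) \<bullet> b) ^ alpha b) *\<^sub>R a alpha) has_sum f y)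
     (Basis \<rightarrow>\<^sub>E (UNIV :: nat set))" by (rule ranalytic_power_series[OF assms]) (rule that)
 define T where "T = (Basis :: 'a set) \<rightarrow>\<^sub>E (UNIV :: nat set)"
 define T1 where "T1 = (Basis :: 'a set) \<rightarrow>\<^sub>E {..1::nat}"
 have T1: "finite T1" "T1 \<subseteq> T" by (auto simp: T1_def T_def intro!: finite_PiE)
 define t where "t = (\<lambda>alpha y. (\<Prod>b\<in>Basis. ((y - x) \<bullet> b) ^ alpha b) *\<^sub>R a alpha)"
 define p where "p = (\<lambda>y. \<Sum>alpha\<in>T1. t alpha y)"
 have p: "p differentiable (at y)" for y
 proof -
  have "(\<lambda>y. (\<Prod>b\<in>Basis. ((y - x) \<bullet> b) ^ alpha b)) differentiable (at y)" for alpha :: "'a \<Rightarrow> nat"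
  proof -
   have "((\<lambda>y. \<Prod>b\<in>Basis. ((y - x) \<bullet> b) ^ alpha b) has_derivative
     (\<lambda>h. \<Sum>b\<in>Basis. (of_nat (alpha b) * (h \<bullet> b) * ((y - x) \<bullet> b) ^ (alpha b - 1)) * (\<Prod>b'\<in>Basis - {b}. ((y - x) \<bullet> b') ^ alpha b'))) (at y)"
   proof (rule has_derivative_prod)
    show "((\<lambda>y. ((y - x) \<bullet> b) ^ alpha b) has_derivative (\<lambda>h. of_nat (alpha b) * (h \<bullet> b) * ((y - x) \<bullet> b) ^ (alpha b - 1))) (at y)" for b
     by (rule has_derivative_eq_rhs[OF has_derivative_power[where f' = "\<lambda>h. h \<bullet> b"]]) 
       (auto intro!: derivative_eq_intros simp: mult_ac)
   qed
   thus ?thesis unfolding differentiable_def by blast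
  qed
  hence "(\<lambda>y. t alpha y) differentiable (at y)" for alpha unfolding t_def by (intro differentiable_scaleR) auto
  thus ?thesis unfolding p_def using T1(1) by (intro differentiable_sum) auto
 qed
 \<comment> \<open>In the remainder estimate u = 2 |y - x| / r; the square of u supplies 4 / r^2 and
   |y - x|^2, the powers of 1/2 split off supply the convergent sum.\<close>
 define K where "K = M * infsum (\<lambda>alpha. \<Prod>b\<in>Basis. (1/2) ^ alpha b) T * (4 / r^2)"
 have M0: "M \<ge> 0"
 proof -
  have "norm (a (\<lambda>b\<in>Basis. 0)) \<le> M" using a[of "\<lambda>b\<in>Basis. 0"] by simp
  thus ?thesis using norm_ge_zero order_trans by blast
 qed
 have rem: "norm (f y - p y) \<le> K * norm (y - x) ^ 2" if y: "norm (y - x) \<le> r / 2" for y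
 proof -
  define u where "u = 2 * norm (y - x) / r"
  have u: "0 \<le> u" "u \<le> 1" using y r by (auto simp: u_def field_simps)
  have "y \<in> ball x r" using y r by (simp add: dist_norm norm_minus_commute)
  note S[OF this, folded t_def T_def]
  moreover have "((\<lambda>alpha. t alpha y) has_sum p y) T1" using T1 by (auto simp: p_def intro: has_sum_finiteI)
  ultimately have S2: "((\<lambda>alpha. t alpha y) has_sum (f y - p y)) (T - T1)"
   using T1(2) t_def by (intro has_sum_Diff) auto
  have geo: "(\<lambda>alpha. \<Prod>b\<in>(Basis :: 'a set). (1/2 :: real) ^ alpha b) summable_on T"
   unfolding T_def by (rule summable_on_multi_geometric) auto
  have le: "norm (t alpha y) \<le> M * u ^ 2 * (\<Prod>b\<in>(Basis :: 'a set). (1/2) ^ alpha b)" if alpha: "alpha \<in> T - T1" for alpha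
  proof -
   let ?s = "\<Sum>b\<in>(Basis :: 'a set). alpha b"
   have "\<exists>b\<in>Basis. \<not> alpha b \<le> 1" by (rule ccontr) (use alpha in \<open>auto simp: T_def T1_def PiE_iff\<close>)
   then obtain b where b: "b \<in> Basis" "alpha b \<ge> 2" by auto
   have s2: "?s \<ge> 2" using b member_le_sum[of b Basis alpha] by simp
   have "norm (t alpha y) = (\<Prod>b\<in>(Basis :: 'a set). \<bar>(y - x) \<bullet> b\<bar> ^ alpha b) * norm (a alpha)"
    by (simp add: t_def abs_prod power_abs)
   also have "\<dots> \<le> (\<Prod>b\<in>(Basis :: 'a set). norm (y - x) ^ alpha b) * (M / r ^ ?s)"
    using alpha by (intro mult_mono prod_mono conjI power_mono a prod_nonneg) (auto simp: T_def Basis_le_norm)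
   also have "(\<Prod>b\<in>(Basis :: 'a set). norm (y - x) ^ alpha b) = norm (y - x) ^ ?s" by (simp add: power_sum)
   also have "norm (y - x) ^ ?s * (M / r ^ ?s) = M * u ^ ?s * (1/2) ^ ?s"
    by (simp add: u_def power_divide power_mult_distrib)
   also have "\<dots> \<le> M * u ^ 2 * (1/2) ^ ?s"
    using M0 u s2 by (intro mult_right_mono mult_left_mono power_decreasing) auto
   also have "(1/2 :: real) ^ ?s = (\<Prod>b\<in>(Basis :: 'a set). (1/2) ^ alpha b)" by (simp add: power_sum)
   finally show ?thesis .
  qed
  have hs: "((\<lambda>alpha. M * u ^ 2 * (\<Prod>b\<in>(Basis :: 'a set). (1/2) ^ alpha b)) has_sum
      (M * u ^ 2 * infsum (\<lambda>alpha. \<Prod>b\<in>(Basis :: 'a set). (1/2) ^ alpha b) (T - T1))) (T - T1)"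
   by (intro has_sum_cmult_right has_sum_infsum summable_on_subset_banach[OF geo]) auto
  have "norm (f y - p y) \<le> M * u ^ 2 * infsum (\<lambda>alpha. \<Prod>b\<in>(Basis :: 'a set). (1/2) ^ alpha b) (T - T1)"
   by (rule norm_infsum_le[OF S2 hs le])
  also have "\<dots> \<le> M * u ^ 2 * infsum (\<lambda>alpha. \<Prod>b\<in>(Basis :: 'a set). (1/2) ^ alpha b) T"
   using M0 by (intro mult_left_mono infsum_mono_neutral summable_on_subset_banach[OF geo])
    (auto intro!: geo prod_nonneg)
  also have "\<dots> = K * norm (y - x) ^ 2" by (simp add: K_def u_def power_divide power_mult_distrib)
  finally show ?thesis .
 qed
 have fx: "f x = p x" using rem[of x] r by simp
 have "((\<lambda>y. f y - p y) has_derivative (\<lambda>_. 0)) (at x)" unfolding has_derivative_at_within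
 proof (intro conjI bounded_linear_zero)
  show "((\<lambda>y. ((f y - p y) - (f x - p x) - 0) /\<^sub>R norm (y - x)) \<longlongrightarrow> 0) (at x)"
  proof (rule Lim_null_comparison)
   show "\<forall>\<^sub>F y in at x. norm (((f y - p y) - (f x - p x) - 0) /\<^sub>R norm (y - x)) \<le> K * norm (y - x)"
    unfolding eventually_at
   proof (intro exI[of _ "r/2"] conjI ballI impI)
    fix y assume y: "y \<noteq> x \<and> dist y x < r / 2"
    have "norm (f y - p y) \<le> K * norm (y - x) ^ 2" using y by (intro rem) (simp add: dist_norm)
    hence "norm (f y - p y) / norm (y - x) \<le> K * norm (y - x) ^ 2 / norm (y - x)" by (intro divide_right_mono) auto
    moreover have "norm (((f y - p y) - (f x - p x) - 0) /\<^sub>R norm (y - x)) = norm (f y - p y) / norm (y - x)"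
     unfolding norm_scaleR using fx by (simp add: divide_inverse mult.commute)
    ultimately show "norm (((f y - p y) - (f x - p x) - 0) /\<^sub>R norm (y - x)) \<le> K * norm (y - x)"
     using y by (simp add: power2_eq_square)
   qed (use r in auto)
   show "((\<lambda>y. K * norm (y - x)) \<longlongrightarrow> 0) (at x)" by (rule tendsto_eq_intros refl | simp)+
  qed
 qed
 hence "(\<lambda>y. f y - p y) differentiable (at x)" unfolding differentiable_def by blast
 from differentiable_add[OF this p] show ?thesis by simp
qed

lemma ranalytic_imp_continuous: "ranalytic f x \<Longrightarrow> isCont f x"
 by (intro differentiable_imp_continuous_within ranalytic_imp_differentiable)

lemma ranalytic_frechet_partial:
 assumes b: "b \<in> Basis" and sh: "sep_holo Basis (emb x) r Psi"
  and f: "\<And>y. emb y \<in> polydisc Basis (emb x) r \<Longrightarrow> f y = Psi (emb y)"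
  and y: "emb y \<in> polydisc Basis (emb x) r" and d: "f differentiable (at y)"
 shows "frechet_derivative f (at y) b = deriv (\<lambda>z. Psi ((emb y)(b := z))) (emb y b)"
proof -
 have yb: "emb y b \<in> ball (emb x b) r" using polydisc_memD[OF y b] .
 have "(\<lambda>z. Psi ((emb y)(b := z))) holomorphic_on ball (emb x b) r" using sh y b unfolding sep_holo_def by blast
 from holomorphic_derivI[OF this open_ball yb]
 have 1: "((\<lambda>z. Psi ((emb y)(b := z))) has_field_derivative deriv (\<lambda>z. Psi ((emb y)(b := z))) (emb y b)) (at (emb y b))" .
 have "((\<lambda>t::real. of_real (y \<bullet> b + t) :: complex) has_vector_derivative 1) (at 0)"
  by (auto intro!: derivative_eq_intros simp: has_vector_derivative_def scaleR_conv_of_real)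
 from field_vector_diff_chain_at[OF this, of "\<lambda>z. Psi ((emb y)(b := z))"] 1 b
 have "((\<lambda>t. Psi ((emb y)(b := of_real (y \<bullet> b + t)))) has_vector_derivative deriv (\<lambda>z. Psi ((emb y)(b := z))) (emb y b)) (at 0)"
  by (simp add: o_def)
 hence v1: "((\<lambda>t. f (y + t *\<^sub>R b)) has_vector_derivative deriv (\<lambda>z. Psi ((emb y)(b := z))) (emb y b)) (at 0)"
 proof (rule has_vector_derivative_transform_within_open)
  let ?S = "{t. of_real (y \<bullet> b + t) \<in> ball (emb x b) r}"
  show "open ?S" unfolding mem_ball by (intro open_Collect_less continuous_intros)
  show "0 \<in> ?S" using yb b by simp
  show "Psi ((emb y)(b := of_real (y \<bullet> b + t))) = f (y + t *\<^sub>R b)" if "t \<in> ?S" for t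
   using f[of "y + t *\<^sub>R b"] polydisc_upd[OF y b] that by (simp add: emb_add[OF b])
 qed
 have "(f has_derivative frechet_derivative f (at y)) (at (y + 0 *\<^sub>R b))"
  using d by (simp flip: frechet_derivative_works)
 moreover have "((\<lambda>t. y + t *\<^sub>R b) has_vector_derivative b) (at (0::real))"
  by (auto intro!: derivative_eq_intros simp: has_vector_derivative_def)
 ultimately have "((\<lambda>t. f (y + t *\<^sub>R b)) has_vector_derivative frechet_derivative f (at y) b) (at 0)"
  using vector_derivative_diff_chain_within[of "\<lambda>t. y + t *\<^sub>R b" b 0 UNIV f "frechet_derivative f (at y)"]
  by (simp add: o_def has_derivative_at_withinI)
 with v1 show ?thesis using vector_derivative_unique_at by blast
qed

text \<open>Real partial derivatives of the family are restrictions of complex partial derivatives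
  of \<open>Psi i\<close>. By Cauchy these are bounded by 2 M i / r on the polydisc of half the
  radius, so normal convergence is inherited and derivative and sum commute.\<close>

lemma normal_ra_frechet:
 fixes f :: "'i \<Rightarrow> 'a::euclidean_space \<Rightarrow> complex"
 assumes nr: "normal_ra I f x" and b: "b \<in> Basis"
 shows "normal_ra I (\<lambda>i y. frechet_derivative (f i) (at y) b) x" (is ?th1)
  and "((\<lambda>i. frechet_derivative (f i) (at x) b) has_sum
     frechet_derivative (\<lambda>y. \<Sum>\<^sub>\<infinity>i\<in>I. f i y) (at x) b) I" (is ?th2)
proof -
 obtain r Psi M where "complexifies I f x r Psi M" using nr by (rule normal_raE)
 note * = complexifiesD[OF this]
 obtain U where U: "open U" "x \<in> U" "\<And>y. y \<in> U \<Longrightarrow> normal_ra I f y" using normal_ra_open[OF nr] by blast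
 have df: "f i differentiable (at y)" if "y \<in> U" "i \<in> I" for i y
  by (rule ranalytic_imp_differentiable[OF normal_ra_imp_ranalytic[OF U(3)[OF that(1)] that(2)]])
 define Psi' where "Psi' = (\<lambda>i zeta. deriv (\<lambda>z. Psi i (zeta(b := z))) (zeta b))"
 have eq: "frechet_derivative (f i) (at y) b = Psi' i (emb y)" if "y \<in> U" "y \<in> ball x r" "i \<in> I" for i y
  unfolding Psi'_def using that * by (intro ranalytic_frechet_partial[OF b *(2)] df emb_in_polydisc) auto
 have "normal_ra I (\<lambda>i y. Psi' i (emb y)) x"
 proof (rule normal_raI)
  show "r / 2 > 0" using *(1) by simp
  show "sep_holo Basis (emb x) (r/2) (Psi' i)" if "i \<in> I" for i
   unfolding Psi'_def by (rule sep_holo_partial_deriv(1)[OF *(2)[OF that] *(1) b *(3)[OF that]])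
  show "norm (Psi' i zeta) \<le> 2 * M i / r" if "i \<in> I" "zeta \<in> polydisc Basis (emb x) (r/2)" for i zeta
   unfolding Psi'_def by (rule sep_holo_partial_deriv(2)[OF *(2)[OF that(1)] *(1) b *(3)[OF that(1)] that(2)])
  show "(\<lambda>i. 2 * M i / r) summable_on I"
   unfolding divide_inverse by (intro summable_on_cmult_left summable_on_cmult_right *(5))
 qed auto
 then show ?th1 by (rule normal_ra_cong[of _ _ _ "U \<inter> ball x r"]) (use U * eq in auto)
 have xx: "emb x \<in> polydisc Basis (emb x) r" using *(1) by (intro emb_in_polydisc) auto
 have "((\<lambda>i. deriv (\<lambda>z. Psi i ((emb x)(b := z))) (emb x b)) has_sum
     deriv (\<lambda>z. \<Sum>\<^sub>\<infinity>i\<in>I. Psi i ((emb x)(b := z))) (emb x b)) I"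
 proof (rule has_sum_deriv_infsum[OF open_ball])
  show "(\<lambda>z. Psi i ((emb x)(b := z))) holomorphic_on ball (emb x b) r" if "i \<in> I" for i
   using *(2)[OF that] xx b unfolding sep_holo_def by blast
  show "norm (Psi i ((emb x)(b := z))) \<le> M i" if "i \<in> I" "z \<in> ball (emb x b) r" for i z
   by (rule *(3)[OF that(1) polydisc_upd[OF xx b that(2)]])
  show "emb x b \<in> ball (emb x b) r" using *(1) by simp
 qed fact
 also have "deriv (\<lambda>z. \<Sum>\<^sub>\<infinity>i\<in>I. Psi i ((emb x)(b := z))) (emb x b)
   = frechet_derivative (\<lambda>y. \<Sum>\<^sub>\<infinity>i\<in>I. f i y) (at x) b"
 proof (rule ranalytic_frechet_partial[OF b _ _ xx, symmetric])
  show "sep_holo Basis (emb x) r (\<lambda>zeta. \<Sum>\<^sub>\<infinity>i\<in>I. Psi i zeta)" using * by (intro sep_holo_infsum[where M = M]) auto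
  show "(\<Sum>\<^sub>\<infinity>i\<in>I. f i y) = (\<Sum>\<^sub>\<infinity>i\<in>I. Psi i (emb y))" if "emb y \<in> polydisc Basis (emb x) r" for y
   using *(4) that by (intro infsum_cong) auto
  show "(\<lambda>y. \<Sum>\<^sub>\<infinity>i\<in>I. f i y) differentiable at x" by (rule ranalytic_imp_differentiable[OF normal_ra_infsum[OF nr]])
 qed
 also have "((\<lambda>i. deriv (\<lambda>z. Psi i ((emb x)(b := z))) (emb x b)) has_sum
    frechet_derivative (\<lambda>y. \<Sum>\<^sub>\<infinity>i\<in>I. f i y) (at x) b) I \<longleftrightarrow> ?th2"
  using U(2) *(1) by (intro has_sum_cong) (simp add: eq[unfolded Psi'_def])
 finally show ?th2 .
qed

lemma normal_ra_add:
 assumes "normal_ra I f x" "normal_ra I g x"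
 shows "normal_ra I (\<lambda>i y. f i y + g i y) x"
proof -
 obtain r Psi M where "complexifies I f x r Psi M" using assms(1) by (rule normal_raE)
 note * = complexifiesD[OF this]
 obtain r' Psi' M' where "complexifies I g x r' Psi' M'" using assms(2) by (rule normal_raE)
 note ** = complexifiesD[OF this]
 define rho where "rho = min r r'"
 have rho: "rho > 0" "rho \<le> r" "rho \<le> r'" using * ** by (auto simp: rho_def)
 note P = polydisc_mono[OF rho(2), THEN subsetD] polydisc_mono[OF rho(3), THEN subsetD]
 show ?thesis
 proof (rule normal_raI[OF rho(1)])
  show "sep_holo Basis (emb x) rho (\<lambda>zeta. Psi i zeta + Psi' i zeta)" if "i \<in> I" for i
   using sep_holo_mono[OF *(2)[OF that] rho(2)] sep_holo_mono[OF **(2)[OF that] rho(3)] by (rule sep_holo_add)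
  show "norm (Psi i zeta + Psi' i zeta) \<le> M i + M' i" if "i \<in> I" "zeta \<in> polydisc Basis (emb x) rho" for i zeta
   using *(3)[OF that(1) P(1)[OF that(2)]] **(3)[OF that(1) P(2)[OF that(2)]] by (rule norm_triangle_mono)
  show "(\<lambda>i. M i + M' i) summable_on I" using *(5) **(5) by (rule summable_on_add)
  show "f i y + g i y = Psi i (emb y) + Psi' i (emb y)" if "i \<in> I" "emb y \<in> polydisc Basis (emb x) rho" for i y
   using *(4)[OF that(1) P(1)[OF that(2)]] **(4)[OF that(1) P(2)[OF that(2)]] by simp
 qed
qed

text \<open>The product of two normally convergent series as one series over pairs of indices;
  needed for \<open>R\<close> times \<open>Theta\<close>.\<close>

lemma normal_ra_prod:
 fixes f :: "'i \<Rightarrow> 'a::euclidean_space \<Rightarrow> complex" and g :: "'j \<Rightarrow> 'a \<Rightarrow> complex"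
 assumes "normal_ra I f x" "normal_ra J g x"
 shows "normal_ra (I \<times> J) (\<lambda>ij y. f (fst ij) y * g (snd ij) y) x"
proof -
 obtain r Psi M where "complexifies I f x r Psi M" using assms(1) by (rule normal_raE)
 note * = complexifiesD[OF this]
 obtain r' Psi' M' where "complexifies J g x r' Psi' M'" using assms(2) by (rule normal_raE)
 note ** = complexifiesD[OF this]
 define rho where "rho = min r r'"
 have rho: "rho > 0" "rho \<le> r" "rho \<le> r'" using * ** by (auto simp: rho_def)
 note P = polydisc_mono[OF rho(2), THEN subsetD] polydisc_mono[OF rho(3), THEN subsetD]
 have xx: "emb x \<in> polydisc Basis (emb x) rho" using rho(1) by (intro emb_in_polydisc) auto
 have M0: "M i \<ge> 0" if "i \<in> I" for i by (rule order_trans[OF norm_ge_zero *(3)[OF that P(1)[OF xx]]])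
 have M0': "M' i \<ge> 0" if "i \<in> J" for i by (rule order_trans[OF norm_ge_zero **(3)[OF that P(2)[OF xx]]])
 show ?thesis
 proof (rule normal_raI[OF rho(1)])
  show "sep_holo Basis (emb x) rho (\<lambda>zeta. Psi (fst ij) zeta * Psi' (snd ij) zeta)" if "ij \<in> I \<times> J" for ij
   using that sep_holo_mono[OF *(2) rho(2)] sep_holo_mono[OF **(2) rho(3)] by (intro sep_holo_mult) auto
  show "norm (Psi (fst ij) zeta * Psi' (snd ij) zeta) \<le> M (fst ij) * M' (snd ij)"
   if "ij \<in> I \<times> J" "zeta \<in> polydisc Basis (emb x) rho" for ij zeta unfolding norm_mult using that M0
   by (intro mult_mono *(3)[OF _ P(1)] **(3)[OF _ P(2)]) auto
  show "(\<lambda>ij. M (fst ij) * M' (snd ij)) summable_on I \<times> J"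
  proof (rule summable_on_SigmaI)
   show "((\<lambda>y. M (fst (i, y)) * M' (snd (i, y))) has_sum M i * infsum M' J) J" for i
    using **(5) by (auto intro!: has_sum_cmult_right)
   show "(\<lambda>i. M i * infsum M' J) summable_on I" using *(5) by (rule summable_on_cmult_left)
  qed (use M0 M0' in auto)
  show "f (fst ij) y * g (snd ij) y = Psi (fst ij) (emb y) * Psi' (snd ij) (emb y)"
   if "ij \<in> I \<times> J" "emb y \<in> polydisc Basis (emb x) rho" for ij y using that *(4)[OF _ P(1)] **(4)[OF _ P(2)] by auto
 qed
qed

lemma normal_ra_reindex:
 assumes "normal_ra J f x" "inj_on h I" "h ` I \<subseteq> J"
 shows "normal_ra I (\<lambda>i. f (h i)) x"
proof -
 obtain r Psi M where "complexifies J f x r Psi M" using assms(1) by (rule normal_raE)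
 note * = complexifiesD[OF this]
 have "M summable_on (h ` I)" using *(5) assms(3) by (rule summable_on_subset_banach)
 hence "(M \<circ> h) summable_on I" using summable_on_reindex[OF assms(2)] by blast
 thus ?thesis
  using * assms(3) by (intro normal_raI[of r _ _ "\<lambda>i. Psi (h i)" "\<lambda>i. M (h i)"]) (auto simp: o_def image_subset_iff)
qed

lemma normal_ra_times:
 assumes h: "ranalytic h x" and f: "normal_ra I f x"
 shows "normal_ra I (\<lambda>i y. h y * f i y) x"
proof -
 have "normal_ra ({()} \<times> I) (\<lambda>ij y. h y * f (snd ij) y) x" using normal_ra_prod[OF h[unfolded ranalytic_def] f] .
 from normal_ra_reindex[OF this, of "\<lambda>i. ((), i)" I] show ?thesis by (auto simp: inj_on_def)
qed

lemma ranalytic_add: "ranalytic f x \<Longrightarrow> ranalytic g x \<Longrightarrow> ranalytic (\<lambda>y. f y + g y) x"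
 unfolding ranalytic_def by (rule normal_ra_add)

lemma ranalytic_mult: "ranalytic f x \<Longrightarrow> ranalytic g x \<Longrightarrow> ranalytic (\<lambda>y. f y * g y) x"
 using normal_ra_times[of f x "{()}" "\<lambda>_. g"] unfolding ranalytic_def by simp

lemma ranalytic_const: "ranalytic (\<lambda>_. c) x"
 by (rule ranalyticI[of 1 x "\<lambda>_. c" "norm c"]) (auto intro: sep_holo_const)

lemma ranalytic_cmult: "ranalytic f x \<Longrightarrow> ranalytic (\<lambda>y. c * f y) x" by (intro ranalytic_mult ranalytic_const)

lemma ranalytic_uminus: "ranalytic f x \<Longrightarrow> ranalytic (\<lambda>y. - f y) x" using ranalytic_cmult[of f x "-1"] by simp

lemma ranalytic_diff: "ranalytic f x \<Longrightarrow> ranalytic g x \<Longrightarrow> ranalytic (\<lambda>y. f y - g y) x"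
 using ranalytic_add[OF _ ranalytic_uminus, of f x g] by simp

lemma normal_ra_cmult: "normal_ra I f x \<Longrightarrow> normal_ra I (\<lambda>i y. c * f i y) x"
 by (rule normal_ra_times[OF ranalytic_const])

section \<open>Calculus of Wirtinger derivatives\<close>

text \<open>Records real differentiability together with both Wirtinger derivatives, so that product
  and chain rule treat the two at once; a vanishing last argument means complex
  differentiability.\<close>

definition has_wirt :: "(complex \<Rightarrow> complex) \<Rightarrow> complex \<Rightarrow> complex \<Rightarrow> complex \<Rightarrow> bool" where
 "has_wirt f z p p' \<longleftrightarrow> (f has_derivative (\<lambda>h. p * h + p' * cnj h)) (at z)"

lemma has_wirt_imp_wirt: "has_wirt f z p p' \<Longrightarrow> wirt f z = p"
 and has_wirt_imp_wirt_bar: "has_wirt f z p p' \<Longrightarrow> wirt_bar f z = p'"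
proof -
 assume "has_wirt f z p p'"
 hence "frechet_derivative f (at z) = (\<lambda>h. p * h + p' * cnj h)"
  unfolding has_wirt_def by (rule frechet_derivative_at[symmetric])
 thus "wirt f z = p" "wirt_bar f z = p'" by (simp_all add: wirt_def wirt_bar_def algebra_simps)
qed

lemma has_wirtI:
 assumes "f differentiable (at z)"
 shows "has_wirt f z (wirt f z) (wirt_bar f z)"
proof -
 let ?D = "frechet_derivative f (at z)"
 have D: "(f has_derivative ?D) (at z)" using assms by (simp flip: frechet_derivative_works)
 interpret bounded_linear ?D using D by (rule has_derivative_bounded_linear)
 have "?D h = wirt f z * h + wirt_bar f z * cnj h" for h
 proof -
  have "?D h = ?D (Re h *\<^sub>R 1 + Im h *\<^sub>R \<i>)" by (rule arg_cong[where f = ?D]) (simp add: complex_eq_iff)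
  also have "\<dots> = of_real (Re h) * ?D 1 + of_real (Im h) * ?D \<i>"
   unfolding add scaleR by (simp add: scaleR_conv_of_real)
  also have "of_real (Re h) = (h + cnj h) / 2" by (simp add: complex_eq_iff)
  also have "of_real (Im h) = - \<i> * (h - cnj h) / 2" by (simp add: complex_eq_iff)
  finally show ?thesis by (simp add: wirt_def wirt_bar_def field_simps)
 qed
 hence "?D = (\<lambda>h. wirt f z * h + wirt_bar f z * cnj h)" by blast
 with D show ?thesis unfolding has_wirt_def by simp
qed

lemma has_wirt_field: "(f has_field_derivative D) (at z) \<Longrightarrow> has_wirt f z D 0"
 by (simp add: has_wirt_def has_field_derivative_def)

lemma has_wirt_imp_field: "has_wirt f z D 0 \<Longrightarrow> (f has_field_derivative D) (at z)"
 by (simp add: has_wirt_def has_field_derivative_def)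

lemma has_wirt_const: "has_wirt (\<lambda>_. c) z 0 0" by (simp add: has_wirt_def)

lemma has_wirt_diff: "has_wirt f z p p' \<Longrightarrow> has_wirt g z q q' \<Longrightarrow> has_wirt (\<lambda>w. f w - g w) z (p - q) (p' - q')"
 unfolding has_wirt_def
 by (drule (1) has_derivative_diff, erule has_derivative_eq_rhs) (simp add: fun_eq_iff algebra_simps)

lemma has_wirt_mult: "has_wirt f z p p' \<Longrightarrow> has_wirt g z q q' \<Longrightarrow>
  has_wirt (\<lambda>w. f w * g w) z (p * g z + f z * q) (p' * g z + f z * q')" unfolding has_wirt_def
 by (drule (1) has_derivative_mult, erule has_derivative_eq_rhs) (simp add: fun_eq_iff algebra_simps)

lemma has_wirt_compose:
 assumes "has_wirt f z p p'" and "(g has_field_derivative D) (at (f z))"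
 shows "has_wirt (\<lambda>w. g (f w)) z (D * p) (D * p')"
proof -
 have "((\<lambda>w. g (f w)) has_derivative (\<lambda>h. D * (p * h + p' * cnj h))) (at z)"
  using has_derivative_compose[of f "\<lambda>h. p * h + p' * cnj h" z UNIV g "(*) D"] assms
  by (simp add: has_wirt_def has_field_derivative_def)
 thus ?thesis by (simp add: has_wirt_def ring_distribs mult_ac)
qed

lemma has_wirt_Im: "has_wirt (\<lambda>w. of_real (Im w)) z (1 / (2 * \<i>)) (- 1 / (2 * \<i>))"
proof -
 have "bounded_linear (\<lambda>h. complex_of_real (Im h))"
  by (rule bounded_linear_compose[OF bounded_linear_of_real bounded_linear_Im])
 hence "((\<lambda>w. complex_of_real (Im w)) has_derivative (\<lambda>h. of_real (Im h))) (at z)"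
  by (rule bounded_linear_imp_has_derivative)
 moreover have "complex_of_real (Im h) = 1 / (2 * \<i>) * h + - 1 / (2 * \<i>) * cnj h" for h
  by (simp add: complex_eq_iff Re_divide Im_divide)
 ultimately show ?thesis unfolding has_wirt_def by simp
qed

lemma has_wirt_cong:
 assumes "has_wirt f z p p'" "open S" "z \<in> S" "\<And>w. w \<in> S \<Longrightarrow> f w = g w"
 shows "has_wirt g z p p'" unfolding has_wirt_def
 by (rule has_derivative_transform_within_open[OF assms(1)[unfolded has_wirt_def] assms(2-4)])

lemma has_wirt_differentiable: "has_wirt f z p p' \<Longrightarrow> f differentiable (at z)"
 unfolding has_wirt_def differentiable_def by blast

section \<open>Functions of four complex variables and termwise first-order operators\<close>

type_synonym point4 = "complex \<times> complex \<times> complex \<times> complex"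

definition uc :: "fun4 \<Rightarrow> point4 \<Rightarrow> complex" where
 "uc F = (\<lambda>(tau, u, v, t). F tau u v t)"

lemma uc_apply [simp]: "uc F (tau, u, v, t) = F tau u v t" by (simp add: uc_def)

text \<open>Wirtinger variant of \<open>d_u\<close>, equal to it where the function is holomorphic
  in u (\<open>wirt_eq_deriv\<close>). Unlike \<open>deriv\<close> it is determined by the real
  derivative, which makes it an instance of \<open>first_order\<close>.\<close>

definition d_uw :: "fun4 \<Rightarrow> fun4" where
 "d_uw F tau u v t = wirt (\<lambda>w. F tau w v t) u"

definition d_uwbar :: "fun4 \<Rightarrow> fun4" where
 "d_uwbar F tau u v t = wirt_bar (\<lambda>w. F tau w v t) u"

text \<open>The common shape of the six Wirtinger operators in tau, u and v. Locality, linearity and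
  termwise application to series are proved once for this shape.\<close>

definition first_order :: "(fun4 \<Rightarrow> fun4) \<Rightarrow> bool" where
 "first_order L \<longleftrightarrow> (\<exists>b1\<in>Basis. \<exists>b2\<in>Basis. \<exists>sg. \<forall>F tau u v t. uc F differentiable (at (tau, u, v, t)) \<longrightarrow>
   L F tau u v t = (frechet_derivative (uc F) (at (tau, u, v, t)) b1
    + sg * frechet_derivative (uc F) (at (tau, u, v, t)) b2) / 2)"

lemma slice_frechet:
 assumes "uc F differentiable (at (tau, u, v, t))"
 defines "D \<equiv> frechet_derivative (uc F) (at (tau, u, v, t))"
 shows "((\<lambda>w. F w u v t) has_derivative (\<lambda>h. D (h, 0, 0, 0))) (at tau)" (is ?c1)
  and "((\<lambda>w. F tau w v t) has_derivative (\<lambda>h. D (0, h, 0, 0))) (at u)" (is ?c2)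
  and "((\<lambda>w. F tau u w t) has_derivative (\<lambda>h. D (0, 0, h, 0))) (at v)" (is ?c3)
  and "((\<lambda>w. F tau u v w) has_derivative (\<lambda>h. D (0, 0, 0, h))) (at t)" (is ?c4)
proof -
 have D: "(uc F has_derivative D) (at (tau, u, v, t))"
  using assms(1) unfolding D_def by (simp flip: frechet_derivative_works)
 have "((\<lambda>w. (w, u, v, t)) has_derivative (\<lambda>h. (h, 0, 0, 0))) (at tau)"
  by (auto intro!: derivative_eq_intros simp: zero_prod_def)
 from has_derivative_compose[OF this, of "uc F" D] D
 have "((\<lambda>w. uc F (w, u, v, t)) has_derivative (\<lambda>h. D (h, 0, 0, 0))) (at tau)" by simp
 thus ?c1 by simp
 have "((\<lambda>w. (tau, w, v, t)) has_derivative (\<lambda>h. (0, h, 0, 0))) (at u)"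
  by (auto intro!: derivative_eq_intros simp: zero_prod_def)
 from has_derivative_compose[OF this, of "uc F" D] D
 have "((\<lambda>w. uc F (tau, w, v, t)) has_derivative (\<lambda>h. D (0, h, 0, 0))) (at u)" by simp
 thus ?c2 by simp
 have "((\<lambda>w. (tau, u, w, t)) has_derivative (\<lambda>h. (0, 0, h, 0))) (at v)"
  by (auto intro!: derivative_eq_intros simp: zero_prod_def)
 from has_derivative_compose[OF this, of "uc F" D] D
 have "((\<lambda>w. uc F (tau, u, w, t)) has_derivative (\<lambda>h. D (0, 0, h, 0))) (at v)" by simp
 thus ?c3 by simp
 have "((\<lambda>w. (tau, u, v, w)) has_derivative (\<lambda>h. (0, 0, 0, h))) (at t)"
  by (auto intro!: derivative_eq_intros simp: zero_prod_def)
 from has_derivative_compose[OF this, of "uc F" D] D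
 have "((\<lambda>w. uc F (tau, u, v, w)) has_derivative (\<lambda>h. D (0, 0, 0, h))) (at t)" by simp
 thus ?c4 by simp
qed

lemma slice_differentiable:
 assumes "uc F differentiable (at (tau, u, v, t))"
 shows "(\<lambda>w. F w u v t) differentiable (at tau)" "(\<lambda>w. F tau w v t) differentiable (at u)"
  "(\<lambda>w. F tau u w t) differentiable (at v)" using slice_frechet[OF assms] unfolding differentiable_def by blast+

lemma Basis_point4:
 "(1, 0, 0, 0) \<in> (Basis :: point4 set)" "(\<i>, 0, 0, 0) \<in> (Basis :: point4 set)"
 "(0, 1, 0, 0) \<in> (Basis :: point4 set)" "(0, \<i>, 0, 0) \<in> (Basis :: point4 set)"
 "(0, 0, 1, 0) \<in> (Basis :: point4 set)" "(0, 0, \<i>, 0) \<in> (Basis :: point4 set)"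
 "(0, 0, 0, 1) \<in> (Basis :: point4 set)" "(0, 0, 0, \<i>) \<in> (Basis :: point4 set)"
 by (simp_all add: Basis_prod_def Basis_complex_def zero_prod_def image_iff)

lemma first_orderI:
 assumes "b1 \<in> Basis" "b2 \<in> Basis"
  "\<And>F tau u v t. uc F differentiable (at (tau, u, v, t)) \<Longrightarrow>
   L F tau u v t = (frechet_derivative (uc F) (at (tau, u, v, t)) b1
    + sg * frechet_derivative (uc F) (at (tau, u, v, t)) b2) / 2"
 shows "first_order L" unfolding first_order_def using assms by blast

lemma first_order_d_tau: "first_order d_tau" by (rule first_orderI[OF Basis_point4(1,2), of _ "- \<i>"])
   (simp add: d_tau_def wirt_def frechet_derivative_at[OF slice_frechet(1), symmetric])

lemma first_order_d_taubar: "first_order d_taubar" by (rule first_orderI[OF Basis_point4(1,2), of _ \<i>])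
   (simp add: d_taubar_def wirt_bar_def frechet_derivative_at[OF slice_frechet(1), symmetric])

lemma first_order_d_uw: "first_order d_uw" by (rule first_orderI[OF Basis_point4(3,4), of _ "- \<i>"])
   (simp add: d_uw_def wirt_def frechet_derivative_at[OF slice_frechet(2), symmetric])

lemma first_order_d_uwbar: "first_order d_uwbar" by (rule first_orderI[OF Basis_point4(3,4), of _ \<i>])
   (simp add: d_uwbar_def wirt_bar_def frechet_derivative_at[OF slice_frechet(2), symmetric])

lemma first_order_d_v: "first_order d_v" by (rule first_orderI[OF Basis_point4(5,6), of _ "- \<i>"])
   (simp add: d_v_def wirt_def frechet_derivative_at[OF slice_frechet(3), symmetric])

lemma first_order_d_vbar: "first_order d_vbar" by (rule first_orderI[OF Basis_point4(5,6), of _ \<i>])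
   (simp add: d_vbar_def wirt_bar_def frechet_derivative_at[OF slice_frechet(3), symmetric])

lemmas first_order_intros = first_order_d_tau first_order_d_taubar first_order_d_uw first_order_d_uwbar
 first_order_d_v first_order_d_vbar

definition nra :: "'i set \<Rightarrow> ('i \<Rightarrow> fun4) \<Rightarrow> point4 set \<Rightarrow> bool" where
 "nra I f U \<longleftrightarrow> open U \<and> (\<forall>p\<in>U. normal_ra I (\<lambda>i. uc (f i)) p)"

definition ra4 :: "fun4 \<Rightarrow> point4 set \<Rightarrow> bool" where
 "ra4 F U \<longleftrightarrow> open U \<and> (\<forall>p\<in>U. ranalytic (uc F) p)"

definition fsum :: "'i set \<Rightarrow> ('i \<Rightarrow> fun4) \<Rightarrow> fun4" where
 "fsum I f = (\<lambda>tau u v t. \<Sum>\<^sub>\<infinity>i\<in>I. f i tau u v t)"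

lemma uc_fsum: "uc (fsum I f) = (\<lambda>p. \<Sum>\<^sub>\<infinity>i\<in>I. uc (f i) p)" by (simp add: fun_eq_iff uc_def fsum_def)

lemma nra_ra4: "nra I f U \<Longrightarrow> i \<in> I \<Longrightarrow> ra4 (f i) U"
 unfolding nra_def ra4_def using normal_ra_imp_ranalytic[of I "\<lambda>i. uc (f i)" _ i] by simp

lemma nra_fsum: "nra I f U \<Longrightarrow> ra4 (fsum I f) U"
 unfolding nra_def ra4_def uc_fsum using normal_ra_infsum[of I "\<lambda>i. uc (f i)"] by simp

lemma nra_summable: "nra I f U \<Longrightarrow> (tau, u, v, t) \<in> U \<Longrightarrow> (\<lambda>i. f i tau u v t) summable_on I"
 unfolding nra_def using normal_ra_summable[of I "\<lambda>i. uc (f i)" "(tau, u, v, t)"] by simp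

lemma nra_has_sum: "nra I f U \<Longrightarrow> (tau, u, v, t) \<in> U \<Longrightarrow> ((\<lambda>i. f i tau u v t) has_sum fsum I f tau u v t) I"
 unfolding fsum_def by (intro has_sum_infsum nra_summable)

lemma ra4_differentiable: "ra4 F U \<Longrightarrow> p \<in> U \<Longrightarrow> uc F differentiable (at p)"
 unfolding ra4_def using ranalytic_imp_differentiable[of "uc F"] by simp

lemma ra4_continuous_on: "ra4 F U \<Longrightarrow> continuous_on U (uc F)"
 unfolding ra4_def by (intro continuous_at_imp_continuous_on ballI ranalytic_imp_continuous) auto

lemma ra4_open: "ra4 F U \<Longrightarrow> open U" by (simp add: ra4_def)

lemma ra4_subset: "ra4 F U \<Longrightarrow> V \<subseteq> U \<Longrightarrow> open V \<Longrightarrow> ra4 F V" by (auto simp: ra4_def)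

lemma nra_subset: "nra I f U \<Longrightarrow> V \<subseteq> U \<Longrightarrow> open V \<Longrightarrow> nra I f V" by (auto simp: nra_def)

lemma ra4_add: "ra4 F U \<Longrightarrow> ra4 G U \<Longrightarrow> ra4 (\<lambda>tau u v t. F tau u v t + G tau u v t) U"
 using ranalytic_add[of "uc F" _ "uc G"] by (auto simp: ra4_def uc_def case_prod_unfold)

lemma ra4_diff: "ra4 F U \<Longrightarrow> ra4 G U \<Longrightarrow> ra4 (\<lambda>tau u v t. F tau u v t - G tau u v t) U"
 using ranalytic_diff[of "uc F" _ "uc G"] by (auto simp: ra4_def uc_def case_prod_unfold)

lemma ra4_mult: "ra4 F U \<Longrightarrow> ra4 G U \<Longrightarrow> ra4 (\<lambda>tau u v t. F tau u v t * G tau u v t) U"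
 using ranalytic_mult[of "uc F" _ "uc G"] by (auto simp: ra4_def uc_def case_prod_unfold)

lemma ra4_cmult: "ra4 F U \<Longrightarrow> ra4 (\<lambda>tau u v t. c * F tau u v t) U"
 using ranalytic_cmult[of "uc F" _ c] by (auto simp: ra4_def uc_def case_prod_unfold)

lemma ra4_cong:
 assumes "ra4 F U" "\<And>tau u v t. (tau, u, v, t) \<in> U \<Longrightarrow> F tau u v t = G tau u v t"
 shows "ra4 G U" unfolding ra4_def
proof (intro conjI ballI)
 show op: "open U" using assms(1) by (rule ra4_open)
 fix p assume p: "p \<in> U"
 have "ranalytic (uc F) p" using assms(1) p by (simp add: ra4_def)
 thus "ranalytic (uc G) p" by (rule ranalytic_cong[OF _ op p]) (use assms(2) in \<open>auto simp: uc_def\<close>)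
qed

lemma ra4_real_analytic: "ra4 F U \<Longrightarrow> real_analytic_on (\<lambda>(tau, u, v, t). F tau u v t) U"
 unfolding uc_def[symmetric] by (rule ranalytic_imp_real_analytic_on) (simp add: ra4_def)

lemma real_analytic_imp_ra4: "real_analytic_on (\<lambda>(tau, u, v, t). F tau u v t) U \<Longrightarrow> open U \<Longrightarrow> ra4 F U"
 unfolding uc_def[symmetric] ra4_def using real_analytic_on_imp_ranalytic[of "uc F" U] by simp

lemma first_order_cong:
 assumes L: "first_order L" and F: "ra4 F U" and eq: "\<And>tau u v t. (tau, u, v, t) \<in> U \<Longrightarrow> F tau u v t = G tau u v t"
  and p: "(tau, u, v, t) \<in> U"
 shows "L F tau u v t = L G tau u v t"
proof -
 let ?p = "(tau, u, v, t)"
 have dF: "(uc F has_derivative frechet_derivative (uc F) (at ?p)) (at ?p)"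
  using ra4_differentiable[OF F p] by (simp flip: frechet_derivative_works)
 have "(uc G has_derivative frechet_derivative (uc F) (at ?p)) (at ?p)"
  by (rule has_derivative_transform_within_open[OF dF ra4_open[OF F] p]) (use eq in \<open>auto simp: uc_def\<close>)
 hence eq: "frechet_derivative (uc G) (at ?p) = frechet_derivative (uc F) (at ?p)"
  and dG: "uc G differentiable (at ?p)" by (auto simp: differentiable_def intro: frechet_derivative_at[symmetric])
 obtain b1 b2 sg where
  L': "\<And>F. uc F differentiable (at ?p) \<Longrightarrow>
   L F tau u v t = (frechet_derivative (uc F) (at ?p) b1 + sg * frechet_derivative (uc F) (at ?p) b2) / 2"
  using L unfolding first_order_def by blast
 show ?thesis unfolding L'[OF dG] L'[OF ra4_differentiable[OF F p]] eq ..
qed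

lemma first_order_nra:
 assumes L: "first_order L" and f: "nra I f U"
 shows "nra I (\<lambda>i. L (f i)) U"
  and "\<And>tau u v t. (tau, u, v, t) \<in> U \<Longrightarrow> L (fsum I f) tau u v t = fsum I (\<lambda>i. L (f i)) tau u v t"
proof -
 obtain b1 b2 sg where b: "b1 \<in> Basis" "b2 \<in> Basis" and
  L': "\<And>F tau u v t. uc F differentiable (at (tau, u, v, t)) \<Longrightarrow>
   L F tau u v t = (frechet_derivative (uc F) (at (tau, u, v, t)) b1
    + sg * frechet_derivative (uc F) (at (tau, u, v, t)) b2) / 2" using L unfolding first_order_def by blast
 have U: "open U" using f by (simp add: nra_def)
 have nr: "normal_ra I (\<lambda>i. uc (f i)) p" if "p \<in> U" for p using f that by (simp add: nra_def)
 have dfi: "uc (f i) differentiable (at p)" if "p \<in> U" "i \<in> I" for p i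
  by (rule ranalytic_imp_differentiable[OF normal_ra_imp_ranalytic[OF nr[OF that(1)] that(2)]])
 have uL: "uc (L (f i)) p = (1/2) * (frechet_derivative (uc (f i)) (at p) b1
    + sg * frechet_derivative (uc (f i)) (at p) b2)" if "p \<in> U" "i \<in> I" for p i
  using L'[of "f i"] dfi[OF that] by (cases p) simp
 show "nra I (\<lambda>i. L (f i)) U" unfolding nra_def
 proof (intro conjI ballI U)
  fix p assume p: "p \<in> U"
  have "normal_ra I (\<lambda>i p. (1/2) * (frechet_derivative (uc (f i)) (at p) b1
    + sg * frechet_derivative (uc (f i)) (at p) b2)) p"
   by (intro normal_ra_cmult normal_ra_add normal_ra_frechet(1) nr p b)
  thus "normal_ra I (\<lambda>i. uc (L (f i))) p" by (rule normal_ra_cong[OF _ U p]) (simp add: uL)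
 qed
 fix tau u v t assume p: "(tau, u, v, t) \<in> U"
 let ?p = "(tau, u, v, t)"
 have "((\<lambda>i. (1/2) * (frechet_derivative (uc (f i)) (at ?p) b1
    + sg * frechet_derivative (uc (f i)) (at ?p) b2)) has_sum
   (1/2) * (frechet_derivative (uc (fsum I f)) (at ?p) b1
    + sg * frechet_derivative (uc (fsum I f)) (at ?p) b2)) I"
  unfolding uc_fsum by (intro has_sum_cmult_right has_sum_add normal_ra_frechet(2) nr p b)
 also have "(1/2) * (frechet_derivative (uc (fsum I f)) (at ?p) b1
    + sg * frechet_derivative (uc (fsum I f)) (at ?p) b2) = L (fsum I f) tau u v t"
  unfolding L'[OF ra4_differentiable[OF nra_fsum[OF f] p]] by simp
 finally have "((\<lambda>i. uc (L (f i)) ?p) has_sum L (fsum I f) tau u v t) I"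
  by (rule has_sum_cong[THEN iffD1, rotated]) (simp only: uL[OF p])
 thus "L (fsum I f) tau u v t = fsum I (\<lambda>i. L (f i)) tau u v t" unfolding fsum_def by (simp add: infsumI)
qed

lemma first_order_ra4:
 assumes "first_order L" "ra4 F U" shows "ra4 (L F) U"
proof -
 have "nra {()} (\<lambda>_. F) U" using assms(2) by (simp add: nra_def ra4_def ranalytic_def)
 from nra_ra4[OF first_order_nra(1)[OF assms(1) this]] show ?thesis by simp
qed

text \<open>The first application again yields a normally convergent family, so the second one
  passes through as well; \<open>first_order_cong\<close> is what allows \<open>L'\<close> of the
  sum to be replaced under \<open>L\<close>.\<close>

lemma first_order_nra2:
 assumes L: "first_order L" "first_order L'" and f: "nra I f U" and p: "(tau, u, v, t) \<in> U"
 shows "L (L' (fsum I f)) tau u v t = fsum I (\<lambda>i. L (L' (f i))) tau u v t"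
proof -
 have "L (L' (fsum I f)) tau u v t = L (fsum I (\<lambda>i. L' (f i))) tau u v t" using first_order_nra(2)[OF L(2) f]
  by (intro first_order_cong[OF L(1) first_order_ra4[OF L(2) nra_fsum[OF f]] _ p]) auto
 also have "\<dots> = fsum I (\<lambda>i. L (L' (f i))) tau u v t"
  by (rule first_order_nra(2)[OF L(1) first_order_nra(1)[OF L(2) f] p])
 finally show ?thesis .
qed

section \<open>Gaussian sums over the integers\<close>

lemma has_sum_int_split:
 fixes f :: "int \<Rightarrow> 'a::{topological_comm_monoid_add, t3_space}"
 assumes "((\<lambda>n. f (int n)) has_sum a) UNIV" "((\<lambda>n. f (- 1 - int n)) has_sum b) UNIV"
 shows "(f has_sum (a + b)) UNIV"
proof -
 have un: "range int \<union> range (\<lambda>n. - 1 - int n) = UNIV"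
 proof (intro set_eqI iffI UNIV_I)
  fix k :: int
  show "k \<in> range int \<union> range (\<lambda>n. - 1 - int n)"
  proof (cases "k \<ge> 0")
   case True thus ?thesis by (intro UnI1 image_eqI[of _ _ "nat k"]) auto
  next
   case False thus ?thesis by (intro UnI2 image_eqI[of _ _ "nat (- 1 - k)"]) auto
  qed
 qed
 have 1: "(f has_sum a) (range int)" using assms(1) by (subst has_sum_reindex) (auto simp: o_def)
 have 2: "(f has_sum b) (range (\<lambda>n. - 1 - int n))"
  using assms(2) by (subst has_sum_reindex) (auto simp: o_def inj_on_def)
 have "(f has_sum (a + b)) (range int \<union> range (\<lambda>n. - 1 - int n))" by (rule has_sum_Un_disjoint[OF 1 2]) auto
 thus ?thesis unfolding un .
qed

lemma summable_on_exp_abs_int: "(\<lambda>n::int. exp (- \<bar>of_int n\<bar> :: real)) summable_on UNIV"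
proof -
 have e: "(\<lambda>n. exp (- real n)) = (\<lambda>n. exp (- 1) ^ n)" by (simp add: fun_eq_iff flip: exp_of_nat_mult)
 have s1: "(\<lambda>n. exp (- real n)) summable_on UNIV"
  unfolding e by (rule norm_summable_imp_summable_on) (simp add: summable_geometric)
 have s2: "(\<lambda>n. exp (-1) * exp (- real n)) summable_on UNIV" by (rule summable_on_cmult_right[OF s1])
 have 1: "((\<lambda>n. exp (- \<bar>of_int (int n)\<bar> :: real)) has_sum (\<Sum>\<^sub>\<infinity>n. exp (- real n))) UNIV"
  using has_sum_infsum[OF s1] by simp
 have "exp (- \<bar>of_int (- 1 - int n)\<bar> :: real) = exp (-1) * exp (- real n)" for n by (simp add: abs_if flip: exp_add)
 hence 2: "((\<lambda>n. exp (- \<bar>of_int (- 1 - int n)\<bar> :: real)) has_sum (\<Sum>\<^sub>\<infinity>n. exp (-1) * exp (- real n))) UNIV"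
  using has_sum_infsum[OF s2] by simp
 show ?thesis using has_sum_int_split[of "\<lambda>n. exp (- \<bar>of_int n\<bar> :: real)", OF 1 2] by (rule has_sum_imp_summable)
qed

text \<open>Completing the square in |n| bounds the exponent by a constant minus |n|.\<close>

lemma gaussian_summable:
 assumes c: "c > 0"
 shows "(\<lambda>n::int. exp (- c * (of_int n)^2 + d * \<bar>of_int n\<bar> + e :: real)) summable_on UNIV"
proof (rule summable_on_comparison_test)
 show "(\<lambda>n::int. exp ((d + 1)^2 / (4 * c) + e) * exp (- \<bar>of_int n\<bar> :: real)) summable_on UNIV"
  by (rule summable_on_cmult_right[OF summable_on_exp_abs_int])
 fix n :: int
 let ?x = "\<bar>of_int n\<bar> :: real"
 have "0 \<le> (2 * c * ?x - (d + 1))^2 / (4 * c)" using c by simp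
 also have "\<dots> = c * ?x\<^sup>2 - (d + 1) * ?x + (d + 1)^2 / (4 * c)" using c by (simp add: field_simps power2_eq_square)
 finally have "- c * ?x\<^sup>2 + d * ?x + e \<le> ((d + 1)^2 / (4 * c) + e) + - ?x" by (simp add: algebra_simps)
 thus "exp (- c * (of_int n)^2 + d * \<bar>of_int n\<bar> + e :: real) \<le> exp ((d + 1)^2 / (4 * c) + e) * exp (- ?x)"
  by (simp flip: exp_add)
qed simp

lemma gaussian_shift_le:
 assumes "c \<ge> 0" "d \<ge> 0"
 shows "- c * (x + delta)^2 + d * \<bar>x + delta\<bar> \<le> - (c / 2) * x^2 + d * \<bar>x\<bar> + (c * delta^2 + d * \<bar>delta\<bar> :: real)"
proof -
 have "0 \<le> (x + 2 * delta)^2" by simp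
 hence "(x + delta)^2 \<ge> x^2 / 2 - delta\<^sup>2" by (simp add: power2_eq_square algebra_simps)
 hence "c * (x + delta)^2 \<ge> c * (x^2 / 2 - delta\<^sup>2)" using assms by (intro mult_left_mono)
 moreover have "d * \<bar>x + delta\<bar> \<le> d * (\<bar>x\<bar> + \<bar>delta\<bar>)" using assms by (intro mult_left_mono) auto
 ultimately show ?thesis by (simp add: algebra_simps)
qed

lemma gaussian_shift_summable:
 assumes "c > 0" "d \<ge> 0"
 shows "(\<lambda>n::int. exp (- c * (of_int n + delta)^2 + d * \<bar>of_int n + delta\<bar> + e :: real)) summable_on UNIV"
proof (rule summable_on_comparison_test)
 show "(\<lambda>n::int. exp (- (c / 2) * (of_int n)^2 + d * \<bar>of_int n\<bar> + (c * delta^2 + d * \<bar>delta\<bar> + e) :: real)) summable_on UNIV"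
  using assms by (intro gaussian_summable) auto
 fix n :: int
 show "exp (- c * (of_int n + delta)^2 + d * \<bar>of_int n + delta\<bar> + e :: real)
   \<le> exp (- (c / 2) * (of_int n)^2 + d * \<bar>of_int n\<bar> + (c * delta^2 + d * \<bar>delta\<bar> + e))"
  using gaussian_shift_le[of c d "of_int n" delta] assms by simp
qed simp

section \<open>Exponentials and theta functions\<close>

lemma e2pi_0 [simp]: "e2pi 0 = 1" by (simp add: e2pi_def)

lemma e2pi_eqI: "a = b \<Longrightarrow> e2pi a = e2pi b" by simp

lemma e2pi_add: "e2pi (a + b) = e2pi a * e2pi b" by (simp add: e2pi_def exp_add ring_distribs)

lemma e2pi_diff: "e2pi (a - b) = e2pi a / e2pi b" by (simp add: e2pi_def exp_diff right_diff_distrib)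

lemma e2pi_uminus: "e2pi (- a) = inverse (e2pi a)" by (simp add: e2pi_def exp_minus)

lemma e2pi_nonzero [simp]: "e2pi a \<noteq> 0" by (simp add: e2pi_def)

lemma qpow_e2pi: "qpow tau r = e2pi (of_real r * tau)" by (simp add: qpow_def e2pi_def mult_ac)

lemma e2pi_of_int [simp]: "e2pi (of_int k) = 1" using exp_integer_2pi[of "of_int k"] by (simp add: e2pi_def mult_ac)

lemma e2pi_Ints: "z \<in> \<int> \<Longrightarrow> e2pi z = 1" by (auto elim: Ints_cases)

lemma e2pi_of_real_Ints: "x \<in> \<int> \<Longrightarrow> e2pi (of_real x) = 1" by (rule e2pi_Ints) simp

lemma norm_e2pi: "norm (e2pi z) = exp (- 2 * pi * Im z)" by (simp add: e2pi_def)

lemma e2pi_eq_1_iff: "e2pi z = 1 \<longleftrightarrow> z \<in> \<int>"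
proof
 assume "e2pi z = 1"
 then obtain n :: int where n: "Re (2 * of_real pi * \<i> * z) = 0" "Im (2 * of_real pi * \<i> * z) = of_int (2 * n) * pi"
  unfolding e2pi_def exp_eq_1 by blast
 hence "z = of_int n" by (simp add: complex_eq_iff)
 thus "z \<in> \<int>" by simp
qed (rule e2pi_Ints)

lemma holomorphic_e2pi [holomorphic_intros]: "f holomorphic_on A \<Longrightarrow> (\<lambda>z. e2pi (f z)) holomorphic_on A"
 unfolding e2pi_def by (intro holomorphic_intros)

lemma continuous_e2pi [continuous_intros]: "continuous_on A f \<Longrightarrow> continuous_on A (\<lambda>z. e2pi (f z))"
 unfolding e2pi_def by (intro continuous_intros)

lemma has_field_derivative_e2pi:
 "(f has_field_derivative D) (at z within A) \<Longrightarrow>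
  ((\<lambda>z. e2pi (f z)) has_field_derivative (2 * of_real pi * \<i> * D * e2pi (f z))) (at z within A)"
 unfolding e2pi_def by (auto intro!: derivative_eq_intros)

definition sgn_unit :: "complex \<Rightarrow> bool" where "sgn_unit eps \<longleftrightarrow> eps = 1 \<or> eps = -1"

lemma sgn_unitD: "sgn_unit eps \<Longrightarrow> eps \<noteq> 0" "sgn_unit eps \<Longrightarrow> norm (eps powi n) = 1" "sgn_unit eps \<Longrightarrow> eps * eps = 1"
 "sgn_unit eps \<Longrightarrow> inverse eps = eps" by (auto simp: sgn_unit_def norm_power_int)

lemma sgn_unit_add: "sgn_unit eps \<Longrightarrow> eps powi (a + b) = eps powi a * eps powi b"
 by (rule power_int_add) (auto dest: sgn_unitD(1))

text \<open>The power of q and the exponential in z are merged into a single \<open>e2pi\<close>, so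
  that every transformation law becomes a comparison of exponents.\<close>

definition theta_term :: "complex \<Rightarrow> real \<Rightarrow> real \<Rightarrow> int \<Rightarrow> complex \<Rightarrow> complex \<Rightarrow> complex" where
 "theta_term eps j m n tau z = eps powi n *
   e2pi (of_real (m * (of_int n + j / (2 * m))^2) * tau + of_real (m * (of_int n + j / (2 * m))) * z)"

lemma Theta_eq: "Theta eps j m tau z = (\<Sum>\<^sub>\<infinity>n. theta_term eps j m n tau z)"
 by (simp add: Theta_def theta_term_def qpow_e2pi e2pi_add mult_ac)

definition theta_bound :: "real \<Rightarrow> real \<Rightarrow> real \<Rightarrow> real \<Rightarrow> int \<Rightarrow> real" where
 "theta_bound j m y h n = exp (- (2 * pi * m * y) * (of_int n + j / (2 * m))^2
   + 2 * pi * m * h * \<bar>of_int n + j / (2 * m)\<bar>)"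

lemma norm_theta_term_le:
 assumes "sgn_unit eps" "m > 0" "y \<le> Im tau" "\<bar>Im z\<bar> \<le> h"
 shows "norm (theta_term eps j m n tau z) \<le> theta_bound j m y h n"
proof -
 define N where "N = of_int n + j / (2 * m)"
 have "norm (theta_term eps j m n tau z) = exp (- 2 * pi * (m * N^2 * Im tau + m * N * Im z))"
  using assms(1) by (simp add: theta_term_def norm_mult sgn_unitD norm_e2pi N_def)
 also have "- 2 * pi * (m * N^2 * Im tau + m * N * Im z) \<le> - (2 * pi * m * y) * N^2 + 2 * pi * m * h * \<bar>N\<bar>"
 proof -
  have "(2 * pi * m * N^2) * y \<le> (2 * pi * m * N^2) * Im tau" using assms by (intro mult_left_mono) auto
  moreover have "- (N * Im z) \<le> \<bar>N\<bar> * h"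
   using assms(4) mult_left_mono[of "\<bar>Im z\<bar>" h "\<bar>N\<bar>"] by (simp add: abs_mult[symmetric])
  hence "(2 * pi * m) * - (N * Im z) \<le> (2 * pi * m) * (\<bar>N\<bar> * h)" using assms(2) by (intro mult_left_mono) auto
  moreover have "- 2 * pi * (m * N^2 * Im tau + m * N * Im z)
    = - ((2 * pi * m * N^2) * Im tau) + (2 * pi * m) * - (N * Im z)" by (simp add: algebra_simps)
  moreover have "- (2 * pi * m * y) * N^2 + 2 * pi * m * h * \<bar>N\<bar>
    = - ((2 * pi * m * N^2) * y) + (2 * pi * m) * (\<bar>N\<bar> * h)" by (simp add: algebra_simps)
  ultimately show ?thesis by linarith
 qed
 finally show ?thesis by (simp add: theta_bound_def N_def)
qed

lemma theta_bound_summable: "m > 0 \<Longrightarrow> y > 0 \<Longrightarrow> h \<ge> 0 \<Longrightarrow> theta_bound j m y h summable_on UNIV"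
 using gaussian_shift_summable[of "2 * pi * m * y" "2 * pi * m * h" "j / (2 * m)" 0] unfolding theta_bound_def by simp

lemma theta_has_sum:
 assumes "sgn_unit eps" "m > 0" "Im tau > 0"
 shows "((\<lambda>n. theta_term eps j m n tau z) has_sum Theta eps j m tau z) UNIV"
proof -
 have "(\<lambda>n. theta_term eps j m n tau z) summable_on UNIV"
  by (rule abs_summable_summable, rule Infinite_Sum.abs_summable_on_comparison_test'[OF theta_bound_summable[of m "Im tau" "\<bar>Im z\<bar>" j]])
    (use assms in \<open>auto intro!: norm_theta_term_le\<close>)
 thus ?thesis unfolding Theta_eq by (rule has_sum_infsum)
qed

lemma holomorphic_theta_term: "(\<lambda>z. theta_term eps j m n tau z) holomorphic_on A"
 unfolding theta_term_def by (intro holomorphic_intros)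

lemma holomorphic_Theta:
 assumes "sgn_unit eps" "m > 0" "Im tau > 0"
 shows "(\<lambda>z. Theta eps j m tau z) holomorphic_on A"
proof -
 have "(\<lambda>z. Theta eps j m tau z) field_differentiable (at z)" for z
 proof -
  have "(\<lambda>z. Theta eps j m tau z) holomorphic_on ball z 1" unfolding Theta_eq
  proof (rule holomorphic_on_infsum[OF open_ball])
   show "norm (theta_term eps j m n tau w) \<le> theta_bound j m (Im tau) (\<bar>Im z\<bar> + 1) n" if "w \<in> ball z 1" for n w
    using assms that abs_Im_le_cmod[of "w - z"] by (intro norm_theta_term_le) (auto simp: dist_norm norm_minus_commute)
  qed (use assms in \<open>auto intro!: theta_bound_summable holomorphic_theta_term\<close>)
  thus ?thesis by (rule holomorphic_on_imp_differentiable_at) auto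
 qed
 thus ?thesis by (simp add: field_differentiable_at_within holomorphic_on_def)
qed

lemma Theta_shift_2int:
 assumes "2 * m \<in> \<int>" "m \<noteq> 0"
 shows "Theta eps j m tau (z + 2 * of_int k) = e2pi (of_real (j * of_int k)) * Theta eps j m tau z"
proof -
 have "theta_term eps j m n tau (z + 2 * of_int k) = e2pi (of_real (j * of_int k)) * theta_term eps j m n tau z" for n
 proof -
  have eq: "of_real (m * (of_int n + j / (2 * m))^2) * tau + of_real (m * (of_int n + j / (2 * m))) * (z + 2 * of_int k)
   = (of_real (m * (of_int n + j / (2 * m))^2) * tau + of_real (m * (of_int n + j / (2 * m))) * z)
    + of_real (j * of_int k) + of_real ((2 * m) * of_int n * of_int k)" using assms(2) by (simp add: field_simps)
  have "e2pi (of_real ((2 * m) * of_int n * of_int k)) = 1"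
   by (intro e2pi_of_real_Ints Ints_mult[OF Ints_mult[OF assms(1) Ints_of_int] Ints_of_int])
  thus ?thesis unfolding theta_term_def eq by (simp add: e2pi_add mult_ac)
 qed
 thus ?thesis unfolding Theta_eq by (simp add: infsum_cmult_right')
qed

text \<open>Reindexing n to n + l completes the square. The shift has the sign and size that u + l
  tau induces in the argument -2u.\<close>

lemma Theta_shift_tau:
 assumes "sgn_unit eps" "m \<noteq> 0"
 shows "Theta eps j m tau (z - 2 * of_int l * tau)
   = eps powi l * qpow tau (- m * (of_int l)^2) * e2pi (of_real (m * of_int l) * z) * Theta eps j m tau z"
proof -
 have t: "theta_term eps j m (n + l) tau (z - 2 * of_int l * tau)
   = eps powi l * qpow tau (- m * (of_int l)^2) * e2pi (of_real (m * of_int l) * z) * theta_term eps j m n tau z" for n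
 proof -
  have eq: "of_real (m * (of_int (n + l) + j / (2 * m))^2) * tau + of_real (m * (of_int (n + l) + j / (2 * m))) * (z - 2 * of_int l * tau)
   = of_real (- m * (of_int l)^2) * tau + of_real (m * of_int l) * z
    + (of_real (m * (of_int n + j / (2 * m))^2) * tau + of_real (m * (of_int n + j / (2 * m))) * z)"
   using assms(2) by (simp add: field_simps power2_eq_square)
  show ?thesis unfolding theta_term_def eq by (simp only: e2pi_add qpow_e2pi sgn_unit_add[OF assms(1)] mult_ac)
 qed
 have bij: "bij_betw (\<lambda>n. n + l) UNIV (UNIV :: int set)" by (rule bij_betwI[of _ _ _ "\<lambda>n. n - l"]) auto
 have "Theta eps j m tau (z - 2 * of_int l * tau) = (\<Sum>\<^sub>\<infinity>n. theta_term eps j m (n + l) tau (z - 2 * of_int l * tau))"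
  unfolding Theta_eq by (rule infsum_reindex_bij_betw[OF bij, symmetric])
 thus ?thesis unfolding t Theta_eq by (simp add: infsum_cmult_right')
qed

text \<open>The square is completed by moving n + j/(2m) by 1/(2m), that is by lowering j. This is
  the effect of the shift of u by tau/(2m) on the argument -2u.\<close>

lemma Theta_shift_tau_over_m:
 assumes "m \<noteq> 0"
 shows "Theta eps j m tau (z - tau / of_real m) = qpow tau (- 1 / (4 * m)) * e2pi (z / 2) * Theta eps (j - 1) m tau z"
proof -
 have "theta_term eps j m n tau (z - tau / of_real m) = qpow tau (- 1 / (4 * m)) * e2pi (z / 2) * theta_term eps (j - 1) m n tau z" for n
 proof -
  have eq: "of_real (m * (of_int n + j / (2 * m))^2) * tau + of_real (m * (of_int n + j / (2 * m))) * (z - tau / of_real m)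
   = of_real (- 1 / (4 * m)) * tau + z / 2
    + (of_real (m * (of_int n + (j - 1) / (2 * m))^2) * tau + of_real (m * (of_int n + (j - 1) / (2 * m))) * z)"
   using assms by (simp add: field_simps power2_eq_square)
  show ?thesis unfolding theta_term_def eq by (simp only: e2pi_add qpow_e2pi mult_ac)
 qed
 thus ?thesis unfolding Theta_eq by (simp add: infsum_cmult_right')
qed

lemma Theta_index_shift:
 assumes "sgn_unit eps" "m \<noteq> 0"
 shows "Theta eps (j + 2 * m) m tau z = eps * Theta eps j m tau z"
proof -
 have t: "theta_term eps (j + 2 * m) m n tau z = eps * theta_term eps j m (n + 1) tau z" for n
 proof -
  have "(j + 2 * m) / (2 * m) = j / (2 * m) + 1" using assms by (simp add: field_simps)
  thus ?thesis using sgn_unitD(3)[OF assms(1)] unfolding theta_term_def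
   by (simp add: sgn_unit_add[OF assms(1)] add_ac)
 qed
 have bij: "bij_betw (\<lambda>n. n + 1) UNIV (UNIV :: int set)" by (rule bij_betwI[of _ _ _ "\<lambda>n. n - 1"]) auto
 have "Theta eps j m tau z = (\<Sum>\<^sub>\<infinity>n. theta_term eps j m (n + 1) tau z)"
  unfolding Theta_eq by (rule infsum_reindex_bij_betw[OF bij, symmetric])
 thus ?thesis unfolding t Theta_eq by (simp add: infsum_cmult_right')
qed

lemma Theta_shift_int_over_m:
 assumes "m \<noteq> 0"
 shows "Theta eps j m tau (z - of_real (of_int k / m)) = e2pi (- of_real (j * of_int k / (2 * m))) * Theta eps j m tau z"
proof -
 have "theta_term eps j m n tau (z - of_real (of_int k / m)) = e2pi (- of_real (j * of_int k / (2 * m))) * theta_term eps j m n tau z" for n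
 proof -
  have eq: "of_real (m * (of_int n + j / (2 * m))^2) * tau + of_real (m * (of_int n + j / (2 * m))) * (z - of_real (of_int k / m))
   = - of_real (j * of_int k / (2 * m))
    + (of_real (m * (of_int n + j / (2 * m))^2) * tau + of_real (m * (of_int n + j / (2 * m))) * z) + of_int (- n * k)"
   using assms by (simp add: field_simps power2_eq_square)
  show ?thesis unfolding theta_term_def eq e2pi_add e2pi_of_int by (simp add: mult_ac)
 qed
 thus ?thesis unfolding Theta_eq by (simp add: infsum_cmult_right')
qed

lemma theta11_shift_1: "theta11 tau (z + of_int k) = (-1) powi k * theta11 tau z"
proof -
 have "e2pi (of_real (of_int k / 2)) = (-1) powi k"
 proof -
  have "e2pi (of_real (of_int k / 2)) = cis (of_int k * pi)" by (simp add: e2pi_def cis_conv_exp mult_ac)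
  also have "\<dots> = cis pi powi k" by (rule cis_power_int[symmetric])
  finally show ?thesis by simp
 qed
 thus ?thesis using Theta_shift_2int[of "1/2" "-1" "1/2" tau "2 * z" k] by (simp add: theta11_def ring_distribs)
qed

lemma theta11_shift_tau:
 "theta11 tau (z + of_int l * tau) = (-1) powi l * e2pi (- of_real ((of_int l)^2 / 2) * tau - of_int l * z) * theta11 tau z"
proof -
 have p: "(-1) powi (- l) = ((-1) powi l :: complex)" by (simp add: power_int_minus flip: power_int_inverse)
 have e: "qpow tau (- (1 / 2) * (of_int (- l))^2) * e2pi (of_real (1 / 2 * of_int (- l)) * (2 * z))
   = e2pi (- of_real ((of_int l)^2 / 2) * tau - of_int l * z)"
  unfolding qpow_e2pi e2pi_add[symmetric] by (rule e2pi_eqI) (simp add: algebra_simps)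
 have "Theta (-1) (1/2) (1/2) tau (2 * z - 2 * of_int (- l) * tau) = (-1) powi (- l)
   * (qpow tau (- (1 / 2) * (of_int (- l))^2) * e2pi (of_real (1 / 2 * of_int (- l)) * (2 * z))) * Theta (-1) (1/2) (1/2) tau (2 * z)"
  using Theta_shift_tau[of "-1" "1/2" "1/2" tau "2 * z" "- l"] by (simp only: sgn_unit_def mult.assoc) simp
 thus ?thesis unfolding e p by (simp add: theta11_def ring_distribs mult_ac)
qed

section \<open>Holomorphic families are real analytic families\<close>

definition holo4 :: "real \<Rightarrow> point4 \<Rightarrow> fun4 \<Rightarrow> bool" where
 "holo4 rho p g \<longleftrightarrow> (case p of (tau0, u0, v0, t0) \<Rightarrow>
   \<forall>tau\<in>ball tau0 rho. \<forall>u\<in>ball u0 rho. \<forall>v\<in>ball v0 rho. \<forall>t\<in>ball t0 rho.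
    (\<lambda>w. g w u v t) holomorphic_on ball tau0 rho \<and> (\<lambda>w. g tau w v t) holomorphic_on ball u0 rho \<and>
    (\<lambda>w. g tau u w t) holomorphic_on ball v0 rho \<and> (\<lambda>w. g tau u v w) holomorphic_on ball t0 rho)"

text \<open>The coordinate tau on the complexification, where real and imaginary part have become
  independent complex variables. A holomorphic function of tau is complexified by substituting
  \<open>c_tau\<close>; the same holds for the next three definitions.\<close>

definition c_tau :: "(point4 \<Rightarrow> complex) \<Rightarrow> complex" where
 "c_tau zeta = zeta (1, 0, 0, 0) + \<i> * zeta (\<i>, 0, 0, 0)"
definition c_u :: "(point4 \<Rightarrow> complex) \<Rightarrow> complex" where
 "c_u zeta = zeta (0, 1, 0, 0) + \<i> * zeta (0, \<i>, 0, 0)"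
definition c_v :: "(point4 \<Rightarrow> complex) \<Rightarrow> complex" where
 "c_v zeta = zeta (0, 0, 1, 0) + \<i> * zeta (0, 0, \<i>, 0)"
definition c_t :: "(point4 \<Rightarrow> complex) \<Rightarrow> complex" where
 "c_t zeta = zeta (0, 0, 0, 1) + \<i> * zeta (0, 0, 0, \<i>)"

lemma c_emb [simp]: "c_tau (emb (tau, u, v, t)) = tau" "c_u (emb (tau, u, v, t)) = u"
 "c_v (emb (tau, u, v, t)) = v" "c_t (emb (tau, u, v, t)) = t"
 by (simp_all add: c_tau_def c_u_def c_v_def c_t_def Basis_point4 inner_complex_def complex_eq_iff)

lemma Basis_point4_cases:
 assumes "b \<in> (Basis :: point4 set)"
 obtains "b = (1, 0, 0, 0)" | "b = (\<i>, 0, 0, 0)" | "b = (0, 1, 0, 0)" | "b = (0, \<i>, 0, 0)"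
  | "b = (0, 0, 1, 0)" | "b = (0, 0, \<i>, 0)" | "b = (0, 0, 0, 1)" | "b = (0, 0, 0, \<i>)"
 using assms by (auto simp: Basis_prod_def Basis_complex_def zero_prod_def)

lemma polydisc_c_ball:
 assumes z: "zeta \<in> polydisc Basis (emb (tau0, u0, v0, t0)) r"
 shows "c_tau zeta \<in> ball tau0 (2 * r)" "c_u zeta \<in> ball u0 (2 * r)" "c_v zeta \<in> ball v0 (2 * r)"
  "c_t zeta \<in> ball t0 (2 * r)"
  "zeta (\<i>, 0, 0, 0) \<in> ball (of_real (Im tau0)) r" (is ?c1) "zeta (0, 0, \<i>, 0) \<in> ball (of_real (Im v0)) r" (is ?c2)
proof -
 have *: "x + \<i> * y \<in> ball w (2 * r)" if "x \<in> ball (of_real (Re w)) r" "y \<in> ball (of_real (Im w)) r"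
  for x y w :: complex
 proof -
  have "w - (x + \<i> * y) = (of_real (Re w) - x) + \<i> * (of_real (Im w) - y)" by (simp add: complex_eq_iff)
  also have "norm \<dots> \<le> norm (of_real (Re w) - x) + norm (of_real (Im w) - y)"
   by (rule norm_triangle_le) (simp add: norm_mult)
  also have "\<dots> < 2 * r" using that by (simp add: dist_norm)
  finally show ?thesis by (simp add: dist_norm)
 qed
 note P = polydisc_memD[OF z]
 show "c_tau zeta \<in> ball tau0 (2 * r)" "c_u zeta \<in> ball u0 (2 * r)" "c_v zeta \<in> ball v0 (2 * r)"
  "c_t zeta \<in> ball t0 (2 * r)" unfolding c_tau_def c_u_def c_v_def c_t_def
  using P[OF Basis_point4(1)] P[OF Basis_point4(2)] P[OF Basis_point4(3)] P[OF Basis_point4(4)]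
   P[OF Basis_point4(5)] P[OF Basis_point4(6)] P[OF Basis_point4(7)] P[OF Basis_point4(8)]
  by (intro *; simp add: Basis_point4 inner_complex_def)+
 show ?c1 "zeta (0, 0, \<i>, 0) \<in> ball (of_real (Im v0)) r"
  using P[OF Basis_point4(2)] P[OF Basis_point4(6)] by (simp_all add: Basis_point4 inner_complex_def)
qed

lemma holo4_sep_holo:
 assumes g: "holo4 rho p0 g" and r: "2 * r \<le> rho"
 shows "sep_holo Basis (emb p0) r (\<lambda>zeta. g (c_tau zeta) (c_u zeta) (c_v zeta) (c_t zeta))" unfolding sep_holo_def
proof (intro ballI)
 fix zeta b assume z: "zeta \<in> polydisc Basis (emb p0) r" and b: "b \<in> (Basis :: point4 set)"
 obtain tau0 u0 v0 t0 where p0: "p0 = (tau0, u0, v0, t0)" by (cases p0) auto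
 have in_ball: "c_tau zeta' \<in> ball tau0 rho \<and> c_u zeta' \<in> ball u0 rho \<and> c_v zeta' \<in> ball v0 rho \<and> c_t zeta' \<in> ball t0 rho"
  if "zeta' \<in> polydisc Basis (emb p0) r" for zeta'
  using polydisc_c_ball[OF that[unfolded p0]] subset_ball[OF r] by blast
 note upd = in_ball[OF polydisc_upd[OF z b]]
 have hol: "(\<lambda>w. g w (c_u zeta) (c_v zeta) (c_t zeta)) holomorphic_on ball tau0 rho"
  "(\<lambda>w. g (c_tau zeta) w (c_v zeta) (c_t zeta)) holomorphic_on ball u0 rho"
  "(\<lambda>w. g (c_tau zeta) (c_u zeta) w (c_t zeta)) holomorphic_on ball v0 rho"
  "(\<lambda>w. g (c_tau zeta) (c_u zeta) (c_v zeta) w) holomorphic_on ball t0 rho"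
  using g in_ball[OF z] unfolding holo4_def p0 by auto
 have comp: "(\<lambda>z. h (c z)) holomorphic_on ball (emb p0 b) r"
  if "h holomorphic_on ball w0 rho" "c holomorphic_on ball (emb p0 b) r"
   "\<And>z. z \<in> ball (emb p0 b) r \<Longrightarrow> c z \<in> ball w0 rho" for h c w0
  using holomorphic_on_compose_gen[OF that(2,1)] that(3) by (auto simp: o_def image_subset_iff)
 show "(\<lambda>z. g (c_tau (zeta(b := z))) (c_u (zeta(b := z))) (c_v (zeta(b := z))) (c_t (zeta(b := z)))) holomorphic_on ball (emb p0 b) r"
  using b
 proof (cases rule: Basis_point4_cases)
  case 1
  have "(\<lambda>z. g (c_tau (zeta(b := z))) (c_u zeta) (c_v zeta) (c_t zeta)) holomorphic_on ball (emb p0 b) r"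
   by (rule comp[OF hol(1)]) (use upd in \<open>auto simp: c_tau_def 1 intro!: holomorphic_intros\<close>)
  thus ?thesis by (simp add: c_u_def c_v_def c_t_def 1)
 next
  case 2
  have "(\<lambda>z. g (c_tau (zeta(b := z))) (c_u zeta) (c_v zeta) (c_t zeta)) holomorphic_on ball (emb p0 b) r"
   by (rule comp[OF hol(1)]) (use upd in \<open>auto simp: c_tau_def 2 intro!: holomorphic_intros\<close>)
  thus ?thesis by (simp add: c_u_def c_v_def c_t_def 2)
 next
  case 3
  have "(\<lambda>z. g (c_tau zeta) (c_u (zeta(b := z))) (c_v zeta) (c_t zeta)) holomorphic_on ball (emb p0 b) r"
   by (rule comp[OF hol(2)]) (use upd in \<open>auto simp: c_u_def 3 intro!: holomorphic_intros\<close>)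
  thus ?thesis by (simp add: c_tau_def c_v_def c_t_def 3)
 next
  case 4
  have "(\<lambda>z. g (c_tau zeta) (c_u (zeta(b := z))) (c_v zeta) (c_t zeta)) holomorphic_on ball (emb p0 b) r"
   by (rule comp[OF hol(2)]) (use upd in \<open>auto simp: c_u_def 4 intro!: holomorphic_intros\<close>)
  thus ?thesis by (simp add: c_tau_def c_v_def c_t_def 4)
 next
  case 5
  have "(\<lambda>z. g (c_tau zeta) (c_u zeta) (c_v (zeta(b := z))) (c_t zeta)) holomorphic_on ball (emb p0 b) r"
   by (rule comp[OF hol(3)]) (use upd in \<open>auto simp: c_v_def 5 intro!: holomorphic_intros\<close>)
  thus ?thesis by (simp add: c_tau_def c_u_def c_t_def 5)
 next
  case 6
  have "(\<lambda>z. g (c_tau zeta) (c_u zeta) (c_v (zeta(b := z))) (c_t zeta)) holomorphic_on ball (emb p0 b) r"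
   by (rule comp[OF hol(3)]) (use upd in \<open>auto simp: c_v_def 6 intro!: holomorphic_intros\<close>)
  thus ?thesis by (simp add: c_tau_def c_u_def c_t_def 6)
 next
  case 7
  have "(\<lambda>z. g (c_tau zeta) (c_u zeta) (c_v zeta) (c_t (zeta(b := z)))) holomorphic_on ball (emb p0 b) r"
   by (rule comp[OF hol(4)]) (use upd in \<open>auto simp: c_t_def 7 intro!: holomorphic_intros\<close>)
  thus ?thesis by (simp add: c_tau_def c_u_def c_v_def 7)
 next
  case 8
  have "(\<lambda>z. g (c_tau zeta) (c_u zeta) (c_v zeta) (c_t (zeta(b := z)))) holomorphic_on ball (emb p0 b) r"
   by (rule comp[OF hol(4)]) (use upd in \<open>auto simp: c_t_def 8 intro!: holomorphic_intros\<close>)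
  thus ?thesis by (simp add: c_tau_def c_u_def c_v_def 8)
 qed
qed

text \<open>The main source of \<open>nra\<close> families: substitution of the complexified
  coordinates extends each member, and the local bounds carry over. The radius is halved because |x
  + i y| can reach twice the polyradius.\<close>

lemma nra_holoI:
 assumes U: "open U"
  and "\<And>tau0 u0 v0 t0. (tau0, u0, v0, t0) \<in> U \<Longrightarrow> \<exists>rho>0. \<exists>M. M summable_on I \<and>
   (\<forall>i\<in>I. holo4 rho (tau0, u0, v0, t0) (g i) \<and>
    (\<forall>tau\<in>ball tau0 rho. \<forall>u\<in>ball u0 rho. \<forall>v\<in>ball v0 rho. \<forall>t\<in>ball t0 rho. norm (g i tau u v t) \<le> M i))"
 shows "nra I g U" unfolding nra_def
proof (intro conjI U ballI)
 fix p assume p: "p \<in> U"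
 obtain tau0 u0 v0 t0 where p0: "p = (tau0, u0, v0, t0)" by (cases p) auto
 from p have "(tau0, u0, v0, t0) \<in> U" unfolding p0 .
 from assms(2)[OF this] obtain rho M where rho: "rho > 0" and M: "M summable_on I" and
  H: "\<forall>i\<in>I. holo4 rho (tau0, u0, v0, t0) (g i) \<and>
    (\<forall>tau\<in>ball tau0 rho. \<forall>u\<in>ball u0 rho. \<forall>v\<in>ball v0 rho. \<forall>t\<in>ball t0 rho. norm (g i tau u v t) \<le> M i)"
  by (elim exE conjE) (rule that)
 have h: "\<And>i. i \<in> I \<Longrightarrow> holo4 rho p (g i)"
  and le: "\<And>i tau u v t. i \<in> I \<Longrightarrow> tau \<in> ball tau0 rho \<Longrightarrow> u \<in> ball u0 rho \<Longrightarrow> v \<in> ball v0 rho \<Longrightarrow> t \<in> ball t0 rho \<Longrightarrow>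
    norm (g i tau u v t) \<le> M i" using H unfolding p0 by simp_all
 show "normal_ra I (\<lambda>i. uc (g i)) p"
 proof (rule normal_raI)
  show "rho / 2 > 0" using rho by simp
  show "sep_holo Basis (emb p) (rho/2) (\<lambda>zeta. g i (c_tau zeta) (c_u zeta) (c_v zeta) (c_t zeta))" if "i \<in> I" for i
   by (rule holo4_sep_holo[OF h[OF that]]) simp
  show "norm (g i (c_tau zeta) (c_u zeta) (c_v zeta) (c_t zeta)) \<le> M i"
   if "i \<in> I" "zeta \<in> polydisc Basis (emb p) (rho/2)" for i zeta
   using polydisc_c_ball[OF that(2)[unfolded p0]] by (intro le that(1)) simp_all
  show "uc (g i) y = g i (c_tau (emb y)) (c_u (emb y)) (c_v (emb y)) (c_t (emb y))" for i y by (cases y) simp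
 qed fact
qed

lemma open_X: "open X"
proof -
 have eq: "X = {p. Im (fst p) > 0}" by (auto simp: X_def)
 show ?thesis unfolding eq by (intro open_Collect_less continuous_intros)
qed

lemma box_bounds:
 assumes "tau \<in> ball tau0 rho" "rho \<le> 1" "rho \<le> Im tau0 / 2"
 shows "Im tau0 / 2 \<le> Im tau" "Im tau \<le> Im tau0 + 1" "Im tau0 > 0 \<Longrightarrow> Im tau > 0"
 using assms abs_Im_le_cmod[of "tau - tau0"] by (auto simp: dist_norm norm_minus_commute)

lemma ball_Im_le: "u \<in> ball u0 rho \<Longrightarrow> rho \<le> 1 \<Longrightarrow> \<bar>Im u\<bar> \<le> \<bar>Im u0\<bar> + 1"
 using abs_Im_le_cmod[of "u - u0"] by (auto simp: dist_norm norm_minus_commute)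

lemma theta_nra:
 fixes alpha beta :: real
 assumes "sgn_unit eps" "m > 0"
 shows "nra UNIV (\<lambda>n tau u v t. theta_term eps j m n tau (of_real alpha * u + of_real beta * v)) X"
proof (rule nra_holoI[OF open_X])
 fix tau0 u0 v0 t0 assume "(tau0, u0, v0, t0) \<in> X"
 hence y: "Im tau0 > 0" by (simp add: X_def)
 define rho where "rho = min 1 (Im tau0 / 2)"
 have rho: "rho > 0" "rho \<le> 1" "rho \<le> Im tau0 / 2" using y by (auto simp: rho_def)
 define h where "h = \<bar>alpha\<bar> * (\<bar>Im u0\<bar> + 1) + \<bar>beta\<bar> * (\<bar>Im v0\<bar> + 1)"
 have h: "h \<ge> 0" by (simp add: h_def)
 have "norm (theta_term eps j m n tau (of_real alpha * u + of_real beta * v)) \<le> theta_bound j m (Im tau0 / 2) h n"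
  if "tau \<in> ball tau0 rho" "u \<in> ball u0 rho" "v \<in> ball v0 rho" for n tau u v
 proof (rule norm_theta_term_le[OF assms box_bounds(1)[OF that(1) rho(2,3)]])
  have "\<bar>Im (of_real alpha * u + of_real beta * v)\<bar> \<le> \<bar>alpha\<bar> * \<bar>Im u\<bar> + \<bar>beta\<bar> * \<bar>Im v\<bar>"
   by (simp add: abs_mult[symmetric] abs_triangle_ineq)
  also have "\<dots> \<le> h" unfolding h_def using ball_Im_le[OF that(2) rho(2)] ball_Im_le[OF that(3) rho(2)]
   by (intro add_mono mult_left_mono) auto
  finally show "\<bar>Im (of_real alpha * u + of_real beta * v)\<bar> \<le> h" .
 qed
 moreover have "holo4 rho (tau0, u0, v0, t0) (\<lambda>tau u v t. theta_term eps j m n tau (of_real alpha * u + of_real beta * v))" for n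
  unfolding holo4_def theta_term_def prod.case by (intro ballI conjI holomorphic_intros)
 ultimately show "\<exists>rho>0. \<exists>M. M summable_on UNIV \<and> (\<forall>n\<in>UNIV. holo4 rho (tau0, u0, v0, t0)
    (\<lambda>tau u v t. theta_term eps j m n tau (of_real alpha * u + of_real beta * v)) \<and>
   (\<forall>tau\<in>ball tau0 rho. \<forall>u\<in>ball u0 rho. \<forall>v\<in>ball v0 rho. \<forall>t\<in>ball t0 rho.
    norm (theta_term eps j m n tau (of_real alpha * u + of_real beta * v)) \<le> M n))"
  using rho(1) theta_bound_summable[of m "Im tau0 / 2" h j] y h assms(2)
  by (intro exI[of _ rho] conjI exI[of _ "theta_bound j m (Im tau0 / 2) h"] ballI) auto
qed

lemma Theta_ra4:
 fixes alpha beta :: real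
 assumes "sgn_unit eps" "m > 0"
 shows "ra4 (\<lambda>tau u v t. Theta eps j m tau (of_real alpha * u + of_real beta * v)) X"
 using nra_fsum[OF theta_nra[OF assms]] unfolding fsum_def Theta_eq .

lemma theta11_ra4: "ra4 (\<lambda>tau u v t. theta11 tau (v - u)) X" "ra4 (\<lambda>tau u v t. theta11 tau (v + u)) X"
proof -
 have "sgn_unit (-1)" by (simp add: sgn_unit_def)
 note T = ra4_cmult[OF Theta_ra4[OF this, of "1/2" "1/2"], of \<i>]
 show "ra4 (\<lambda>tau u v t. theta11 tau (v - u)) X" "ra4 (\<lambda>tau u v t. theta11 tau (v + u)) X"
  using T[of "-2" 2] T[of 2 2] by (simp_all add: theta11_def algebra_simps)
qed

lemma regular_eq: "regular = {p\<in>X. uc (\<lambda>tau u v t. theta11 tau (v - u) * theta11 tau (v + u)) p \<noteq> 0}"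
 by (auto simp: regular_def)

lemma open_regular: "open regular"
proof -
 have "continuous_on X (uc (\<lambda>tau u v t. theta11 tau (v - u) * theta11 tau (v + u)))"
  by (rule ra4_continuous_on[OF ra4_mult[OF theta11_ra4]])
 from continuous_open_preimage[OF this open_X, of "- {0}"] show ?thesis
  unfolding regular_eq by (simp add: vimage_def Int_def open_Compl)
qed

lemma regular_subset_X: "regular \<subseteq> X" by (auto simp: regular_def)

section \<open>The zeros of theta11\<close>

text \<open>The theta terms of index n and -1 - n add up to a multiple of 1 - e2pi z; the quotient
  is a finite geometric sum (\<open>theta11_term_eq\<close>). Hence \<open>Kf\<close> is theta11(z)
  / (1 - e2pi z), entire in z by construction.\<close>

definition K_term :: "nat \<Rightarrow> complex \<Rightarrow> complex \<Rightarrow> complex" where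
 "K_term n tau z = - \<i> * (-1) ^ n * e2pi (of_real ((of_nat n + 1/2)^2 / 2) * tau)
   * (\<Sum>i\<le>2*n. e2pi (of_real (of_nat n - of_nat i - 1/2) * z))"

definition K_bound :: "real \<Rightarrow> real \<Rightarrow> nat \<Rightarrow> real" where
 "K_bound y h n = exp (- (pi * y) * (of_nat n)^2 + (2 * pi * h + 2) * of_nat n + 2 * pi * h)"

definition Kf :: "complex \<Rightarrow> complex \<Rightarrow> complex" where
 "Kf tau z = (\<Sum>\<^sub>\<infinity>n. K_term n tau z)"

lemma norm_K_term_le:
 assumes "y \<le> Im tau" "y \<ge> 0" "\<bar>Im z\<bar> \<le> h"
 shows "norm (K_term n tau z) \<le> K_bound y h n"
proof -
 have h: "h \<ge> 0" using assms(3) by linarith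
 have "norm (\<Sum>i\<le>2*n. e2pi (of_real (of_nat n - of_nat i - 1/2) * z)) \<le> (\<Sum>i\<le>2*n. exp (2 * pi * (of_nat n + 1) * h))"
 proof (rule sum_norm_le)
  fix i assume "i \<in> {..2*n}"
  hence "\<bar>real n - real i - 1/2\<bar> \<le> real n + 1" by (auto simp: abs_if)
  hence "\<bar>real n - real i - 1/2\<bar> * \<bar>Im z\<bar> \<le> (real n + 1) * h" using assms(3) h by (intro mult_mono) auto
  hence "- ((real n - real i - 1/2) * Im z) \<le> (real n + 1) * h" by (simp add: abs_mult[symmetric])
  thus "norm (e2pi (of_real (of_nat n - of_nat i - 1/2) * z)) \<le> exp (2 * pi * (of_nat n + 1) * h)"
   using mult_left_mono[of "- ((real n - real i - 1/2) * Im z)" "(real n + 1) * h" "2 * pi"]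
   by (simp add: norm_e2pi mult_ac)
 qed
 also have "\<dots> = (2 * real n + 1) * exp (2 * pi * (of_nat n + 1) * h)" by simp
 also have "\<dots> \<le> exp (2 * real n) * exp (2 * pi * (of_nat n + 1) * h)"
  using exp_ge_add_one_self[of "2 * real n"] by (intro mult_right_mono) (auto simp: add.commute)
 finally have 1: "norm (\<Sum>i\<le>2*n. e2pi (of_real (of_nat n - of_nat i - 1/2) * z)) \<le> exp (2 * real n) * exp (2 * pi * (of_nat n + 1) * h)" .
 have "(of_nat n)^2 * y \<le> (of_nat n + 1/2)^2 * Im tau" using assms by (intro mult_mono power_mono) auto
 hence "norm (e2pi (of_real ((of_nat n + 1/2)^2 / 2) * tau)) \<le> exp (- (pi * y) * (of_nat n)^2)"
  by (simp add: norm_e2pi mult_ac mult_left_mono)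
 hence "norm (K_term n tau z) \<le> exp (- (pi * y) * (of_nat n)^2) * (exp (2 * real n) * exp (2 * pi * (of_nat n + 1) * h))"
  unfolding K_term_def norm_mult using 1 by (intro mult_mono) (auto simp: norm_power)
 also have "\<dots> = K_bound y h n" by (simp add: K_bound_def algebra_simps flip: exp_add)
 finally show ?thesis .
qed

lemma K_bound_summable: "y > 0 \<Longrightarrow> K_bound y h summable_on UNIV"
proof -
 assume y: "y > 0"
 let ?f = "\<lambda>n::int. exp (- (pi * y) * (of_int n)^2 + (2 * pi * h + 2) * \<bar>of_int n\<bar> + 2 * pi * h :: real)"
 have "?f summable_on UNIV" using y by (intro gaussian_summable) simp
 hence "?f summable_on range int" by (rule summable_on_subset_banach) auto
 hence "(?f \<circ> int) summable_on UNIV" by (subst (asm) summable_on_reindex) auto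
 hence "(\<lambda>n. K_bound y h n) summable_on UNIV" by (simp add: o_def K_bound_def)
 thus ?thesis .
qed

lemma K_has_sum:
 assumes "Im tau > 0" shows "((\<lambda>n. K_term n tau z) has_sum Kf tau z) UNIV" unfolding Kf_def
 by (rule has_sum_infsum, rule abs_summable_summable,
   rule Infinite_Sum.abs_summable_on_comparison_test'[OF K_bound_summable[OF assms, of "\<bar>Im z\<bar>"]])
   (use assms in \<open>auto intro!: norm_K_term_le\<close>)

lemma norm_Kf_le:
 assumes "y \<le> Im tau" "y > 0" "\<bar>Im z\<bar> \<le> h"
 shows "norm (Kf tau z) \<le> infsum (K_bound y h) UNIV"
 using assms by (intro norm_infsum_le[OF K_has_sum has_sum_infsum[OF K_bound_summable]] norm_K_term_le) auto

lemma theta11_term_eq: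
 "(1 - e2pi z) * K_term n tau z = \<i> * (theta_term (-1) (1/2) (1/2) (int n) tau (2 * z)
   + theta_term (-1) (1/2) (1/2) (- 1 - int n) tau (2 * z))"
proof -
 define a where "a = (\<lambda>i::nat. e2pi (of_real (of_nat n - of_nat i + 1/2) * z))"
 have "(1 - e2pi z) * e2pi (of_real (of_nat n - of_nat i - 1/2) * z) = a (Suc i) - a i" for i
  unfolding a_def by (simp add: left_diff_distrib e2pi_add[symmetric] ring_distribs add_ac)
 hence "(1 - e2pi z) * (\<Sum>i\<le>2*n. e2pi (of_real (of_nat n - of_nat i - 1/2) * z)) = (\<Sum>i<Suc (2*n). a (Suc i) - a i)"
  by (simp add: sum_distrib_left lessThan_Suc_atMost)
 also have "\<dots> = a (Suc (2*n)) - a 0" by (rule sum_lessThan_telescope)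
 finally have S: "(1 - e2pi z) * (\<Sum>i\<le>2*n. e2pi (of_real (of_nat n - of_nat i - 1/2) * z))
   = e2pi (- (of_nat n + 1/2) * z) - e2pi ((of_nat n + 1/2) * z)" by (simp add: a_def algebra_simps)
 have p: "(-1) powi (- 1 - int n) = - ((-1) ^ n :: complex)"
 proof -
  have "(-1) powi (- 1 - int n) = (-1) powi (-1) * inverse ((-1) powi int n :: complex)"
   using power_int_add[of "-1 :: complex" "-1" "- int n"] by (simp add: power_int_minus)
  also have "inverse ((-1) powi int n :: complex) = (-1) ^ n" by (simp flip: power_inverse)
  finally show ?thesis by simp
 qed
 have t1: "theta_term (-1) (1/2) (1/2) (int n) tau (2 * z) = (-1) ^ n * e2pi (of_real ((of_nat n + 1/2)^2 / 2) * tau)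
   * e2pi ((of_nat n + 1/2) * z)" by (simp add: theta_term_def e2pi_add)
 have t2: "theta_term (-1) (1/2) (1/2) (- 1 - int n) tau (2 * z) = - ((-1) ^ n) * e2pi (of_real ((of_nat n + 1/2)^2 / 2) * tau)
   * e2pi (- (of_nat n + 1/2) * z)"
 proof -
  have e: "of_real (1/2 * (of_int (- 1 - int n) + 1/2 / (2 * (1/2)))^2) * tau + of_real (1/2 * (of_int (- 1 - int n) + 1/2 / (2 * (1/2)))) * (2 * z)
   = of_real ((of_nat n + 1/2)^2 / 2) * tau + (- (of_nat n + 1/2) * z)" by (simp add: field_simps power2_eq_square)
  show ?thesis unfolding theta_term_def p e e2pi_add by simp
 qed
 have "(1 - e2pi z) * K_term n tau z = - \<i> * (-1) ^ n * e2pi (of_real ((of_nat n + 1/2)^2 / 2) * tau)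
   * ((1 - e2pi z) * (\<Sum>i\<le>2*n. e2pi (of_real (of_nat n - of_nat i - 1/2) * z)))" by (simp only: K_term_def mult_ac)
 also have "\<dots> = \<i> * (theta_term (-1) (1/2) (1/2) (int n) tau (2 * z)
   + theta_term (-1) (1/2) (1/2) (- 1 - int n) tau (2 * z))" unfolding S t1 t2 by (simp add: algebra_simps)
 finally show ?thesis .
qed

lemma theta11_eq_K:
 assumes "Im tau > 0" shows "theta11 tau z = (1 - e2pi z) * Kf tau z"
proof -
 let ?f = "\<lambda>n. theta_term (-1) (1/2) (1/2) n tau (2 * z)"
 have s: "(?f has_sum Theta (-1) (1/2) (1/2) tau (2 * z)) UNIV"
  using assms by (intro theta_has_sum) (auto simp: sgn_unit_def)
 have sub: "(\<lambda>n. ?f (h n)) summable_on UNIV" if "inj h" for h :: "nat \<Rightarrow> int"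
 proof -
  have "?f summable_on range h" by (rule summable_on_subset_banach[OF has_sum_imp_summable[OF s]]) auto
  thus ?thesis using that by (subst (asm) summable_on_reindex) (auto simp: o_def)
 qed
 have s1: "(\<lambda>n. ?f (int n)) summable_on UNIV" by (rule sub) (simp add: inj_on_def)
 have s2: "(\<lambda>n. ?f (- 1 - int n)) summable_on UNIV" by (rule sub) (simp add: inj_on_def)
 have eq: "Theta (-1) (1/2) (1/2) tau (2 * z) = (\<Sum>\<^sub>\<infinity>n. ?f (int n)) + (\<Sum>\<^sub>\<infinity>n. ?f (- 1 - int n))"
  by (rule has_sum_unique[OF s has_sum_int_split[of ?f, OF has_sum_infsum[OF s1] has_sum_infsum[OF s2]]])
 have "((\<lambda>n. (1 - e2pi z) * K_term n tau z) has_sum (1 - e2pi z) * Kf tau z) UNIV"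
  by (rule has_sum_cmult_right[OF K_has_sum[OF assms]])
 moreover have "((\<lambda>n. (1 - e2pi z) * K_term n tau z) has_sum \<i> * ((\<Sum>\<^sub>\<infinity>n. ?f (int n)) + (\<Sum>\<^sub>\<infinity>n. ?f (- 1 - int n)))) UNIV"
  unfolding theta11_term_eq by (intro has_sum_cmult_right has_sum_add has_sum_infsum s1 s2)
 ultimately show ?thesis unfolding theta11_def eq using has_sum_unique by blast
qed

text \<open>The infinite q-Pochhammer symbol (x; q).\<close>

definition qprod :: "complex \<Rightarrow> complex \<Rightarrow> complex" where
 "qprod q x = lim (\<lambda>N. \<Prod>n<N. 1 - q ^ n * x)"

lemma qprod_uniform_limit:
 assumes q: "norm q < 1" and r: "r > 0"
 shows "uniform_limit (cball 0 r) (\<lambda>N x. \<Prod>n<N. 1 - q ^ n * x) (qprod q) sequentially"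
proof -
 have "uniformly_convergent_on (cball 0 r) (\<lambda>N x. \<Prod>n<N. 1 - q ^ n * x)"
 proof (rule uniformly_convergent_on_prod')
  show "continuous_on (cball 0 r) (\<lambda>x. 1 - q ^ n * x)" for n by (intro continuous_intros)
  show "uniformly_convergent_on (cball 0 r) (\<lambda>N x. \<Sum>n<N. norm (1 - q ^ n * x - 1))"
  proof (rule Weierstrass_m_test'_ev)
   show "summable (\<lambda>n. norm q ^ n * r)" using q by (intro summable_mult2 summable_geometric) simp
   show "\<forall>\<^sub>F n in sequentially. \<forall>x\<in>cball 0 r. norm (norm (1 - q ^ n * x - 1)) \<le> norm q ^ n * r"
    by (intro always_eventually allI ballI) (simp add: norm_mult norm_power mult_left_mono)
  qed
 qed auto
 thus ?thesis unfolding uniformly_convergent_uniform_limit_iff qprod_def .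
qed

lemma qprod_LIMSEQ: "norm q < 1 \<Longrightarrow> (\<lambda>N. \<Prod>n<N. 1 - q ^ n * x) \<longlonglongrightarrow> qprod q x"
 by (rule tendsto_uniform_limitI[OF qprod_uniform_limit[of q "norm x + 1"]]) (auto intro: add_nonneg_pos)

lemma holomorphic_qprod:
 assumes q: "norm q < 1"
 shows "qprod q holomorphic_on A"
proof -
 have "qprod q field_differentiable (at z)" for z
 proof -
  have "qprod q holomorphic_on ball 0 (norm z + 1)"
  proof (rule holomorphic_on_uniform_limit[OF open_ball])
   show "uniform_limit (ball 0 (norm z + 1)) (\<lambda>N x. \<Prod>n<N. 1 - q ^ n * x) (qprod q) sequentially"
    by (rule uniform_limit_on_subset[OF qprod_uniform_limit[OF q, of "norm z + 1"]]) (auto intro: add_nonneg_pos)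
  qed (auto intro!: always_eventually holomorphic_intros)
  thus ?thesis by (rule holomorphic_on_imp_differentiable_at) auto
 qed
 thus ?thesis by (simp add: field_differentiable_at_within holomorphic_on_def)
qed

lemma qprod_step:
 assumes q: "norm q < 1"
 shows "qprod q x = (1 - x) * qprod q (q * x)"
proof -
 have "(\<lambda>N. \<Prod>n<Suc N. 1 - q ^ n * x) \<longlonglongrightarrow> qprod q x" using qprod_LIMSEQ[OF q] by (rule LIMSEQ_Suc)
 moreover have "(\<Prod>n<Suc N. 1 - q ^ n * x) = (1 - x) * (\<Prod>n<N. 1 - q ^ n * (q * x))" for N
  by (subst prod.lessThan_Suc_shift) (simp add: mult_ac)
 ultimately have "(\<lambda>N. (1 - x) * (\<Prod>n<N. 1 - q ^ n * (q * x))) \<longlonglongrightarrow> qprod q x" by simp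
 moreover have "(\<lambda>N. (1 - x) * (\<Prod>n<N. 1 - q ^ n * (q * x))) \<longlonglongrightarrow> (1 - x) * qprod q (q * x)"
  by (intro tendsto_intros qprod_LIMSEQ q)
 ultimately show ?thesis by (rule LIMSEQ_unique)
qed

lemma qprod_nonzero:
 assumes q: "norm q < 1" and x: "norm x < 1"
 shows "qprod q x \<noteq> 0"
proof -
 let ?f = "\<lambda>n. 1 - q ^ n * x"
 have "summable (\<lambda>n. norm (?f n - 1))" using q by (simp add: norm_mult norm_power summable_mult2 summable_geometric)
 hence cp: "convergent_prod ?f"
  by (intro abs_convergent_prod_imp_convergent_prod) (simp add: abs_convergent_prod_conv_summable)
 have nz: "?f n \<noteq> 0" for n
 proof
  assume "?f n = 0"
  hence "norm (q ^ n * x) = 1" by simp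
  moreover have "norm (q ^ n * x) \<le> 1 * norm x"
   unfolding norm_mult norm_power using q by (intro mult_right_mono power_le_one) auto
  ultimately show False using x by simp
 qed
 have "(\<lambda>n. \<Prod>i<n. ?f i) \<longlonglongrightarrow> prodinf ?f" using convergent_prod_LIMSEQ[OF cp] by (simp add: LIMSEQ_lessThan_iff_atMost)
 hence "qprod q x = prodinf ?f" using qprod_LIMSEQ[OF q] LIMSEQ_unique by blast
 thus ?thesis using prodinf_nonzero[OF cp nz] by simp
qed

lemma holomorphic_K_term: "(\<lambda>z. K_term n tau z) holomorphic_on A" unfolding K_term_def by (intro holomorphic_intros)

lemma holomorphic_Kf:
 assumes "Im tau > 0" shows "(\<lambda>z. Kf tau z) holomorphic_on A"
proof -
 have "(\<lambda>z. Kf tau z) field_differentiable (at z)" for z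
 proof -
  have "(\<lambda>z. Kf tau z) holomorphic_on ball z 1" unfolding Kf_def
  proof (rule holomorphic_on_infsum[OF open_ball])
   show "norm (K_term n tau w) \<le> K_bound (Im tau) (\<bar>Im z\<bar> + 1) n" if "w \<in> ball z 1" for n w
    using assms ball_Im_le[OF that] by (intro norm_K_term_le) auto
  qed (use assms in \<open>auto intro!: K_bound_summable holomorphic_K_term\<close>)
  thus ?thesis by (rule holomorphic_on_imp_differentiable_at) auto
 qed
 thus ?thesis by (simp add: field_differentiable_at_within holomorphic_on_def)
qed

lemma holomorphic_theta11: "Im tau > 0 \<Longrightarrow> (\<lambda>z. theta11 tau z) holomorphic_on A"
 using holomorphic_on_compose_gen[OF _ holomorphic_Theta[of "-1" "1/2" tau "1/2" UNIV], of "\<lambda>z. 2 * z" A]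
 unfolding theta11_def by (auto simp: o_def sgn_unit_def intro!: holomorphic_intros)

lemma Kf_plus_1: "Kf tau (z + 1) = - Kf tau z"
proof -
 have "K_term n tau (z + 1) = (-1) * K_term n tau z" for n
 proof -
  have h: "e2pi (- 1 / 2) = -1" by (simp add: e2pi_def exp_minus)
  have "e2pi (of_real (of_nat n - of_nat i - 1/2) * (z + 1)) = - e2pi (of_real (of_nat n - of_nat i - 1/2) * z)" for i
  proof -
   have "of_real (of_nat n - of_nat i - 1/2) * (z + 1)
     = of_real (of_nat n - of_nat i - 1/2) * z + of_int (int n - int i) + (- 1/2)" by (simp add: algebra_simps)
   thus ?thesis by (simp only: e2pi_add e2pi_of_int h) simp
  qed
  thus ?thesis unfolding K_term_def by (simp add: sum_negf)
 qed
 thus ?thesis unfolding Kf_def by (simp add: infsum_uminus)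
qed

lemma has_integral_e2pi_int:
 "((\<lambda>x::real. e2pi (of_int n * of_real x)) has_integral (if n = 0 then 1 else 0)) {0..1}"
proof (cases "n = 0")
 case True
 thus ?thesis using has_integral_const_real[of "1::complex" 0 1] by simp
next
 case False
 let ?c = "2 * of_real pi * \<i> * of_int n :: complex"
 have c: "?c \<noteq> 0" using False by simp
 have "((\<lambda>x::real. e2pi (of_int n * of_real x)) has_integral (e2pi (of_int n * of_real 1) / ?c - e2pi (of_int n * of_real 0) / ?c)) {0..1}"
 proof (rule fundamental_theorem_of_calculus)
  fix x :: real
  have "((\<lambda>z. e2pi (of_int n * z) / ?c) has_field_derivative e2pi (of_int n * of_real x)) (at (of_real x))"
   using c by (auto intro!: derivative_eq_intros has_field_derivative_e2pi)
  from has_field_derivative_at_within[OF this] 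
  have "((\<lambda>z. e2pi (of_int n * z) / ?c) has_field_derivative e2pi (of_int n * of_real x)) (at (of_real x) )" by simp
  from has_vector_derivative_real_field[OF this]
  show "((\<lambda>x. e2pi (of_int n * of_real x) / ?c) has_vector_derivative e2pi (of_int n * of_real x)) (at x within {0..1})"
   by (rule has_vector_derivative_at_within)
 qed simp
 thus ?thesis using False by simp
qed

text \<open>On the real line the series is e2pi(x/2) times an absolutely convergent Fourier series,
  whose constant coefficient is recovered by integration over a period and is an exponential, hence
  nonzero.\<close>

lemma theta11_not_identically_0:
 assumes y: "Im tau > 0" shows "\<exists>x::real. theta11 tau (of_real x) \<noteq> 0"
proof (rule ccontr)
 assume "\<not> ?thesis"
 hence z0: "theta11 tau (of_real x) = 0" for x by blast
 define c where "c = (\<lambda>n::int. (-1) powi n * e2pi (of_real ((of_int n + 1/2)^2 / 2) * tau))"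
 define f where "f = (\<lambda>n (x::real). c n * e2pi (of_int n * of_real x))"
 have th: "theta_term (-1) (1/2) (1/2) n tau (2 * of_real x) = e2pi (of_real x / 2) * f n x" for n x
 proof -
  have "of_real (1/2 * (of_int n + 1/2 / (2 * (1/2)))^2) * tau + of_real (1/2 * (of_int n + 1/2 / (2 * (1/2)))) * (2 * of_real x)
   = of_real x / 2 + of_real ((of_int n + 1/2)^2 / 2) * tau + of_int n * of_real x" by (simp add: algebra_simps)
  thus ?thesis unfolding theta_term_def f_def c_def by (simp only: e2pi_add mult_ac)
 qed
 have hs: "((\<lambda>n. f n x) has_sum 0) UNIV" for x
 proof -
  have "((\<lambda>n. theta_term (-1) (1/2) (1/2) n tau (2 * of_real x)) has_sum Theta (-1) (1/2) (1/2) tau (2 * of_real x)) UNIV"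
   using y by (intro theta_has_sum) (auto simp: sgn_unit_def)
  also have "Theta (-1) (1/2) (1/2) tau (2 * of_real x) = 0" using z0[of x] by (simp add: theta11_def)
  finally show ?thesis unfolding th by (subst (asm) has_sum_cmult_right_iff) auto
 qed
 have le: "norm (f n x) \<le> theta_bound (1/2) (1/2) (Im tau) 0 n" for n x
 proof -
  have "norm (f n x) = norm (theta_term (-1) (1/2) (1/2) n tau (2 * of_real x))" by (simp add: th norm_mult norm_e2pi)
  also have "\<dots> \<le> theta_bound (1/2) (1/2) (Im tau) 0 n" using y by (intro norm_theta_term_le) (auto simp: sgn_unit_def)
  finally show ?thesis .
 qed
 have "uniform_limit {0..1} (\<lambda>J x. \<Sum>n\<in>J. f n x) (\<lambda>x. 0) (finite_subsets_at_top UNIV)"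
  using le hs y by (intro Weierstrass_m_test_general'[where M = "theta_bound (1/2) (1/2) (Im tau) 0"] theta_bound_summable) auto
 moreover have "continuous_on {0..1} (\<lambda>x. \<Sum>n\<in>J. f n x)" for J unfolding f_def by (intro continuous_intros)
 ultimately obtain I J where I: "\<And>F. ((\<lambda>x. \<Sum>n\<in>F. f n x) has_integral I F) {0..1}"
  and J: "((\<lambda>x. 0 :: complex) has_integral J) {0..1::real}" and lim: "(I \<longlongrightarrow> J) (finite_subsets_at_top UNIV)"
  by (rule uniform_limit_integral) auto
 have J0: "J = 0" using J has_integral_unique has_integral_0 by blast
 \<comment> \<open>Every finite set containing 0 already integrates to \<open>c 0\<close>, so the
   limit over finite sets is \<open>c 0\<close> as well as 0.\<close>
 have "eventually (\<lambda>F. I F = c 0) (finite_subsets_at_top UNIV)" unfolding eventually_finite_subsets_at_top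
 proof (intro exI[of _ "{0}"] conjI allI impI)
  fix F :: "int set" assume F: "finite F \<and> {0} \<subseteq> F \<and> F \<subseteq> UNIV"
  have "((\<lambda>x. \<Sum>n\<in>F. f n x) has_integral (\<Sum>n\<in>F. c n * (if n = 0 then 1 else 0))) {0..1}"
   unfolding f_def using F by (intro has_integral_sum has_integral_mult_right has_integral_e2pi_int) auto
  hence "I F = (\<Sum>n\<in>F. c n * (if n = 0 then 1 else 0))" using I has_integral_unique by blast
  also have "\<dots> = c 0" using F by (simp add: if_distrib sum.delta cong: if_cong)
  finally show "I F = c 0" .
 qed auto
 hence "(I \<longlongrightarrow> c 0) (finite_subsets_at_top UNIV)" by (rule tendsto_eventually)
 hence "c 0 = 0" using lim J0 tendsto_unique[OF finite_subsets_at_top_neq_bot] by blast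
 thus False by (simp add: c_def)
qed

text \<open>In essence the Jacobi triple product. The quotient \<open>Q\<close> of \<open>Kf\<close>
  by the product \<open>D\<close> is invariant under z -> z + 1 and, inside the strip, under z -> z
  + tau. Its modulus thus attains its maximum over the open strip on a compact rectangle, so
  \<open>Q\<close> is constant, and nonzero by \<open>theta11_not_identically_0\<close>.\<close>

lemma Kf_nonzero:
 assumes y: "Im tau > 0" and z: "\<bar>Im z\<bar> < Im tau"
 shows "Kf tau z \<noteq> 0"
proof -
 define q where "q = e2pi tau"
 have q: "norm q < 1" and q0: "q \<noteq> 0" using y by (auto simp: q_def norm_e2pi)
 define S where "S = {z. \<bar>Im z\<bar> < Im tau}"
 define D where "D = (\<lambda>z. qprod q (q * e2pi z) * qprod q (q * e2pi (- z)))"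
 have D0: "D z \<noteq> 0" if "z \<in> S" for z
 proof -
  have "norm (q * e2pi w) < 1" if "\<bar>Im w\<bar> < Im tau" for w
  proof -
   have "norm (q * e2pi w) = exp (- 2 * pi * (Im tau + Im w))"
    by (simp add: q_def norm_mult norm_e2pi algebra_simps flip: exp_add)
   also have "\<dots> < 1" using that by (simp add: mult_pos_pos)
   finally show ?thesis .
  qed
  from this[of z] this[of "- z"] have "norm (q * e2pi z) < 1" "norm (q * e2pi (- z)) < 1"
   using that by (auto simp: S_def)
  thus ?thesis unfolding D_def using qprod_nonzero[OF q] by simp
 qed
 define Q where "Q = (\<lambda>z. Kf tau z * e2pi (z / 2) / D z)"
 have holQ: "Q holomorphic_on S"
 proof -
  have "(\<lambda>z. qprod q (g z)) holomorphic_on S" if "g holomorphic_on S" for g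
   using holomorphic_on_compose_gen[OF that holomorphic_qprod[OF q, of UNIV]] by (simp add: o_def)
  note comp = this
  have "D holomorphic_on S" unfolding D_def by (intro holomorphic_on_mult; rule comp; intro holomorphic_intros)
  thus ?thesis unfolding Q_def using D0 by (intro holomorphic_intros holomorphic_Kf y) auto
 qed
 have Q1: "Q (z + 1) = Q z" for z
 proof -
  have "e2pi (1 / 2) = -1" by (simp add: e2pi_def)
  moreover have "e2pi (z + 1) = e2pi z" "e2pi (- (z + 1)) = e2pi (- z)"
   using e2pi_of_int[of 1] by (simp_all add: e2pi_add e2pi_diff e2pi_uminus)
  ultimately show ?thesis unfolding Q_def D_def by (simp add: Kf_plus_1 add_divide_distrib e2pi_add)
 qed
 have Qk: "Q (z + of_int k) = Q z" for z k
 proof (induction k rule: int_induct[where k = 0])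
  case (step1 i) thus ?case using Q1[of "z + of_int i"] by (simp add: add_ac)
 next
  case (step2 i) thus ?case using Q1[of "z + of_int i - 1"] by (simp add: algebra_simps)
 qed simp
 \<comment> \<open>The restriction on Im z keeps both z and z + tau in the strip, where
   \<open>D\<close> has no zeros, and gives |x| > 1, so that 1 - x may be divided out.\<close>
 have Qt: "Q (z + tau) = Q z" if z: "- Im tau < Im z" "Im z < 0" for z
 proof -
  define x where "x = e2pi z"
  have x0: "x \<noteq> 0" by (simp add: x_def)
  have "norm x > 1" using z by (simp add: x_def norm_e2pi mult_pos_neg)
  hence x1: "x \<noteq> 1" by auto
  have nqx: "norm (q * x) < 1"
  proof -
   have "norm (q * x) = exp (- 2 * pi * (Im tau + Im z))"
    by (simp add: q_def x_def norm_mult norm_e2pi algebra_simps flip: exp_add)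
   also have "\<dots> < 1" using z by (simp add: mult_pos_pos)
   finally show ?thesis .
  qed
  hence qx1: "1 - q * x \<noteq> 0" by auto
  have "(1 - q * x) * Kf tau (z + tau) = theta11 tau (z + of_int 1 * tau)"
   by (simp add: theta11_eq_K[OF y] e2pi_add q_def x_def mult_ac)
  also have "\<dots> = - e2pi (- tau / 2 - z) * ((1 - x) * Kf tau z)"
   unfolding theta11_shift_tau by (simp add: theta11_eq_K[OF y] x_def)
  finally have K: "Kf tau (z + tau) = - e2pi (- tau / 2 - z) * (1 - x) * Kf tau z / (1 - q * x)"
   using qx1 by (simp add: field_simps)
  have e1: "e2pi (z + tau) = q * x" "q * e2pi (- (z + tau)) = 1 / x" "q * e2pi (- z) = q / x"
   using q0 by (simp_all add: q_def x_def e2pi_add e2pi_uminus e2pi_diff divide_inverse)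
  have D1: "D (z + tau) = (qprod q (q * x) / (1 - q * x)) * ((1 - 1 / x) * qprod q (q / x))"
   using qprod_step[OF q, of "q * x"] qprod_step[OF q, of "1 / x"] qx1 unfolding D_def e1 by simp
  have D2: "D z = qprod q (q * x) * qprod q (q / x)" unfolding D_def e1 by (simp add: x_def)
  have nz: "qprod q (q * x) \<noteq> 0" "qprod q (q / x) \<noteq> 0"
  proof -
   have "D z \<noteq> 0" using z by (intro D0) (auto simp: S_def)
   thus "qprod q (q * x) \<noteq> 0" "qprod q (q / x) \<noteq> 0" unfolding D2 by auto
  qed
  have e2: "e2pi (- tau / 2 - z) * e2pi ((z + tau) / 2) = e2pi (z / 2) / x"
   unfolding x_def e2pi_add[symmetric] e2pi_diff[symmetric] by (rule e2pi_eqI) (simp add: field_simps)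
  have "Q (z + tau) = - (e2pi (- tau / 2 - z) * e2pi ((z + tau) / 2)) * (1 - x) * Kf tau z / (1 - q * x) / D (z + tau)"
   unfolding Q_def K by (simp add: mult_ac)
  also have "\<dots> = - (e2pi (z / 2) / x) * (1 - x) * Kf tau z / ((1 - 1 / x) * (qprod q (q * x) * qprod q (q / x)))"
   unfolding e2 D1 using qx1 by simp
  also have "\<dots> = Q z" unfolding Q_def D2 using x0 x1 nz by (simp add: field_simps)
  finally show ?thesis .
 qed
 \<comment> \<open>Half the height of the strip suffices: one shift by tau or -tau brings any point
   of the strip to |Im z| <= Im tau / 2, integer shifts do the rest.\<close>
 define C where "C = cbox (Complex 0 (- Im tau / 2)) (Complex 1 (Im tau / 2))"
 have C: "z \<in> C \<longleftrightarrow> 0 \<le> Re z \<and> Re z \<le> 1 \<and> - Im tau / 2 \<le> Im z \<and> Im z \<le> Im tau / 2" for z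
  by (simp add: C_def in_cbox_complex_iff)
 have CS: "C \<subseteq> S" using y by (auto simp: C S_def)
 have "0 \<in> C" using y by (simp add: C)
 moreover have "continuous_on C (\<lambda>z. norm (Q z))"
  using holQ CS by (intro continuous_intros) (meson holomorphic_on_imp_continuous_on continuous_on_subset)
 ultimately obtain xi where xi: "xi \<in> C" "\<And>z. z \<in> C \<Longrightarrow> norm (Q z) \<le> norm (Q xi)"
  using continuous_attains_sup[of C "\<lambda>z. norm (Q z)"] compact_cbox unfolding C_def by blast
 have red: "\<exists>w\<in>C. Q w = Q z" if z: "z \<in> S" for z
 proof -
  obtain w where w: "\<bar>Im w\<bar> \<le> Im tau / 2" "Q w = Q z"
  proof -
   consider "\<bar>Im z\<bar> \<le> Im tau / 2" | "Im z > Im tau / 2" | "Im z < - Im tau / 2" by linarith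
   thus ?thesis
   proof cases
    case 1 thus ?thesis using that by blast
   next
    case 2
    show ?thesis by (rule that[of "z - tau"]) (use 2 z y Qt[of "z - tau"] in \<open>auto simp: S_def abs_if\<close>)
   next
    case 3
    show ?thesis by (rule that[of "z + tau"]) (use 3 z y Qt[of "z"] in \<open>auto simp: S_def abs_if\<close>)
   qed
  qed
  define k where "k = - \<lfloor>Re w\<rfloor>"
  have "w + of_int k \<in> C" using w(1) unfolding C k_def by (simp add: abs_le_iff) linarith
  thus ?thesis using Qk[of w k] w(2) by (intro bexI[of _ "w + of_int k"]) auto
 qed
 have opS: "open S" unfolding S_def by (intro open_Collect_less continuous_intros)
 have "convex S"
 proof -
  have "S = {z. Im z < Im tau} \<inter> {z. Im z > - Im tau}" by (auto simp: S_def)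
  thus ?thesis by (simp add: convex_Int convex_halfspace_Im_lt convex_halfspace_Im_gt)
 qed
 hence "Q constant_on S"
  using maximum_modulus_principle[OF holQ opS convex_connected opS order_refl, of xi] xi CS red by (metis subsetD)
 then obtain c where c: "\<And>z. z \<in> S \<Longrightarrow> Q z = c" unfolding constant_on_def by blast
 have "c \<noteq> 0"
 proof
  assume c0: "c = 0"
  obtain x :: real where "theta11 tau (of_real x) \<noteq> 0" using theta11_not_identically_0[OF y] by blast
  hence "Kf tau (of_real x) \<noteq> 0" by (simp add: theta11_eq_K[OF y])
  moreover have "of_real x \<in> S" using y by (simp add: S_def)
  ultimately show False using c[of "of_real x"] c0 D0[of "of_real x"] by (simp add: Q_def)
 qed
 thus ?thesis using c[of z] z by (auto simp: Q_def S_def)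
qed

definition lattice :: "complex \<Rightarrow> complex set" where
 "lattice tau = {z. \<exists>j k :: int. z = of_int j + of_int k * tau}"

lemma theta11_lattice_factor:
 "\<exists>kappa. kappa \<noteq> 0 \<and> theta11 tau (z + (of_int j + of_int k * tau)) = kappa * theta11 tau z"
proof -
 have "theta11 tau (z + (of_int j + of_int k * tau)) = theta11 tau ((z + of_int k * tau) + of_int j)" by (simp add: add_ac)
 also have "\<dots> = ((-1) powi j * ((-1) powi k * e2pi (- of_real ((of_int k)^2 / 2) * tau - of_int k * z))) * theta11 tau z"
  unfolding theta11_shift_1 theta11_shift_tau by simp
 finally show ?thesis
  by (intro exI[of _ "(-1) powi j * ((-1) powi k * e2pi (- of_real ((of_int k)^2 / 2) * tau - of_int k * z))"]) simp
qed

text \<open>A shift by a multiple of tau moves z into the strip of \<open>Kf_nonzero\<close>, where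
  theta11 is (1 - e2pi w) times a nonvanishing factor.\<close>

lemma theta11_eq_0_iff:
 assumes y: "Im tau > 0"
 shows "theta11 tau z = 0 \<longleftrightarrow> z \<in> lattice tau"
proof
 assume "z \<in> lattice tau"
 then obtain j k :: int where z: "z = of_int j + of_int k * tau" by (auto simp: lattice_def)
 have "theta11 tau 0 = 0" by (simp add: theta11_eq_K[OF y])
 thus "theta11 tau z = 0" using theta11_lattice_factor[of tau 0 j k] z by auto
next
 assume 0: "theta11 tau z = 0"
 define k where "k = \<lfloor>Im z / Im tau\<rfloor>"
 define w where "w = z - of_int k * tau"
 have "of_int k \<le> Im z / Im tau" "Im z / Im tau < of_int k + 1" by (auto simp: k_def)
 hence "\<bar>Im w\<bar> < Im tau" using y by (auto simp: w_def field_simps abs_if)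
 hence K: "Kf tau w \<noteq> 0" using y by (intro Kf_nonzero)
 have "theta11 tau w = 0" using theta11_lattice_factor[of tau w 0 k] 0 by (auto simp: w_def)
 hence "e2pi w = 1" using K by (simp add: theta11_eq_K[OF y])
 then obtain j :: int where "w = of_int j" by (auto simp: e2pi_eq_1_iff elim: Ints_cases)
 hence "z = of_int j + of_int k * tau" by (simp add: w_def algebra_simps)
 thus "z \<in> lattice tau" by (auto simp: lattice_def)
qed

lemma theta11_deriv_0:
 assumes y: "Im tau > 0" shows "(theta11 tau has_field_derivative (- 2 * pi * \<i> * Kf tau 0)) (at 0)"
proof -
 have "(Kf tau has_field_derivative deriv (Kf tau) 0) (at 0)"
  using holomorphic_Kf[OF y, of UNIV] by (intro holomorphic_derivI[of _ UNIV]) auto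
 hence "((\<lambda>z. (1 - e2pi z) * Kf tau z) has_field_derivative (- 2 * pi * \<i> * Kf tau 0)) (at 0)"
  by (auto intro!: derivative_eq_intros has_field_derivative_e2pi)
 moreover have "theta11 tau = (\<lambda>z. (1 - e2pi z) * Kf tau z)" using theta11_eq_K[OF y] by blast
 ultimately show ?thesis by simp
qed

section \<open>The error function in the complex plane\<close>

definition erfc_prim :: "(complex \<Rightarrow> complex) \<Rightarrow> bool" where
 "erfc_prim g \<longleftrightarrow> g 0 = 0 \<and> (\<forall>z. (g has_field_derivative 2 * exp (- of_real pi * z^2)) (at z))"

text \<open>The entire extension of \<open>E\<close> (\<open>E_eq_Ec\<close>), chosen as the
  primitive of 2 exp(- pi z^2) vanishing at 0; it is needed to complexify \<open>R\<close>.\<close>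

definition Ec :: "complex \<Rightarrow> complex" where
 "Ec = (SOME g. erfc_prim g)"

lemma erfc_prim_Ec: "erfc_prim Ec"
proof -
 have h: "(\<lambda>z. 2 * exp (- of_real pi * z^2)) holomorphic_on (UNIV :: complex set)" by (intro holomorphic_intros)
 obtain g where "\<And>z. z \<in> UNIV \<Longrightarrow> (g has_field_derivative 2 * exp (- of_real pi * z^2)) (at z within (UNIV :: complex set))"
  by (rule holomorphic_convex_primitive'[OF convex_UNIV open_UNIV h]) (rule that)
 hence g: "\<And>z. (g has_field_derivative 2 * exp (- of_real pi * z^2)) (at (z :: complex))" by simp
 have "erfc_prim (\<lambda>z. g z - g 0)" unfolding erfc_prim_def by (auto intro!: derivative_eq_intros g)
 thus ?thesis unfolding Ec_def by (rule someI[where P = erfc_prim])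
qed

lemma Ec_0 [simp]: "Ec 0 = 0" using erfc_prim_Ec by (simp add: erfc_prim_def)

lemma has_field_derivative_Ec: "(Ec has_field_derivative 2 * exp (- of_real pi * z^2)) (at z)"
 using erfc_prim_Ec by (simp add: erfc_prim_def)

lemma holomorphic_Ec: "Ec holomorphic_on A" unfolding holomorphic_on_def field_differentiable_def
 using has_field_derivative_Ec has_field_derivative_at_within by blast

lemma Ec_has_vector_derivative: "((\<lambda>x. Ec (of_real x)) has_vector_derivative of_real (2 * exp (- pi * x^2))) (at x)"
proof -
 have "((\<lambda>x. Ec (of_real x)) has_vector_derivative 2 * exp (- of_real pi * (of_real x)^2)) (at x)"
  by (rule has_vector_derivative_real_field[OF has_field_derivative_Ec])
 also have "2 * exp (- of_real pi * (of_real x)^2) = complex_of_real (2 * exp (- pi * x^2))"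
  by (simp flip: exp_of_real of_real_power)
 finally show ?thesis .
qed

lemma Re_Ec_deriv: "((\<lambda>x. Re (Ec (of_real x))) has_real_derivative 2 * exp (- pi * x^2)) (at x)"
 using bounded_linear.has_vector_derivative[OF bounded_linear_Re Ec_has_vector_derivative]
 by (simp add: has_real_derivative_iff_has_vector_derivative)

lemma Im_Ec_of_real: "Im (Ec (of_real x)) = 0"
proof -
 have "((\<lambda>x. Im (Ec (of_real x))) has_real_derivative 0) (at x)" for x
  using bounded_linear.has_vector_derivative[OF bounded_linear_Im Ec_has_vector_derivative[of x]]
  by (simp add: has_real_derivative_iff_has_vector_derivative)
 hence "Im (Ec (of_real x)) = Im (Ec (of_real 0))" using DERIV_isconst_all[of "\<lambda>x. Im (Ec (of_real x))" x 0] by blast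
 thus ?thesis by simp
qed

lemma E_eq_Ec: "of_real (E x) = Ec (of_real x)"
proof -
 have "(LBINT w=ereal 0..ereal x. exp (- pi * w^2)) = Re (Ec (of_real x)) / 2 - Re (Ec (of_real 0)) / 2"
 proof (rule interval_integral_FTC_finite)
  fix y :: real
  have "((\<lambda>x. Re (Ec (of_real x)) / 2) has_real_derivative exp (- pi * y^2)) (at y)"
   using DERIV_cdivide[OF Re_Ec_deriv[of y], of 2] by simp
  thus "((\<lambda>x. Re (Ec (of_real x)) / 2) has_vector_derivative exp (- pi * y^2)) (at y within {min 0 x..max 0 x})"
   by (simp add: has_real_derivative_iff_has_vector_derivative has_vector_derivative_at_within)
 qed (intro continuous_intros)
 hence "E x = Re (Ec (of_real x))" by (simp add: E_def)
 thus ?thesis using Im_Ec_of_real[of x] by (simp add: complex_eq_iff)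
qed

lemma Ec_minus: "Ec (- z) = - Ec z"
proof -
 have "((\<lambda>z. Ec (- z) + Ec z) has_field_derivative 0) (at z within UNIV)" for z
  by (rule derivative_eq_intros DERIV_chain2[OF has_field_derivative_Ec] has_field_derivative_Ec refl | simp)+
 from has_field_derivative_zero_constant[OF convex_UNIV this] obtain c where "\<And>z. Ec (- z) + Ec z = c" by blast
 from this[of z] this[of 0] show ?thesis by (simp add: eq_neg_iff_add_eq_0)
qed

lemma Re_Ec_at_top: "((\<lambda>x. Re (Ec (of_real x))) \<longlongrightarrow> 1) at_top"
proof -
 define G where "G = (\<lambda>y. sqrt pi / 2 * Re (Ec (of_real (y / sqrt pi))))"
 have G: "(G has_real_derivative exp (- y\<^sup>2)) (at y)" for y
 proof -
  have "((\<lambda>y. Re (Ec (of_real (y / sqrt pi)))) has_real_derivative (2 * exp (- pi * (y / sqrt pi)^2)) * (1 / sqrt pi)) (at y)"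
   by (rule DERIV_chain2[OF Re_Ec_deriv])
     (auto intro!: derivative_eq_intros simp: sqrt_divide_self_eq inverse_eq_divide)
  note * = DERIV_cmult[OF this, of "sqrt pi / 2"]
  show ?thesis
  proof -
   have "sqrt pi / pi = 1 / sqrt pi" by (simp add: sqrt_divide_self_eq inverse_eq_divide)
   moreover note *
   ultimately show ?thesis unfolding G_def by (simp add: power_divide)
  qed
 qed
 let ?f = "\<lambda>x::real. indicator {0..} x *\<^sub>R exp (- x\<^sup>2)"
 have int: "integrable lborel ?f" and val: "(\<integral>x. ?f x \<partial>lborel) = sqrt pi / 2"
  using gaussian_moment_0 has_bochner_integral_iff by blast+
 have lim: "((\<lambda>y. \<integral>x. indicator {..y} x *\<^sub>R ?f x \<partial>lborel) \<longlongrightarrow> sqrt pi / 2) at_top"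
  unfolding val[symmetric] by (rule tendsto_integral_at_top[OF _ int]) simp
 have "eventually (\<lambda>y. (\<integral>x. indicator {..y} x *\<^sub>R ?f x \<partial>lborel) = G y) at_top" using eventually_ge_at_top[of 0]
 proof eventually_elim
  case (elim y)
  have "has_bochner_integral lborel (\<lambda>x. indicator {0..y} x *\<^sub>R exp (- x\<^sup>2)) (G y - G 0)"
  proof (rule has_bochner_integral_FTC_Icc)
   show "(G has_vector_derivative exp (- x\<^sup>2)) (at x within {0..y})" for x
    using G[of x] by (simp add: has_real_derivative_iff_has_vector_derivative has_vector_derivative_at_within)
  qed (use elim in \<open>auto intro!: continuous_intros\<close>)
  hence "(\<integral>x. indicator {0..y} x *\<^sub>R exp (- x\<^sup>2) \<partial>lborel) = G y - G 0" by (rule has_bochner_integral_integral_eq)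
  also have "(\<lambda>x. indicator {0..y} x *\<^sub>R exp (- x\<^sup>2)) = (\<lambda>x. indicator {..y} x *\<^sub>R ?f x)"
   by (auto simp: fun_eq_iff indicator_def)
  finally show ?case by (simp add: G_def)
 qed
 with lim have "(G \<longlongrightarrow> sqrt pi / 2) at_top" by (rule Lim_transform_eventually)
 moreover have "filterlim (\<lambda>x. sqrt pi * x) at_top at_top"
  by (rule filterlim_tendsto_pos_mult_at_top[OF tendsto_const]) (auto simp: filterlim_ident)
 ultimately have "((\<lambda>x. G (sqrt pi * x)) \<longlongrightarrow> sqrt pi / 2) at_top" by (rule filterlim_compose)
 from tendsto_mult[OF tendsto_const[of "2 / sqrt pi"] this] show ?thesis by (simp add: G_def)
qed

text \<open>The difference g of bound and complementary error function vanishes at 0, increases up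
  to 1/pi, decreases afterwards and tends to 0, so it is nonnegative throughout.\<close>

lemma erfc_real_bound:
 assumes x: "x \<ge> 0"
 shows "\<bar>1 - Re (Ec (of_real x))\<bar> \<le> exp (- pi * x^2)"
proof -
 define F where "F = (\<lambda>x. Re (Ec (complex_of_real x)))"
 have F: "(F has_real_derivative 2 * exp (- pi * x^2)) (at x)" for x unfolding F_def by (rule Re_Ec_deriv)
 have lim: "(F \<longlongrightarrow> 1) at_top" unfolding F_def by (rule Re_Ec_at_top)
 have F1: "F x \<le> 1"
 proof (rule tendsto_lowerbound[OF lim])
  show "\<forall>\<^sub>F y in at_top. F x \<le> F y" using eventually_ge_at_top[of x]
   by eventually_elim (rule DERIV_nonneg_imp_nondecreasing, use F in \<open>auto intro!: exI\<close>)
 qed simp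
 define g where "g = (\<lambda>x. exp (- pi * x^2) - (1 - F x))"
 have g: "(g has_real_derivative 2 * (1 - pi * x) * exp (- pi * x^2)) (at x)" for x
  unfolding g_def by (auto intro!: derivative_eq_intros F simp: algebra_simps)
 have "g x \<ge> 0"
 proof (cases "x \<le> 1 / pi")
  case True
  have "g 0 \<le> g x"
  proof (rule DERIV_nonneg_imp_nondecreasing[OF x])
   fix z assume z: "0 \<le> z" "z \<le> x"
   have "pi * z \<le> pi * (1 / pi)" using z True by (intro mult_left_mono) auto
   hence "pi * z \<le> 1" by simp
   thus "\<exists>y. (g has_real_derivative y) (at z) \<and> 0 \<le> y"
    using g[of z] by (intro exI[of _ "2 * (1 - pi * z) * exp (- pi * z^2)"]) auto
  qed
  thus ?thesis by (simp add: g_def F_def)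
 next
  case False
  have "(g \<longlongrightarrow> 0 - (1 - 1)) at_top"
  proof -
   have "filterlim (\<lambda>x::real. x^2) at_top at_top" by (rule filterlim_pow_at_top) (auto simp: filterlim_ident)
   hence "filterlim (\<lambda>x::real. pi * x^2) at_top at_top"
    by (intro filterlim_tendsto_pos_mult_at_top[OF tendsto_const]) auto
   hence "((\<lambda>x. exp (- (pi * x^2))) \<longlongrightarrow> 0) at_top"
    by (intro filterlim_compose[OF exp_at_bot]) (simp add: filterlim_uminus_at_bot)
   thus ?thesis unfolding g_def by (intro tendsto_diff lim tendsto_const) simp
  qed
  hence lim0: "(g \<longlongrightarrow> 0) at_top" by simp
  show ?thesis
  proof (rule tendsto_upperbound[OF lim0])
   show "\<forall>\<^sub>F y in at_top. g y \<le> g x" using eventually_ge_at_top[of x]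
   proof eventually_elim
    case (elim y)
    show ?case
    proof (rule DERIV_nonpos_imp_nonincreasing[OF elim])
     fix z assume z: "x \<le> z" "z \<le> y"
     have "1 / pi \<le> z" using z False by simp
     hence "pi * z \<ge> 1" by (simp add: field_simps)
     thus "\<exists>y. (g has_real_derivative y) (at z) \<and> y \<le> 0"
      using g[of z] by (intro exI[of _ "2 * (1 - pi * z) * exp (- pi * z^2)"]) (auto intro!: mult_nonpos_nonneg)
    qed
   qed
  qed simp
 qed
 thus ?thesis using F1 by (simp add: g_def F_def)
qed

text \<open>Compare with the real point \<open>a\<close> below z: along the vertical segment the
  derivative 2 exp(- pi w^2) is largest in modulus at z, and at \<open>a\<close> the real bound
  applies.\<close>

lemma erfc_bound_right:
 assumes "Re z \<ge> 0"
 shows "norm (1 - Ec z) \<le> (1 + 2 * \<bar>Im z\<bar>) * exp (- pi * Re (z^2))"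
proof -
 define a where "a = complex_of_real (Re z)"
 define B where "B = 2 * exp (- pi * Re (z^2))"
 have Rz: "Re (z^2) = (Re z)^2 - (Im z)\<^sup>2" by (simp add: power2_eq_square)
 have "norm (Ec z - Ec a) \<le> B * norm (z - a)"
 proof (rule field_differentiable_bound)
  show "convex (closed_segment a z)" by (rule convex_closed_segment)
  show "(Ec has_field_derivative 2 * exp (- of_real pi * w^2)) (at w within closed_segment a z)" for w
   using has_field_derivative_Ec has_field_derivative_at_within by blast
  fix w assume "w \<in> closed_segment a z"
  then obtain u where u: "0 \<le> u" "u \<le> 1" and w: "w = (1 - u) *\<^sub>R a + u *\<^sub>R z" by (auto simp: in_segment)
  have Rw: "Re w = Re z" and Iw: "Im w = u * Im z" by (simp_all add: w a_def algebra_simps)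
  have "u^2 \<le> 1" using u by (simp add: power_le_one)
  hence "(Im w)^2 \<le> (Im z)^2" unfolding Iw power_mult_distrib by (intro mult_left_le_one_le) auto
  hence "Re (w^2) \<ge> Re (z^2)" unfolding Rz by (simp add: power2_eq_square Rw)
  thus "norm (2 * exp (- of_real pi * w^2)) \<le> B" by (simp add: norm_mult B_def)
 qed auto
 also have "norm (z - a) = \<bar>Im z\<bar>" by (simp add: a_def norm_complex_def)
 finally have 1: "norm (Ec z - Ec a) \<le> B * \<bar>Im z\<bar>" .
 have "1 - Ec a = of_real (1 - Re (Ec a))" using Im_Ec_of_real[of "Re z"] by (simp add: a_def complex_eq_iff)
 hence "norm (1 - Ec a) = \<bar>1 - Re (Ec a)\<bar>" by (simp only: norm_of_real)
 also have "\<dots> \<le> exp (- pi * (Re z)^2)" unfolding a_def by (rule erfc_real_bound[OF assms])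
 also have "\<dots> \<le> exp (- pi * Re (z^2))" by (simp add: Rz)
 finally have "norm (1 - Ec a) \<le> exp (- pi * Re (z^2))" .
 moreover have "norm (1 - Ec z) \<le> norm (1 - Ec a) + norm (Ec z - Ec a)"
  using norm_triangle_ineq4[of "1 - Ec a" "Ec z - Ec a"] by simp
 ultimately show ?thesis using 1 by (simp add: B_def algebra_simps)
qed

lemma erfc_bound:
 assumes "s = 1 \<and> Re z \<ge> 0 \<or> s = -1 \<and> Re z \<le> 0"
 shows "norm (s - Ec z) \<le> (1 + 2 * \<bar>Im z\<bar>) * exp (- pi * Re (z^2))" using assms
proof
 assume *: "s = -1 \<and> Re z \<le> 0"
 have "s - Ec z = - (1 - Ec (- z))" using * by (simp add: Ec_minus)
 hence "norm (s - Ec z) = norm (1 - Ec (- z))" by (simp only: norm_minus_cancel)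
 thus ?thesis using erfc_bound_right[of "- z"] * by simp
qed (use erfc_bound_right in auto)

text \<open>If the sign s does not fit the half-plane of z then -s does, and passing from s to -s
  costs |2s| = 2.\<close>

lemma erfc_crude_bound:
 assumes "s = 1 \<or> s = (-1 :: complex)"
 shows "norm (s - Ec z) \<le> (if s = 1 \<and> Re z \<ge> 0 \<or> s = -1 \<and> Re z \<le> 0 then 0 else 2)
  + (1 + 2 * \<bar>Im z\<bar>) * exp (- pi * Re (z^2))"
proof (cases "s = 1 \<and> Re z \<ge> 0 \<or> s = -1 \<and> Re z \<le> 0")
 case True
 thus ?thesis using erfc_bound[OF True] by simp
next
 case False
 have "norm (- s - Ec z) \<le> (1 + 2 * \<bar>Im z\<bar>) * exp (- pi * Re (z^2))" by (rule erfc_bound) (use False assms in auto)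
 moreover have "norm (s - Ec z) \<le> norm (2 * s) + norm (- s - Ec z)"
  using norm_triangle_ineq[of "2 * s" "- s - Ec z"] by simp
 moreover have "norm (2 * s) = 2" using assms by (auto simp: norm_mult)
 ultimately show ?thesis using False by auto
qed

section \<open>Normal convergence of the non-holomorphic series R\<close>

text \<open>The argument \<open>psi\<close> of the error function, with Im tau and Im v replaced by
  independent complex variables y and alpha.\<close>

definition Psi_c :: "real \<Rightarrow> real \<Rightarrow> complex \<Rightarrow> complex \<Rightarrow> complex" where
 "Psi_c m n y alpha = (of_real n - 2 * of_real m * (alpha / y)) * csqrt (y / of_real m)"

definition R_sgn :: "real \<Rightarrow> int \<Rightarrow> complex" where
 "R_sgn m k = of_real (sgn (2 * m * of_int k - 1/2 + 2 * m))"

definition R_term :: "complex \<Rightarrow> real \<Rightarrow> real \<Rightarrow> int \<Rightarrow> complex \<Rightarrow> complex \<Rightarrow> complex" where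
 "R_term eps j m k tau v = eps powi k * (R_sgn m k - Ec (Psi_c m (j + 2 * m * of_int k) (of_real (Im tau)) (of_real (Im v))))
   * e2pi (- of_real ((j + 2 * m * of_int k)^2 / (4 * m)) * tau + of_real (j + 2 * m * of_int k) * v)"

lemma psi_eq: "m > 0 \<Longrightarrow> Im tau > 0 \<Longrightarrow> complex_of_real (psi m n tau v) = Psi_c m n (of_real (Im tau)) (of_real (Im v))"
proof -
 assume "m > 0" "Im tau > 0"
 hence "csqrt (of_real (Im tau) / of_real m) = of_real (sqrt (Im tau / m))"
  using csqrt_of_real_nonneg[of "of_real (Im tau / m)"] by simp
 thus ?thesis by (simp add: psi_def Psi_c_def)
qed

text \<open>The summand -1/2 decides the case k = -1, where 2 m k + 2 m vanishes.\<close>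

lemma R_sgn_cases: "m > 1/2 \<Longrightarrow> R_sgn m k = (if k \<ge> 0 then 1 else -1)"
proof -
 assume m: "m > 1/2"
 show ?thesis
 proof (cases "k \<ge> 0")
  case True
  hence "2 * m * of_int k \<ge> 0" using m by simp
  hence "2 * m * of_int k - 1/2 + 2 * m > 0" using m by linarith
  thus ?thesis using True by (simp add: R_sgn_def)
 next
  case False
  hence "of_int k \<le> (-1 :: real)" by linarith
  hence "2 * m * of_int k \<le> 2 * m * (-1)" using m by (intro mult_left_mono) auto
  hence "2 * m * of_int k - 1/2 + 2 * m < 0" by linarith
  thus ?thesis using False by (simp add: R_sgn_def)
 qed
qed

lemma half_ints_add: "x \<in> half_ints \<Longrightarrow> y \<in> half_ints \<Longrightarrow> x + y \<in> half_ints" by (simp add: half_ints_def distrib_left)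

lemma R_eq_infsum:
 assumes m: "m > 0" "2 * m \<in> \<int>" and j: "j \<in> half_ints" and y: "Im tau > 0"
 shows "R eps j m tau v = (\<Sum>\<^sub>\<infinity>k. R_term eps j m k tau v)"
proof -
 let ?I = "{n. n \<in> half_ints \<and> (n - j) / (2 * m) \<in> \<int>}"
 have mem: "j + 2 * m * of_int k \<in> half_ints" for k
 proof -
  have "2 * (2 * m * of_int k) \<in> \<int>" by (intro Ints_mult[OF _ Ints_mult[OF m(2) Ints_of_int]]) auto
  thus ?thesis using j by (intro half_ints_add) (auto simp: half_ints_def)
 qed
 have div: "(j + 2 * m * of_int k - j) / (2 * m) = of_int k" for k using m by simp
 have bij: "bij_betw (\<lambda>k::int. j + 2 * m * of_int k) UNIV ?I"
 proof (rule bij_betwI[of _ _ _ "\<lambda>n. \<lfloor>(n - j) / (2 * m)\<rfloor>"])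
  show "(\<lambda>k::int. j + 2 * m * of_int k) \<in> UNIV \<rightarrow> ?I" using mem div by simp
  show "j + 2 * m * of_int \<lfloor>(n - j) / (2 * m)\<rfloor> = n" if "n \<in> ?I" for n
  proof -
   obtain k where k: "(n - j) / (2 * m) = of_int k" using \<open>n \<in> ?I\<close> by (auto elim: Ints_cases)
   hence "n = j + 2 * m * of_int k" using m by (simp add: field_simps)
   thus ?thesis by (simp add: k)
  qed
 qed (use div in auto)
 have "R eps j m tau v = (\<Sum>\<^sub>\<infinity>k. eps powi \<lfloor>((j + 2 * m * of_int k) - j) / (2 * m)\<rfloor>
    * of_real (sgn ((j + 2 * m * of_int k) - 1/2 - j + 2 * m) - E (psi m (j + 2 * m * of_int k) tau v))
    * exp (- (of_real (pi * (j + 2 * m * of_int k)^2 / (2 * m)) * \<i> * tau) + of_real (2 * pi * (j + 2 * m * of_int k)) * \<i> * v))"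
  unfolding R_def by (rule infsum_reindex_bij_betw[OF bij, symmetric])
 also have "\<dots> = (\<Sum>\<^sub>\<infinity>k. R_term eps j m k tau v)"
 proof (rule infsum_cong)
  fix k :: int
  let ?n = "j + 2 * m * of_int k"
  have "exp (- (of_real (pi * ?n\<^sup>2 / (2 * m)) * \<i> * tau) + of_real (2 * pi * ?n) * \<i> * v)
    = e2pi (- of_real (?n\<^sup>2 / (4 * m)) * tau + of_real ?n * v)"
   unfolding e2pi_def by (rule arg_cong[where f = exp]) (use m in \<open>simp add: field_simps\<close>)
  moreover have "of_real (sgn (?n - 1/2 - j + 2 * m) - E (psi m ?n tau v))
    = R_sgn m k - Ec (Psi_c m ?n (of_real (Im tau)) (of_real (Im v)))"
   using m y by (simp add: R_sgn_def E_eq_Ec psi_eq)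
  ultimately show "eps powi \<lfloor>(?n - j) / (2 * m)\<rfloor>
    * of_real (sgn (?n - 1/2 - j + 2 * m) - E (psi m ?n tau v))
    * exp (- (of_real (pi * ?n\<^sup>2 / (2 * m)) * \<i> * tau) + of_real (2 * pi * ?n) * \<i> * v) = R_term eps j m k tau v"
   unfolding div by (simp add: R_term_def)
 qed
 finally show ?thesis .
qed

lemma Re_csqrt_ge:
 assumes "Re z > 0" shows "norm (csqrt z) \<le> 2 * Re (csqrt z)"
proof -
 let ?s = "csqrt z"
 have p: "Re ?s \<ge> 0" using csqrt_principal[of z] by auto
 have "Re (?s\<^sup>2) = (Re ?s)^2 - (Im ?s)\<^sup>2" by (simp only: power2_eq_square times_complex.sel)
 hence "(Re ?s)^2 - (Im ?s)\<^sup>2 > 0" using assms unfolding power2_csqrt by simp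
 moreover have "(norm ?s)^2 = (Re ?s)^2 + (Im ?s)^2" by (rule cmod_power2)
 moreover have "(2 * Re ?s)^2 = 4 * (Re ?s)^2" by (simp only: power_mult_distrib) simp
 moreover have "0 \<le> (Im ?s)^2" by simp
 ultimately have "(norm ?s)^2 \<le> (2 * Re ?s)^2" by linarith
 moreover have "2 * Re ?s \<ge> 0" using p by linarith
 ultimately show ?thesis by (rule power2_le_imp_le)
qed

text \<open>The complexified quadratic exponent of \<open>E\<close> gains \<open>exp (-\<pi> n^2 y / m)\<close>, which beats the growth
 \<open>exp (\<pi> n^2 y / (2 m))\<close> of the exponential factor of \<open>R\<close>.\<close>

lemma R_complexified_bound:
 assumes m: "m > 1/2" and y0: "y0 > 0" and A: "A \<ge> 0" and B: "B \<ge> 0"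
 shows "\<exists>C c d. c > 0 \<and> d \<ge> 0 \<and> (\<forall>k w alpha tau v. norm (w - of_real y0) \<le> y0 / 8 \<longrightarrow> norm alpha \<le> A \<longrightarrow>
   Im tau \<le> Re w + y0 / 8 \<longrightarrow> Im tau \<ge> 0 \<longrightarrow> \<bar>Im v\<bar> \<le> B \<longrightarrow>
   norm ((R_sgn m k - Ec (Psi_c m (j + 2 * m * of_int k) w alpha))
    * e2pi (- of_real ((j + 2 * m * of_int k)^2 / (4 * m)) * tau + of_real (j + 2 * m * of_int k) * v))
   \<le> exp (- c * (of_int k + j / (2 * m))^2 + d * \<bar>of_int k + j / (2 * m)\<bar> + C))"
proof -
 \<comment> \<open>Lower bound for Re w and |w| when |w - y0| <= y0/8.\<close>
 define y1 where "y1 = 7 * y0 / 8"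
 have y1: "y1 > 0" using y0 by (simp add: y1_def)
 define S where "S = sqrt (2 * y0 / m)"
 define T where "T = 2 * m * A / y1"
 define N0 where "N0 = max \<bar>j\<bar> (2 * T)"
 define C1 where "C1 = 4 * m * A^2 / y1"
 \<comment> \<open>Net Gaussian rate pi/(2m) (y1 - y0/8): the decay pi n^2 Re w / m from the error
   function minus the growth pi n^2 Im tau / (2m) with Im tau <= Re w + y0/8.\<close>
 define c where "c = 3 * pi * y0 / (8 * m)"
 define d where "d = 4 * pi * A + 2 * pi * B + 2 * S"
 define C2 where "C2 = pi * C1 + 2 * S * T"
 define C3 where "C3 = c * N0^2 + pi * N0^2 / (2 * m) * (2 * y0) + 2 * pi * N0 * B + 1"
 have m0: "m > 0" using m by simp
 have S0: "S \<ge> 0" "T \<ge> 0" "C1 \<ge> 0" "N0 \<ge> 0" using m0 y0 y1 A by (auto simp: S_def T_def C1_def N0_def)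
 have c0: "c > 0" "d \<ge> 0" using m0 y0 A B S0 by (auto simp: c_def d_def)
 have main: "norm ((R_sgn m k - Ec (Psi_c m n w alpha)) * e2pi (- of_real (n^2 / (4 * m)) * tau + of_real n * v))
   \<le> exp (- c * n^2 + d * \<bar>n\<bar> + (C2 + C3 + 1))"
  if w: "norm (w - of_real y0) \<le> y0 / 8" and alpha: "norm alpha \<le> A" and tau: "Im tau \<le> Re w + y0 / 8" "Im tau \<ge> 0"
   and v: "\<bar>Im v\<bar> \<le> B" and n: "n = j + 2 * m * of_int k" for k :: int and n w alpha tau v
 proof -
  have Rw: "y1 \<le> Re w" "Re w \<le> 9 * y0 / 8"
   using abs_Re_le_cmod[of "w - of_real y0"] w by (auto simp: y1_def abs_le_iff)
  have nw: "y1 \<le> norm w" "norm w \<le> 2 * y0"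
   using Rw(1) abs_Re_le_cmod[of w] norm_triangle_ineq[of "w - of_real y0" "of_real y0"] w y0 by auto
  have w0: "w \<noteq> 0" using nw y1 by auto
  define sg where "sg = csqrt (w / of_real m)"
  define x where "x = Psi_c m n w alpha"
  have x: "x = (of_real n - 2 * of_real m * (alpha / w)) * sg" by (simp add: x_def Psi_c_def sg_def)
  have "norm sg = sqrt (norm w / m)" using m0 by (simp add: sg_def norm_csqrt norm_divide)
  also have "\<dots> \<le> S" unfolding S_def using nw m0 by (intro real_sqrt_le_mono divide_right_mono) auto
  finally have nsg: "norm sg \<le> S" .
  have Rwm: "Re (w / of_real m) > 0" using Rw y1 m0 by (simp add: Re_divide_of_real)
  have sg2: "norm sg \<le> 2 * Re sg" unfolding sg_def by (rule Re_csqrt_ge[OF Rwm])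
  have sg0: "norm sg > 0" using w0 m0 by (simp add: sg_def)
  have Rsg: "Re sg > 0" using sg2 sg0 by linarith
  have alphaw: "norm (2 * of_real m * (alpha / w)) \<le> T"
  proof -
   have "norm (alpha / w) \<le> A / y1" unfolding norm_divide using nw alpha y1 A by (intro frac_le) auto
   hence "2 * m * norm (alpha / w) \<le> 2 * m * (A / y1)" using m0 by (intro mult_left_mono) auto
   moreover have "norm (2 * of_real m * (alpha / w)) = 2 * m * norm (alpha / w)"
    using m0 by (simp only: norm_mult) simp
   ultimately show ?thesis by (simp add: T_def)
  qed
  have nx: "norm x \<le> (\<bar>n\<bar> + T) * S" unfolding x norm_mult
   using nsg alphaw norm_triangle_ineq4[of "of_real n" "2 * of_real m * (alpha / w)"] S0 by (intro mult_mono) auto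
  have ix: "1 + 2 * \<bar>Im x\<bar> \<le> exp (2 * S * \<bar>n\<bar> + 2 * S * T)"
  proof -
   have "1 + 2 * \<bar>Im x\<bar> \<le> 1 + 2 * ((\<bar>n\<bar> + T) * S)" using abs_Im_le_cmod[of x] nx by linarith
   also have "\<dots> \<le> exp (2 * ((\<bar>n\<bar> + T) * S))" by (rule exp_ge_add_one_self)
   finally show ?thesis by (simp add: algebra_simps)
  qed
  have x2: "x^2 = of_real (n^2 / m) * w - of_real (4 * n) * alpha + of_real (4 * m) * (alpha^2 / w)"
   unfolding x power_mult_distrib sg_def power2_csqrt using w0 m0 by (simp add: field_simps power2_eq_square)
  have Rx2: "n^2 / m * Re w - 4 * \<bar>n\<bar> * A - C1 \<le> Re (x^2)"
  proof -
   have 1: "Re (of_real (n^2 / m) * w) = n^2 / m * Re w" by simp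
   have "norm (of_real (4 * n) * alpha) \<le> 4 * \<bar>n\<bar> * A" using alpha by (simp add: norm_mult abs_mult mult_left_mono)
   hence 2: "\<bar>Re (of_real (4 * n) * alpha)\<bar> \<le> 4 * \<bar>n\<bar> * A" using abs_Re_le_cmod order_trans by blast
   have "norm (alpha^2 / w) \<le> A^2 / y1"
    unfolding norm_divide norm_power using nw alpha y1 A by (intro frac_le power_mono) auto
   hence "norm (of_real (4 * m) * (alpha^2 / w)) \<le> C1"
    using m0 mult_left_mono[of "norm (alpha^2 / w)" "A^2 / y1" "4 * m"] unfolding C1_def norm_mult by simp
   hence 3: "\<bar>Re (of_real (4 * m) * (alpha^2 / w))\<bar> \<le> C1" using abs_Re_le_cmod order_trans by blast
   show ?thesis unfolding x2 plus_complex.sel minus_complex.sel using 1 2 3 by linarith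
  qed
  have ee: "norm (e2pi (- of_real (n^2 / (4 * m)) * tau + of_real n * v)) \<le> exp (pi * n^2 / (2 * m) * Im tau + 2 * pi * \<bar>n\<bar> * B)"
  proof -
   have "norm (e2pi (- of_real (n^2 / (4 * m)) * tau + of_real n * v)) = exp (pi * n^2 / (2 * m) * Im tau + 2 * pi * - (n * Im v))"
    unfolding norm_e2pi by (rule arg_cong[where f = exp]) (use m0 in \<open>simp add: field_simps\<close>)
   moreover have "- (n * Im v) \<le> \<bar>n\<bar> * B" using mult_left_mono[OF v, of "\<bar>n\<bar>"] by (simp add: abs_mult[symmetric])
   hence "2 * pi * - (n * Im v) \<le> 2 * pi * (\<bar>n\<bar> * B)" by (intro mult_left_mono) auto
   ultimately show ?thesis by simp
  qed
  have e1: "(1 + 2 * \<bar>Im x\<bar>) * exp (- pi * Re (x^2)) * exp (pi * n^2 / (2 * m) * Im tau + 2 * pi * \<bar>n\<bar> * B)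
    \<le> exp (- c * n^2 + d * \<bar>n\<bar> + C2)"
  proof -
   have "- pi * Re (x^2) \<le> - pi * (n^2 / m * Re w - 4 * \<bar>n\<bar> * A - C1)" using Rx2 by (simp add: mult_left_mono)
   moreover have "pi * n^2 / (2 * m) * Im tau \<le> pi * n^2 / (2 * m) * (Re w + y0 / 8)"
    using tau m0 by (intro mult_left_mono) auto
   moreover have "- pi * (n^2 / m * Re w) + pi * n^2 / (2 * m) * (Re w + y0 / 8) \<le> - c * n^2"
   proof -
    have "- pi * (n^2 / m * Re w) + pi * n^2 / (2 * m) * (Re w + y0 / 8) = - (pi * n^2 / (2 * m)) * (Re w - y0 / 8)"
     using m0 by (simp add: field_simps)
    also have "\<dots> \<le> - (pi * n^2 / (2 * m)) * (y1 - y0 / 8)" using Rw m0 by (intro mult_left_mono_neg) auto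
    also have "\<dots> = - c * n^2" using m0 by (simp add: y1_def c_def field_simps)
    finally show ?thesis .
   qed
   ultimately have "(2 * S * \<bar>n\<bar> + 2 * S * T) + (- pi * Re (x^2)) + (pi * n^2 / (2 * m) * Im tau + 2 * pi * \<bar>n\<bar> * B)
    \<le> - c * n^2 + d * \<bar>n\<bar> + C2" by (simp add: d_def C2_def algebra_simps)
   hence "exp (2 * S * \<bar>n\<bar> + 2 * S * T) * exp (- pi * Re (x^2)) * exp (pi * n^2 / (2 * m) * Im tau + 2 * pi * \<bar>n\<bar> * B)
    \<le> exp (- c * n^2 + d * \<bar>n\<bar> + C2)" by (simp flip: exp_add)
   moreover have "(1 + 2 * \<bar>Im x\<bar>) * exp (- pi * Re (x^2)) * exp (pi * n^2 / (2 * m) * Im tau + 2 * pi * \<bar>n\<bar> * B)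
     \<le> exp (2 * S * \<bar>n\<bar> + 2 * S * T) * exp (- pi * Re (x^2)) * exp (pi * n^2 / (2 * m) * Im tau + 2 * pi * \<bar>n\<bar> * B)"
    using ix by (intro mult_right_mono) auto
   ultimately show ?thesis by linarith
  qed
  \<comment> \<open>Indices at which the sign does not fit the half-plane of x, so that the error
    function term does not decay. They satisfy |n| <= N0, and the constant \<open>C3\<close> absorbs
    them.\<close>
  define mis where "mis \<longleftrightarrow> \<not> (R_sgn m k = 1 \<and> Re x \<ge> 0 \<or> R_sgn m k = -1 \<and> Re x \<le> 0)"
  have e2: "(if mis then 2 else 0) * exp (pi * n^2 / (2 * m) * Im tau + 2 * pi * \<bar>n\<bar> * B)
    \<le> exp (- c * n^2 + d * \<bar>n\<bar> + C3)"
  proof (cases mis)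
   case True
   have Rx: "Re x = n * Re sg - Re (2 * of_real m * (alpha / w) * sg)" by (simp add: x algebra_simps)
   have "norm (2 * of_real m * (alpha / w) * sg) \<le> T * (2 * Re sg)"
    unfolding norm_mult[of "2 * of_real m * (alpha / w)"] using alphaw sg2 S0 by (intro mult_mono) auto
   hence R2: "\<bar>Re (2 * of_real m * (alpha / w) * sg)\<bar> \<le> 2 * T * Re sg"
    using abs_Re_le_cmod[of "2 * of_real m * (alpha / w) * sg"] by (simp add: mult_ac)
   \<comment> \<open>The sign of k bounds n by j from one side; a mismatch bounds n by 2T or -2T
     from the other.\<close>
   have "\<bar>n\<bar> \<le> N0"
   proof (cases "k \<ge> 0")
    case k: True
    hence "Re x < 0" using True R_sgn_cases[OF m, of k] by (simp add: mis_def)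
    hence "n * Re sg < 2 * T * Re sg" using Rx R2 by (simp add: abs_le_iff)
    hence "n < 2 * T" using Rsg by simp
    moreover have "n \<ge> j" using k m0 by (simp add: n)
    ultimately show ?thesis by (auto simp: N0_def abs_le_iff)
   next
    case k: False
    hence "Re x > 0" using True R_sgn_cases[OF m, of k] by (simp add: mis_def)
    hence "- (2 * T) * Re sg < n * Re sg" using Rx R2 by (simp add: abs_le_iff)
    hence "n > - (2 * T)" using Rsg by (subst (asm) mult_less_cancel_right_pos) auto
    moreover have "2 * m * of_int k \<le> 0" using k m0 by (simp add: mult_nonneg_nonpos)
    hence "n \<le> j" by (simp add: n)
    ultimately show ?thesis by (auto simp: N0_def abs_le_iff)
   qed
   moreover from this have n2: "n^2 \<le> N0^2" using S0 by (simp add: abs_le_square_iff[symmetric])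
   ultimately have "pi * n^2 / (2 * m) * Im tau + 2 * pi * \<bar>n\<bar> * B \<le> pi * N0^2 / (2 * m) * (2 * y0) + 2 * pi * N0 * B"
    using tau Rw y0 m0 B by (intro add_mono mult_mono divide_right_mono mult_left_mono) auto
   moreover have "c * n^2 \<le> c * N0^2" using n2 c0 by (intro mult_left_mono) auto
   moreover have "d * \<bar>n\<bar> \<ge> 0" using c0 by simp
   ultimately have "1 + (pi * n^2 / (2 * m) * Im tau + 2 * pi * \<bar>n\<bar> * B) \<le> - c * n^2 + d * \<bar>n\<bar> + C3"
    by (simp add: C3_def)
   hence "exp 1 * exp (pi * n^2 / (2 * m) * Im tau + 2 * pi * \<bar>n\<bar> * B) \<le> exp (- c * n^2 + d * \<bar>n\<bar> + C3)"
    by (simp flip: exp_add)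
   moreover have "(2::real) * exp (pi * n^2 / (2 * m) * Im tau + 2 * pi * \<bar>n\<bar> * B) \<le> exp 1 * exp (pi * n^2 / (2 * m) * Im tau + 2 * pi * \<bar>n\<bar> * B)"
    using exp_ge_add_one_self[of 1] by (intro mult_right_mono) auto
   ultimately have "2 * exp (pi * n^2 / (2 * m) * Im tau + 2 * pi * \<bar>n\<bar> * B) \<le> exp (- c * n^2 + d * \<bar>n\<bar> + C3)"
    by (rule order_trans[rotated])
   thus ?thesis using True by (simp only: if_True)
  qed simp
  have "norm (R_sgn m k - Ec x) \<le> (if mis then 2 else 0) + (1 + 2 * \<bar>Im x\<bar>) * exp (- pi * Re (x^2))"
   using erfc_crude_bound[of "R_sgn m k" x] R_sgn_cases[OF m, of k] unfolding mis_def by (auto split: if_splits)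
  hence "norm ((R_sgn m k - Ec x) * e2pi (- of_real (n^2 / (4 * m)) * tau + of_real n * v))
   \<le> ((if mis then 2 else 0) + (1 + 2 * \<bar>Im x\<bar>) * exp (- pi * Re (x^2))) * exp (pi * n^2 / (2 * m) * Im tau + 2 * pi * \<bar>n\<bar> * B)"
   unfolding norm_mult using ee by (intro mult_mono) auto
  also have "\<dots> \<le> exp (- c * n^2 + d * \<bar>n\<bar> + C3) + exp (- c * n^2 + d * \<bar>n\<bar> + C2)"
   by (rule order_trans[OF eq_refl[OF distrib_right] add_mono[OF e2 e1]])
  also have "\<dots> \<le> exp (- c * n^2 + d * \<bar>n\<bar> + (C2 + C3)) + exp (- c * n^2 + d * \<bar>n\<bar> + (C2 + C3))"
  proof -
   have "C2 \<ge> 0" "C3 \<ge> 0" using S0 c0 y0 m0 B by (auto simp: C2_def C3_def)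
   thus ?thesis by (intro add_mono) auto
  qed
  also have "\<dots> = 2 * exp (- c * n^2 + d * \<bar>n\<bar> + (C2 + C3))" by simp
  also have "\<dots> \<le> exp 1 * exp (- c * n^2 + d * \<bar>n\<bar> + (C2 + C3))"
   using exp_ge_add_one_self[of 1] by (intro mult_right_mono) auto
  also have "\<dots> = exp (- c * n^2 + d * \<bar>n\<bar> + (C2 + C3 + 1))" by (simp add: add_ac flip: exp_add)
  finally show ?thesis by (simp add: x_def)
 qed
 have nk: "j + 2 * m * of_int k = (2 * m) * (of_int k + j / (2 * m))" for k :: int using m0 by (simp add: field_simps)
 have "- c * (j + 2 * m * of_int k)^2 + d * \<bar>j + 2 * m * of_int k\<bar> + (C2 + C3 + 1)
   = - (c * (2 * m)^2) * (of_int k + j / (2 * m))^2 + d * (2 * m) * \<bar>of_int k + j / (2 * m)\<bar> + (C2 + C3 + 1)" for k :: int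
  unfolding nk abs_mult power_mult_distrib using m0 by simp
 note main' = main[OF _ _ _ _ _ refl, unfolded this]
 show ?thesis
  by (intro exI[of _ "C2 + C3 + 1"] exI[of _ "c * (2 * m)^2"] exI[of _ "d * (2 * m)"] conjI allI impI main')
    (use c0 m0 in auto)
qed

text \<open>Im tau and Im v enter in two ways, as real variables inside the error function and
  through tau and v in the exponential. They are complexified accordingly, by \<open>yzeta\<close>
  and \<open>azeta\<close> in the first place and by \<open>c_tau\<close> and \<open>c_v\<close> in
  the second.\<close>

lemma R_nra:
 assumes eps: "sgn_unit eps" and m: "m > 1/2"
 shows "nra UNIV (\<lambda>k tau u v t. R_term eps j m k tau v) X" unfolding nra_def
proof (intro conjI open_X ballI)
 fix p assume "p \<in> X"
 then obtain tau0 u0 v0 t0 where p: "p = (tau0, u0, v0, t0)" and y: "Im tau0 > 0" by (auto simp: X_def)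
 define r where "r = min (1/2) (Im tau0 / 8)"
 have r: "r > 0" "r \<le> 1/2" "r \<le> Im tau0 / 8" using y by (auto simp: r_def)
 have v1: "0 \<le> \<bar>Im v0\<bar> + 1" by simp
 obtain C c d where c: "c > 0" "d \<ge> 0" and bd: "\<forall>k w alpha tau v. norm (w - of_real (Im tau0)) \<le> Im tau0 / 8 \<longrightarrow> norm alpha \<le> \<bar>Im v0\<bar> + 1 \<longrightarrow>
   Im tau \<le> Re w + Im tau0 / 8 \<longrightarrow> Im tau \<ge> 0 \<longrightarrow> \<bar>Im v\<bar> \<le> \<bar>Im v0\<bar> + 1 \<longrightarrow>
   norm ((R_sgn m k - Ec (Psi_c m (j + 2 * m * of_int k) w alpha))
    * e2pi (- of_real ((j + 2 * m * of_int k)^2 / (4 * m)) * tau + of_real (j + 2 * m * of_int k) * v))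
   \<le> exp (- c * (of_int k + j / (2 * m))^2 + d * \<bar>of_int k + j / (2 * m)\<bar> + C)"
  using R_complexified_bound[OF m y v1 v1, of j] by (elim exE conjE) (rule that)
 define yzeta where "yzeta = (\<lambda>zeta::point4 \<Rightarrow> complex. zeta (\<i>, 0, 0, 0))"
 define azeta where "azeta = (\<lambda>zeta::point4 \<Rightarrow> complex. zeta (0, 0, \<i>, 0))"
 define Psi where "Psi = (\<lambda>k zeta. eps powi k * ((R_sgn m k - Ec (Psi_c m (j + 2 * m * of_int k) (yzeta zeta) (azeta zeta)))
    * e2pi (- of_real ((j + 2 * m * of_int k)^2 / (4 * m)) * c_tau zeta + of_real (j + 2 * m * of_int k) * c_v zeta)))"
 have Rey: "Re (yzeta zeta) > 0" and ny: "norm (yzeta zeta - of_real (Im tau0)) \<le> Im tau0 / 8"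
  if z: "zeta \<in> polydisc Basis (emb p) r" for zeta
 proof -
  have n: "norm (yzeta zeta - of_real (Im tau0)) < r"
   using polydisc_c_ball(5)[OF z[unfolded p]] by (simp add: yzeta_def dist_norm norm_minus_commute)
  thus "norm (yzeta zeta - of_real (Im tau0)) \<le> Im tau0 / 8" using r by linarith
  show "Re (yzeta zeta) > 0"
   using abs_Re_le_cmod[of "yzeta zeta - of_real (Im tau0)"] n r y by (auto simp: abs_le_iff)
 qed
 show "normal_ra UNIV (\<lambda>k. uc (\<lambda>tau u v t. R_term eps j m k tau v)) p"
 proof (rule normal_raI[OF r(1), of _ _ Psi "\<lambda>k. exp (- c * (of_int k + j / (2 * m))^2 + d * \<bar>of_int k + j / (2 * m)\<bar> + C)"])
  fix k :: int
  let ?n = "j + 2 * m * of_int k"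
  have ynz: "yzeta zeta \<noteq> 0" if "zeta \<in> polydisc Basis (emb p) r" for zeta using Rey[OF that] by auto
  have sy: "sep_holo Basis (emb p) r yzeta" and sa: "sep_holo Basis (emb p) r azeta"
   unfolding yzeta_def azeta_def by (rule sep_holo_coord)+
  have "sep_holo Basis (emb p) r (\<lambda>zeta. csqrt (yzeta zeta / of_real m))"
  proof (rule sep_holo_compose[where U = "{z. Re z > 0}" and g = csqrt and f = "\<lambda>zeta. yzeta zeta / of_real m"])
   show "csqrt holomorphic_on {z. Re z > 0}"
    by (rule holomorphic_on_subset[OF holomorphic_on_csqrt]) (auto simp: complex_nonpos_Reals_iff)
   show "sep_holo Basis (emb p) r (\<lambda>zeta. yzeta zeta / of_real m)"
    using m by (intro sep_holo_divide sy sep_holo_const) auto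
   show "yzeta zeta / of_real m \<in> {z. Re z > 0}" if "zeta \<in> polydisc Basis (emb p) r" for zeta
    using Rey[OF that] m by (simp add: Re_divide_of_real)
  qed
  hence sP: "sep_holo Basis (emb p) r (\<lambda>zeta. Psi_c m ?n (yzeta zeta) (azeta zeta))"
   unfolding Psi_c_def by (intro sep_holo_mult sep_holo_diff sep_holo_const sep_holo_divide sy sa ynz)
  have sE: "sep_holo Basis (emb p) r (\<lambda>zeta. Ec (Psi_c m ?n (yzeta zeta) (azeta zeta)))"
   by (rule sep_holo_compose[OF sP holomorphic_Ec[of UNIV]]) simp
  have se: "sep_holo Basis (emb p) r (\<lambda>zeta. e2pi (- of_real (?n\<^sup>2 / (4 * m)) * c_tau zeta + of_real ?n * c_v zeta))"
   unfolding e2pi_def c_tau_def c_v_def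
   by (intro sep_holo_exp sep_holo_mult sep_holo_add sep_holo_const sep_holo_coord)
  show "sep_holo Basis (emb p) r (Psi k)"
   unfolding Psi_def by (intro sep_holo_mult sep_holo_diff sep_holo_const sE se)
  show "uc (\<lambda>tau u v t. R_term eps j m k tau v) q = Psi k (emb q)" for q
   by (cases q) (simp add: R_term_def Psi_def yzeta_def azeta_def Basis_point4 inner_complex_def mult_ac)
  fix zeta assume z: "zeta \<in> polydisc Basis (emb p) r"
  note P = polydisc_c_ball[OF z[unfolded p]]
  have "norm (Psi k zeta) = norm ((R_sgn m k - Ec (Psi_c m ?n (yzeta zeta) (azeta zeta)))
    * e2pi (- of_real (?n\<^sup>2 / (4 * m)) * c_tau zeta + of_real ?n * c_v zeta))"
   unfolding Psi_def norm_mult[of "eps powi k"] sgn_unitD(2)[OF eps] by simp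
  also have "\<dots> \<le> exp (- c * (of_int k + j / (2 * m))^2 + d * \<bar>of_int k + j / (2 * m)\<bar> + C)"
  proof (rule bd[rule_format])
   show "norm (yzeta zeta - of_real (Im tau0)) \<le> Im tau0 / 8" by (rule ny[OF z])
   have "norm (azeta zeta - of_real (Im v0)) < r" using P(6) by (simp add: azeta_def dist_norm norm_minus_commute)
   thus "norm (azeta zeta) \<le> \<bar>Im v0\<bar> + 1"
    using norm_triangle_ineq[of "azeta zeta - of_real (Im v0)" "of_real (Im v0)"] r(2) by simp
   \<comment> \<open>Im (c_tau zeta) is Re (yzeta zeta) plus the imaginary part acquired by the
     complexified Re tau, which is below r <= Im tau0 / 8.\<close>
   have "\<bar>Im (zeta (1, 0, 0, 0))\<bar> < r"
    using polydisc_memD[OF z Basis_point4(1)] abs_Im_le_cmod[of "zeta (1, 0, 0, 0) - of_real (Re tau0)"]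
    by (simp add: p Basis_point4 inner_complex_def dist_norm norm_minus_commute)
   thus "Im (c_tau zeta) \<le> Re (yzeta zeta) + Im tau0 / 8" using r(3) by (simp add: c_tau_def yzeta_def)
   have "\<bar>Im (c_tau zeta - tau0)\<bar> < 2 * r" using P(1) abs_Im_le_cmod[of "c_tau zeta - tau0"]
    by (simp add: dist_norm norm_minus_commute)
   thus "Im (c_tau zeta) \<ge> 0" using r(3) y by (simp add: abs_less_iff)
   have "\<bar>Im (c_v zeta - v0)\<bar> < 2 * r" using P(3) abs_Im_le_cmod[of "c_v zeta - v0"]
    by (simp add: dist_norm norm_minus_commute)
   thus "\<bar>Im (c_v zeta)\<bar> \<le> \<bar>Im v0\<bar> + 1" using r(2) by (simp add: abs_less_iff abs_le_iff) linarith
  qed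
  finally show "norm (Psi k zeta) \<le> exp (- c * (of_int k + j / (2 * m))^2 + d * \<bar>of_int k + j / (2 * m)\<bar> + C)" .
 next
  show "(\<lambda>k::int. exp (- c * (of_int k + j / (2 * m))^2 + d * \<bar>of_int k + j / (2 * m)\<bar> + C)) summable_on UNIV"
   by (rule gaussian_shift_summable[OF c])
 qed
qed

lemma nra_prod:
 assumes "nra I f U" "nra J g U"
 shows "nra (I \<times> J) (\<lambda>ij tau u v t. f (fst ij) tau u v t * g (snd ij) tau u v t) U"
proof -
 have eq: "uc (\<lambda>tau u v t. f (fst ij) tau u v t * g (snd ij) tau u v t) = (\<lambda>y. uc (f (fst ij)) y * uc (g (snd ij)) y)" for ij
  by (auto simp: uc_def)
 show ?thesis using assms unfolding nra_def eq by (auto intro: normal_ra_prod)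
qed

lemma nra_times:
 assumes "ra4 h U" "nra I f U"
 shows "nra I (\<lambda>i tau u v t. h tau u v t * f i tau u v t) U"
proof -
 have eq: "uc (\<lambda>tau u v t. h tau u v t * f i tau u v t) = (\<lambda>y. uc h y * uc (f i) y)" for i by (auto simp: uc_def)
 show ?thesis using assms unfolding nra_def ra4_def eq by (auto intro: normal_ra_times)
qed

lemma ra4_e2pi_t: "ra4 (\<lambda>tau u v t. e2pi (of_real m * t)) X"
proof -
 have "nra {()} (\<lambda>_ tau u v t. e2pi (of_real m * t)) X"
 proof (rule nra_holoI[OF open_X])
  fix tau0 u0 v0 t0
  have "norm (e2pi (of_real m * t)) \<le> exp (2 * pi * (\<bar>m\<bar> * (\<bar>Im t0\<bar> + 1)))" if "t \<in> ball t0 1" for t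
  proof -
   have "- (m * Im t) \<le> \<bar>m\<bar> * \<bar>Im t\<bar>" by (simp add: abs_mult[symmetric])
   also have "\<dots> \<le> \<bar>m\<bar> * (\<bar>Im t0\<bar> + 1)" using ball_Im_le[OF that] by (intro mult_left_mono) auto
   finally have "2 * pi * - (m * Im t) \<le> 2 * pi * (\<bar>m\<bar> * (\<bar>Im t0\<bar> + 1))" by (intro mult_left_mono) auto
   thus ?thesis by (simp add: norm_e2pi)
  qed
  moreover have "holo4 1 (tau0, u0, v0, t0) (\<lambda>tau u v t. e2pi (of_real m * t))"
   unfolding holo4_def prod.case by (intro ballI conjI holomorphic_intros)
  ultimately show "\<exists>rho>0. \<exists>M. M summable_on {()} \<and> (\<forall>i\<in>{()}. holo4 rho (tau0, u0, v0, t0) (\<lambda>tau u v t. e2pi (of_real m * t)) \<and>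
    (\<forall>tau\<in>ball tau0 rho. \<forall>u\<in>ball u0 rho. \<forall>v\<in>ball v0 rho. \<forall>t\<in>ball t0 rho. norm (e2pi (of_real m * t)) \<le> M i))"
   by (intro exI[of _ 1] conjI exI[of _ "\<lambda>_. exp (2 * pi * (\<bar>m\<bar> * (\<bar>Im t0\<bar> + 1)))"]) auto
 qed
 thus ?thesis by (rule nra_ra4) simp
qed

definition add_index :: "real \<Rightarrow> real \<Rightarrow> real set" where
 "add_index m s = {j. j - s \<in> \<int> \<and> s \<le> j \<and> j < s + 2 * m}"

text \<open>The product of the series for \<open>R\<close> and \<open>Theta\<close> as one series
  over pairs, so that the termwise results apply to each summand of \<open>Phi_add\<close>.\<close>

definition add_term :: "complex \<Rightarrow> real \<Rightarrow> real \<Rightarrow> int \<times> int \<Rightarrow> fun4" where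
 "add_term eps m j kn = (\<lambda>tau u v t. e2pi (of_real m * t) *
   (R_term eps j m (fst kn) tau v * theta_term eps j m (snd kn) tau (- 2 * u)))"

lemma finite_add_index: "finite (add_index m s)"
proof -
 have "add_index m s \<subseteq> (\<lambda>i. s + of_int i) ` {0..\<lceil>2 * m\<rceil>}"
 proof
  fix j assume "j \<in> add_index m s"
  then obtain i where i: "j - s = of_int i" "s \<le> j" "j < s + 2 * m" by (auto simp: add_index_def elim: Ints_cases)
  hence "0 \<le> i" "i \<le> \<lceil>2 * m\<rceil>" by linarith+
  thus "j \<in> (\<lambda>i. s + of_int i) ` {0..\<lceil>2 * m\<rceil>}" using i by (intro image_eqI[of _ _ i]) auto
 qed
 thus ?thesis by (rule finite_subset) simp
qed

lemma add_term_nra: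
 assumes "sgn_unit eps" "m > 1/2"
 shows "nra UNIV (add_term eps m j) X"
proof -
 have "nra UNIV (\<lambda>n tau u v t. theta_term eps j m n tau (- 2 * u)) X" using theta_nra[of eps m j "-2" 0] assms by simp
 from nra_times[OF ra4_e2pi_t nra_prod[OF R_nra[OF assms] this]]
 show ?thesis unfolding add_term_def by simp
qed

lemma fsum_add_term:
 assumes e: "sgn_unit eps" and m: "m > 1/2" "2 * m \<in> \<int>" and j: "j \<in> half_ints" and p: "(tau, u, v, t) \<in> X"
 shows "fsum UNIV (add_term eps m j) tau u v t = e2pi (of_real m * t) * (R eps j m tau v * Theta eps j m tau (- 2 * u))"
proof -
 have y: "Im tau > 0" using p by (simp add: X_def)
 have m0: "m > 0" using m by simp
 have S: "((\<lambda>kn. add_term eps m j kn tau u v t) has_sum fsum UNIV (add_term eps m j) tau u v t) (UNIV \<times> UNIV)"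
  using nra_has_sum[OF add_term_nra[OF e m(1)] p] by simp
 have in1: "((\<lambda>n. add_term eps m j (k, n) tau u v t) has_sum e2pi (of_real m * t) * (R_term eps j m k tau v * Theta eps j m tau (- 2 * u))) UNIV" for k
  unfolding add_term_def fst_conv snd_conv by (intro has_sum_cmult_right theta_has_sum e m0 y)
 have "((\<lambda>k. e2pi (of_real m * t) * (R_term eps j m k tau v * Theta eps j m tau (- 2 * u))) has_sum fsum UNIV (add_term eps m j) tau u v t) UNIV"
  by (rule has_sum_SigmaD[OF S in1])
 moreover have "((\<lambda>k. e2pi (of_real m * t) * (R_term eps j m k tau v * Theta eps j m tau (- 2 * u))) has_sum
   e2pi (of_real m * t) * (R eps j m tau v * Theta eps j m tau (- 2 * u))) UNIV"
  unfolding R_eq_infsum[OF m0 m(2) j y] using nra_has_sum[OF R_nra[OF e m(1)] p, of j]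
  by (intro has_sum_cmult_right has_sum_cmult_left) (simp add: fsum_def)
 ultimately show ?thesis using has_sum_unique by blast
qed

section \<open>The Appell-Lerch sum Phi\<close>

text \<open>theta11(z) / (1 - e2pi(z + n tau)) written without a denominator, as
  \<open>Kn_eq\<close> shows; holomorphic also where the denominator vanishes.\<close>

definition Kn :: "int \<Rightarrow> complex \<Rightarrow> complex \<Rightarrow> complex" where
 "Kn n tau z = (-1) powi n * e2pi (of_real ((of_int n)^2 / 2) * tau + of_int n * z) * Kf tau (z + of_int n * tau)"

lemma Kn_eq:
 assumes "Im tau > 0" shows "(1 - e2pi (z + of_int n * tau)) * Kn n tau z = theta11 tau z"
proof -
 let ?A = "of_real ((of_int n)^2 / 2) * tau + of_int n * z"
 have "(1 - e2pi (z + of_int n * tau)) * Kn n tau z = (-1) powi n * e2pi ?A * theta11 tau (z + of_int n * tau)"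
  unfolding Kn_def theta11_eq_K[OF assms] by (simp only: mult_ac)
 also have "theta11 tau (z + of_int n * tau) = (-1) powi n * e2pi (- ?A) * theta11 tau z"
  unfolding theta11_shift_tau by (rule arg_cong2[where f = "(*)"], rule arg_cong2[where f = "(*)"]) (auto intro!: arg_cong[where f = e2pi])
 also have "(-1) powi n * e2pi ?A * ((-1) powi n * e2pi (- ?A) * theta11 tau z)
  = ((-1) powi n * (-1) powi n) * (e2pi ?A * e2pi (- ?A)) * theta11 tau z" by (simp only: mult_ac)
 also have "(-1) powi n * (-1) powi n = (1 :: complex)" by (simp flip: power_int_mult_distrib)
 also have "e2pi ?A * e2pi (- ?A) = 1" by (simp flip: e2pi_add)
 finally show ?thesis by simp
qed

lemma holomorphic_Kf_compose:
 assumes S: "open S" and f: "f holomorphic_on S" and g: "g holomorphic_on S" and y: "y > 0"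
  and le: "\<And>w. w \<in> S \<Longrightarrow> y \<le> Im (f w)" "\<And>w. w \<in> S \<Longrightarrow> \<bar>Im (g w)\<bar> \<le> h"
 shows "(\<lambda>w. Kf (f w) (g w)) holomorphic_on S" unfolding Kf_def
proof (rule holomorphic_on_infsum[OF S])
 show "(\<lambda>z. K_term n (f z) (g z)) holomorphic_on S" for n unfolding K_term_def by (intro holomorphic_intros f g)
 show "norm (K_term n (f w) (g w)) \<le> K_bound y h n" if "w \<in> S" for n w
  using le[OF that] y by (intro norm_K_term_le) auto
 show "K_bound y h summable_on UNIV" using y by (rule K_bound_summable)
qed

text \<open>For large |n| the denominator in \<open>Kn_eq\<close> is at least 1/2 in modulus, so the
  bound for theta11 serves; for the finitely many other n the bound for \<open>Kf\<close>
  does.\<close>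

lemma Kn_uniform_bound:
 assumes y: "y > 0" and h: "h \<ge> 0" and Y: "Y \<ge> 0"
 shows "\<exists>C. \<forall>n tau z. y \<le> Im tau \<longrightarrow> Im tau \<le> Y \<longrightarrow> \<bar>Im z\<bar> \<le> h \<longrightarrow> norm (Kn n tau z) \<le> C"
proof -
 define T where "T = infsum (theta_bound (1/2) (1/2) y (2 * h)) UNIV"
 \<comment> \<open>For |n| >= N0 the imaginary part of z + n tau has modulus at least 1, which keeps
   \<open>W\<close> away from 1.\<close>
 define N0 where "N0 = \<lceil>(h + 1) / y\<rceil>"
 define H where "H = h + \<bar>of_int N0\<bar> * Y"
 define Kb where "Kb = infsum (K_bound y H) UNIV"
 define C where "C = 2 * T + exp (2 * pi * \<bar>of_int N0\<bar> * h) * Kb"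
 have T0: "T \<ge> 0" unfolding T_def by (rule infsum_nonneg) (simp add: theta_bound_def)
 have Kb0: "Kb \<ge> 0" unfolding Kb_def by (rule infsum_nonneg) (simp add: K_bound_def)
 have N0: "of_int N0 * y \<ge> h + 1" using y unfolding N0_def by (metis divide_le_eq le_of_int_ceiling)
 have "norm (Kn n tau z) \<le> C" if tau: "y \<le> Im tau" "Im tau \<le> Y" and z: "\<bar>Im z\<bar> \<le> h" for n tau z
 proof -
  have im: "Im tau > 0" using tau y by linarith
  have e2: "exp (- 2 * pi) \<le> (1/2 :: real)"
  proof -
   have "2 \<le> exp (1 :: real)" using exp_ge_add_one_self[of 1] by simp
   also have "exp 1 \<le> exp (2 * pi)" using pi_gt3 by simp
   finally have "2 \<le> exp (2 * pi)" .
   thus ?thesis by (simp add: exp_minus field_simps)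
  qed
  have th: "norm (theta11 tau z) \<le> T"
  proof -
   have "norm (Theta (-1) (1/2) (1/2) tau (2 * z)) \<le> T" unfolding T_def
   proof (rule norm_infsum_le[OF theta_has_sum has_sum_infsum])
    show "theta_bound (1/2) (1/2) y (2 * h) summable_on UNIV" using y h by (intro theta_bound_summable) auto
    show "norm (theta_term (-1) (1/2) (1/2) n tau (2 * z)) \<le> theta_bound (1/2) (1/2) y (2 * h) n" for n
     using tau z by (intro norm_theta_term_le) (auto simp: sgn_unit_def)
   qed (use im in \<open>auto simp: sgn_unit_def\<close>)
   thus ?thesis by (simp add: theta11_def norm_mult)
  qed
  define W where "W = e2pi (z + of_int n * tau)"
  have nW: "norm W = exp (- 2 * pi * (Im z + of_int n * Im tau))" by (simp add: W_def norm_e2pi)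
  have far: "norm (Kn n tau z) \<le> 2 * T" if "norm (1 - W) \<ge> 1/2"
  proof -
   have "norm (1 - W) * norm (Kn n tau z) = norm (theta11 tau z)"
    using Kn_eq[OF im, of z n] by (simp add: W_def flip: norm_mult)
   moreover have "1/2 * norm (Kn n tau z) \<le> norm (1 - W) * norm (Kn n tau z)"
    using that by (intro mult_right_mono) auto
   ultimately show ?thesis using th by simp
  qed
  consider "n \<ge> N0" | "n \<le> - N0" | "\<bar>n\<bar> \<le> \<bar>N0\<bar>" by linarith
  thus ?thesis
  proof cases
   case 1
   have N0p: "of_int N0 > (0::real)" using N0 y h by (smt (verit) mult_nonpos_nonneg)
   have "of_int N0 * y \<le> of_int n * Im tau" using 1 tau y N0p by (intro mult_mono) auto
   hence "1 \<le> Im z + of_int n * Im tau" using N0 z by (simp add: abs_le_iff)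
   hence "2 * pi * 1 \<le> 2 * pi * (Im z + of_int n * Im tau)" by (rule mult_left_mono) simp
   hence "norm W \<le> exp (- 2 * pi)" unfolding nW by simp
   hence "norm (1 - W) \<ge> 1/2" using norm_triangle_ineq2[of 1 W] e2 by simp
   from far[OF this] show ?thesis unfolding C_def using Kb0 by (simp add: add_increasing2)
  next
   case 2
   have N0p: "of_int N0 > (0::real)" using N0 y h by (smt (verit) mult_nonpos_nonneg)
   have "of_int N0 * y \<le> (- of_int n) * Im tau" using 2 tau y N0p by (intro mult_mono) auto
   hence "1 \<le> - (Im z + of_int n * Im tau)" using N0 z by (simp add: abs_le_iff)
   hence "2 * pi * 1 \<le> 2 * pi * - (Im z + of_int n * Im tau)" by (rule mult_left_mono) simp
   hence "exp (2 * pi) \<le> norm W"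
    unfolding nW exp_le_cancel_iff by (simp only: mult_minus_left mult_minus_right mult_1_right)
   moreover have "exp (2 * pi) \<ge> 1 + 2 * pi" by (rule exp_ge_add_one_self)
   ultimately have "norm W \<ge> 2" using pi_gt3 by linarith
   hence "norm (1 - W) \<ge> 1/2" using norm_triangle_ineq2[of W 1] by (simp add: norm_minus_commute)
   from far[OF this] show ?thesis unfolding C_def using Kb0 by (simp add: add_increasing2)
  next
   case 3
   have nn: "\<bar>of_int n\<bar> \<le> \<bar>of_int N0 :: real\<bar>" using 3 by linarith
   have "norm (Kf tau (z + of_int n * tau)) \<le> Kb" unfolding Kb_def
   proof (rule norm_Kf_le[OF tau(1) y])
    have "\<bar>of_int n * Im tau\<bar> \<le> \<bar>of_int N0\<bar> * Y" unfolding abs_mult using nn tau im by (intro mult_mono) auto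
    thus "\<bar>Im (z + of_int n * tau)\<bar> \<le> H" using z unfolding H_def by simp
   qed
   moreover have "norm (e2pi (of_real ((of_int n)^2 / 2) * tau + of_int n * z)) \<le> exp (2 * pi * \<bar>of_int N0\<bar> * h)"
   proof -
    have "- (of_int n * Im z) \<le> \<bar>of_int n\<bar> * \<bar>Im z\<bar>" by (simp add: abs_mult[symmetric])
    also have "\<dots> \<le> \<bar>of_int N0\<bar> * h" using nn z by (intro mult_mono) auto
    finally have "- (of_int n * Im z) \<le> \<bar>of_int N0\<bar> * h" .
    moreover have "(of_int n)^2 / 2 * Im tau \<ge> 0" using im by simp
    ultimately have "- ((of_int n)^2 / 2 * Im tau + of_int n * Im z) \<le> \<bar>of_int N0\<bar> * h" by linarith
    hence le: "2 * pi * - ((of_int n)^2 / 2 * Im tau + of_int n * Im z) \<le> 2 * pi * (\<bar>of_int N0\<bar> * h)"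
     by (rule mult_left_mono) simp
    have eq: "- 2 * pi * Im (of_real ((of_int n)^2 / 2) * tau + of_int n * z)
      = 2 * pi * - ((of_int n)^2 / 2 * Im tau + of_int n * Im z)" by (simp add: algebra_simps)
    show ?thesis unfolding norm_e2pi eq exp_le_cancel_iff using le by (simp only: mult.assoc)
   qed
   ultimately have "norm (Kn n tau z) \<le> exp (2 * pi * \<bar>of_int N0\<bar> * h) * Kb"
    unfolding Kn_def norm_mult by (auto simp: norm_power_int intro!: mult_mono)
   thus ?thesis unfolding C_def using T0 by simp
  qed
 qed
 thus ?thesis by blast
qed

lemma nra_cong:
 assumes "nra I f U" "\<And>i tau u v t. i \<in> I \<Longrightarrow> (tau, u, v, t) \<in> U \<Longrightarrow> f i tau u v t = g i tau u v t"
 shows "nra I g U" unfolding nra_def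
proof (intro conjI ballI)
 show U: "open U" using assms(1) by (simp add: nra_def)
 fix p assume p: "p \<in> U"
 have "normal_ra I (\<lambda>i. uc (f i)) p" using assms(1) p by (simp add: nra_def)
 thus "normal_ra I (\<lambda>i. uc (g i)) p"
 proof (rule normal_ra_cong[OF _ U p])
  fix i y assume "i \<in> I" "y \<in> U"
  thus "uc (f i) y = uc (g i) y" using assms(2)[of i] by (cases y) simp
 qed
qed

lemma open_point4_box:
 assumes "open U" "(tau0, u0, v0, t0) \<in> (U :: point4 set)"
 shows "\<exists>rho>0. \<forall>tau\<in>ball tau0 rho. \<forall>u\<in>ball u0 rho. \<forall>v\<in>ball v0 rho. \<forall>t\<in>ball t0 rho. (tau, u, v, t) \<in> U"
proof -
 from open_prod_elim[OF assms] obtain A B where "open A" "open B" "(tau0, u0, v0, t0) \<in> A \<times> B" "A \<times> B \<subseteq> U" .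
 hence A: "open A" "open B" "tau0 \<in> A" "(u0, v0, t0) \<in> B" "A \<times> B \<subseteq> U" by auto
 from open_prod_elim[OF A(2,4)] obtain C D where "open C" "open D" "(u0, v0, t0) \<in> C \<times> D" "C \<times> D \<subseteq> B" .
 hence C: "open C" "open D" "u0 \<in> C" "(v0, t0) \<in> D" "C \<times> D \<subseteq> B" by auto
 from open_prod_elim[OF C(2,4)] obtain E1 F1 where "open E1" "open F1" "(v0, t0) \<in> E1 \<times> F1" "E1 \<times> F1 \<subseteq> D" .
 hence E: "open E1" "open F1" "v0 \<in> E1" "t0 \<in> F1" "E1 \<times> F1 \<subseteq> D" by auto
 obtain a where a: "a > 0" "ball tau0 a \<subseteq> A" using A(1,3) open_contains_ball by blast
 obtain b where b: "b > 0" "ball u0 b \<subseteq> C" using C(1,3) open_contains_ball by blast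
 obtain c where c: "c > 0" "ball v0 c \<subseteq> E1" using E(1,3) open_contains_ball by blast
 obtain d where d: "d > 0" "ball t0 d \<subseteq> F1" using E(2,4) open_contains_ball by blast
 define rho where "rho = min (min a b) (min c d)"
 have sub: "ball tau0 rho \<subseteq> A" "ball u0 rho \<subseteq> C" "ball v0 rho \<subseteq> E1" "ball t0 rho \<subseteq> F1"
  using a(2) b(2) c(2) d(2) by (auto simp: rho_def subset_iff)
 have "(tau, u, v, t) \<in> U" if "tau \<in> ball tau0 rho" "u \<in> ball u0 rho" "v \<in> ball v0 rho" "t \<in> ball t0 rho" for tau u v t
 proof -
  have "(v, t) \<in> D" using that sub E(5) by blast
  hence "(u, v, t) \<in> B" using that sub C(5) by blast
  thus ?thesis using that sub A(5) by blast
 qed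
 moreover have "rho > 0" using a b c d by (simp add: rho_def)
 ultimately show ?thesis by (intro exI[of _ rho]) simp
qed

lemma holomorphic_Theta_compose:
 assumes S: "open S" and f: "f holomorphic_on S" and g: "g holomorphic_on S" and y: "y > 0" and h: "h \<ge> 0"
  and le: "\<And>w. w \<in> S \<Longrightarrow> y \<le> Im (f w)" "\<And>w. w \<in> S \<Longrightarrow> \<bar>Im (g w)\<bar> \<le> h"
  and em: "sgn_unit eps" "m > 0"
 shows "(\<lambda>w. Theta eps j m (f w) (g w)) holomorphic_on S" unfolding Theta_eq
proof (rule holomorphic_on_infsum[OF S])
 show "(\<lambda>z. theta_term eps j m n (f z) (g z)) holomorphic_on S" for n
  unfolding theta_term_def by (intro holomorphic_intros f g)
 show "norm (theta_term eps j m n (f w) (g w)) \<le> theta_bound j m y h n" if "w \<in> S" for n w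
  using le[OF that] em by (intro norm_theta_term_le)
 show "theta_bound j m y h summable_on UNIV" using em y h by (intro theta_bound_summable)
qed

definition phi_coef :: "complex \<Rightarrow> real \<Rightarrow> real \<Rightarrow> int \<Rightarrow> complex \<Rightarrow> complex \<Rightarrow> complex \<Rightarrow> complex" where
 "phi_coef eps m s n tau u v = eps powi n *
   e2pi (of_real (m * (of_int n)^2 + of_int n * s) * tau - of_real (2 * m * of_int n) * u + of_real s * (v - u))"

text \<open>theta11(v - u) times \<open>Phi_term\<close> with the pole cancelled
  (\<open>theta_Phi_term_eq\<close>); it gives a series on all of \<open>X\<close> and not only at
  regular points.\<close>

definition G_term :: "complex \<Rightarrow> real \<Rightarrow> real \<Rightarrow> int \<Rightarrow> fun4" where
 "G_term eps m s n = (\<lambda>tau u v t. e2pi (of_real m * t) * (phi_coef eps m s n tau u v * Kn n tau (v - u)))"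

definition Phi_term :: "complex \<Rightarrow> real \<Rightarrow> real \<Rightarrow> int \<Rightarrow> fun4" where
 "Phi_term eps m s n = (\<lambda>tau u v t. e2pi (of_real m * t) *
   (phi_coef eps m s n tau u v / (1 - e2pi (v - u + of_int n * tau))))"

lemma norm_phi_coef_le:
 assumes "sgn_unit eps" "m > 0" "y \<le> Im tau" "0 \<le> Im tau" "Im tau \<le> Y" "\<bar>Im u\<bar> \<le> hu" "\<bar>Im (v - u)\<bar> \<le> hz"
 shows "norm (phi_coef eps m s n tau u v)
  \<le> exp (- (2 * pi * m * y) * (of_int n)^2 + (2 * pi * (\<bar>s\<bar> * Y + 2 * m * hu)) * \<bar>of_int n\<bar> + 2 * pi * (\<bar>s\<bar> * hz))"
proof -
 let ?n = "of_int n :: real"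
 have 1: "m * ?n\<^sup>2 * y \<le> m * ?n\<^sup>2 * Im tau" using assms by (intro mult_left_mono) auto
 have "- (?n * s * Im tau) \<le> \<bar>?n * s * Im tau\<bar>" by linarith
 also have "\<dots> = \<bar>?n\<bar> * \<bar>s\<bar> * Im tau" using assms by (simp add: abs_mult)
 also have "\<dots> \<le> \<bar>?n\<bar> * \<bar>s\<bar> * Y" using assms by (intro mult_left_mono) auto
 finally have 2: "- (?n * s * Im tau) \<le> \<bar>?n\<bar> * \<bar>s\<bar> * Y" .
 have "2 * m * ?n * Im u \<le> \<bar>2 * m * ?n * Im u\<bar>" by linarith
 also have "\<dots> = 2 * m * \<bar>?n\<bar> * \<bar>Im u\<bar>" using assms by (simp add: abs_mult)
 also have "\<dots> \<le> 2 * m * \<bar>?n\<bar> * hu" using assms by (intro mult_left_mono) auto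
 finally have 3: "2 * m * ?n * Im u \<le> 2 * m * \<bar>?n\<bar> * hu" .
 have "- (s * Im (v - u)) \<le> \<bar>s * Im (v - u)\<bar>" by linarith
 also have "\<dots> = \<bar>s\<bar> * \<bar>Im (v - u)\<bar>" by (rule abs_mult)
 also have "\<dots> \<le> \<bar>s\<bar> * hz" using assms by (intro mult_left_mono) auto
 finally have 4: "- (s * Im (v - u)) \<le> \<bar>s\<bar> * hz" .
 have "norm (phi_coef eps m s n tau u v) = exp (2 * pi * (- (m * ?n\<^sup>2 * Im tau) + - (?n * s * Im tau) + 2 * m * ?n * Im u + - (s * Im (v - u))))"
  unfolding phi_coef_def norm_mult sgn_unitD(2)[OF assms(1)] norm_e2pi by (simp add: algebra_simps)
 also have "\<dots> \<le> exp (2 * pi * (- (m * ?n\<^sup>2 * y) + \<bar>?n\<bar> * \<bar>s\<bar> * Y + 2 * m * \<bar>?n\<bar> * hu + \<bar>s\<bar> * hz))"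
  unfolding exp_le_cancel_iff using 1 2 3 4 by (intro mult_left_mono) auto
 also have "2 * pi * (- (m * ?n\<^sup>2 * y) + \<bar>?n\<bar> * \<bar>s\<bar> * Y + 2 * m * \<bar>?n\<bar> * hu + \<bar>s\<bar> * hz)
   = - (2 * pi * m * y) * ?n\<^sup>2 + (2 * pi * (\<bar>s\<bar> * Y + 2 * m * hu)) * \<bar>?n\<bar> + 2 * pi * (\<bar>s\<bar> * hz)"
  by (simp add: algebra_simps)
 finally show ?thesis .
qed

lemma G_nra:
 assumes e: "sgn_unit eps" and m: "m > 0"
 shows "nra UNIV (G_term eps m s) X"
proof -
 have "nra UNIV (\<lambda>n tau u v t. phi_coef eps m s n tau u v * Kn n tau (v - u)) X"
 proof (rule nra_holoI[OF open_X])
  fix tau0 u0 v0 t0 assume "(tau0, u0, v0, t0) \<in> X"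
  hence y: "Im tau0 > 0" by (simp add: X_def)
  define rho where "rho = min 1 (Im tau0 / 2)"
  have rho: "rho > 0" "rho \<le> 1" "rho \<le> Im tau0 / 2" using y by (auto simp: rho_def)
  define y1 where "y1 = Im tau0 / 2"
  define Y where "Y = Im tau0 + 1"
  define hu where "hu = \<bar>Im u0\<bar> + 1"
  define hz where "hz = \<bar>Im v0\<bar> + 1 + hu"
  have pos: "y1 > 0" "Y \<ge> 0" "hu \<ge> 0" "hz \<ge> 0" using y by (auto simp: y1_def Y_def hu_def hz_def)
  note B = box_bounds(1,2)[OF _ rho(2,3), folded y1_def Y_def]
  have z: "\<bar>Im (v - u)\<bar> \<le> hz" if "u \<in> ball u0 rho" "v \<in> ball v0 rho" for u v
   using ball_Im_le[OF that(1) rho(2)] ball_Im_le[OF that(2) rho(2)] abs_triangle_ineq4[of "Im v" "Im u"]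
   by (simp add: hz_def hu_def)
  have u: "\<bar>Im u\<bar> \<le> hu" if "u \<in> ball u0 rho" for u using ball_Im_le[OF that rho(2)] by (simp add: hu_def)
  obtain C where C: "\<forall>n tau z. y1 \<le> Im tau \<longrightarrow> Im tau \<le> Y \<longrightarrow> \<bar>Im z\<bar> \<le> hz \<longrightarrow> norm (Kn n tau z) \<le> C"
   using Kn_uniform_bound[OF pos(1,4,2)] by (elim exE) (rule that)
  define M where "M = (\<lambda>n::int. exp (- (2 * pi * m * y1) * (of_int n)^2 + (2 * pi * (\<bar>s\<bar> * Y + 2 * m * hu)) * \<bar>of_int n\<bar> + 2 * pi * (\<bar>s\<bar> * hz)) * C)"
  have le: "norm (phi_coef eps m s n tau u v * Kn n tau (v - u)) \<le> M n"
   if "tau \<in> ball tau0 rho" "u \<in> ball u0 rho" "v \<in> ball v0 rho" for n tau u v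
   unfolding norm_mult M_def using B[OF that(1)] pos C[rule_format, of tau "v - u" n] z[OF that(2,3)]
   by (intro mult_mono norm_phi_coef_le[OF e m]) (auto intro: u[OF that(2)])
  have M: "M summable_on UNIV" unfolding M_def using m pos by (intro summable_on_cmult_left gaussian_summable) simp
  have imb: "\<bar>Im (v - u + of_int n * tau)\<bar> \<le> hz + \<bar>of_int n\<bar> * Y"
   if "tau \<in> ball tau0 rho" "u \<in> ball u0 rho" "v \<in> ball v0 rho" for n tau u v
  proof -
   have "\<bar>of_int n * Im tau\<bar> \<le> \<bar>of_int n\<bar> * Y"
    unfolding abs_mult using B[OF that(1)] pos by (intro mult_left_mono) auto
   thus ?thesis using z[OF that(2,3)] abs_triangle_ineq[of "Im (v - u)" "of_int n * Im tau"] by simp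
  qed
  have h: "holo4 rho (tau0, u0, v0, t0) (\<lambda>tau u v t. phi_coef eps m s n tau u v * Kn n tau (v - u))" for n
   unfolding holo4_def prod.case phi_coef_def Kn_def
  proof (intro ballI conjI holomorphic_intros)
   fix tau u v t assume A: "tau \<in> ball tau0 rho" "u \<in> ball u0 rho" "v \<in> ball v0 rho"
   show "(\<lambda>w. Kf w (v - u + of_int n * w)) holomorphic_on ball tau0 rho"
    by (rule holomorphic_Kf_compose[OF open_ball _ _ pos(1), where h = "hz + \<bar>of_int n\<bar> * Y"])
      (use A B imb in \<open>auto intro!: holomorphic_intros\<close>)
   show "(\<lambda>w. Kf tau (v - w + of_int n * tau)) holomorphic_on ball u0 rho"
    by (rule holomorphic_Kf_compose[OF open_ball _ _ pos(1), where h = "hz + \<bar>of_int n\<bar> * Y"])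
      (use A B imb in \<open>auto intro!: holomorphic_intros\<close>)
   show "(\<lambda>w. Kf tau (w - u + of_int n * tau)) holomorphic_on ball v0 rho"
    by (rule holomorphic_Kf_compose[OF open_ball _ _ pos(1), where h = "hz + \<bar>of_int n\<bar> * Y"])
      (use A B imb in \<open>auto intro!: holomorphic_intros\<close>)
  qed
  show "\<exists>rho>0. \<exists>M. M summable_on UNIV \<and> (\<forall>n\<in>UNIV. holo4 rho (tau0, u0, v0, t0)
    (\<lambda>tau u v t. phi_coef eps m s n tau u v * Kn n tau (v - u)) \<and>
   (\<forall>tau\<in>ball tau0 rho. \<forall>u\<in>ball u0 rho. \<forall>v\<in>ball v0 rho. \<forall>t\<in>ball t0 rho.
    norm (phi_coef eps m s n tau u v * Kn n tau (v - u)) \<le> M n))"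
   using rho(1) M h le by (intro exI[of _ rho] conjI exI[of _ M] ballI) auto
 qed
 from nra_times[OF ra4_e2pi_t this] show ?thesis unfolding G_term_def .
qed

lemma ra4_inverse_theta11: "ra4 (\<lambda>tau u v t. 1 / theta11 tau (v - u)) regular"
proof -
 let ?th = "\<lambda>tau u v (t::complex). theta11 tau (v - u)"
 have "nra {()} (\<lambda>_ tau u v t. 1 / theta11 tau (v - u)) regular"
 proof (rule nra_holoI[OF open_regular])
  fix tau0 u0 v0 t0 assume p: "(tau0, u0, v0, t0) \<in> regular"
  define delta where "delta = norm (theta11 tau0 (v0 - u0)) / 2"
  have y: "Im tau0 > 0" and delta: "delta > 0" using p by (auto simp: regular_def X_def delta_def)
  have "continuous_on X (uc ?th)" by (rule ra4_continuous_on[OF theta11_ra4(1)])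
  hence "continuous_on X (\<lambda>p. norm (uc ?th p))" by (rule continuous_on_norm)
  from continuous_open_preimage[OF this open_X open_greaterThan[of delta]]
  have op: "open (X \<inter> (\<lambda>p. norm (uc ?th p)) -` {delta<..})" .
  have mem: "(tau0, u0, v0, t0) \<in> X \<inter> (\<lambda>p. norm (uc ?th p)) -` {delta<..}"
   using p delta by (auto simp: regular_def delta_def)
  obtain rho1 where rho1: "rho1 > 0" and b1': "\<forall>tau\<in>ball tau0 rho1. \<forall>u\<in>ball u0 rho1. \<forall>v\<in>ball v0 rho1. \<forall>t\<in>ball t0 rho1.
    (tau, u, v, t) \<in> X \<inter> (\<lambda>p. norm (uc ?th p)) -` {delta<..}"
   using open_point4_box[OF op mem] by (elim exE conjE) (rule that)
  define rho where "rho = min rho1 (min 1 (Im tau0 / 2))"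
  have rho: "rho > 0" "rho \<le> 1" "rho \<le> Im tau0 / 2" "rho \<le> rho1" using y rho1 by (auto simp: rho_def)
  have big: "norm (theta11 tau (v - u)) > delta" if "tau \<in> ball tau0 rho" "u \<in> ball u0 rho" "v \<in> ball v0 rho" for tau u v
  proof -
   have "(tau, u, v, t0) \<in> X \<inter> (\<lambda>p. norm (uc ?th p)) -` {delta<..}"
    using that rho rho1 by (intro b1'[rule_format]) auto
   thus ?thesis by simp
  qed
  have nz: "theta11 tau (v - u) \<noteq> 0" if "tau \<in> ball tau0 rho" "u \<in> ball u0 rho" "v \<in> ball v0 rho" for tau u v
   using big[OF that] delta by auto
  have le: "norm (1 / theta11 tau (v - u)) \<le> 1 / delta" if "tau \<in> ball tau0 rho" "u \<in> ball u0 rho" "v \<in> ball v0 rho" for tau u v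
   using big[OF that] delta unfolding norm_divide by (intro frac_le) auto
  define h where "h = 2 * (\<bar>Im v0\<bar> + 1 + (\<bar>Im u0\<bar> + 1))"
  have z: "\<bar>Im (2 * (v - u))\<bar> \<le> h" if "u \<in> ball u0 rho" "v \<in> ball v0 rho" for u v
  proof -
   have eq: "Im (2 * (v - u)) = 2 * (Im v - Im u)" by simp
   show ?thesis unfolding eq h_def
    using ball_Im_le[OF that(1) rho(2)] ball_Im_le[OF that(2) rho(2)] abs_triangle_ineq4[of "Im v" "Im u"]
    by (simp only: abs_mult) simp
  qed
  have hol: "(\<lambda>w. theta11 (f w) (g w)) holomorphic_on S" if "open S" "f holomorphic_on S" "g holomorphic_on S"
   "\<And>w. w \<in> S \<Longrightarrow> Im tau0 / 2 \<le> Im (f w)" "\<And>w. w \<in> S \<Longrightarrow> \<bar>Im (2 * g w)\<bar> \<le> h" for f g S unfolding theta11_def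
   by (intro holomorphic_intros holomorphic_Theta_compose[OF that(1,2), where h = h and y = "Im tau0 / 2"] that(3,4,5))
     (use y in \<open>auto simp: h_def sgn_unit_def\<close>)
  have "holo4 rho (tau0, u0, v0, t0) (\<lambda>tau u v t. 1 / theta11 tau (v - u))" unfolding holo4_def prod.case
  proof (intro ballI conjI holomorphic_on_divide holomorphic_on_const)
   fix tau u v t assume A: "tau \<in> ball tau0 rho" "u \<in> ball u0 rho" "v \<in> ball v0 rho" "t \<in> ball t0 rho"
   note B = box_bounds(1)[OF _ rho(2,3)]
   show "(\<lambda>w. theta11 w (v - u)) holomorphic_on ball tau0 rho"
    by (rule hol[OF open_ball]) (use A B z in \<open>auto intro!: holomorphic_intros\<close>)
   show "(\<lambda>w. theta11 tau (v - w)) holomorphic_on ball u0 rho"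
    by (rule hol[OF open_ball]) (use A B z in \<open>auto intro!: holomorphic_intros\<close>)
   show "(\<lambda>w. theta11 tau (w - u)) holomorphic_on ball v0 rho"
    by (rule hol[OF open_ball]) (use A B z in \<open>auto intro!: holomorphic_intros\<close>)
  qed (use nz in auto)
  with rho(1) le show "\<exists>rho>0. \<exists>M. M summable_on {()} \<and> (\<forall>i\<in>{()}. holo4 rho (tau0, u0, v0, t0) (\<lambda>tau u v t. 1 / theta11 tau (v - u)) \<and>
    (\<forall>tau\<in>ball tau0 rho. \<forall>u\<in>ball u0 rho. \<forall>v\<in>ball v0 rho. \<forall>t\<in>ball t0 rho. norm (1 / theta11 tau (v - u)) \<le> M i))"
   by (intro exI[of _ rho] conjI exI[of _ "\<lambda>_. 1 / delta"]) auto
 qed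
 thus ?thesis by (rule nra_ra4) simp
qed

lemma denominator_nonzero:
 assumes "Im tau > 0" "theta11 tau (v - u) \<noteq> 0" shows "1 - e2pi (v - u + of_int n * tau) \<noteq> 0"
proof
 assume "1 - e2pi (v - u + of_int n * tau) = 0"
 with Kn_eq[OF assms(1), of "v - u" n] assms(2) show False by simp
qed

lemma regularD:
 assumes "(tau, u, v, t) \<in> regular"
 shows "Im tau > 0" "theta11 tau (v - u) \<noteq> 0" "theta11 tau (v + u) \<noteq> 0" using assms by (auto simp: regular_def X_def)

lemma theta_Phi_term_eq:
 assumes y: "Im tau > 0" and th: "theta11 tau (v - u) \<noteq> 0"
 shows "theta11 tau (v - u) * Phi_term eps m s n tau u v t = G_term eps m s n tau u v t"
 unfolding Phi_term_def G_term_def Kn_eq[OF y, of "v - u" n, symmetric]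
 using denominator_nonzero[OF assms, of n] by (simp add: field_simps)

lemma Phi_nra:
 assumes "sgn_unit eps" "m > 0"
 shows "nra UNIV (Phi_term eps m s) regular"
proof (rule nra_cong)
 show "nra UNIV (\<lambda>n tau u v t. 1 / theta11 tau (v - u) * G_term eps m s n tau u v t) regular"
  by (rule nra_times[OF ra4_inverse_theta11 nra_subset[OF G_nra[OF assms] regular_subset_X open_regular]])
 fix n tau u v t assume p: "(tau, u, v, t) \<in> regular"
 thus "1 / theta11 tau (v - u) * G_term eps m s n tau u v t = Phi_term eps m s n tau u v t"
  unfolding theta_Phi_term_eq[OF regularD(1,2)[OF p], symmetric] by (simp add: regular_def)
qed

lemma Phi_term_has_sum:
 assumes e: "sgn_unit eps" "m > 0" and y: "Im tau > 0" and th: "theta11 tau (v - u) \<noteq> 0"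
 shows "((\<lambda>n. Phi_term eps m s n tau u v t) has_sum fsum UNIV (G_term eps m s) tau u v t / theta11 tau (v - u)) UNIV"
proof -
 have eq: "Phi_term eps m s n tau u v t = (1 / theta11 tau (v - u)) * G_term eps m s n tau u v t" for n
  unfolding theta_Phi_term_eq[OF y th, symmetric] using th by simp
 have "((\<lambda>n. G_term eps m s n tau u v t) has_sum fsum UNIV (G_term eps m s) tau u v t) UNIV"
  by (rule nra_has_sum[OF G_nra[OF e]]) (use y in \<open>simp add: X_def\<close>)
 from has_sum_cmult_right[OF this, of "1 / theta11 tau (v - u)"] show ?thesis unfolding eq by simp
qed

lemma fsum_Phi_term_eq:
 assumes "sgn_unit eps" "m > 0" "Im tau > 0" "theta11 tau (v - u) \<noteq> 0"
 shows "fsum UNIV (Phi_term eps m s) tau u v t = fsum UNIV (G_term eps m s) tau u v t / theta11 tau (v - u)"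
 using Phi_term_has_sum[OF assms, THEN infsumI] by (simp add: fsum_def)

lemma Phi_eq_fsum: "Phi eps m s tau (v - u) (- v - u) t = fsum UNIV (Phi_term eps m s) tau u v t"
proof -
 have "eps powi n * (qpow tau (m * (of_int n)^2 + of_int n * s)
     * e2pi (of_real (m * of_int n) * ((v - u) + (- v - u)) + of_real s * (v - u)))
    / (1 - e2pi (v - u) * qpow tau (of_int n)) = phi_coef eps m s n tau u v / (1 - e2pi (v - u + of_int n * tau))" for n
 proof -
  have "qpow tau (m * (of_int n)^2 + of_int n * s) * e2pi (of_real (m * of_int n) * ((v - u) + (- v - u)) + of_real s * (v - u))
   = e2pi (of_real (m * (of_int n)^2 + of_int n * s) * tau - of_real (2 * m * of_int n) * u + of_real s * (v - u))"
   unfolding qpow_e2pi e2pi_add[symmetric] by (rule e2pi_eqI) (simp add: algebra_simps)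
  thus ?thesis by (simp add: phi_coef_def e2pi_add qpow_e2pi)
 qed
 thus ?thesis unfolding Phi_def fsum_def Phi_term_def infsum_cmult_right' by (simp only:)
qed

text \<open>At v = u the factor theta11 is 0, so every term with a nonzero denominator vanishes and
  only n = 0 survives. Up to a constant this is the residue of \<open>Phi\<close> along v =
  u.\<close>

lemma fsum_G_diag:
 assumes y: "Im tau > 0"
 shows "fsum UNIV (G_term eps m s) tau v v t = e2pi (of_real m * t) * Kf tau 0"
proof -
 have K0: "Kn n tau 0 = 0" if "n \<noteq> 0" for n
 proof -
  have "e2pi (0 + of_int n * tau) \<noteq> 1"
  proof
   assume "e2pi (0 + of_int n * tau) = 1"
   then obtain k :: int where "of_int n * tau = of_int k" by (auto simp: e2pi_eq_1_iff elim: Ints_cases)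
   hence "Im (of_int n * tau) = Im (of_int k)" by (simp only:)
   thus False using y that by simp
  qed
  moreover have "(1 - e2pi (0 + of_int n * tau)) * Kn n tau 0 = 0"
   using Kn_eq[OF y, of 0 n] theta11_eq_K[OF y, of 0] by simp
  ultimately show ?thesis by simp
 qed
 have "((\<lambda>n. G_term eps m s n tau v v t) has_sum G_term eps m s 0 tau v v t) UNIV"
  by (rule has_sum_cong_neutral[THEN iffD1, OF _ _ _ has_sum_finite[of "{0}", simplified]]) (auto simp: G_term_def K0)
 hence "fsum UNIV (G_term eps m s) tau v v t = G_term eps m s 0 tau v v t" unfolding fsum_def by (rule infsumI)
 thus ?thesis by (simp add: G_term_def phi_coef_def Kn_def)
qed

section \<open>Transformation laws under shifts of u and v\<close>

definition Rs :: "complex \<Rightarrow> real \<Rightarrow> real \<Rightarrow> complex \<Rightarrow> complex \<Rightarrow> complex" where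
 "Rs eps j m tau v = (\<Sum>\<^sub>\<infinity>k. R_term eps j m k tau v)"

lemma Rs_has_sum:
 assumes "sgn_unit eps" "m > 1/2" "Im tau > 0"
 shows "((\<lambda>k. R_term eps j m k tau v) has_sum Rs eps j m tau v) UNIV"
 using nra_has_sum[OF R_nra[OF assms(1,2)], of tau 0 v 0 j] assms(3) by (simp add: fsum_def Rs_def X_def)

lemma Psi_c_shift_real:
 "Psi_c m n y (of_real (Im (v + of_real x))) = Psi_c m n y (of_real (Im v))" by simp

lemma Rs_shift_real:
 assumes m: "m \<noteq> 0"
 shows "Rs eps j m tau (v + of_real (of_int k / (2 * m))) = e2pi (of_real (j * of_int k / (2 * m))) * Rs eps j m tau v"
proof -
 have "R_term eps j m i tau (v + of_real (of_int k / (2 * m))) = e2pi (of_real (j * of_int k / (2 * m))) * R_term eps j m i tau v" for i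
 proof -
  have eq: "- of_real ((j + 2 * m * of_int i)^2 / (4 * m)) * tau + of_real (j + 2 * m * of_int i) * (v + of_real (of_int k / (2 * m)))
   = of_real (j * of_int k / (2 * m)) + (- of_real ((j + 2 * m * of_int i)^2 / (4 * m)) * tau + of_real (j + 2 * m * of_int i) * v) + of_int (i * k)"
  proof -
   have "(j + 2 * m * of_int i) * (of_int k / (2 * m)) = j * of_int k / (2 * m) + of_int (i * k)"
    using m by (simp add: field_simps)
   note r = this
   have "of_real (j + 2 * m * of_int i) * of_real (of_int k / (2 * m)) = (of_real (j * of_int k / (2 * m)) + of_int (i * k) :: complex)"
    unfolding of_real_mult[symmetric] r by (simp only: of_real_add of_real_of_int_eq)
   thus ?thesis by (simp only: distrib_left add_ac)
  qed
  show ?thesis unfolding R_term_def eq e2pi_add e2pi_of_int Psi_c_shift_real by (simp only: mult_ac mult_1_right mult_1_left)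
 qed
 thus ?thesis unfolding Rs_def by (simp add: infsum_cmult_right')
qed

text \<open>The shift raises 2 m Im v / Im tau by one; in the argument of the error function this is
  the same as lowering n = j + 2 m k by one, and completing the square does the same in the
  exponential.\<close>

lemma Rs_shift_tau:
 assumes m: "m > 0" and y: "Im tau > 0"
 shows "Rs eps j m tau (v + tau / (2 * of_real m)) = qpow tau (1 / (4 * m)) * e2pi v * Rs eps (j - 1) m tau v"
proof -
 have "R_term eps j m i tau (v + tau / (2 * of_real m)) = qpow tau (1 / (4 * m)) * e2pi v * R_term eps (j - 1) m i tau v" for i
 proof -
  let ?n = "j + 2 * m * of_int i"
  have n1: "j - 1 + 2 * m * of_int i = ?n - 1" by simp
  have eq: "- of_real (?n\<^sup>2 / (4 * m)) * tau + of_real ?n * (v + tau / (2 * of_real m))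
   = of_real (1 / (4 * m)) * tau + v + (- of_real ((?n - 1)^2 / (4 * m)) * tau + of_real (?n - 1) * v)"
  proof -
   define n where "n = ?n"
   show ?thesis unfolding n_def[symmetric] using m by (simp add: field_simps power2_eq_square)
  qed
  have P: "Psi_c m ?n (of_real (Im tau)) (of_real (Im (v + tau / (2 * of_real m)))) = Psi_c m (?n - 1) (of_real (Im tau)) (of_real (Im v))"
  proof -
   have "Im (v + tau / (2 * of_real m)) = Im v + Im tau / (2 * m)"
   proof -
    have "tau / (2 * of_real m) = tau / of_real (2 * m)" by simp
    thus ?thesis by (simp only: plus_complex.sel Im_divide_of_real)
   qed
   moreover have "2 * m * ((Im v + Im tau / (2 * m)) / Im tau) = 2 * m * (Im v / Im tau) + 1"
    using m y by (simp add: field_simps)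
   hence "2 * complex_of_real m * (complex_of_real (Im v + Im tau / (2 * m)) / complex_of_real (Im tau))
     = 2 * complex_of_real m * (complex_of_real (Im v) / complex_of_real (Im tau)) + 1"
    by (metis (no_types) of_real_1 of_real_add of_real_divide of_real_mult of_real_numeral)
   ultimately show ?thesis unfolding Psi_c_def by simp
  qed
  show ?thesis unfolding R_term_def n1 eq P qpow_e2pi by (simp only: e2pi_add mult_ac)
 qed
 thus ?thesis unfolding Rs_def by (simp add: infsum_cmult_right')
qed

text \<open>Raising j by 2m is the reindexing k -> k + 1, except that the sign does not move along:
  \<open>R_sgn m k\<close> and \<open>R_sgn m (k + 1)\<close> differ only at k = -1, and that
  difference leaves a single exponential.\<close>

lemma Rs_index_shift:
 assumes e: "sgn_unit eps" and m: "m > 1/2" and y: "Im tau > 0"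
 shows "Rs eps (j + 2 * m) m tau v = eps * (Rs eps j m tau v - 2 * e2pi (- of_real (j^2 / (4 * m)) * tau + of_real j * v))"
proof -
 let ?e = "e2pi (- of_real (j^2 / (4 * m)) * tau + of_real j * v)"
 have t: "R_term eps (j + 2 * m) m k tau v = eps * (R_term eps j m (k + 1) tau v + (if k = -1 then - 2 * ?e else 0))" for k
 proof -
  have n: "j + 2 * m + 2 * m * of_int k = j + 2 * m * of_int (k + 1)" by (simp add: algebra_simps)
  have ep: "eps * eps powi (k + 1) = eps powi k" using sgn_unit_add[OF e, of k 1] sgn_unitD(3)[OF e] by simp
  have sg: "R_sgn m k = R_sgn m (k + 1) + (if k = -1 then -2 else 0)"
   using R_sgn_cases[OF m, of k] R_sgn_cases[OF m, of "k + 1"] by auto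
  let ?P = "Ec (Psi_c m (j + 2 * m * of_int (k + 1)) (of_real (Im tau)) (of_real (Im v)))"
  let ?ex = "e2pi (- of_real ((j + 2 * m * of_int (k + 1))^2 / (4 * m)) * tau + of_real (j + 2 * m * of_int (k + 1)) * v)"
  have "R_term eps (j + 2 * m) m k tau v = (eps * eps powi (k + 1)) * (R_sgn m (k + 1) + (if k = -1 then -2 else 0) - ?P) * ?ex"
   unfolding R_term_def n ep sg by simp
  also have "\<dots> = eps * (R_term eps j m (k + 1) tau v + eps powi (k + 1) * (if k = -1 then -2 else 0) * ?ex)"
   unfolding R_term_def by (simp only: ring_distribs mult_ac add_ac diff_conv_add_uminus) 
  also have "eps powi (k + 1) * (if k = -1 then -2 else 0) * ?ex = (if k = -1 then - 2 * ?e else 0)" by simp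
  finally show ?thesis .
 qed
 have bij: "bij_betw (\<lambda>n. n + 1) UNIV (UNIV :: int set)" by (rule bij_betwI[of _ _ _ "\<lambda>n. n - 1"]) auto
 have 1: "((\<lambda>k. R_term eps j m (k + 1) tau v) has_sum Rs eps j m tau v) UNIV"
  using Rs_has_sum[OF e m y, of j v] has_sum_reindex_bij_betw[OF bij, of "\<lambda>k. R_term eps j m k tau v"] by simp
 have 2: "((\<lambda>k. if k = -1 then - 2 * ?e else 0) has_sum (- 2 * ?e)) (UNIV :: int set)"
  by (rule has_sum_finite_neutralI[of "{-1}"]) auto
 have "((\<lambda>k. R_term eps (j + 2 * m) m k tau v) has_sum eps * (Rs eps j m tau v + - 2 * ?e)) UNIV"
  unfolding t by (intro has_sum_cmult_right has_sum_add 1 2)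
 hence "Rs eps (j + 2 * m) m tau v = eps * (Rs eps j m tau v + - 2 * ?e)" unfolding Rs_def by (rule infsumI)
 thus ?thesis by simp
qed

definition AddF :: "complex \<Rightarrow> real \<Rightarrow> real \<Rightarrow> fun4" where
 "AddF eps m s tau u v t = e2pi (of_real m * t) * (\<Sum>j\<in>add_index m s. Rs eps j m tau v * Theta eps j m tau (- 2 * u))"

definition PhiF :: "complex \<Rightarrow> real \<Rightarrow> real \<Rightarrow> fun4" where
 "PhiF eps m s = fsum UNIV (Phi_term eps m s)"

lemma add_index_half_ints:
 assumes "s \<in> half_ints" "j \<in> add_index m s" shows "j \<in> half_ints"
proof -
 have 1: "2 * s \<in> \<int>" using assms(1) by (simp add: half_ints_def)
 have 2: "2 * (j - s) \<in> \<int>" by (rule Ints_mult[OF Ints_numeral]) (use assms(2) in \<open>simp add: add_index_def\<close>)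
 from Ints_add[OF 1 2] show ?thesis by (simp add: half_ints_def algebra_simps)
qed

lemma phi_tilde_eq:
 assumes "m > 1/2" "2 * m \<in> \<int>" "s \<in> half_ints" "Im tau > 0"
 shows "phi_tilde eps m s tau u v t = PhiF eps m s tau u v t - 1/2 * AddF eps m s tau u v t"
proof -
 have "R eps j m tau v = Rs eps j m tau v" if "j \<in> add_index m s" for j
  unfolding Rs_def using assms add_index_half_ints[OF assms(3) that] by (intro R_eq_infsum) auto
 moreover have "(v - u - (- v - u)) / 2 = v" "v - u + (- v - u) = - 2 * u" by simp_all
 ultimately have "Phi_add eps m s tau (v - u) (- v - u) t = AddF eps m s tau u v t"
  unfolding Phi_add_def AddF_def add_index_def[symmetric] by simp
 thus ?thesis by (simp add: phi_tilde_def Phi_tilde_def Phi_eq_fsum PhiF_def)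
qed

lemma PhiF_alt:
 "PhiF eps m s tau u v t = e2pi (of_real m * t) * (\<Sum>\<^sub>\<infinity>n. phi_coef eps m s n tau u v / (1 - e2pi (v - u + of_int n * tau)))"
 unfolding PhiF_def fsum_def Phi_term_def infsum_cmult_right' ..

text \<open>The two families of real shifts share one computation: \<open>x\<close> is the shift of \<open>u\<close>, \<open>x + d\<close> that of \<open>v\<close>.\<close>

lemma PhiF_shift_real:
 assumes "2 * m * x \<in> \<int>"
 shows "PhiF eps m s tau (u + of_real x) (v + of_real x + of_int d) t = e2pi (of_real (s * of_int d)) * PhiF eps m s tau u v t"
proof -
 have c: "phi_coef eps m s n tau (u + of_real x) (v + of_real x + of_int d) = e2pi (of_real (s * of_int d)) * phi_coef eps m s n tau u v" for n
 proof -
  have eq: "of_real (m * (of_int n)^2 + of_int n * s) * tau - of_real (2 * m * of_int n) * (u + of_real x)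
    + of_real s * ((v + of_real x + of_int d) - (u + of_real x))
   = (of_real (m * (of_int n)^2 + of_int n * s) * tau - of_real (2 * m * of_int n) * u + of_real s * (v - u))
    + of_real (s * of_int d) + of_real (- ((2 * m * x) * of_int n))" by (simp add: algebra_simps)
  have "e2pi (of_real (- ((2 * m * x) * of_int n))) = 1"
   by (intro e2pi_of_real_Ints Ints_minus Ints_mult[OF assms Ints_of_int])
  thus ?thesis unfolding phi_coef_def eq e2pi_add by simp
 qed
 have d: "e2pi (v + of_real x + of_int d - (u + of_real x) + of_int n * tau) = e2pi (v - u + of_int n * tau)" for n
 proof -
  have "v + of_real x + of_int d - (u + of_real x) + of_int n * tau = (v - u + of_int n * tau) + of_int d" by simp
  thus ?thesis by (simp only: e2pi_add e2pi_of_int mult_1_right)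
 qed
 have "PhiF eps m s tau (u + of_real x) (v + of_real x + of_int d) t
   = e2pi (of_real m * t) * (\<Sum>\<^sub>\<infinity>n. e2pi (of_real (s * of_int d)) * (phi_coef eps m s n tau u v / (1 - e2pi (v - u + of_int n * tau))))"
  unfolding PhiF_alt c d by simp
 thus ?thesis unfolding PhiF_alt infsum_cmult_right' by simp
qed

lemma PhiF_shift_u_tau:
 assumes e: "sgn_unit eps"
 shows "PhiF eps m s tau (u + of_int l * tau) v t
  = eps powi l * e2pi (- of_real (2 * m * of_int l) * u - of_real (m * (of_int l)^2) * tau) * PhiF eps m s tau u v t"
proof -
 let ?c = "eps powi l * e2pi (- of_real (2 * m * of_int l) * u - of_real (m * (of_int l)^2) * tau)"
 have t: "phi_coef eps m s (n + l) tau (u + of_int l * tau) v / (1 - e2pi (v - (u + of_int l * tau) + of_int (n + l) * tau))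
   = ?c * (phi_coef eps m s n tau u v / (1 - e2pi (v - u + of_int n * tau)))" for n
 proof -
  have eq: "of_real (m * (of_int (n + l))^2 + of_int (n + l) * s) * tau - of_real (2 * m * of_int (n + l)) * (u + of_int l * tau)
    + of_real s * (v - (u + of_int l * tau))
   = (- of_real (2 * m * of_int l) * u - of_real (m * (of_int l)^2) * tau)
    + (of_real (m * (of_int n)^2 + of_int n * s) * tau - of_real (2 * m * of_int n) * u + of_real s * (v - u))"
   by (simp add: algebra_simps power2_eq_square)
  have d: "v - (u + of_int l * tau) + of_int (n + l) * tau = v - u + of_int n * tau" by (simp add: algebra_simps)
  show ?thesis unfolding phi_coef_def eq d sgn_unit_add[OF e] e2pi_add[of "- of_real (2 * m * of_int l) * u - of_real (m * (of_int l)^2) * tau"]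
   by (simp only: times_divide_eq_right mult_ac)
 qed
 have bij: "bij_betw (\<lambda>n. n + l) UNIV (UNIV :: int set)" by (rule bij_betwI[of _ _ _ "\<lambda>n. n - l"]) auto
 have "PhiF eps m s tau (u + of_int l * tau) v t = e2pi (of_real m * t) *
   (\<Sum>\<^sub>\<infinity>n. phi_coef eps m s (n + l) tau (u + of_int l * tau) v / (1 - e2pi (v - (u + of_int l * tau) + of_int (n + l) * tau)))"
  unfolding PhiF_alt by (subst infsum_reindex_bij_betw[OF bij, symmetric]) simp
 thus ?thesis unfolding t PhiF_alt infsum_cmult_right' by simp
qed

text \<open>The denominators 1 - W depend only on v - u and stay. Each numerator gains e2pi(-n tau)
  = e2pi(v - u) + e2pi(-n tau) (1 - W); the first summand reproduces \<open>PhiF\<close>, the second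
  cancels the denominator and sums to a theta series.\<close>

lemma PhiF_shift_tau:
 assumes e: "sgn_unit eps" and m: "m > 0" and y: "Im tau > 0" and th: "theta11 tau (v - u) \<noteq> 0"
 shows "PhiF eps m s tau (u + tau / (2 * of_real m)) (v + tau / (2 * of_real m)) t
  = e2pi (v - u) * PhiF eps m s tau u v t
   + e2pi (of_real m * t) * (e2pi (of_real s * v - u - of_real ((s - 1)^2 / (4 * m)) * tau) * Theta eps (s - 1) m tau (- 2 * u))"
proof -
 let ?h = "tau / (2 * of_real m)"
 let ?A = "e2pi (of_real s * v - u - of_real ((s - 1)^2 / (4 * m)) * tau)"
 have t: "Phi_term eps m s n tau (u + ?h) (v + ?h) t = e2pi (v - u) * Phi_term eps m s n tau u v t
   + e2pi (of_real m * t) * (?A * theta_term eps (s - 1) m n tau (- 2 * u))" for n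
 proof -
  let ?a = "of_real (m * (of_int n)^2 + of_int n * s) * tau - of_real (2 * m * of_int n) * u + of_real s * (v - u)"
  let ?W = "e2pi (v - u + of_int n * tau)"
  have W: "1 - ?W \<noteq> 0" by (rule denominator_nonzero[OF y th])
  have eq1: "of_real (m * (of_int n)^2 + of_int n * s) * tau - of_real (2 * m * of_int n) * (u + ?h) + of_real s * ((v + ?h) - (u + ?h))
    = ?a + - (of_int n * tau)" using m by (simp add: field_simps)
  have d: "v + ?h - (u + ?h) + of_int n * tau = v - u + of_int n * tau" by simp
  have "m * (of_int n + (s - 1) / (2 * m))^2 = m * (of_int n)^2 + of_int n * (s - 1) + (s - 1)^2 / (4 * m)"
   using m by (simp add: field_simps power2_eq_square)
  note q1 = this
  have q2: "m * (of_int n + (s - 1) / (2 * m)) = m * of_int n + (s - 1) / 2" using m by (simp add: field_simps)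
  have "(of_real s * v - u - of_real ((s - 1)^2 / (4 * m)) * tau) + (of_real (m * (of_int n + (s - 1) / (2 * m))^2) * tau
    + of_real (m * (of_int n + (s - 1) / (2 * m))) * (- 2 * u)) = ?a + - (of_int n * tau)"
   unfolding q1 q2 by (simp add: field_simps)
  hence th: "?A * theta_term eps (s - 1) m n tau (- 2 * u) = eps powi n * e2pi (?a + - (of_int n * tau))"
   unfolding theta_term_def mult.left_commute[of ?A] e2pi_add[symmetric] by (simp only:)
  have "e2pi (?a + - (of_int n * tau)) / (1 - ?W) = e2pi (v - u) * (e2pi ?a / (1 - ?W)) + e2pi (?a + - (of_int n * tau))"
  proof -
   have "e2pi (v - u) * e2pi ?a = e2pi (?a + - (of_int n * tau)) * ?W"
    unfolding e2pi_add[symmetric] by (rule e2pi_eqI) simp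
   thus ?thesis using W by (simp add: field_simps)
  qed
  hence "eps powi n * e2pi (?a + - (of_int n * tau)) / (1 - ?W)
    = e2pi (v - u) * (eps powi n * e2pi ?a / (1 - ?W)) + eps powi n * e2pi (?a + - (of_int n * tau))"
   by (simp add: ring_distribs flip: times_divide_eq_right)
  thus ?thesis unfolding Phi_term_def phi_coef_def eq1 d th by (simp add: ring_distribs)
 qed
 have "((\<lambda>n. Phi_term eps m s n tau (u + ?h) (v + ?h) t) has_sum e2pi (v - u) * PhiF eps m s tau u v t
   + e2pi (of_real m * t) * (?A * Theta eps (s - 1) m tau (- 2 * u))) UNIV"
  unfolding t PhiF_def fsum_Phi_term_eq[OF e m y th]
  by (intro has_sum_add has_sum_cmult_right Phi_term_has_sum theta_has_sum e m y th)
 thus ?thesis unfolding PhiF_def fsum_def by (intro infsumI)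
qed

lemma AddF_shift_real:
 assumes m: "m > 1/2" "2 * m \<in> \<int>" and x: "x = of_int k / (2 * m)"
 shows "AddF eps m s tau (u + of_real x) (v + of_real x + of_int d) t = e2pi (of_real (s * of_int d)) * AddF eps m s tau u v t"
proof -
 have m0: "m \<noteq> 0" using m by simp
 have "Rs eps j m tau (v + of_real x + of_int d) * Theta eps j m tau (- 2 * (u + of_real x))
   = e2pi (of_real (s * of_int d)) * (Rs eps j m tau v * Theta eps j m tau (- 2 * u))" if j: "j \<in> add_index m s" for j
 proof -
  obtain M :: int where M: "2 * m = of_int M" using m(2) by (auto elim: Ints_cases)
  have "of_real (of_int (M * d) / (2 * m)) = (of_int d :: complex)" using m0 M[symmetric] by simp
  hence r1: "Rs eps j m tau (v + of_real x + of_int d) = e2pi (of_real (j * of_int d)) * Rs eps j m tau (v + of_real x)"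
   using Rs_shift_real[OF m0, of eps j tau "v + of_real x" "M * d"] m0 M[symmetric] by simp
  have r2: "Rs eps j m tau (v + of_real x) = e2pi (of_real (j * of_int k / (2 * m))) * Rs eps j m tau v"
   unfolding x by (rule Rs_shift_real[OF m0])
  have r3: "Theta eps j m tau (- 2 * (u + of_real x)) = e2pi (- of_real (j * of_int k / (2 * m))) * Theta eps j m tau (- 2 * u)"
   using Theta_shift_int_over_m[OF m0, of eps j tau "- 2 * u" k] by (simp add: x algebra_simps)
  have "e2pi (of_real (j * of_int d)) = e2pi (of_real (s * of_int d)) * e2pi (of_real ((j - s) * of_int d))"
   unfolding e2pi_add[symmetric] by (simp add: algebra_simps)
  also have "e2pi (of_real ((j - s) * of_int d)) = 1"
   using j by (intro e2pi_of_real_Ints Ints_mult) (auto simp: add_index_def)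
  finally have r4: "e2pi (of_real (j * of_int d)) = e2pi (of_real (s * of_int d))" by simp
  show ?thesis unfolding r1 r2 r3 r4 by (simp add: e2pi_uminus)
 qed
 thus ?thesis unfolding AddF_def by (simp add: sum_distrib_left mult_ac)
qed

lemma AddF_shift_u_tau:
 assumes e: "sgn_unit eps" and m: "m > 0"
 shows "AddF eps m s tau (u + of_int l * tau) v t
  = eps powi l * e2pi (- of_real (2 * m * of_int l) * u - of_real (m * (of_int l)^2) * tau) * AddF eps m s tau u v t"
proof -
 have "Theta eps j m tau (- 2 * (u + of_int l * tau))
   = eps powi l * e2pi (- of_real (2 * m * of_int l) * u - of_real (m * (of_int l)^2) * tau) * Theta eps j m tau (- 2 * u)" for j
 proof -
  have "qpow tau (- m * (of_int l)^2) * e2pi (of_real (m * of_int l) * (- 2 * u))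
    = e2pi (- of_real (2 * m * of_int l) * u - of_real (m * (of_int l)^2) * tau)"
   unfolding qpow_e2pi e2pi_add[symmetric] by (rule e2pi_eqI) (simp add: algebra_simps)
  moreover have "- 2 * (u + of_int l * tau) = - 2 * u - 2 * of_int l * tau" by (simp add: algebra_simps)
  ultimately show ?thesis using Theta_shift_tau[OF e, of m j tau "- 2 * u" l] m by (simp add: mult.assoc)
 qed
 thus ?thesis unfolding AddF_def by (simp add: sum_distrib_left mult_ac)
qed

lemma sum_add_index_shift:
 assumes m: "m > 0" "2 * m \<in> \<int>"
 shows "(\<Sum>j\<in>add_index m s. f (j - 1)) = (\<Sum>j\<in>add_index m s. f j) + f (s - 1) - (f (s - 1 + 2 * m) :: complex)"
proof -
 define J where "J = add_index m s - {s - 1 + 2 * m}"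
 have top: "s - 1 + 2 * m \<in> add_index m s"
 proof -
  obtain M :: int where M: "2 * m = of_int M" using m(2) by (auto elim: Ints_cases)
  hence "M \<ge> 1" using m by simp
  hence "2 * m \<ge> 1" using M by simp
  moreover have "s - 1 + 2 * m - s \<in> \<int>" using m(2) Ints_diff[OF m(2) Ints_1] by (simp add: algebra_simps)
  ultimately show ?thesis by (simp add: add_index_def)
 qed
 have fin: "finite J" unfolding J_def using finite_add_index by blast
 have img: "(\<lambda>j. j - 1) ` add_index m s = insert (s - 1) J"
 proof (intro set_eqI iffI)
  fix i assume "i \<in> (\<lambda>j. j - 1) ` add_index m s"
  then obtain j where j: "j \<in> add_index m s" "i = j - 1" by auto
  obtain d :: int where d: "j - s = of_int d" using j by (auto simp: add_index_def elim: Ints_cases)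
  have d0: "0 \<le> d" using j d by (simp add: add_index_def)
  show "i \<in> insert (s - 1) J"
  proof (cases "d = 0")
   case True thus ?thesis using d j by simp
  next
   case False
   hence "d \<ge> 1" using d0 by simp
   hence "of_int d \<ge> (1::real)" by simp
   moreover have "i - s = of_int (d - 1)" using d j by simp
   hence "i - s \<in> \<int>" by (simp only: Ints_of_int)
   ultimately show ?thesis using j d by (auto simp: J_def add_index_def)
  qed
 next
  fix i assume i: "i \<in> insert (s - 1) J"
  show "i \<in> (\<lambda>j. j - 1) ` add_index m s"
  proof (cases "i = s - 1")
   case True
   moreover have "s \<in> add_index m s" using m by (simp add: add_index_def)
   ultimately show ?thesis by (intro image_eqI[of _ _ s]) auto
  next
   case False
   hence iJ: "i \<in> add_index m s" "i \<noteq> s - 1 + 2 * m" using i by (auto simp: J_def)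
   obtain d :: int where d: "i - s = of_int d" using iJ by (auto simp: add_index_def elim: Ints_cases)
   obtain M :: int where M: "2 * m = of_int M" using m(2) by (auto elim: Ints_cases)
   have i': "i = s + of_int d" using d by simp
   have "d < M" using iJ(1) M i' by (simp add: add_index_def)
   moreover have "d \<noteq> M - 1" using iJ(2) M i' by auto
   ultimately have "d + 1 < M" by simp
   hence "of_int d + 1 < (of_int M :: real)" by linarith
   moreover have "i + 1 - s = of_int (d + 1)" using d by simp
   hence "i + 1 - s \<in> \<int>" by (simp only: Ints_of_int)
   moreover have "s \<le> i" using iJ(1) by (simp add: add_index_def)
   ultimately have "i + 1 \<in> add_index m s" using M d by (simp add: add_index_def)
   thus ?thesis by (intro image_eqI[of _ _ "i + 1"]) auto
  qed
 qed
 have "(\<Sum>j\<in>add_index m s. f (j - 1)) = (\<Sum>i\<in>(\<lambda>j. j - 1) ` add_index m s. f i)"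
  by (subst sum.reindex) (auto simp: inj_on_def)
 also have "\<dots> = f (s - 1) + (\<Sum>i\<in>J. f i)"
 proof -
  have "s - 1 \<notin> J" by (auto simp: J_def add_index_def)
  thus ?thesis unfolding img using fin by simp
 qed
 also have "(\<Sum>i\<in>J. f i) = (\<Sum>j\<in>add_index m s. f j) - f (s - 1 + 2 * m)"
  unfolding J_def using top finite_add_index by (simp add: sum_diff1)
 finally show ?thesis by simp
qed

text \<open>Every product of index j turns into that of index j - 1, so the sum changes by its two
  boundary terms f(s - 1) and f(s - 1 + 2m). By \<open>Rs_index_shift\<close> their difference is
  twice the theta term in \<open>PhiF_shift_tau\<close>, which explains the coefficient 1/2 of the
  correction.\<close>

lemma AddF_shift_tau:
 assumes e: "sgn_unit eps" and m: "m > 1/2" "2 * m \<in> \<int>" and y: "Im tau > 0"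
 shows "AddF eps m s tau (u + tau / (2 * of_real m)) (v + tau / (2 * of_real m)) t
  = e2pi (v - u) * AddF eps m s tau u v t
   + 2 * e2pi (of_real m * t) * (e2pi (of_real s * v - u - of_real ((s - 1)^2 / (4 * m)) * tau) * Theta eps (s - 1) m tau (- 2 * u))"
proof -
 let ?h = "tau / (2 * of_real m)"
 let ?B = "e2pi (- of_real ((s - 1)^2 / (4 * m)) * tau + of_real (s - 1) * v)"
 define f where "f = (\<lambda>j. Rs eps j m tau v * Theta eps j m tau (- 2 * u))"
 have m0: "m > 0" using m by simp
 have mn: "m \<noteq> 0" using m by simp
 have st: "Rs eps j m tau (v + ?h) * Theta eps j m tau (- 2 * (u + ?h)) = e2pi (v - u) * f (j - 1)" for j
 proof -
  have a: "- 2 * (u + ?h) = - 2 * u - tau / of_real m" using mn by (simp add: field_simps)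
  have "qpow tau (1 / (4 * m)) * e2pi v * (qpow tau (- 1 / (4 * m)) * e2pi (- 2 * u / 2)) = e2pi (v - u)"
   unfolding qpow_e2pi e2pi_add[symmetric] by (rule e2pi_eqI) simp
  note pr = this
  have "Rs eps j m tau (v + ?h) * Theta eps j m tau (- 2 * (u + ?h)) =
    (qpow tau (1 / (4 * m)) * e2pi v * (qpow tau (- 1 / (4 * m)) * e2pi (- 2 * u / 2))) * f (j - 1)"
   unfolding a Rs_shift_tau[OF m0 y] Theta_shift_tau_over_m[OF mn] f_def by (simp only: mult_ac)
  thus ?thesis unfolding pr .
 qed
 have ft: "f (s - 1 + 2 * m) = f (s - 1) - 2 * ?B * Theta eps (s - 1) m tau (- 2 * u)"
 proof -
  have "f (s - 1 + 2 * m) = (eps * eps) * ((Rs eps (s - 1) m tau v - 2 * ?B) * Theta eps (s - 1) m tau (- 2 * u))"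
   unfolding f_def Rs_index_shift[OF e m(1) y] Theta_index_shift[OF e mn] by (simp only: mult_ac)
  thus ?thesis using sgn_unitD(3)[OF e] by (simp add: f_def ring_distribs)
 qed
 have "AddF eps m s tau (u + ?h) (v + ?h) t = e2pi (of_real m * t) * (e2pi (v - u) * (\<Sum>j\<in>add_index m s. f (j - 1)))"
  unfolding AddF_def st by (simp add: sum_distrib_left)
 also have "(\<Sum>j\<in>add_index m s. f (j - 1)) = (\<Sum>j\<in>add_index m s. f j) + 2 * ?B * Theta eps (s - 1) m tau (- 2 * u)"
  unfolding sum_add_index_shift[OF m0 m(2)] ft by simp
 also have "e2pi (v - u) * ((\<Sum>j\<in>add_index m s. f j) + 2 * ?B * Theta eps (s - 1) m tau (- 2 * u))
   = e2pi (v - u) * (\<Sum>j\<in>add_index m s. f j) + 2 * ((e2pi (v - u) * ?B) * Theta eps (s - 1) m tau (- 2 * u))"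
  by (simp add: ring_distribs mult_ac)
 also have "e2pi (v - u) * ?B = e2pi (of_real s * v - u - of_real ((s - 1)^2 / (4 * m)) * tau)"
  unfolding e2pi_add[symmetric] by (rule e2pi_eqI) (simp add: algebra_simps)
 finally show ?thesis unfolding AddF_def f_def by (simp add: ring_distribs mult_ac)
qed

text \<open>The form of \<open>phi_tilde\<close> in terms of integer-indexed series; they agree for
  Im tau > 0 under the hypotheses of \<open>phi_tilde_eq\<close>.\<close>

definition phiF :: "complex \<Rightarrow> real \<Rightarrow> real \<Rightarrow> fun4" where
 "phiF eps m s tau u v t = PhiF eps m s tau u v t - 1/2 * AddF eps m s tau u v t"

lemma phiF_shift_real:
 assumes m: "m > 1/2" "2 * m \<in> \<int>" and x: "x = of_int k / (2 * m)"
 shows "phiF eps m s tau (u + of_real x) (v + of_real x + of_int d) t = e2pi (of_real (s * of_int d)) * phiF eps m s tau u v t"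
proof -
 have xi: "2 * m * x \<in> \<int>" unfolding x using m(1) by simp
 show ?thesis unfolding phiF_def PhiF_shift_real[OF xi] AddF_shift_real[OF m x]
  by (simp only: right_diff_distrib mult_ac)
qed

lemma phiF_shift_u_tau:
 assumes e: "sgn_unit eps" and m: "m > 0"
 shows "phiF eps m s tau (u + of_int l * tau) v t
  = eps powi l * e2pi (- of_real (2 * m * of_int l) * u - of_real (m * (of_int l)^2) * tau) * phiF eps m s tau u v t"
 unfolding phiF_def PhiF_shift_u_tau[OF e] AddF_shift_u_tau[OF e m]
  right_diff_distrib[of "_ * e2pi _"] by (simp only: mult_ac)

lemma phiF_shift_tau:
 assumes e: "sgn_unit eps" and m: "m > 1/2" "2 * m \<in> \<int>" and y: "Im tau > 0" and th: "theta11 tau (v - u) \<noteq> 0"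
 shows "phiF eps m s tau (u + tau / (2 * of_real m)) (v + tau / (2 * of_real m)) t = e2pi (v - u) * phiF eps m s tau u v t"
proof -
 have m0: "m > 0" using m by simp
 show ?thesis unfolding phiF_def PhiF_shift_tau[OF e m0 y th] AddF_shift_tau[OF e m y]
  by (simp add: right_diff_distrib distrib_left)
qed

lemma phiF_shift_tau_int:
 assumes e: "sgn_unit eps" and m: "m > 1/2" "2 * m \<in> \<int>" and y: "Im tau > 0" and th: "theta11 tau (v - u) \<noteq> 0"
 shows "phiF eps m s tau (u + of_int k * (tau / (2 * of_real m))) (v + of_int k * (tau / (2 * of_real m))) t
  = e2pi (of_int k * (v - u)) * phiF eps m s tau u v t"
proof -
 let ?h = "tau / (2 * of_real m)"
 have nat: "phiF eps m s tau (u + of_nat n * ?h) (v + of_nat n * ?h) t = e2pi (of_nat n * (v - u)) * phiF eps m s tau u v t"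
  if th: "theta11 tau (v - u) \<noteq> 0" for n u v
 proof (induction n)
  case 0 show ?case by (simp add: e2pi_def)
 next
  case (Suc n)
  have d: "v + of_nat n * ?h - (u + of_nat n * ?h) = v - u" by simp
  have s: "x + of_nat (Suc n) * ?h = x + of_nat n * ?h + ?h" for x by (simp only: of_nat_Suc distrib_right mult_1_left add_ac)
  have e': "e2pi (of_nat (Suc n) * (v - u)) = e2pi (v - u) * e2pi (of_nat n * (v - u))"
   unfolding e2pi_add[symmetric] by (rule e2pi_eqI) (simp add: algebra_simps)
  have th': "theta11 tau (v + of_nat n * ?h - (u + of_nat n * ?h)) \<noteq> 0" unfolding d by (rule th)
  show ?case unfolding s phiF_shift_tau[OF e m y th'] Suc.IH e' d by (simp only: mult_ac)
 qed
 show ?thesis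
 proof (cases "k \<ge> 0")
  case True
  thus ?thesis using nat[OF th, of "nat k"] by simp
 next
  case False
  define n where "n = nat (- k)"
  \<comment> \<open>Negative steps are obtained by applying the law for n steps at the shifted point
    and dividing; v - u, and with it the condition on theta11, is the same there.\<close>
  have k: "(of_int k :: complex) = - of_nat n" using False by (simp add: n_def)
  have d: "v + - of_nat n * ?h - (u + - of_nat n * ?h) = v - u" by simp
  have th': "theta11 tau (v + - of_nat n * ?h - (u + - of_nat n * ?h)) \<noteq> 0" unfolding d by (rule th)
  have c: "x + - of_nat n * ?h + of_nat n * ?h = x" for x by simp
  have "phiF eps m s tau u v t = e2pi (of_nat n * (v - u)) * phiF eps m s tau (u + - of_nat n * ?h) (v + - of_nat n * ?h) t"
   using nat[OF th', of n] unfolding c d .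
  moreover have "e2pi (- of_nat n * (v - u)) * e2pi (of_nat n * (v - u)) = 1"
   unfolding e2pi_add[symmetric] by (simp add: e2pi_def)
  ultimately show ?thesis unfolding k by (simp only: mult.assoc[symmetric] mult_1_left)
 qed
qed

text \<open>The shift of u and v by k tau consists of 2 m k joint steps of tau/(2m); what remains is
  a shift of u alone by (j - k) tau.\<close>

lemma phiF_shift_tau_tau:
 assumes e: "sgn_unit eps" and m: "m > 1/2" "2 * m \<in> \<int>" and y: "Im tau > 0" and th: "theta11 tau (v - u) \<noteq> 0"
 shows "phiF eps m s tau (u + of_int j * tau) (v + of_int k * tau) t
  = eps powi (j - k) * e2pi (2 * of_real m * (of_int k * v - of_int j * u)) * qpow tau (m * of_int (k^2 - j\<^sup>2)) * phiF eps m s tau u v t"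
proof -
 have m0: "m > 0" using m by simp
 obtain M :: int where M: "2 * m = of_int M" using m(2) by (auto elim: Ints_cases)
 have Mc: "(of_int M :: complex) = 2 * of_real m" using arg_cong[OF M, of complex_of_real] by simp
 have h: "of_int (M * k) * (tau / (2 * of_real m)) = of_int k * tau" using m0 by (simp add: Mc)
 have s1: "phiF eps m s tau (u + of_int k * tau) (v + of_int k * tau) t = e2pi (of_int (M * k) * (v - u)) * phiF eps m s tau u v t"
  using phiF_shift_tau_int[OF e m y th, of s "M * k" t] unfolding h .
 have u: "u + of_int j * tau = u + of_int k * tau + of_int (j - k) * tau" by (simp add: algebra_simps)
 have "e2pi (- of_real (2 * m * of_int (j - k)) * (u + of_int k * tau) - of_real (m * (of_int (j - k))^2) * tau) * e2pi (of_int (M * k) * (v - u))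
   = e2pi (2 * of_real m * (of_int k * v - of_int j * u)) * qpow tau (m * of_int (k^2 - j\<^sup>2))"
  unfolding qpow_e2pi e2pi_add[symmetric] by (rule e2pi_eqI) (simp add: Mc algebra_simps power2_eq_square)
 note q = this
 show ?thesis unfolding u phiF_shift_u_tau[OF e m0, of s tau "u + of_int k * tau"] s1
  using arg_cong[OF q, of "\<lambda>x. eps powi (j - k) * x * phiF eps m s tau u v t"] by (simp only: mult_ac)
qed

lemma regular_shift:
 assumes "(tau, u, v, t) \<in> regular"
 shows "(tau, u + of_int j, v + of_int k, t) \<in> regular" (is ?c1)
  and "(tau, u + of_int j * tau, v + of_int k * tau, t) \<in> regular" (is ?c2)
proof -
 have a: "v + of_int k - (u + of_int j) = v - u + of_int (k - j)" "v + of_int k + (u + of_int j) = v + u + of_int (k + j)"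
  "v + of_int k * tau - (u + of_int j * tau) = v - u + of_int (k - j) * tau"
  "v + of_int k * tau + (u + of_int j * tau) = v + u + of_int (k + j) * tau" by (simp_all add: algebra_simps)
 show ?c1
  using assms unfolding regular_def X_def mem_Collect_eq prod.case a theta11_shift_1 by simp
 show ?c2
  using assms unfolding regular_def X_def mem_Collect_eq prod.case a theta11_shift_tau by (simp add: e2pi_def)
qed

lemma F3_cong:
 assumes "\<And>tau u v t. (tau, u, v, t) \<in> regular \<Longrightarrow> F tau u v t = G tau u v t" "F3 m s s' F"
 shows "F3 m s s' G" unfolding F3_def
proof (intro allI impI)
 fix tau u v t and j k :: int assume p: "(tau, u, v, t) \<in> regular"
 show "G tau (u + of_int j) (v + of_int k) t = e2pi (of_real (s * of_int (j + k))) * G tau u v t \<and>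
    G tau (u + of_int j * tau) (v + of_int k * tau) t
     = e2pi (of_real (s' * of_int (j + k)) + 2 * of_real m * (of_int k * v - of_int j * u))
      * qpow tau (m * of_int (k^2 - j\<^sup>2)) * G tau u v t" using assms(2)[unfolded F3_def, rule_format, OF p, of j k]
  unfolding assms(1)[OF p] assms(1)[OF regular_shift(1)[OF p]] assms(1)[OF regular_shift(2)[OF p]] .
qed

lemma F4_cong:
 assumes "\<And>tau u v t. (tau, u, v, t) \<in> regular \<Longrightarrow> F tau u v t = G tau u v t" "F4 m F"
 shows "F4 m G" using assms(2) unfolding F4_def Let_def by (simp add: assms(1))

lemma phiF_F3:
 assumes m: "m > 1/2" "2 * m \<in> \<int>" and s: "s \<in> half_ints" and s': "s' \<in> half_ints"
  and e: "sgn_unit eps" "eps = e2pi (of_real s')"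
 shows "F3 m s s' (phiF eps m s)" unfolding F3_def
proof (intro allI impI conjI)
 have two: "e2pi (of_real (r * of_int (2 * k))) = 1" if "r \<in> half_ints" for r and k :: int
 proof (rule e2pi_of_real_Ints)
  have "r * of_int (2 * k) = (2 * r) * of_int k" by simp
  thus "r * of_int (2 * k) \<in> \<int>" using that unfolding half_ints_def by (auto intro!: Ints_mult simp only: mem_Collect_eq Ints_of_int)
 qed
 \<comment> \<open>The exponents differ by 2 r j, an integer because r is a half-integer; this turns
   the k - j of the computed laws into the j + k of (F3).\<close>
 have par: "e2pi (of_real (r * of_int (k - j))) = e2pi (of_real (r * of_int (j + k)))" if "r \<in> half_ints" for r and j k :: int
 proof -
  have "e2pi (of_real (r * of_int (k - j))) = e2pi (of_real (r * of_int (k - j))) * e2pi (of_real (r * of_int (2 * j)))"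
   unfolding two[OF that] by simp
  also have "\<dots> = e2pi (of_real (r * of_int (j + k)))"
   unfolding e2pi_add[symmetric] by (rule e2pi_eqI) (simp add: algebra_simps)
  finally show ?thesis .
 qed
 fix tau u v t and j k :: int assume p: "(tau, u, v, t) \<in> regular"
 obtain M :: int where M: "2 * m = of_int M" using m(2) by (auto elim: Ints_cases)
 have x: "of_int j = of_int (M * j) / (2 * m)" using m(1) by (simp add: M[symmetric])
 have v: "v + of_int k = v + of_real (of_int j) + of_int (k - j)" by simp
 show "phiF eps m s tau (u + of_int j) (v + of_int k) t = e2pi (of_real (s * of_int (j + k))) * phiF eps m s tau u v t"
  using phiF_shift_real[OF m x, of eps s tau u v "k - j" t] unfolding v par[OF s] by simp
 have pw: "e2pi (of_real s') powi l = e2pi (of_real (s' * of_int l))" for l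
  unfolding e2pi_def by (simp add: exp_power_int mult_ac)
 have "eps powi (j - k) = e2pi (of_real (s' * of_int (j + k)))"
  unfolding e(2) pw using par[OF s', of j k] par[OF s', of k j] by (simp add: add.commute)
 thus "phiF eps m s tau (u + of_int j * tau) (v + of_int k * tau) t
     = e2pi (of_real (s' * of_int (j + k)) + 2 * of_real m * (of_int k * v - of_int j * u))
      * qpow tau (m * of_int (k^2 - j\<^sup>2)) * phiF eps m s tau u v t"
  unfolding phiF_shift_tau_tau[OF e(1) m regularD(1,2)[OF p]] e2pi_add by simp
qed

lemma phiF_F4:
 assumes m: "m > 1/2" "2 * m \<in> \<int>" and e: "sgn_unit eps"
 shows "F4 m (phiF eps m s)" unfolding F4_def Let_def
proof (intro allI impI conjI)
 fix tau u v t and k :: int assume p: "(tau, u, v, t) \<in> regular"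
 show "phiF eps m s tau (u + of_real (of_int k / (2 * m))) (v + of_real (of_int k / (2 * m))) t = phiF eps m s tau u v t"
  using phiF_shift_real[OF m refl, of eps s tau u k v 0 t] by (simp add: e2pi_def)
 have h: "of_real (of_int k / (2 * m)) * tau = of_int k * (tau / (2 * of_real m))" by simp
 show "phiF eps m s tau (u + of_real (of_int k / (2 * m)) * tau) (v + of_real (of_int k / (2 * m)) * tau) t
  = e2pi (of_int k * (v - u)) * phiF eps m s tau u v t"
  unfolding h by (rule phiF_shift_tau_int[OF e m regularD(1,2)[OF p]])
qed

section \<open>The differential equations\<close>

lemma has_wirt_eq: "has_wirt f z p p' \<Longrightarrow> p = q \<Longrightarrow> p' = q' \<Longrightarrow> has_wirt f z q q'" by simp

lemma has_wirt_cmult: "has_wirt f z p p' \<Longrightarrow> has_wirt (\<lambda>w. c * f w) z (c * p) (c * p')"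
 using has_wirt_mult[OF has_wirt_const] by simp

lemma wirt_eq_deriv: "f field_differentiable (at z) \<Longrightarrow> wirt f z = deriv f z"
 by (rule has_wirt_imp_wirt[OF has_wirt_field]) (simp add: DERIV_deriv_iff_field_differentiable)

text \<open>The operator D on functions whose dependence on t is e2pi(m t): the derivative in t
  becomes the factor 2 pi i m. Like \<open>LDbar\<close> and \<open>LDelta\<close> it is built from
  \<open>first_order\<close> operators only and so passes through normally convergent
  series.\<close>

definition LD :: "real \<Rightarrow> fun4 \<Rightarrow> fun4" where
 "LD m F tau u v t = 8 * of_real pi * \<i> * of_real m * d_tau F tau u v t + d_v (d_v F) tau u v t - d_uw (d_uw F) tau u v t"

definition LDbar :: "real \<Rightarrow> fun4 \<Rightarrow> fun4" where
 "LDbar m F tau u v t = 8 * of_real pi * \<i> * of_real m * (d_taubar F tau u v t + acoord tau v * d_vbar F tau u v t)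
   + d_vbar (d_vbar F) tau u v t"

definition LDelta :: "real \<Rightarrow> fun4 \<Rightarrow> fun4" where
 "LDelta m F tau u v t = 4 * of_real pi * \<i> * of_real m * acoord tau v * d_vbar F tau u v t - d_v (d_vbar F) tau u v t"

definition solves :: "real \<Rightarrow> fun4 \<Rightarrow> point4 set \<Rightarrow> bool" where
 "solves m F U \<longleftrightarrow> (\<forall>tau u v t. (tau, u, v, t) \<in> U \<longrightarrow> LD m F tau u v t = 0 \<and> LDbar m F tau u v t = 0 \<and> LDelta m F tau u v t = 0)"

lemma first_order_cong2:
 assumes L: "first_order L" "first_order L'" and F: "ra4 F U" and eq: "\<And>tau u v t. (tau, u, v, t) \<in> U \<Longrightarrow> F tau u v t = G tau u v t"
  and p: "(tau, u, v, t) \<in> U"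
 shows "L (L' F) tau u v t = L (L' G) tau u v t"
 by (rule first_order_cong[OF L(1) first_order_ra4[OF L(2) F] _ p]) (rule first_order_cong[OF L(2) F eq])

lemma solves_cong:
 assumes F: "ra4 F U" and eq: "\<And>tau u v t. (tau, u, v, t) \<in> U \<Longrightarrow> F tau u v t = G tau u v t" and s: "solves m F U"
 shows "solves m G U" unfolding solves_def
proof (intro allI impI)
 fix tau u v t assume p: "(tau, u, v, t) \<in> U"
 have c: "L F tau u v t = L G tau u v t" if "first_order L" for L by (rule first_order_cong[OF that F _ p]) (rule eq)
 have c2: "L (L' F) tau u v t = L (L' G) tau u v t" if "first_order L" "first_order L'" for L L'
  by (rule first_order_cong2[OF that F _ p]) (rule eq)
 show "LD m G tau u v t = 0 \<and> LDbar m G tau u v t = 0 \<and> LDelta m G tau u v t = 0" using s p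
  unfolding solves_def LD_def LDbar_def LDelta_def c[OF first_order_d_tau, symmetric] c[OF first_order_d_taubar, symmetric]
   c[OF first_order_d_vbar, symmetric] c2[OF first_order_d_v first_order_d_v, symmetric] c2[OF first_order_d_uw first_order_d_uw, symmetric]
   c2[OF first_order_d_vbar first_order_d_vbar, symmetric] c2[OF first_order_d_v first_order_d_vbar, symmetric]
  by simp
qed

lemma solves_fsum:
 assumes f: "nra I f U" and s: "\<And>i. i \<in> I \<Longrightarrow> solves m (f i) U"
 shows "solves m (fsum I f) U" unfolding solves_def
proof (intro allI impI)
 fix tau u v t assume p: "(tau, u, v, t) \<in> U"
 have h1: "((\<lambda>i. L (f i) tau u v t) has_sum L (fsum I f) tau u v t) I" if "first_order L" for L
  unfolding first_order_nra(2)[OF that f p] by (rule nra_has_sum[OF first_order_nra(1)[OF that f] p])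
 have h2: "((\<lambda>i. L (L' (f i)) tau u v t) has_sum L (L' (fsum I f)) tau u v t) I" if "first_order L" "first_order L'" for L L'
  unfolding first_order_nra2[OF that f p]
  by (rule nra_has_sum[OF first_order_nra(1)[OF that(1) first_order_nra(1)[OF that(2) f]] p])
 have sub: "((\<lambda>i. g i - h i) has_sum (a - b)) I" if "(g has_sum a) I" "(h has_sum b) I" for g h :: "'a \<Rightarrow> complex" and a b
  using has_sum_add[OF that(1) has_sum_uminusI[OF that(2)]] by simp
 have z: "x = 0" if "(g has_sum x) I" "\<And>i. i \<in> I \<Longrightarrow> g i = 0" for g :: "'a \<Rightarrow> complex" and x
  using infsumI[OF that(1)] infsum_0[of I g] that(2) by simp
 have "((\<lambda>i. LD m (f i) tau u v t) has_sum LD m (fsum I f) tau u v t) I" unfolding LD_def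
  by (rule sub[OF has_sum_add[OF has_sum_cmult_right[OF h1[OF first_order_d_tau]] h2[OF first_order_d_v first_order_d_v]]
   h2[OF first_order_d_uw first_order_d_uw]])
 hence 1: "LD m (fsum I f) tau u v t = 0" by (rule z) (use s p in \<open>simp add: solves_def\<close>)
 have "((\<lambda>i. LDbar m (f i) tau u v t) has_sum LDbar m (fsum I f) tau u v t) I" unfolding LDbar_def
  by (rule has_sum_add[OF has_sum_cmult_right[OF has_sum_add[OF h1[OF first_order_d_taubar]
   has_sum_cmult_right[OF h1[OF first_order_d_vbar]]]] h2[OF first_order_d_vbar first_order_d_vbar]])
 hence 2: "LDbar m (fsum I f) tau u v t = 0" by (rule z) (use s p in \<open>simp add: solves_def\<close>)
 have "((\<lambda>i. LDelta m (f i) tau u v t) has_sum LDelta m (fsum I f) tau u v t) I" unfolding LDelta_def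
  by (rule sub[OF has_sum_cmult_right[OF h1[OF first_order_d_vbar]] h2[OF first_order_d_v first_order_d_vbar]])
 hence "LDelta m (fsum I f) tau u v t = 0" by (rule z) (use s p in \<open>simp add: solves_def\<close>)
 with 1 2 show "LD m (fsum I f) tau u v t = 0 \<and> LDbar m (fsum I f) tau u v t = 0 \<and> LDelta m (fsum I f) tau u v t = 0"
  by simp
qed

lemma first_order_lincomb:
 assumes L: "first_order L" and F: "ra4 F U" and G: "ra4 G U" and p: "(tau, u, v, t) \<in> U"
 shows "L (\<lambda>tau u v t. F tau u v t + c * G tau u v t) tau u v t = L F tau u v t + c * L G tau u v t"
proof -
 let ?p = "(tau, u, v, t)" and ?H = "\<lambda>tau u v t. F tau u v t + c * G tau u v t"
 have dF: "(uc F has_derivative frechet_derivative (uc F) (at ?p)) (at ?p)"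
  using ra4_differentiable[OF F p] by (simp flip: frechet_derivative_works)
 have dG: "(uc G has_derivative frechet_derivative (uc G) (at ?p)) (at ?p)"
  using ra4_differentiable[OF G p] by (simp flip: frechet_derivative_works)
 have e: "uc ?H = (\<lambda>p. uc F p + c * uc G p)" by (simp add: fun_eq_iff uc_def)
 have dH: "(uc ?H has_derivative (\<lambda>h. frechet_derivative (uc F) (at ?p) h + c * frechet_derivative (uc G) (at ?p) h)) (at ?p)"
  unfolding e by (intro has_derivative_add has_derivative_mult_right dF dG)
 have fH: "frechet_derivative (uc ?H) (at ?p) = (\<lambda>h. frechet_derivative (uc F) (at ?p) h + c * frechet_derivative (uc G) (at ?p) h)"
  by (rule frechet_derivative_at[OF dH, symmetric])
 have "uc ?H differentiable (at ?p)" using dH by (auto simp: differentiable_def)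
 obtain b1 b2 sg where
  L': "\<And>F. uc F differentiable (at ?p) \<Longrightarrow>
   L F tau u v t = (frechet_derivative (uc F) (at ?p) b1 + sg * frechet_derivative (uc F) (at ?p) b2) / 2"
  using L unfolding first_order_def by blast
 show ?thesis
  unfolding L'[OF \<open>uc ?H differentiable (at ?p)\<close>] L'[OF ra4_differentiable[OF F p]] L'[OF ra4_differentiable[OF G p]] fH
  by (simp add: field_simps)
qed

lemma first_order_lincomb2:
 assumes L: "first_order L" "first_order L'" and F: "ra4 F U" and G: "ra4 G U" and p: "(tau, u, v, t) \<in> U"
 shows "L (L' (\<lambda>tau u v t. F tau u v t + c * G tau u v t)) tau u v t = L (L' F) tau u v t + c * L (L' G) tau u v t"
proof -
 have "L (L' (\<lambda>tau u v t. F tau u v t + c * G tau u v t)) tau u v t = L (\<lambda>tau u v t. L' F tau u v t + c * L' G tau u v t) tau u v t"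
  by (rule first_order_cong[OF L(1) first_order_ra4[OF L(2)] _ p])
    (intro ra4_add ra4_cmult F G, rule first_order_lincomb[OF L(2) F G])
 also have "\<dots> = L (L' F) tau u v t + c * L (L' G) tau u v t"
  by (rule first_order_lincomb[OF L(1) first_order_ra4[OF L(2) F] first_order_ra4[OF L(2) G] p])
 finally show ?thesis .
qed

lemma solves_lincomb:
 assumes F: "ra4 F U" and G: "ra4 G U" and s: "solves m F U" "solves m G U"
 shows "solves m (\<lambda>tau u v t. F tau u v t + c * G tau u v t) U" unfolding solves_def
proof (intro allI impI)
 fix tau u v t assume p: "(tau, u, v, t) \<in> U"
 let ?H = "\<lambda>tau u v t. F tau u v t + c * G tau u v t"
 note c = first_order_lincomb[OF _ F G p] and c2 = first_order_lincomb2[OF _ _ F G p]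
 have "LD m ?H tau u v t = LD m F tau u v t + c * LD m G tau u v t"
  unfolding LD_def c[OF first_order_d_tau] c2[OF first_order_d_v first_order_d_v] c2[OF first_order_d_uw first_order_d_uw]
  by (simp add: algebra_simps)
 moreover have "LDbar m ?H tau u v t = LDbar m F tau u v t + c * LDbar m G tau u v t"
  unfolding LDbar_def c[OF first_order_d_taubar] c[OF first_order_d_vbar] c2[OF first_order_d_vbar first_order_d_vbar]
  by (simp add: algebra_simps)
 moreover have "LDelta m ?H tau u v t = LDelta m F tau u v t + c * LDelta m G tau u v t"
  unfolding LDelta_def c[OF first_order_d_vbar] c2[OF first_order_d_v first_order_d_vbar] by (simp add: algebra_simps)
 ultimately show "LD m ?H tau u v t = 0 \<and> LDbar m ?H tau u v t = 0 \<and> LDelta m ?H tau u v t = 0"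
  using s p by (simp add: solves_def)
qed

lemma regular_t_iff: "(tau, u, v, t) \<in> regular \<longleftrightarrow> (tau, u, v, 0) \<in> regular" by (simp add: regular_def X_def)

lemma open_slice:
 assumes "open (U :: point4 set)"
 shows "open {w. (w, u, v, t) \<in> U}" "open {w. (tau, w, v, t) \<in> U}" "open {w. (tau, u, w, t) \<in> U}"
proof -
 have "open ((\<lambda>w. (w, u, v, t)) -` U)" "open ((\<lambda>w. (tau, w, v, t)) -` U)" "open ((\<lambda>w. (tau, u, w, t)) -` U)"
  by (intro open_vimage assms continuous_intros)+
 thus "open {w. (w, u, v, t) \<in> U}" "open {w. (tau, w, v, t) \<in> U}" "open {w. (tau, u, w, t) \<in> U}"
  by (simp_all add: vimage_def)
qed

lemma d_t_e2pi:
 assumes "\<And>t. G tau u v t = e2pi (of_real m * t) * G tau u v 0"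
 shows "d_t G tau u v t = 2 * of_real pi * \<i> * of_real m * G tau u v t"
proof -
 define K where "K = G tau u v 0"
 have G: "G tau u v t = e2pi (of_real m * t) * K" for t unfolding K_def by (rule assms)
 show ?thesis unfolding d_t_def G e2pi_def by (rule DERIV_imp_deriv) (auto intro!: derivative_eq_intros)
qed

lemma F1_derivs:
 assumes F: "F1 m F" "ra4 F regular" and p: "(tau, u, v, t) \<in> regular"
 shows "d_tau F tau u v t = e2pi (of_real m * t) * d_tau F tau u v 0" (is ?c1)
  and "d_taubar F tau u v t = e2pi (of_real m * t) * d_taubar F tau u v 0" (is ?c2)
  and "d_vbar F tau u v t = e2pi (of_real m * t) * d_vbar F tau u v 0" (is ?c3)
proof -
 have p0: "(tau, u, v, 0) \<in> regular" using p regular_t_iff[of tau u v t] by simp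
 note d = slice_differentiable[OF ra4_differentiable[OF F(2) p0]]
 have eq: "F tau u v t = e2pi (of_real m * t) * F tau u v 0" if "(tau, u, v, t) \<in> regular" for tau u v
  using F(1) that unfolding F1_def by simp
 have "has_wirt (\<lambda>w. F w u v t) tau (e2pi (of_real m * t) * d_tau F tau u v 0) (e2pi (of_real m * t) * d_taubar F tau u v 0)"
  unfolding d_tau_def d_taubar_def
  by (rule has_wirt_cong[OF has_wirt_cmult[OF has_wirtI[OF d(1)]] open_slice(1)[OF open_regular, of u v t]])
    (use p eq in auto)
 thus ?c1
  "d_taubar F tau u v t = e2pi (of_real m * t) * d_taubar F tau u v 0"
  unfolding d_tau_def[of F tau u v t] d_taubar_def[of F tau u v t]
  by (rule has_wirt_imp_wirt, rule has_wirt_imp_wirt_bar)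
 have "has_wirt (\<lambda>w. F tau u w t) v (e2pi (of_real m * t) * d_v F tau u v 0) (e2pi (of_real m * t) * d_vbar F tau u v 0)"
  unfolding d_v_def d_vbar_def
  by (rule has_wirt_cong[OF has_wirt_cmult[OF has_wirtI[OF d(3)]] open_slice(3)[OF open_regular, of tau u t]])
    (use p eq in auto)
 thus ?c3
  unfolding d_vbar_def[of F tau u v t] by (rule has_wirt_imp_wirt_bar)
qed

lemma d_u_d_u_eq:
 assumes h: "\<And>tau u v t. (tau, u, v, t) \<in> U \<Longrightarrow> (\<lambda>w. F tau w v t) field_differentiable (at u)"
  and U: "open U" and p: "(tau, u, v, t) \<in> U"
 shows "d_u (d_u F) tau u v t = d_uw (d_uw F) tau u v t"
proof -
 let ?W = "{w. (tau, w, v, t) \<in> U}"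
 have W: "open ?W" by (rule open_slice(2)[OF U])
 have "(\<lambda>w. F tau w v t) holomorphic_on ?W" using h by (auto simp: holomorphic_on_open[OF W] field_differentiable_def)
 hence "deriv (\<lambda>w. F tau w v t) holomorphic_on ?W" by (rule holomorphic_deriv[OF _ W])
 hence d: "(deriv (\<lambda>w. F tau w v t) has_field_derivative d_u (d_u F) tau u v t) (at u)"
  unfolding d_u_def[abs_def] using p holomorphic_derivI[OF _ W, of "deriv (\<lambda>w. F tau w v t)" u] by simp
 have "has_wirt (\<lambda>w. d_uw F tau w v t) u (d_u (d_u F) tau u v t) 0"
  by (rule has_wirt_cong[OF has_wirt_field[OF d] W]) (use p h in \<open>simp_all add: d_uw_def wirt_eq_deriv\<close>)
 thus ?thesis unfolding d_uw_def[of "d_uw F"] by (rule has_wirt_imp_wirt[symmetric])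
qed

lemma op_eq_L:
 assumes F: "F1 m F" "ra4 F regular"
  and h: "\<And>tau u v t. (tau, u, v, t) \<in> regular \<Longrightarrow> (\<lambda>w. F tau w v t) field_differentiable (at u)"
  and p: "(tau, u, v, t) \<in> regular"
 shows "opD F tau u v t = LD m F tau u v t" "opDbar F tau u v t = LDbar m F tau u v t" "opDelta F tau u v t = LDelta m F tau u v t"
proof -
 have pt: "(tau, u, v, t') \<in> regular" for t' using p regular_t_iff[of tau u v t] regular_t_iff[of tau u v t'] by simp
 have D: "Dtaubar F tau u v t' = e2pi (of_real m * t') * Dtaubar F tau u v 0" for t'
  unfolding Dtaubar_def F1_derivs(2,3)[OF F pt[of t']] distrib_left by (simp only: mult_ac)
 note t = d_t_e2pi[of "d_tau F" tau u v m, OF F1_derivs(1)[OF F pt]]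
  and tb = d_t_e2pi[of "d_vbar F" tau u v m, OF F1_derivs(3)[OF F pt]]
  and tD = d_t_e2pi[of "Dtaubar F" tau u v m, OF D, unfolded Dtaubar_def[of F tau u v]]
 have uu: "d_u (d_u F) tau u v t = d_uw (d_uw F) tau u v t" by (rule d_u_d_u_eq[OF _ open_regular p]) (rule h)
 show "opD F tau u v t = LD m F tau u v t" "opDbar F tau u v t = LDbar m F tau u v t" "opDelta F tau u v t = LDelta m F tau u v t"
  unfolding opD_def opDbar_def opDelta_def LD_def LDbar_def LDelta_def t tb tD uu by simp_all
qed

text \<open>Only this step needs (F1), for the derivative in t, and holomorphy in u, for
  \<open>d_u\<close>; from here on (F5) is treated through \<open>solves\<close>.\<close>

lemma F5_iff_solves:
 assumes F: "F1 m F" "ra4 F regular"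
  and h: "\<And>tau u v t. (tau, u, v, t) \<in> regular \<Longrightarrow> (\<lambda>w. F tau w v t) field_differentiable (at u)"
 shows "F5 F \<longleftrightarrow> solves m F regular"
proof -
 have "opD F tau u v t = LD m F tau u v t \<and> opDbar F tau u v t = LDbar m F tau u v t \<and> opDelta F tau u v t = LDelta m F tau u v t"
  if p: "(tau, u, v, t) \<in> regular" for tau u v t by (intro conjI op_eq_L[OF F _ p] h)
 thus ?thesis unfolding F5_def solves_def by simp
qed

definition Sq :: "real \<Rightarrow> complex \<Rightarrow> complex" where
 "Sq m tau = csqrt (of_real (Im tau) / of_real m)"

lemma Sq_props:
 assumes "m > 0" "Im tau > 0"
 shows "(Sq m tau)^2 = of_real (Im tau) / of_real m" "Sq m tau \<noteq> 0"
 using assms by (simp_all only: Sq_def power2_csqrt csqrt_eq_0) simp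

lemma has_wirt_Sq:
 assumes m: "m > 0" "Im tau > 0"
 shows "has_wirt (Sq m) tau (1 / (4 * \<i> * of_real m * Sq m tau)) (- 1 / (4 * \<i> * of_real m * Sq m tau))"
proof -
 have "complex_of_real (Im tau) / of_real m = of_real (Im tau / m)" by simp
 moreover have "Im tau / m > 0" using m by (intro divide_pos_pos)
 ultimately have "complex_of_real (Im tau) / of_real m \<notin> \<real>\<^sub>\<le>\<^sub>0" by (simp only: nonpos_Reals_of_real_iff not_le)
 from has_field_derivative_csqrt[OF this]
 have c: "(csqrt has_field_derivative inverse (2 * Sq m tau)) (at (of_real (Im tau) / of_real m))" unfolding Sq_def .
 have "((\<lambda>x. x / of_real m) has_field_derivative 1 / of_real m) (at (of_real (Im tau)))"
  using m by (auto intro!: derivative_eq_intros)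
 note d = this
 have mc: "complex_of_real m \<noteq> 0" using m(1) by simp
 show ?thesis using has_wirt_compose[OF has_wirt_compose[OF has_wirt_Im d] c] unfolding Sq_def[abs_def]
  by (elim has_wirt_eq) (simp_all add: field_simps)
qed

text \<open>The argument \<open>psi\<close> in terms of S = sqrt(Im tau / m) instead of Im tau; its
  derivatives are then rational in S.\<close>

definition Ps :: "real \<Rightarrow> real \<Rightarrow> complex \<Rightarrow> complex \<Rightarrow> complex" where
 "Ps m N tau v = of_real N * Sq m tau - 2 * (of_real (Im v) / Sq m tau)"

lemma Psi_c_eq_Ps:
 assumes "m > 0" "Im tau > 0"
 shows "Psi_c m N (of_real (Im tau)) (of_real (Im v)) = Ps m N tau v"
proof -
 have "of_real (Im tau) = of_real m * (Sq m tau)^2" using Sq_props(1)[OF assms] assms by simp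
 thus ?thesis unfolding Psi_c_def Ps_def Sq_def[symmetric]
  using assms Sq_props(2)[OF assms] by (simp add: field_simps power2_eq_square)
qed

lemma has_wirt_Ps:
 fixes N :: real and v :: complex
 assumes m: "m > 0" "Im tau > 0"
 defines "q \<equiv> of_real N + 2 * (of_real (Im v) / (Sq m tau)^2)"
 shows "has_wirt (\<lambda>w. Ps m N w v) tau (q * (1 / (4 * \<i> * of_real m * Sq m tau))) (- q * (1 / (4 * \<i> * of_real m * Sq m tau)))" (is ?c1)
  and "has_wirt (\<lambda>w. Ps m N tau w) v (\<i> / Sq m tau) (- \<i> / Sq m tau)" (is ?c2)
proof -
 have "((\<lambda>x. of_real N * x - 2 * (of_real (Im v) / x)) has_field_derivative q) (at (Sq m tau))"
  unfolding q_def by (rule derivative_eq_intros refl | use Sq_props(2)[OF m] in \<open>simp add: field_simps power2_eq_square\<close>)+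
 from has_wirt_compose[OF has_wirt_Sq[OF m] this]
 show ?c1
  unfolding Ps_def by (rule has_wirt_eq) simp_all
 have "((\<lambda>x. of_real N * Sq m tau - 2 * (x / Sq m tau)) has_field_derivative - 2 / Sq m tau) (at (of_real (Im v)))"
  using Sq_props(2)[OF m] by (auto intro!: derivative_eq_intros)
 from has_wirt_compose[OF has_wirt_Im this]
 show ?c2
  unfolding Ps_def by (rule has_wirt_eq) (use Sq_props(2)[OF m] in \<open>simp_all add: field_simps\<close>)
qed

text \<open>A plane wave annihilated by D: the coefficient of tau is chosen to balance the squares
  of the frequencies 2 m kappa in u and N in v against the factor 4 m.\<close>

definition Ex :: "real \<Rightarrow> real \<Rightarrow> real \<Rightarrow> fun4" where
 "Ex m N kappa tau u v t = e2pi (of_real m * t + of_real (m * kappa^2 - N\<^sup>2 / (4 * m)) * tau - of_real (2 * m * kappa) * u + of_real N * v)"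

lemma Ex_deriv:
 "has_wirt (\<lambda>w. Ex m N kappa w u v t) tau (2 * of_real pi * \<i> * of_real (m * kappa^2 - N\<^sup>2 / (4 * m)) * Ex m N kappa tau u v t) 0"
 "has_wirt (\<lambda>w. Ex m N kappa tau w v t) u (- 2 * of_real pi * \<i> * of_real (2 * m * kappa) * Ex m N kappa tau u v t) 0"
 "has_wirt (\<lambda>w. Ex m N kappa tau u w t) v (2 * of_real pi * \<i> * of_real N * Ex m N kappa tau u v t) 0"
 unfolding Ex_def e2pi_def by (rule has_wirt_field, (rule derivative_eq_intros refl)+, simp add: algebra_simps)+

text \<open>The factor \<open>p\<close> is the general form of the terms of the non-holomorphic part and of all their derivatives.\<close>

lemma has_wirt_holo_Ps:
 fixes N kappa :: real and u v t :: complex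
 assumes m: "m > 0" "Im tau > 0" and p: "(p has_field_derivative p') (at (Ps m N tau v))"
 defines "q \<equiv> of_real N + 2 * (of_real (Im v) / (Sq m tau)^2)" and "S \<equiv> Sq m tau" and "e \<equiv> Ex m N kappa tau u v t"
 shows "has_wirt (\<lambda>w. p (Ps m N w v) * Ex m N kappa w u v t) tau
   ((p' * q / (4 * \<i> * of_real m * S) + 2 * of_real pi * \<i> * of_real (m * kappa^2 - N\<^sup>2 / (4 * m)) * p (Ps m N tau v)) * e)
   (- (p' * q / (4 * \<i> * of_real m * S)) * e)" (is ?c1)
  and "has_wirt (\<lambda>w. p (Ps m N tau w) * Ex m N kappa tau u w t) v
   ((p' * \<i> / S + 2 * of_real pi * \<i> * of_real N * p (Ps m N tau v)) * e) (- (p' * \<i> / S) * e)" (is ?c2)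
proof -
 show ?c1 unfolding S_def e_def
  by (rule has_wirt_eq[OF has_wirt_mult[OF has_wirt_compose[OF has_wirt_Ps(1)[OF m] p] Ex_deriv(1)], folded q_def])
    (simp_all add: algebra_simps)
 show ?c2 unfolding S_def e_def
  by (rule has_wirt_eq[OF has_wirt_mult[OF has_wirt_compose[OF has_wirt_Ps(2)[OF m] p] Ex_deriv(3)]])
    (simp_all add: algebra_simps)
qed

definition E_term :: "real \<Rightarrow> real \<Rightarrow> real \<Rightarrow> complex \<Rightarrow> fun4" where
 "E_term m N kappa sg tau u v t = (sg - Ec (Ps m N tau v)) * Ex m N kappa tau u v t"

definition gauss :: "complex \<Rightarrow> complex" where
 "gauss x = 2 * exp (- of_real pi * x^2)"

lemma gauss_deriv: "(gauss has_field_derivative - 2 * of_real pi * x * gauss x) (at x)"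
 unfolding gauss_def[abs_def] by (auto intro!: derivative_eq_intros simp: power2_eq_square)

lemma E_term_first:
 fixes N kappa :: real and u v t :: complex
 assumes m: "m > 0" "Im tau > 0"
 defines "S \<equiv> Sq m tau" and "e \<equiv> Ex m N kappa tau u v t" and "x \<equiv> Ps m N tau v"
  and "q \<equiv> of_real N + 2 * (of_real (Im v) / (Sq m tau)^2)"
 shows "d_tau (E_term m N kappa sg) tau u v t = (- (gauss x * q / (4 * \<i> * of_real m * S))
    + 2 * of_real pi * \<i> * of_real (m * kappa^2 - N\<^sup>2 / (4 * m)) * (sg - Ec x)) * e" (is ?c1)
  and "d_taubar (E_term m N kappa sg) tau u v t = (gauss x * q / (4 * \<i> * of_real m * S)) * e" (is ?c2)
  and "d_v (E_term m N kappa sg) tau u v t = (- (gauss x * \<i> / S) + 2 * of_real pi * \<i> * of_real N * (sg - Ec x)) * e" (is ?c3)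
  and "d_vbar (E_term m N kappa sg) tau u v t = (gauss x * \<i> / S) * e" (is ?c4)
  and "d_uw (E_term m N kappa sg) tau u v t = (- 2 * of_real pi * \<i> * of_real (2 * m * kappa)) * E_term m N kappa sg tau u v t" (is ?c5)
proof -
 have p: "((\<lambda>x. sg - Ec x) has_field_derivative - gauss x) (at x)"
  using has_field_derivative_Ec[of x] by (auto intro!: derivative_eq_intros simp: gauss_def)
 note w = has_wirt_holo_Ps[OF m p[unfolded x_def], where kappa = kappa and u = u and t = t]
 show ?c1
  "d_taubar (E_term m N kappa sg) tau u v t = (gauss x * q / (4 * \<i> * of_real m * S)) * e"
  ?c3
  "d_vbar (E_term m N kappa sg) tau u v t = (gauss x * \<i> / S) * e"
  unfolding d_tau_def d_taubar_def d_v_def d_vbar_def E_term_def S_def e_def x_def q_def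
   has_wirt_imp_wirt[OF w(1)] has_wirt_imp_wirt_bar[OF w(1)] has_wirt_imp_wirt[OF w(2)] has_wirt_imp_wirt_bar[OF w(2)]
  by simp_all
 show ?c5
  unfolding d_uw_def E_term_def has_wirt_imp_wirt[OF has_wirt_cmult[OF Ex_deriv(2)]] by (simp only: mult_ac)
qed

lemma E_term_second:
 fixes N kappa :: real and u v t :: complex
 assumes m: "m > 0" "Im tau > 0"
 defines "S \<equiv> Sq m tau" and "e \<equiv> Ex m N kappa tau u v t" and "x \<equiv> Ps m N tau v"
 shows "d_v (d_v (E_term m N kappa sg)) tau u v t = ((2 * of_real pi * x * gauss x * \<i> / S - 2 * of_real pi * \<i> * of_real N * gauss x) * \<i> / S
   + 2 * of_real pi * \<i> * of_real N * (- (gauss x * \<i> / S) + 2 * of_real pi * \<i> * of_real N * (sg - Ec x))) * e" (is ?c1)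
  and "d_v (d_vbar (E_term m N kappa sg)) tau u v t = ((- 2 * of_real pi * x * gauss x) * \<i> / S * \<i> / S + 2 * of_real pi * \<i> * of_real N * (gauss x * \<i> / S)) * e" (is ?c2)
  and "d_vbar (d_vbar (E_term m N kappa sg)) tau u v t = (2 * of_real pi * x * gauss x) * \<i> / S * \<i> / S * e" (is ?c3)
  and "d_uw (d_uw (E_term m N kappa sg)) tau u v t = (- 2 * of_real pi * \<i> * of_real (2 * m * kappa))^2 * ((sg - Ec x) * e)" (is ?c4)
proof -
 have p: "((\<lambda>x. - (gauss x * \<i> / S) + 2 * of_real pi * \<i> * of_real N * (sg - Ec x)) has_field_derivative
   2 * of_real pi * x * gauss x * \<i> / S - 2 * of_real pi * \<i> * of_real N * gauss x) (at x)"
  using has_field_derivative_Ec[of x] gauss_deriv[of x]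
  by (auto intro!: derivative_eq_intros simp: gauss_def Sq_props(2)[OF m] S_def field_simps)
 note w = has_wirt_holo_Ps(2)[OF m p[unfolded x_def], where kappa = kappa and u = u and t = t]
 show ?c1
  unfolding d_v_def[of "d_v _"] E_term_first[OF m] S_def e_def x_def using has_wirt_imp_wirt[OF w] by (simp add: S_def)
 have p: "((\<lambda>x. gauss x * \<i> / S) has_field_derivative (- 2 * of_real pi * x * gauss x) * \<i> / S) (at x)"
  using gauss_deriv[of x] by (auto intro!: derivative_eq_intros simp: gauss_def Sq_props(2)[OF m] S_def field_simps)
 note w = has_wirt_holo_Ps(2)[OF m p[unfolded x_def], where kappa = kappa and u = u and t = t]
 show ?c2
  "d_vbar (d_vbar (E_term m N kappa sg)) tau u v t = (2 * of_real pi * x * gauss x) * \<i> / S * \<i> / S * e"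
  unfolding d_v_def[of "d_vbar _"] d_vbar_def[of "d_vbar _"] E_term_first[OF m] S_def e_def x_def
  using has_wirt_imp_wirt[OF w] has_wirt_imp_wirt_bar[OF w] by (simp_all add: S_def)
 have c: "has_wirt (\<lambda>w. c * ((sg - Ec x) * Ex m N kappa tau w v t)) u (c * ((sg - Ec x) * (- 2 * of_real pi * \<i> * of_real (2 * m * kappa) * e))) (c * ((sg - Ec x) * 0))" for c
  unfolding e_def by (intro has_wirt_cmult Ex_deriv)
 show ?c4
  unfolding d_uw_def[of "d_uw _"] E_term_first(5)[OF m] E_term_def x_def[symmetric] has_wirt_imp_wirt[OF c]
  by (simp only: power2_eq_square mult_ac)
qed

text \<open>The parts containing the error function itself cancel because D annihilates
  \<open>Ex\<close>. The rest is a Gaussian times a rational function of S and Im v, which vanishes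
  identically once Im tau = m S^2 is inserted.\<close>

lemma E_term_solves:
 assumes m: "m > 0" shows "solves m (E_term m N kappa sg) X" unfolding solves_def
proof (intro allI impI)
 fix tau u v t assume "(tau, u, v, t) \<in> X"
 hence y: "Im tau > 0" by (simp add: X_def)
 define S where "S = Sq m tau"
 define alpha where "alpha = complex_of_real (Im v)"
 define B where "B = gauss (Ps m N tau v)"
 define e where "e = Ex m N kappa tau u v t"
 have S0: "S \<noteq> 0" and yS: "of_real (Im tau) = of_real m * S^2" and mc: "of_real m \<noteq> (0::complex)"
  using Sq_props[OF m y] m by (simp_all add: S_def)
 have ac: "acoord tau v = alpha / (of_real m * S^2)" unfolding acoord_def of_real_divide yS alpha_def ..
 have x: "Ps m N tau v = of_real N * S - 2 * (alpha / S)" by (simp add: Ps_def S_def alpha_def)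
 note d = E_term_first[OF m y, where u = u and v = v and t = t and N = N and kappa = kappa and sg = sg, folded S_def alpha_def B_def e_def]
  E_term_second[OF m y, where u = u and v = v and t = t and N = N and kappa = kappa and sg = sg, folded S_def alpha_def B_def e_def]
 have "LD m (E_term m N kappa sg) tau u v t = 0"
  unfolding LD_def d x using S0 mc by (simp add: field_simps power2_eq_square)
 moreover have "LDbar m (E_term m N kappa sg) tau u v t = 0"
  unfolding LDbar_def d x ac using S0 mc by (simp add: field_simps power2_eq_square)
 moreover have "LDelta m (E_term m N kappa sg) tau u v t = 0"
  unfolding LDelta_def d x ac using S0 mc by (simp add: field_simps power2_eq_square)
 ultimately show "LD m (E_term m N kappa sg) tau u v t = 0 \<and> LDbar m (E_term m N kappa sg) tau u v t = 0 \<and> LDelta m (E_term m N kappa sg) tau u v t = 0"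
  by simp
qed

definition H_term :: "real \<Rightarrow> int \<Rightarrow> (complex \<Rightarrow> complex) \<Rightarrow> fun4" where
 "H_term m n g tau u v t = g (v - u + of_int n * tau) * Ex m 0 (of_int n) tau u v t"

lemma H_term_deriv:
 fixes m :: real and n :: int and u v t :: complex
 assumes g: "(g has_field_derivative g') (at (v - u + of_int n * tau))"
 defines "e \<equiv> Ex m 0 (of_int n) tau u v t" and "z \<equiv> v - u + of_int n * tau"
 shows "has_wirt (\<lambda>w. H_term m n g w u v t) tau ((of_int n * g' + 2 * of_real pi * \<i> * of_real m * (of_int n)^2 * g z) * e) 0" (is ?c1)
  and "has_wirt (\<lambda>w. H_term m n g tau w v t) u ((- g' - 4 * of_real pi * \<i> * of_real m * of_int n * g z) * e) 0" (is ?c2)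
  and "has_wirt (\<lambda>w. H_term m n g tau u w t) v (g' * e) 0" (is ?c3)
proof -
 have a: "((\<lambda>w. g (v - u + of_int n * w)) has_field_derivative g' * of_int n) (at tau)"
  by (rule DERIV_chain2[where f = g], rule g) (auto intro!: derivative_eq_intros)
 have b: "((\<lambda>w. g (v - w + of_int n * tau)) has_field_derivative g' * - 1) (at u)"
  by (rule DERIV_chain2[where f = g], rule g) (auto intro!: derivative_eq_intros)
 have c: "((\<lambda>w. g (w - u + of_int n * tau)) has_field_derivative g' * 1) (at v)"
  by (rule DERIV_chain2[where f = g], rule g) (auto intro!: derivative_eq_intros)
 show ?c1
  unfolding H_term_def e_def z_def
  by (rule has_wirt_eq[OF has_wirt_mult[OF has_wirt_field[OF a] Ex_deriv(1)]]) (simp_all add: algebra_simps)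
 show ?c2
  unfolding H_term_def e_def z_def
  by (rule has_wirt_eq[OF has_wirt_mult[OF has_wirt_field[OF b] Ex_deriv(2)]]) (simp_all add: algebra_simps)
 show ?c3 unfolding H_term_def e_def z_def
  by (rule has_wirt_eq[OF has_wirt_mult[OF has_wirt_field[OF c] Ex_deriv(3)]]) (simp_all add: algebra_simps)
qed

text \<open>With z = v - u + n tau, the second derivatives of g in u and v cancel, and the mixed
  term from the exponential in u balances n g' from the tau-derivative. The other two operators
  vanish because the term is holomorphic in tau and v.\<close>

lemma H_term_solves:
 assumes U: "open U" and W: "open W" and g: "g holomorphic_on W"
  and mem: "\<And>tau u v t. (tau, u, v, t) \<in> U \<Longrightarrow> v - u + of_int n * tau \<in> W"
 shows "solves m (H_term m n g) U"
  and "\<And>tau u v t. (tau, u, v, t) \<in> U \<Longrightarrow> d_vbar (H_term m n g) tau u v t = 0"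
proof -
 note d1 = holomorphic_derivI[OF g W mem]
 note d2 = holomorphic_derivI[OF holomorphic_deriv[OF g W] W mem]
 have vb: "d_vbar (H_term m n g) tau u v t = 0" if p: "(tau, u, v, t) \<in> U" for tau u v t
  unfolding d_vbar_def by (rule has_wirt_imp_wirt_bar[OF H_term_deriv(3)[OF d1[OF p]]])
 show "d_vbar (H_term m n g) tau u v t = 0" if p: "(tau, u, v, t) \<in> U" for tau u v t by (rule vb[OF p])
 show "solves m (H_term m n g) U" unfolding solves_def
 proof (intro allI impI)
  fix tau u v t assume p: "(tau, u, v, t) \<in> U"
  define z where "z = v - u + of_int n * tau"
  define e where "e = Ex m 0 (of_int n) tau u v t"
  have t: "d_tau (H_term m n g) tau u v t = (of_int n * deriv g z + 2 * of_real pi * \<i> * of_real m * (of_int n)^2 * g z) * e"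
   and tb: "d_taubar (H_term m n g) tau u v t = 0" unfolding d_tau_def d_taubar_def z_def e_def
   by (rule has_wirt_imp_wirt[OF H_term_deriv(1)[OF d1[OF p]]] has_wirt_imp_wirt_bar[OF H_term_deriv(1)[OF d1[OF p]]])+
  have v: "d_v (H_term m n g) tau u v t = H_term m n (deriv g) tau u v t" if p: "(tau, u, v, t) \<in> U" for tau u v t
   unfolding d_v_def has_wirt_imp_wirt[OF H_term_deriv(3)[OF d1[OF p]]] by (simp only: H_term_def)
  have "has_wirt (\<lambda>w. d_v (H_term m n g) tau u w t) v (deriv (deriv g) z * e) 0"
  proof (rule has_wirt_cong[OF _ open_slice(3)[OF U, of tau u t]])
   show "has_wirt (\<lambda>w. H_term m n (deriv g) tau u w t) v (deriv (deriv g) z * e) 0"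
    unfolding z_def e_def by (rule H_term_deriv(3)[OF d2[OF p]])
  qed (simp_all add: v p)
  hence vv: "d_v (d_v (H_term m n g)) tau u v t = deriv (deriv g) z * e"
   unfolding d_v_def[of "d_v _"] by (rule has_wirt_imp_wirt)
  have vb0: "has_wirt (\<lambda>w. d_vbar (H_term m n g) tau u w t) v 0 0"
   by (rule has_wirt_cong[OF has_wirt_const open_slice(3)[OF U, of tau u t]]) (simp_all add: vb p)
  have vvb: "d_v (d_vbar (H_term m n g)) tau u v t = 0" "d_vbar (d_vbar (H_term m n g)) tau u v t = 0"
   unfolding d_v_def[of "d_vbar _"] d_vbar_def[of "d_vbar _"]
   by (rule has_wirt_imp_wirt[OF vb0] has_wirt_imp_wirt_bar[OF vb0])+
  define c where "c = 4 * of_real pi * \<i> * of_real m * of_int n"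
  have uu1: "d_uw (H_term m n g) tau u v t = - H_term m n (deriv g) tau u v t - c * H_term m n g tau u v t" if p: "(tau, u, v, t) \<in> U" for tau u v t
   unfolding d_uw_def has_wirt_imp_wirt[OF H_term_deriv(2)[OF d1[OF p]]] by (simp add: H_term_def c_def algebra_simps)
  have "has_wirt (\<lambda>w. -1 * H_term m n (deriv g) tau w v t - c * H_term m n g tau w v t) u
    (-1 * ((- deriv (deriv g) z - c * deriv g z) * e) - c * ((- deriv g z - c * g z) * e)) (-1 * 0 - c * 0)"
   unfolding c_def z_def e_def by (intro has_wirt_diff has_wirt_cmult H_term_deriv(2) d1[OF p] d2[OF p])
  hence "has_wirt (\<lambda>w. d_uw (H_term m n g) tau w v t) u
    (-1 * ((- deriv (deriv g) z - c * deriv g z) * e) - c * ((- deriv g z - c * g z) * e)) (-1 * 0 - c * 0)"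
   by (rule has_wirt_cong[OF _ open_slice(2)[OF U, of tau v t]]) (simp_all add: uu1 p)
  hence uu: "d_uw (d_uw (H_term m n g)) tau u v t = -1 * ((- deriv (deriv g) z - c * deriv g z) * e) - c * ((- deriv g z - c * g z) * e)"
   unfolding d_uw_def[of "d_uw _"] by (rule has_wirt_imp_wirt)
  show "LD m (H_term m n g) tau u v t = 0 \<and> LDbar m (H_term m n g) tau u v t = 0 \<and> LDelta m (H_term m n g) tau u v t = 0"
   unfolding LD_def LDbar_def LDelta_def t tb vv uu vvb vb[OF p] c_def by (simp add: algebra_simps power2_eq_square)
 qed
qed

lemma solves_zero: "solves m (\<lambda>tau u v t. 0) U"
proof -
 have z: "d_tau (\<lambda>tau u v t. 0) = (\<lambda>tau u v t. 0)" "d_taubar (\<lambda>tau u v t. 0) = (\<lambda>tau u v t. 0)" "d_v (\<lambda>tau u v t. 0) = (\<lambda>tau u v t. 0)"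
  "d_vbar (\<lambda>tau u v t. 0) = (\<lambda>tau u v t. 0)" "d_uw (\<lambda>tau u v t. 0) = (\<lambda>tau u v t. 0)"
  unfolding fun_eq_iff d_tau_def d_taubar_def d_v_def d_vbar_def d_uw_def
  by (simp_all add: has_wirt_imp_wirt[OF has_wirt_const] has_wirt_imp_wirt_bar[OF has_wirt_const])
 show ?thesis unfolding solves_def LD_def LDbar_def LDelta_def z by simp
qed

lemma ra4_zero: "ra4 (\<lambda>tau u v t. 0) X" using ra4_cmult[OF ra4_e2pi_t, of 0] by simp

lemma solves_cmult: "ra4 F U \<Longrightarrow> solves m F U \<Longrightarrow> solves m (\<lambda>tau u v t. c * F tau u v t) U"
 using solves_lincomb[of F U F m "c - 1"] by (simp add: algebra_simps)

lemma solves_sum: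
 assumes "finite J" "\<And>j. j \<in> J \<Longrightarrow> ra4 (F j) X" "\<And>j. j \<in> J \<Longrightarrow> solves m (F j) X"
 shows "ra4 (\<lambda>tau u v t. \<Sum>j\<in>J. F j tau u v t) X \<and> solves m (\<lambda>tau u v t. \<Sum>j\<in>J. F j tau u v t) X" using assms
proof (induction J rule: finite_induct)
 case empty
 show ?case by (simp add: ra4_zero solves_zero)
next
 case (insert j J)
 have "ra4 (F j) X" "solves m (F j) X" using insert.prems by simp_all
 moreover have "ra4 (\<lambda>tau u v t. \<Sum>j\<in>J. F j tau u v t) X" "solves m (\<lambda>tau u v t. \<Sum>j\<in>J. F j tau u v t) X"
  using insert.IH insert.prems by simp_all
 ultimately show ?case using ra4_add[of "F j" X "\<lambda>tau u v t. \<Sum>j\<in>J. F j tau u v t"]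
   solves_lincomb[of "F j" X "\<lambda>tau u v t. \<Sum>j\<in>J. F j tau u v t" m 1] insert.hyps by simp
qed

lemma add_term_eq:
 assumes m: "m > 0" and p: "(tau, u, v, t) \<in> X"
 shows "(eps powi k * eps powi n) * E_term m (j + 2 * m * of_int k) (of_int n + j / (2 * m)) (R_sgn m k) tau u v t
  = add_term eps m j (k, n) tau u v t"
proof -
 let ?N = "j + 2 * m * of_int k" and ?kappa = "of_int n + j / (2 * m)"
 have y: "Im tau > 0" using p by (simp add: X_def)
 have "Ex m ?N ?kappa tau u v t = e2pi (of_real m * t) * (e2pi (- of_real (?N\<^sup>2 / (4 * m)) * tau + of_real ?N * v)
   * e2pi (of_real (m * ?kappa\<^sup>2) * tau + of_real (m * ?kappa) * (- 2 * u)))" unfolding Ex_def e2pi_add[symmetric]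
  by (rule e2pi_eqI) (simp only: of_real_diff of_real_mult of_real_numeral, simp add: algebra_simps)
 thus ?thesis
  unfolding add_term_def E_term_def R_term_def theta_term_def fst_conv snd_conv Psi_c_eq_Ps[OF m y] by (simp only: mult_ac)
qed

lemma fsum_add_term_Rs:
 assumes e: "sgn_unit eps" and m: "m > 1/2" "2 * m \<in> \<int>" and j: "j \<in> half_ints" and p: "(tau, u, v, t) \<in> X"
 shows "fsum UNIV (add_term eps m j) tau u v t = e2pi (of_real m * t) * (Rs eps j m tau v * Theta eps j m tau (- 2 * u))"
proof -
 have y: "Im tau > 0" and m0: "m > 0" using p m by (simp_all add: X_def)
 show ?thesis unfolding fsum_add_term[OF e m j p] R_eq_infsum[OF m0 m(2) j y] Rs_def ..
qed

lemma AddF_ra4_solves: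
 assumes e: "sgn_unit eps" and m: "m > 1/2" "2 * m \<in> \<int>" and s: "s \<in> half_ints"
 shows "ra4 (AddF eps m s) X" "solves m (AddF eps m s) X"
proof -
 have m0: "m > 0" using m by simp
 have r: "ra4 (fsum UNIV (add_term eps m j)) X" for j by (rule nra_fsum[OF add_term_nra[OF e m(1)]])
 have t: "solves m (add_term eps m j kn) X" for j kn
 proof -
  obtain k n where kn: "kn = (k, n)" by fastforce
  let ?c = "eps powi k * eps powi n" and ?E = "E_term m (j + 2 * m * of_int k) (of_int n + j / (2 * m)) (R_sgn m k)"
  have A: "ra4 (add_term eps m j (k, n)) X" by (rule nra_ra4[OF add_term_nra[OF e m(1)]]) simp
  have c0: "?c \<noteq> 0" using e by (auto simp: sgn_unit_def)
  have one: "1 / a * (a * x) = x" if "a \<noteq> 0" for a x :: complex using that by simp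
  \<comment> \<open>Analyticity of a single \<open>E_term\<close> is read off from
    \<open>add_term\<close>, which differs from it by a nonzero constant.\<close>
  have E: "ra4 ?E X"
  proof (rule ra4_cong[OF ra4_cmult[OF A, of "1 / ?c"]])
   fix tau u v t assume p: "(tau, u, v, t) \<in> X"
   show "1 / ?c * add_term eps m j (k, n) tau u v t = ?E tau u v t"
    unfolding add_term_eq[OF m0 p, symmetric] by (rule one[OF c0])
  qed
  show ?thesis unfolding kn
   by (rule solves_cong[OF ra4_cmult[OF E] add_term_eq[OF m0] solves_cmult[OF E E_term_solves[OF m0]]])
 qed
 have so: "solves m (fsum UNIV (add_term eps m j)) X" for j by (rule solves_fsum[OF add_term_nra[OF e m(1)] t])
 have eq: "(\<Sum>j\<in>add_index m s. fsum UNIV (add_term eps m j) tau u v t) = AddF eps m s tau u v t" if p: "(tau, u, v, t) \<in> X" for tau u v t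
 proof -
  have "fsum UNIV (add_term eps m j) tau u v t = e2pi (of_real m * t) * (Rs eps j m tau v * Theta eps j m tau (- 2 * u))"
   if "j \<in> add_index m s" for j by (rule fsum_add_term_Rs[OF e m add_index_half_ints[OF s that] p])
  thus ?thesis unfolding AddF_def by (simp add: sum_distrib_left)
 qed
 note S = solves_sum[OF finite_add_index[of m s], of "\<lambda>j. fsum UNIV (add_term eps m j)" m, OF r so]
 show "ra4 (AddF eps m s) X" by (rule ra4_cong[OF conjunct1[OF S] eq])
 show "solves m (AddF eps m s) X" by (rule solves_cong[OF conjunct1[OF S] eq conjunct2[OF S]])
qed

lemma Phi_term_eq_H_term:
 "Phi_term eps m s n = H_term m n (\<lambda>z. eps powi n * (e2pi (of_real s * z) / (1 - e2pi z)))"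
proof (intro ext)
 fix tau u v t
 have "e2pi (of_real (m * (of_int n)^2 + of_int n * s) * tau - of_real (2 * m * of_int n) * u + of_real s * (v - u)) * e2pi (of_real m * t)
  = e2pi (of_real s * (v - u + of_int n * tau)) * Ex m 0 (of_int n) tau u v t"
  unfolding Ex_def e2pi_add[symmetric] by (rule e2pi_eqI) (simp add: algebra_simps)
 note q = this
 show "Phi_term eps m s n tau u v t = H_term m n (\<lambda>z. eps powi n * (e2pi (of_real s * z) / (1 - e2pi z))) tau u v t"
  unfolding Phi_term_def phi_coef_def H_term_def
  using arg_cong[OF q, of "\<lambda>x. eps powi n * x / (1 - e2pi (v - u + of_int n * tau))"] by (simp add: mult_ac)
qed

lemma PhiF_solves:
 assumes e: "sgn_unit eps" and m: "m > 0"
 shows "ra4 (PhiF eps m s) regular" "solves m (PhiF eps m s) regular"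
  "\<And>tau u v t. (tau, u, v, t) \<in> regular \<Longrightarrow> d_vbar (PhiF eps m s) tau u v t = 0"
proof -
 note n = Phi_nra[OF e m, of s]
 show "ra4 (PhiF eps m s) regular" unfolding PhiF_def by (rule nra_fsum[OF n])
 have W: "open {z. 1 - e2pi z \<noteq> 0}" unfolding e2pi_def by (intro open_Collect_neq continuous_intros)
 have g: "(\<lambda>z. eps powi n * (e2pi (of_real s * z) / (1 - e2pi z))) holomorphic_on {z. 1 - e2pi z \<noteq> 0}" for n
  unfolding e2pi_def by (auto intro!: holomorphic_intros)
 have mem: "v - u + of_int n * tau \<in> {z. 1 - e2pi z \<noteq> 0}" if "(tau, u, v, t) \<in> regular" for tau u v t and n
  using denominator_nonzero[OF regularD(1,2)[OF that], of n] by simp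
 have H1: "solves m (Phi_term eps m s n) regular" for n
  unfolding Phi_term_eq_H_term by (rule H_term_solves(1)[OF open_regular W g]) (rule mem)
 have H2: "d_vbar (Phi_term eps m s n) tau u v t = 0" if "(tau, u, v, t) \<in> regular" for n tau u v t
  unfolding Phi_term_eq_H_term by (rule H_term_solves(2)[OF open_regular W g _ that]) (rule mem)
 show "solves m (PhiF eps m s) regular" unfolding PhiF_def by (rule solves_fsum[OF n H1])
 fix tau u v t assume p: "(tau, u, v, t) \<in> regular"
 have "d_vbar (PhiF eps m s) tau u v t = fsum UNIV (\<lambda>n. d_vbar (Phi_term eps m s n)) tau u v t"
  unfolding PhiF_def by (rule first_order_nra(2)[OF first_order_d_vbar n p])
 thus "d_vbar (PhiF eps m s) tau u v t = 0" unfolding fsum_def H2[OF p] by simp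
qed

lemma phiF_solves:
 assumes e: "sgn_unit eps" and m: "m > 1/2" "2 * m \<in> \<int>" and s: "s \<in> half_ints"
 shows "ra4 (phiF eps m s) regular" "solves m (phiF eps m s) regular"
  "\<And>tau u v t. (tau, u, v, t) \<in> regular \<Longrightarrow> d_vbar (phiF eps m s) tau u v t = - 1/2 * d_vbar (AddF eps m s) tau u v t"
proof -
 have m0: "m > 0" using m by simp
 have eq: "phiF eps m s = (\<lambda>tau u v t. PhiF eps m s tau u v t + - 1/2 * AddF eps m s tau u v t)"
  by (simp add: fun_eq_iff phiF_def)
 note A = ra4_subset[OF AddF_ra4_solves(1)[OF e m s] regular_subset_X open_regular]
 have As: "solves m (AddF eps m s) regular"
  using AddF_ra4_solves(2)[OF e m s] regular_subset_X unfolding solves_def by blast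
 note P = PhiF_solves[OF e m0, of s]
 show "ra4 (phiF eps m s) regular" unfolding eq by (intro ra4_add ra4_cmult A P)
 show "solves m (phiF eps m s) regular" unfolding eq by (rule solves_lincomb[OF P(1) A P(2) As])
 fix tau u v t assume p: "(tau, u, v, t) \<in> regular"
 show "d_vbar (phiF eps m s) tau u v t = - 1/2 * d_vbar (AddF eps m s) tau u v t"
  unfolding eq first_order_lincomb[OF first_order_d_vbar P(1) A p] PhiF_solves(3)[OF e m0 p] by simp
qed

section \<open>Multiples of phi tilde belong to the space\<close>

text \<open>The extension demanded by (F2), written without division by theta11(v - u); on regular
  points it agrees with the defining product (\<open>phiG_eq\<close>).\<close>

definition phiG :: "complex \<Rightarrow> real \<Rightarrow> real \<Rightarrow> fun4" where
 "phiG eps m s tau u v t = theta11 tau (v + u) * (fsum UNIV (G_term eps m s) tau u v t - 1/2 * (theta11 tau (v - u) * AddF eps m s tau u v t))"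

lemma phiG_eq:
 assumes e: "sgn_unit eps" "m > 0" and p: "(tau, u, v, t) \<in> regular"
 shows "phiG eps m s tau u v t = theta11 tau (v - u) * theta11 tau (v + u) * phiF eps m s tau u v t"
 using regularD[OF p] unfolding phiG_def phiF_def PhiF_def fsum_Phi_term_eq[OF e regularD(1,2)[OF p]]
 by (simp add: field_simps)

text \<open>The derivative in ubar may be taken term by term and vanishes in each term.\<close>

lemma fsum_G_holomorphic_u:
 assumes e: "sgn_unit eps" "m > 0" and y: "Im tau > 0"
 shows "(\<lambda>u. fsum UNIV (G_term eps m s) tau u v t) holomorphic_on UNIV"
proof -
 have "(\<lambda>u. fsum UNIV (G_term eps m s) tau u v t) field_differentiable (at u)" for u
 proof -
  have p: "(tau, u, v, t) \<in> X" using y by (simp add: X_def)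
  have "d_uwbar (G_term eps m s n) tau u v t = 0" for n
  proof -
   have "(\<lambda>w. Kf tau (v - w + of_int n * tau)) holomorphic_on UNIV"
   proof -
    have "(\<lambda>w. v - w + of_int n * tau) holomorphic_on UNIV" by (intro holomorphic_intros)
    from holomorphic_on_compose_gen[OF this holomorphic_Kf[OF y, of UNIV]] show ?thesis by (simp add: o_def)
   qed
   hence "(\<lambda>w. G_term eps m s n tau w v t) holomorphic_on UNIV"
    unfolding G_term_def phi_coef_def Kn_def e2pi_def by (intro holomorphic_intros)
   hence "((\<lambda>w. G_term eps m s n tau w v t) has_field_derivative deriv (\<lambda>w. G_term eps m s n tau w v t) u) (at u)"
    by (rule holomorphic_derivI) auto
   from has_wirt_imp_wirt_bar[OF has_wirt_field[OF this]] show ?thesis unfolding d_uwbar_def .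
  qed
  hence "fsum UNIV (\<lambda>n. d_uwbar (G_term eps m s n)) tau u v t = 0" unfolding fsum_def by simp
  hence z: "d_uwbar (fsum UNIV (G_term eps m s)) tau u v t = 0"
   unfolding first_order_nra(2)[OF first_order_d_uwbar G_nra[OF e] p] .
  have "(\<lambda>w. fsum UNIV (G_term eps m s) tau w v t) differentiable (at u)"
   by (rule slice_differentiable(2)[OF ra4_differentiable[OF nra_fsum[OF G_nra[OF e]] p]])
  from has_wirt_imp_field[OF has_wirtI[OF this, folded d_uwbar_def, unfolded z]]
  show ?thesis unfolding field_differentiable_def by (rule exI)
 qed
 thus ?thesis by (simp add: holomorphic_on_def field_differentiable_at_within)
qed

lemma phiG_holomorphic_u:
 assumes e: "sgn_unit eps" "m > 0" and y: "Im tau > 0"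
 shows "(\<lambda>u. phiG eps m s tau u v t) holomorphic_on UNIV"
proof -
 have th: "(\<lambda>w. theta11 tau (f w)) holomorphic_on UNIV" if "f holomorphic_on UNIV" for f
  using holomorphic_on_compose_gen[OF that holomorphic_theta11[OF y, of UNIV]] by (simp add: o_def)
 have Th: "(\<lambda>w. Theta eps j m tau (- 2 * w)) holomorphic_on UNIV" for j
 proof -
  have "(\<lambda>w. - 2 * w) holomorphic_on UNIV" by (intro holomorphic_intros)
  from holomorphic_on_compose_gen[OF this holomorphic_Theta[OF e y, of j UNIV]] show ?thesis by (simp add: o_def)
 qed
 show ?thesis unfolding phiG_def AddF_def by (intro holomorphic_intros th Th fsum_G_holomorphic_u[OF e y])
qed

lemma phiG_ra4:
 assumes e: "sgn_unit eps" and m: "m > 1/2" "2 * m \<in> \<int>" and s: "s \<in> half_ints"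
 shows "ra4 (phiG eps m s) X"
proof -
 have m0: "m > 0" using m by simp
 show ?thesis unfolding phiG_def[abs_def]
  by (intro ra4_mult ra4_diff ra4_cmult theta11_ra4 nra_fsum[OF G_nra[OF e m0]] AddF_ra4_solves(1)[OF e m s])
qed

lemma phiF_field_differentiable_u:
 assumes e: "sgn_unit eps" "m > 0" and p: "(tau, u, v, t) \<in> regular"
 shows "(\<lambda>w. phiF eps m s tau w v t) field_differentiable (at u)"
proof -
 note y = regularD(1)[OF p]
 let ?W = "{w. (tau, w, v, t) \<in> regular}"
 have W: "open ?W" by (rule open_slice(2)[OF open_regular])
 have th: "(\<lambda>w. theta11 tau (f w)) holomorphic_on ?W" if "f holomorphic_on ?W" for f
  using holomorphic_on_compose_gen[OF that holomorphic_theta11[OF y, of UNIV]] by (simp add: o_def)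
 have "(\<lambda>w. phiG eps m s tau w v t / (theta11 tau (v - w) * theta11 tau (v + w))) holomorphic_on ?W"
  by (intro holomorphic_on_divide holomorphic_on_mult th holomorphic_on_subset[OF phiG_holomorphic_u[OF e y]] holomorphic_intros)
    (auto simp: regular_def)
 moreover have "phiG eps m s tau w v t / (theta11 tau (v - w) * theta11 tau (v + w)) = phiF eps m s tau w v t" if "w \<in> ?W" for w
  using that unfolding mem_Collect_eq by (subst phiG_eq[OF e]) (auto simp: regular_def)
 ultimately have "(\<lambda>w. phiF eps m s tau w v t) holomorphic_on ?W" by (rule holomorphic_transform)
 thus ?thesis by (rule holomorphic_on_imp_differentiable_at[OF _ W]) (use p in simp)
qed

lemma F3_cmult:
 assumes "F3 m s s' F" shows "F3 m s s' (\<lambda>tau u v t. c * F tau u v t)" unfolding F3_def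
proof (intro allI impI)
 fix tau u v t and j k :: int assume p: "(tau, u, v, t) \<in> regular"
 note F = assms[unfolded F3_def, rule_format, OF p, of j k]
 show "c * F tau (u + of_int j) (v + of_int k) t = e2pi (of_real (s * of_int (j + k))) * (c * F tau u v t) \<and>
    c * F tau (u + of_int j * tau) (v + of_int k * tau) t
     = e2pi (of_real (s' * of_int (j + k)) + 2 * of_real m * (of_int k * v - of_int j * u))
      * qpow tau (m * of_int (k^2 - j\<^sup>2)) * (c * F tau u v t)"
  unfolding conjunct1[OF F] conjunct2[OF F] by (simp only: mult_ac simp_thms)
qed

lemma F4_cmult:
 assumes "F4 m F" shows "F4 m (\<lambda>tau u v t. c * F tau u v t)" using assms unfolding F4_def Let_def by simp

lemma phiF_F1: "F1 m (phiF eps m s)"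
 unfolding F1_def phiF_def PhiF_alt AddF_def by (simp add: e2pi_def right_diff_distrib)

lemma restrict_regular_eq: "(tau, u, v, t) \<in> regular \<Longrightarrow> restrict_regular F tau u v t = F tau u v t"
 by (simp add: restrict_regular_def)

lemma scaled_phi_in_Fspace:
 assumes m: "m > 1/2" "2 * m \<in> \<int>" and s: "s \<in> half_ints" "s' \<in> half_ints"
  and e: "sgn_unit eps" "eps = e2pi (of_real s')"
 shows "restrict_regular (\<lambda>tau u v t. c * phi_tilde eps m s tau u v t) \<in> Fspace m s s'"
proof -
 have m0: "m > 0" using m by simp
 define F where "F = restrict_regular (\<lambda>tau u v t. c * phi_tilde eps m s tau u v t)"
 define P where "P = (\<lambda>tau u v t. c * phiF eps m s tau u v t)"
 have eq: "P tau u v t = F tau u v t" if "(tau, u, v, t) \<in> regular" for tau u v t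
  using that by (simp add: P_def F_def restrict_regular_def phiF_def phi_tilde_eq[OF m s(1) regularD(1)[OF that]])
 note S = phiF_solves[OF e(1) m s(1)]
 have Pra: "ra4 P regular" and Ps: "solves m P regular" unfolding P_def by (intro ra4_cmult S solves_cmult)+
 have Fra: "ra4 F regular" by (rule ra4_cong[OF Pra eq])
 have F1: "F1 m F" unfolding F1_def
 proof (intro allI impI)
  fix tau u v t assume p: "(tau, u, v, t) \<in> regular"
  have p0: "(tau, u, v, 0) \<in> regular" using p regular_t_iff[of tau u v t] by simp
  have "phiF eps m s tau u v t = e2pi (of_real m * t) * phiF eps m s tau u v 0"
   using phiF_F1 p unfolding F1_def by simp
  thus "F tau u v t = e2pi (of_real m * t) * F tau u v 0"
   unfolding eq[OF p, symmetric] eq[OF p0, symmetric] P_def by simp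
 qed
 have h: "(\<lambda>w. F tau w v t) field_differentiable (at u)" if p: "(tau, u, v, t) \<in> regular" for tau u v t
 proof -
  have "(\<lambda>w. P tau w v t) field_differentiable (at u)"
   unfolding P_def by (intro field_differentiable_mult field_differentiable_const phiF_field_differentiable_u[OF e(1) m0 p])
  then obtain D where "((\<lambda>w. P tau w v t) has_field_derivative D) (at u)" by (auto simp: field_differentiable_def)
  hence "((\<lambda>w. F tau w v t) has_field_derivative D) (at u)"
   by (rule has_field_derivative_transform_within_open[OF _ open_slice(2)[OF open_regular, of tau v t]]) (use p eq in auto)
  thus ?thesis by (auto simp: field_differentiable_def)
 qed
 have F5: "F5 F" using F5_iff_solves[OF F1 Fra h] solves_cong[OF Pra eq Ps] by simp
 have "F3 m s s' P" "F4 m P" unfolding P_def by (intro F3_cmult F4_cmult phiF_F3[OF m s e] phiF_F4[OF m e(1)])+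
 note P34 = this
 have F34: "F3 m s s' F" "F4 m F" by (rule F3_cong[OF eq P34(1)], assumption) (rule F4_cong[OF eq P34(2)])
 have F2: "F2 F" unfolding F2_def
 proof (intro conjI)
  show "\<exists>G. (\<forall>tau u v t. (tau, u, v, t) \<in> regular \<longrightarrow> G tau u v t = theta11 tau (v - u) * theta11 tau (v + u) * F tau u v t) \<and>
    (\<forall>tau v t. Im tau > 0 \<longrightarrow> (\<lambda>u. G tau u v t) holomorphic_on UNIV) \<and> real_analytic_on (\<lambda>(tau, u, v, t). G tau u v t) X"
  proof (intro exI[of _ "\<lambda>tau u v t. c * phiG eps m s tau u v t"] conjI allI impI)
   fix tau u v t assume p: "(tau, u, v, t) \<in> regular"
   show "c * phiG eps m s tau u v t = theta11 tau (v - u) * theta11 tau (v + u) * F tau u v t"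
    unfolding phiG_eq[OF e(1) m0 p] eq[OF p, symmetric] P_def by simp
  next
   fix tau v t :: complex assume y: "Im tau > 0"
   show "(\<lambda>u. c * phiG eps m s tau u v t) holomorphic_on UNIV"
    by (intro holomorphic_intros phiG_holomorphic_u[OF e(1) m0 y])
  next
   show "real_analytic_on (\<lambda>(tau, u, v, t). c * phiG eps m s tau u v t) X"
    by (rule ra4_real_analytic[OF ra4_cmult[OF phiG_ra4[OF e(1) m s(1)]]])
  qed
  show "\<exists>H. (\<forall>tau u v t. (tau, u, v, t) \<in> regular \<longrightarrow> H tau u v t = d_vbar F tau u v t) \<and> real_analytic_on (\<lambda>(tau, u, v, t). H tau u v t) X"
  \<comment> \<open>\<open>PhiF\<close> is holomorphic in v, so only the correction contributes to
    the vbar-derivative, and that is real analytic on all of \<open>X\<close>, across the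
    poles.\<close>
  proof (intro exI[of _ "\<lambda>tau u v t. (c * (- 1/2)) * d_vbar (AddF eps m s) tau u v t"] conjI allI impI)
   fix tau u v t assume p: "(tau, u, v, t) \<in> regular"
   have "d_vbar F tau u v t = d_vbar P tau u v t"
    by (rule first_order_cong[OF first_order_d_vbar Pra eq p, symmetric])
   also have "\<dots> = c * d_vbar (phiF eps m s) tau u v t" unfolding P_def d_vbar_def
    by (rule has_wirt_imp_wirt_bar[OF has_wirt_cmult[OF has_wirtI]]) (rule slice_differentiable(3)[OF ra4_differentiable[OF S(1) p]])
   finally show "c * (- 1/2) * d_vbar (AddF eps m s) tau u v t = d_vbar F tau u v t"
    unfolding phiF_solves(3)[OF e(1) m s(1) p] by simp
  next
   show "real_analytic_on (\<lambda>(tau, u, v, t). (c * (- 1/2)) * d_vbar (AddF eps m s) tau u v t) X"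
    by (rule ra4_real_analytic[OF ra4_cmult[OF first_order_ra4[OF first_order_d_vbar AddF_ra4_solves(1)[OF e(1) m s(1)]]]])
  qed
 qed
 have "F = restrict_regular F" by (simp add: F_def restrict_regular_def fun_eq_iff)
 with F1 F2 F34 F5 show ?thesis unfolding Fspace_def F_def[symmetric] by simp
qed

section \<open>Entire quotients, theta quotients and double periodicity\<close>

lemma eventually_nonzero_simple:
 assumes T: "T holomorphic_on UNIV" and s: "T z = 0 \<Longrightarrow> deriv T z \<noteq> 0"
 shows "\<forall>\<^sub>F w in at z. T w \<noteq> (0 :: complex)"
proof (cases "T z = 0")
 case True
 have "\<exists>beta. T beta \<noteq> 0"
 proof (rule ccontr)
  assume "\<not> (\<exists>beta. T beta \<noteq> 0)"
  hence "T = (\<lambda>_. 0)" by auto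
  thus False using s[OF True] by simp
 qed
 then obtain beta where "T beta \<noteq> 0" ..
 hence "\<forall>\<^sub>F w in at z. T w \<noteq> 0 \<and> w \<in> UNIV" by (intro non_zero_neighbour_alt[OF T]) auto
 thus ?thesis by simp
next
 case False
 have "isCont T z" using holomorphic_on_imp_continuous_on[OF T] by (simp add: continuous_on_eq_continuous_at)
 thus ?thesis unfolding isCont_def using False by (rule tendsto_imp_eventually_ne)
qed

text \<open>The device by which identities known away from isolated zeros of theta functions are
  extended to all points.\<close>

lemma isCont_eqI:
 fixes f g :: "complex \<Rightarrow> 'a :: t2_space"
 assumes "isCont f z" "isCont g z" "\<forall>\<^sub>F w in at z. f w = g w"
 shows "f z = g z"
proof -
 have "(f \<longlongrightarrow> g z) (at z)"
  using assms(2)[unfolded isCont_def] by (rule Lim_transform_eventually) (use assms(3) in \<open>simp add: eq_commute\<close>)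
 thus ?thesis using assms(1) unfolding isCont_def by (rule tendsto_unique[OF trivial_limit_at, rotated])
qed

text \<open>An entire function vanishing on the simple zeros of another one is divisible by it.\<close>

lemma entire_quotient:
 fixes N T :: "complex \<Rightarrow> complex"
 assumes N: "N holomorphic_on UNIV" and T: "T holomorphic_on UNIV"
  and z: "\<And>z. T z = 0 \<Longrightarrow> N z = 0" and s: "\<And>z. T z = 0 \<Longrightarrow> deriv T z \<noteq> 0"
 shows "\<exists>e. e holomorphic_on UNIV \<and> (\<forall>z. N z = T z * e z)"
proof -
 define e where "e = (\<lambda>z. if T z = 0 then deriv N z / deriv T z else N z / T z)"
 have "e field_differentiable (at a)" for a
 proof (cases "T a = 0")
  case False
  have "isCont T a" using holomorphic_on_imp_continuous_on[OF T] by (simp add: continuous_on_eq_continuous_at)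
  hence "\<forall>\<^sub>F w in nhds a. T w \<noteq> 0"
   using False tendsto_imp_eventually_ne[of T "T a" "at a" 0] by (simp add: isCont_def eventually_nhds_conv_at)
  then obtain S where S: "open S" "a \<in> S" "\<And>w. w \<in> S \<Longrightarrow> T w \<noteq> 0" by (auto simp: eventually_nhds)
  have "(\<lambda>w. N w / T w) holomorphic_on S"
   using S by (intro holomorphic_on_divide holomorphic_on_subset[OF N] holomorphic_on_subset[OF T]) auto
  hence "e holomorphic_on S" by (rule holomorphic_transform) (use S in \<open>simp add: e_def\<close>)
  thus ?thesis using S by (intro holomorphic_on_imp_differentiable_at) auto
 next
  case True
  \<comment> \<open>Difference quotient at \<open>a\<close> with the derivative filled in; it is
    entire, and near the simple zero \<open>a\<close> of T the quotient N / T equals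
    \<open>q N\<close> / \<open>q T\<close>.\<close>
  define q where "q = (\<lambda>f z. if z = a then deriv f a else (f z - f a) / (z - a) :: complex)"
  have hq: "q f holomorphic_on UNIV" if "f holomorphic_on UNIV" for f
   unfolding q_def by (rule pole_lemma_open[OF that open_UNIV])
  have "isCont (q T) a" using holomorphic_on_imp_continuous_on[OF hq[OF T]] by (simp add: continuous_on_eq_continuous_at)
  moreover have "q T a \<noteq> 0" using s[OF True] by (simp add: q_def)
  ultimately have "\<forall>\<^sub>F w in nhds a. q T w \<noteq> 0"
   using tendsto_imp_eventually_ne[of "q T" "q T a" "at a" 0] by (simp add: isCont_def eventually_nhds_conv_at)
  then obtain S where S: "open S" "a \<in> S" "\<And>w. w \<in> S \<Longrightarrow> q T w \<noteq> 0" by (auto simp: eventually_nhds)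
  have "(\<lambda>w. q N w / q T w) holomorphic_on S"
   using S by (intro holomorphic_on_divide holomorphic_on_subset[OF hq[OF N]] holomorphic_on_subset[OF hq[OF T]]) auto
  moreover have "q N w / q T w = e w" if "w \<in> S" for w
  proof (cases "w = a")
   case False
   hence "T w \<noteq> 0" using S(3)[OF that] True by (auto simp: q_def)
   thus ?thesis using False True z[OF True] by (simp add: e_def q_def)
  qed (use True in \<open>simp add: e_def q_def\<close>)
  ultimately have "e holomorphic_on S" by (rule holomorphic_transform)
  thus ?thesis using S by (intro holomorphic_on_imp_differentiable_at) auto
 qed
 hence "e holomorphic_on UNIV" by (simp add: holomorphic_on_def field_differentiable_at_within)
 moreover have "N z = T z * e z" for z using z[of z] by (simp add: e_def)
 ultimately show ?thesis by blast
qed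

lemma shift_invariant_int:
 assumes "\<And>z. P (z + p) = P z" shows "P (z + of_int k * p) = P (z :: complex)"
proof -
 have n: "P (z + of_nat n * p) = P z" for n z
 proof (induction n)
  case (Suc n)
  have eq: "z + of_nat (Suc n) * p = (z + of_nat n * p) + p" by (simp add: algebra_simps)
  show ?case unfolding eq assms by (rule Suc.IH)
 qed simp
 show ?thesis
 proof (cases "k \<ge> 0")
  case True thus ?thesis using n[of z "nat k"] by simp
 next
  case False
  thus ?thesis using n[of "z + of_int k * p" "nat (- k)"] by simp
 qed
qed

lemma lattice_induct:
 assumes "z \<in> lattice tau" "P 0" "\<And>z. P (z + 1) = P z" "\<And>z. P (z + tau) = P z"
 shows "P z"
proof -
 obtain j k where z: "z = of_int j + of_int k * tau" using assms(1) by (auto simp: lattice_def)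
 have "P (0 + of_int j * 1 + of_int k * tau) = P 0"
  unfolding shift_invariant_int[of P tau, OF assms(4)] by (rule shift_invariant_int[of P 1, OF assms(3)])
 thus ?thesis using assms(2) by (simp add: z)
qed

lemma doubly_periodic_bounded:
 fixes g :: "complex \<Rightarrow> real"
 assumes c: "continuous_on UNIV g" and y: "Im tau > 0"
  and p: "\<And>z. g (z + 1) = g z" "\<And>z. g (z + tau) = g z"
 shows "\<exists>C. \<forall>z. g z \<le> C"
proof -
 let ?K = "cbox 0 (Complex 1 (Im tau))"
 have "compact (g ` ?K)" by (intro compact_continuous_image continuous_on_subset[OF c]) auto
 hence "bounded (g ` ?K)" by (rule compact_imp_bounded)
 then obtain C where C: "\<And>x. x \<in> g ` ?K \<Longrightarrow> norm x \<le> C" unfolding bounded_iff by blast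
 have "g z \<le> C" for z
 proof -
  define k where "k = \<lfloor>Im z / Im tau\<rfloor>"
  define w where "w = z + of_int (- k) * tau"
  define j where "j = \<lfloor>Re w\<rfloor>"
  define x where "x = w + of_int (- j) * 1"
  have "g x = g w" unfolding x_def by (rule shift_invariant_int[of g 1, OF p(1)])
  also have "\<dots> = g z" unfolding w_def by (rule shift_invariant_int[of g tau, OF p(2)])
  finally have gx: "g x = g z" .
  have "of_int k \<le> Im z / Im tau" "Im z / Im tau < of_int k + 1" unfolding k_def by linarith+
  hence "of_int k * Im tau \<le> Im z" "Im z < (of_int k + 1) * Im tau" using y by (simp_all add: field_simps)
  moreover have "Im x = Im z - of_int k * Im tau" "Re x = Re w - of_int j" by (simp_all add: x_def w_def)
  moreover have "0 \<le> Re w - of_int j" "Re w - of_int j \<le> 1" unfolding j_def by linarith+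
  ultimately have "x \<in> ?K" by (simp add: in_cbox_complex_iff algebra_simps)
  hence "norm (g x) \<le> C" by (intro C imageI)
  thus ?thesis unfolding gx by simp
 qed
 thus ?thesis by blast
qed

lemma doubly_periodic_const:
 assumes e: "e holomorphic_on UNIV" and y: "Im tau > 0"
  and p: "\<And>z. norm (e (z + 1)) = norm (e z)" "\<And>z. norm (e (z + tau)) = norm (e z)"
 shows "\<exists>c. \<forall>z. e z = c"
proof -
 have "continuous_on UNIV (\<lambda>z. norm (e z))" by (intro continuous_on_norm holomorphic_on_imp_continuous_on e)
 then obtain C where C: "\<forall>z. norm (e z) \<le> C" using doubly_periodic_bounded[of "\<lambda>z. norm (e z)" tau] y p by blast
 have "bounded (range e)" using C by (auto simp: bounded_iff)
 from Liouville_theorem[OF e this] show ?thesis by (simp add: constant_on_def)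
qed

lemma one_in_lattice: "1 \<in> lattice tau" "tau \<in> lattice tau" "0 \<in> lattice tau" unfolding lattice_def mem_Collect_eq
 by (rule exI[of _ 1], rule exI[of _ 0], simp, rule exI[of _ 0], rule exI[of _ 1], simp, rule exI[of _ 0], rule exI[of _ 0], simp)

lemma theta11_plus_1: "theta11 tau (z + 1) = - theta11 tau z" using theta11_shift_1[of tau z 1] by simp

lemma theta11_plus_tau: "theta11 tau (z + tau) = - e2pi (- tau / 2 - z) * theta11 tau z"
 using theta11_shift_tau[of tau z 1] by (simp add: algebra_simps)

definition theta_d :: "complex \<Rightarrow> complex \<Rightarrow> complex" where
 "theta_d tau = deriv (theta11 tau)"

lemma theta_has_deriv: "Im tau > 0 \<Longrightarrow> (theta11 tau has_field_derivative theta_d tau z) (at z)"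
 unfolding theta_d_def by (rule holomorphic_derivI[of _ UNIV]) (auto intro: holomorphic_theta11)

lemma theta_d_plus_1:
 assumes y: "Im tau > 0" shows "theta_d tau (z + 1) = - theta_d tau z"
proof -
 have "((\<lambda>z. theta11 tau (z + 1)) has_field_derivative theta_d tau (z + 1)) (at z)"
  using theta_has_deriv[OF y, of "z + 1"] by (simp add: DERIV_shift)
 moreover have "((\<lambda>z. theta11 tau (z + 1)) has_field_derivative - theta_d tau z) (at z)"
  unfolding theta11_plus_1 by (rule DERIV_minus[OF theta_has_deriv[OF y]])
 ultimately show ?thesis by (rule DERIV_unique)
qed

lemma theta_d_plus_tau:
 assumes y: "Im tau > 0"
 shows "theta_d tau (z + tau) = - e2pi (- tau / 2 - z) * (theta_d tau z - 2 * of_real pi * \<i> * theta11 tau z)"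
proof -
 have "((\<lambda>z. theta11 tau (z + tau)) has_field_derivative theta_d tau (z + tau)) (at z)"
  using theta_has_deriv[OF y, of "z + tau"] by (simp add: DERIV_shift)
 moreover have "((\<lambda>z. theta11 tau (z + tau)) has_field_derivative
   - e2pi (- tau / 2 - z) * (theta_d tau z - 2 * of_real pi * \<i> * theta11 tau z)) (at z)"
  unfolding theta11_plus_tau e2pi_def
  by (rule derivative_eq_intros theta_has_deriv[OF y] refl)+ (simp add: algebra_simps)
 ultimately show ?thesis by (rule DERIV_unique)
qed

lemma theta_d_0:
 assumes y: "Im tau > 0" shows "theta_d tau 0 \<noteq> 0"
 using DERIV_unique[OF theta_has_deriv[OF y, of 0] theta11_deriv_0[OF y]] Kf_nonzero[of tau 0] y by simp

text \<open>At 0 the derivative is a multiple of \<open>Kf tau 0\<close>, which is nonzero;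
  quasi-periodicity carries the simplicity of the zero to every lattice point.\<close>

lemma theta_simple:
 assumes y: "Im tau > 0" and z: "theta11 tau z = 0" shows "theta_d tau z \<noteq> 0"
proof -
 have "z \<in> lattice tau" using z theta11_eq_0_iff[OF y] by simp
 hence "theta11 tau z = 0 \<and> theta_d tau z \<noteq> 0"
 proof (rule lattice_induct)
  show "theta11 tau 0 = 0 \<and> theta_d tau 0 \<noteq> 0" using theta_d_0[OF y] theta11_eq_0_iff[OF y] one_in_lattice by simp
 next
  fix z show "(theta11 tau (z + 1) = 0 \<and> theta_d tau (z + 1) \<noteq> 0) = (theta11 tau z = 0 \<and> theta_d tau z \<noteq> 0)"
   by (simp add: theta11_plus_1 theta_d_plus_1[OF y])
 next
  fix z show "(theta11 tau (z + tau) = 0 \<and> theta_d tau (z + tau) \<noteq> 0) = (theta11 tau z = 0 \<and> theta_d tau z \<noteq> 0)"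
   by (auto simp: theta11_plus_tau theta_d_plus_tau[OF y])
 qed
 thus ?thesis by simp
qed

lemma eventually_theta_nonzero:
 assumes y: "Im tau > 0" and c: "c \<noteq> 0"
 shows "\<forall>\<^sub>F v in at z. theta11 tau (c * v + d) \<noteq> 0"
proof (rule eventually_nonzero_simple)
 have d: "((\<lambda>v. theta11 tau (c * v + d)) has_field_derivative theta_d tau (c * w + d) * c) (at w)" for w
  by (rule DERIV_chain2[where f = "theta11 tau"], rule theta_has_deriv[OF y]) (auto intro!: derivative_eq_intros)
 show "(\<lambda>v. theta11 tau (c * v + d)) holomorphic_on UNIV"
  using d by (auto simp: holomorphic_on_open field_differentiable_def)
 assume "theta11 tau (c * z + d) = 0"
 thus "deriv (\<lambda>v. theta11 tau (c * v + d)) z \<noteq> 0" using theta_simple[OF y] c by (simp add: DERIV_imp_deriv[OF d])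
qed

text \<open>At points where theta11 does not vanish the common multiplier \<open>mu\<close> cancels,
  leaving \<open>xi\<close>; the zeros are reached by continuity.\<close>

lemma theta_quotient_shift:
 assumes y: "Im tau > 0" and e: "continuous_on UNIV e" and N: "\<And>z. N z = theta11 tau z * e z"
  and th: "\<And>z. theta11 tau (z + p) = mu z * theta11 tau z" and Np: "\<And>z. N (z + p) = xi * (mu z * N z)"
 shows "e (z + p) = xi * e z"
proof (rule isCont_eqI[where f = "\<lambda>z. e (z + p)" and z = z and g = "\<lambda>z. xi * e z"])
 have i: "isCont e x" for x using e by (simp add: continuous_on_eq_continuous_at)
 show "isCont (\<lambda>z. xi * e z) z" by (intro continuous_intros i)
 show "isCont (\<lambda>z. e (z + p)) z" by (rule isCont_o2[where g = e, OF _ i]) (intro continuous_intros)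
 have "e (w + p) = xi * e w" if "theta11 tau (1 * w + p) \<noteq> 0" for w
 proof -
  have "theta11 tau (w + p) * e (w + p) = theta11 tau (w + p) * (xi * e w)"
   using Np[of w] N[of "w + p"] N[of w] th[of w] by simp
  thus ?thesis using that by simp
 qed
 thus "\<forall>\<^sub>F w in at z. e (w + p) = xi * e w"
  by (rule eventually_mono[OF eventually_theta_nonzero[OF y, of 1 p z], rotated]) simp_all
qed

section \<open>Slices at fixed tau: the values on v = u and v = -u\<close>

definition TT :: "complex \<Rightarrow> complex \<Rightarrow> complex \<Rightarrow> complex" where
 "TT tau u v = theta11 tau (v - u) * theta11 tau (v + u)"

text \<open>The properties of \<open>G = \<vartheta>\<^sub>1\<^sub>1(v - u) \<vartheta>\<^sub>1\<^sub>1(v + u) F\<close> and \<open>H = \<partial>F/\<partial>v\<^sup>-\<close> at fixed \<open>tau\<close> and \<open>t = 0\<close> for an element \<open>F\<close> of the space.\<close>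

locale theta_slice =
 fixes m s s' :: real and tau :: complex and G H Gu Gv Hb :: "complex \<Rightarrow> complex \<Rightarrow> complex"
 assumes m: "m \<ge> 1" "2 * m \<in> \<int>" and s: "s \<in> half_ints" "s' \<in> half_ints" and y: "Im tau > 0"
  and shift_1: "G (u + of_int j) (v + of_int k) = e2pi (of_real (s * of_int (j + k))) * G u v"
  and shift_tau: "G (u + of_int j * tau) (v + of_int k * tau) = e2pi (of_real (s' * of_int (j + k))
   + 2 * of_real m * (of_int k * v - of_int j * u) + of_real (m * of_int (k^2 - j\<^sup>2)) * tau
   - of_int (k^2 + j^2) * tau - 2 * of_int k * v - 2 * of_int j * u) * G u v"
  and half_1: "theta11 tau (v + u) * G (u + 1 / (2 * of_real m)) (v + 1 / (2 * of_real m))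
   = theta11 tau (v + u + 1 / of_real m) * G u v"
  and half_tau: "theta11 tau (v + u) * G (u + tau / (2 * of_real m)) (v + tau / (2 * of_real m))
   = e2pi (v - u) * theta11 tau (v + u + tau / of_real m) * G u v"
  and G_deriv: "((\<lambda>p. G (fst p) (snd p)) has_derivative
   (\<lambda>h. Gu u v * fst h + Gv u v * snd h + TT tau u v * H u v * cnj (snd h))) (at (u, v))"
  and Gv_cont: "continuous_on UNIV (\<lambda>v. Gv u v)"
  and H_wirt: "has_wirt (\<lambda>w. H u w) v (4 * of_real pi * \<i> * of_real m * of_real (Im v / Im tau) * H u v) (Hb u v)"

text \<open>Every condition of the locale is linear in G and H together with their derivatives, the
  multipliers being the same for both slices; hence a multiple of the phi slice can be
  subtracted.\<close>

lemma theta_slice_lincomb: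
 assumes "theta_slice m s s' tau G H Gu Gv Hb" "theta_slice m s s' tau G2 H2 Gu2 Gv2 Hb2"
 shows "theta_slice m s s' tau (\<lambda>u v. G u v - r * G2 u v) (\<lambda>u v. H u v - r * H2 u v) (\<lambda>u v. Gu u v - r * Gu2 u v)
  (\<lambda>u v. Gv u v - r * Gv2 u v) (\<lambda>u v. Hb u v - r * Hb2 u v)"
proof -
 interpret a: theta_slice m s s' tau G H Gu Gv Hb by fact
 interpret b: theta_slice m s s' tau G2 H2 Gu2 Gv2 Hb2 by fact
 show ?thesis
 proof (unfold_locales, goal_cases)
  case 6 show ?case unfolding a.shift_1 b.shift_1 by (simp only: right_diff_distrib mult_ac)
 next
  case 7 show ?case unfolding a.shift_tau b.shift_tau right_diff_distrib[of "e2pi _"] by (simp only: mult_ac)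
 next
  case 8 show ?case unfolding right_diff_distrib mult.left_commute[of _ r] a.half_1 b.half_1 ..
 next
  case 9 show ?case unfolding right_diff_distrib mult.left_commute[of _ r] a.half_tau b.half_tau ..
 next
  case 10 show ?case
   by (rule has_derivative_eq_rhs[OF has_derivative_diff[OF a.G_deriv has_derivative_mult_right[OF b.G_deriv]]])
     (simp add: fun_eq_iff algebra_simps)
 next
  case 11 show ?case by (intro continuous_intros a.Gv_cont b.Gv_cont)
 next
  case 12 show ?case by (rule has_wirt_eq[OF has_wirt_diff[OF a.H_wirt has_wirt_cmult[OF b.H_wirt]]])
     (simp_all add: right_diff_distrib diff_divide_distrib mult_ac)
 qed (rule a.m a.s a.y)+
qed

context theta_slice
begin

lemma slice_wirt: "has_wirt (\<lambda>w. G u w) v (Gv u v) (TT tau u v * H u v)"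
proof -
 have "((\<lambda>w. (u, w)) has_derivative (\<lambda>h. (0, h))) (at v)" by (auto intro!: derivative_eq_intros)
 from has_derivative_compose[OF this, of "\<lambda>p. G (fst p) (snd p)" "\<lambda>h. Gu u v * fst h + Gv u v * snd h + TT tau u v * H u v * cnj (snd h)"] G_deriv[of u v]
 show ?thesis unfolding has_wirt_def by simp
qed

lemma G_isCont: "isCont (\<lambda>w. G u w) v"
 using slice_wirt[of u v] unfolding has_wirt_def by (rule has_derivative_continuous)

text \<open>The vbar-derivative of G carries the factor \<open>TT\<close>, which vanishes on the
  line u = c v for c = 1 and c = -1; there G is holomorphic in v.\<close>

lemma diag_deriv:
 assumes "TT tau (c * v) v = 0"
 shows "((\<lambda>w. G (c * w) w) has_field_derivative (Gu (c * v) v * c + Gv (c * v) v)) (at v)"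
proof -
 have "((\<lambda>w. (c * w, w)) has_derivative (\<lambda>h. (c * h, h))) (at v)" by (auto intro!: derivative_eq_intros)
 from has_derivative_compose[OF this, of "\<lambda>p. G (fst p) (snd p)" "\<lambda>h. Gu (c * v) v * fst h + Gv (c * v) v * snd h + TT tau (c * v) v * H (c * v) v * cnj (snd h)"] G_deriv[of "c * v" v]
 have "((\<lambda>w. G (c * w) w) has_derivative (\<lambda>h. Gu (c * v) v * (c * h) + Gv (c * v) v * h)) (at v)" by (simp add: assms)
 thus ?thesis unfolding has_field_derivative_def by (rule has_derivative_eq_rhs) (simp add: fun_eq_iff algebra_simps)
qed

lemma theta_0: "theta11 tau 0 = 0" using theta11_eq_0_iff[OF y] one_in_lattice by simp

text \<open>G on the diagonal in the coordinate z = v + u; likewise \<open>K\<close> below is G on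
  the antidiagonal in the coordinate z = v - u.\<close>

definition N where "N z = G (z / 2) (z / 2)"

definition K where "K z = G (- (z / 2)) (z / 2)"

lemma diag_holomorphic:
 assumes "\<And>v. TT tau (c * v) v = 0"
 shows "(\<lambda>z. G (c * (z / 2)) (z / 2)) holomorphic_on UNIV"
proof -
 have "(\<lambda>w. G (c * w) w) holomorphic_on UNIV"
  using diag_deriv[OF assms] by (auto simp: holomorphic_on_open field_differentiable_def)
 moreover have "(\<lambda>z. z / 2) holomorphic_on UNIV" by (intro holomorphic_intros) simp
 ultimately have "((\<lambda>w. G (c * w) w) \<circ> (\<lambda>z. z / 2)) holomorphic_on UNIV" by (intro holomorphic_on_compose_gen) auto
 thus ?thesis by (simp add: o_def)
qed

lemma N_holomorphic: "N holomorphic_on UNIV" using diag_holomorphic[of 1] by (simp add: N_def[abs_def] TT_def theta_0)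

lemma K_holomorphic: "K holomorphic_on UNIV"
 using diag_holomorphic[of "- 1"] by (simp add: K_def[abs_def] TT_def theta_0)

text \<open>A real lattice point is an integer, and 0 < 1/m < 1. At m = 1 this breaks down, and that
  case has to be argued differently below.\<close>

lemma inv_m_not_lattice:
 assumes "m > 1" shows "theta11 tau (1 / of_real m) \<noteq> 0"
proof
 assume "theta11 tau (1 / of_real m) = 0"
 then obtain j k :: int where jk: "1 / of_real m = of_int j + of_int k * tau"
  using theta11_eq_0_iff[OF y] by (auto simp: lattice_def)
 have r: "1 / complex_of_real m = of_real (1 / m)" by simp
 have "Im (complex_of_real (1 / m)) = Im (of_int j + of_int k * tau)" using jk unfolding r by (rule arg_cong)
 hence k: "k = 0" using y by simp
 have "Re (complex_of_real (1 / m)) = Re (of_int j + of_int k * tau)" using jk unfolding r by (rule arg_cong)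
 hence j: "1 / m = of_int j" using k by simp
 have "0 < 1 / m" "1 / m < 1" using assms by simp_all
 hence "0 < j" "j < 1" unfolding j by simp_all
 thus False by simp
qed

lemma lattice_add_theta_nonzero:
 assumes "theta11 tau z = 0" "theta11 tau w \<noteq> 0" shows "theta11 tau (z + w) \<noteq> 0"
proof -
 obtain j k :: int where z: "z = of_int j + of_int k * tau"
  using assms(1) theta11_eq_0_iff[OF y] by (auto simp: lattice_def)
 obtain kappa where "kappa \<noteq> 0" "theta11 tau (w + (of_int j + of_int k * tau)) = kappa * theta11 tau w"
  using theta11_lattice_factor by blast
 thus ?thesis using assms(2) z by (simp add: add.commute)
qed

lemma N_plus_2: "N (z + 2) = N z"
proof -
 have "2 * s \<in> \<int>" using s by (simp add: half_ints_def)
 hence "e2pi (of_real (s * of_int (1 + 1))) = 1" by (intro e2pi_of_real_Ints) (simp add: mult.commute)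
 thus ?thesis using shift_1[of "z / 2" 1 "z / 2" 1] by (simp add: N_def add_divide_distrib)
qed

lemma N_plus_2tau: "N (z + 2 * tau) = e2pi (- 2 * tau - 2 * z) * N z"
proof -
 have "2 * s' \<in> \<int>" using s by (simp add: half_ints_def)
 hence e: "e2pi (of_real (s' * of_int (1 + 1))) = 1" by (intro e2pi_of_real_Ints) (simp add: mult.commute)
 have "e2pi (of_real (s' * of_int (1 + 1)) + 2 * of_real m * (of_int 1 * (z / 2) - of_int 1 * (z / 2))
   + of_real (m * of_int (1^2 - 1\<^sup>2)) * tau - of_int (1^2 + 1^2) * tau - 2 * of_int 1 * (z / 2) - 2 * of_int 1 * (z / 2))
   = e2pi (of_real (s' * of_int (1 + 1)) + (- 2 * tau - 2 * z))" by (rule e2pi_eqI) simp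
 also have "\<dots> = e2pi (- 2 * tau - 2 * z)" unfolding e2pi_add e by simp
 finally show ?thesis using shift_tau[of "z / 2" 1 "z / 2" 1] by (simp add: N_def add_divide_distrib)
qed

lemma theta_plus_2tau: "theta11 tau (z + 2 * tau) = e2pi (- 2 * tau - 2 * z) * theta11 tau z"
 using theta11_shift_tau[of tau z 2] by (simp add: algebra_simps)

lemma theta_hol: "theta11 tau holomorphic_on UNIV" by (rule holomorphic_theta11[OF y])

lemma div_theta:
 assumes "M holomorphic_on UNIV" "\<And>z. theta11 tau z = 0 \<Longrightarrow> M z = 0"
 shows "\<exists>e. e holomorphic_on UNIV \<and> (\<forall>z. M z = theta11 tau z * e z)"
 by (rule entire_quotient[OF assms(1) theta_hol assms(2)]) (simp_all add: theta_simple[OF y, unfolded theta_d_def])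

text \<open>At a zero z of theta11 the law \<open>half_1\<close> reads 0 = theta11(z + 1/m) N z with
  a nonzero factor, so N is divisible by theta11. The quotient has periods 2 and 2 tau and is
  constant.\<close>

lemma N_large:
 assumes "m > 1" shows "\<exists>c. \<forall>z. N z = c * theta11 tau z"
proof -
 have z: "N z = 0" if z: "theta11 tau z = 0" for z
 proof -
  have "theta11 tau (z + 1 / of_real m) \<noteq> 0" by (rule lattice_add_theta_nonzero[OF z inv_m_not_lattice[OF assms]])
  thus ?thesis using half_1[of "z / 2" "z / 2"] z by (simp add: N_def)
 qed
 obtain e where e: "e holomorphic_on UNIV" "\<forall>z. N z = theta11 tau z * e z"
  using div_theta[OF N_holomorphic z] by blast
 have ec: "continuous_on UNIV e" by (rule holomorphic_on_imp_continuous_on[OF e(1)])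
 have p: "e (z + 2) = 1 * e z" for z by (rule theta_quotient_shift[OF y ec e(2)[rule_format], where mu = "\<lambda>_. 1"])
    (use theta11_shift_1[of tau _ 2] N_plus_2 in \<open>simp_all\<close>)
 have q: "e (z + 2 * tau) = 1 * e z" for z
  by (rule theta_quotient_shift[OF y ec e(2)[rule_format], where mu = "\<lambda>z. e2pi (- 2 * tau - 2 * z)"])
    (simp_all add: theta_plus_2tau N_plus_2tau)
 have h: "(\<lambda>z. e (2 * z)) holomorphic_on UNIV"
 proof -
  have "(\<lambda>z. 2 * z) holomorphic_on UNIV" by (intro holomorphic_intros)
  from holomorphic_on_compose_gen[OF this e(1)] show ?thesis by (simp add: o_def)
 qed
 have "\<exists>c. \<forall>z. e (2 * z) = c" by (rule doubly_periodic_const[OF h y]) (use p q in \<open>simp_all add: distrib_left\<close>)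
 then obtain c where "\<forall>z. e (2 * z) = c" ..
 hence "e z = c" for z using spec[of "\<lambda>z. e (2 * z) = c" "z / 2"] by simp
 thus ?thesis using e(2) by (auto simp: mult.commute)
qed

text \<open>On v = -u the left side of \<open>half_1\<close> contains theta11(0) = 0 and the right
  side the nonzero factor theta11(1/m).\<close>

lemma K_large:
 assumes "m > 1" shows "K z = 0"
 using half_1[of "z / 2" "- (z / 2)"] inv_m_not_lattice[OF assms] by (simp add: K_def theta_0)

lemma G_half_aux:
 assumes "\<And>w. theta11 tau (w + u) * G (u + h) (w + h) = theta11 tau (w + u) * (mu * G u w)"
 shows "G (u + h) (v + h) = mu * G u v"
proof (rule isCont_eqI[where f = "\<lambda>w. G (u + h) (w + h)" and z = v and g = "\<lambda>w. mu * G u w"])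
 show "isCont (\<lambda>w. G (u + h) (w + h)) v"
  by (rule isCont_o2[where g = "\<lambda>w. G (u + h) w", OF _ G_isCont]) (intro continuous_intros)
 show "isCont (\<lambda>w. mu * G u w) v" by (intro continuous_intros G_isCont)
 have "G (u + h) (w + h) = mu * G u w" if "theta11 tau (1 * w + u) \<noteq> 0" for w
 proof -
  have "theta11 tau (w + u) \<noteq> 0" using that by simp
  with assms[of w] show ?thesis by (simp only: mult_left_cancel not_False_eq_True simp_thms)
 qed
 thus "\<forall>\<^sub>F w in at v. G (u + h) (w + h) = mu * G u w"
  by (rule eventually_mono[OF eventually_theta_nonzero[OF y one_neq_zero], rotated])
qed

text \<open>For m = 1 the numbers 1/m and tau/m are periods, so theta11(v + u) occurs on both sides
  of the half-period laws and may be cancelled.\<close>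

lemma G_half:
 assumes m1: "m = 1"
 shows "G (u + 1 / 2) (v + 1 / 2) = - G u v" "G (u + tau / 2) (v + tau / 2) = - e2pi (- tau / 2 - 2 * u) * G u v" (is ?c1)
proof -
 have "theta11 tau (w + u) * G (u + 1 / 2) (w + 1 / 2) = theta11 tau (w + u) * (- 1 * G u w)" for w
  using half_1[of w u] unfolding m1 by (simp add: theta11_plus_1)
 from G_half_aux[OF this] show "G (u + 1 / 2) (v + 1 / 2) = - G u v" by simp
 have "theta11 tau (w + u) * G (u + tau / 2) (w + tau / 2) = theta11 tau (w + u) * (- e2pi (- tau / 2 - 2 * u) * G u w)" for w
 proof -
  have q: "e2pi (w - u) * e2pi (- tau / 2 - (w + u)) = e2pi (- tau / 2 - 2 * u)"
   unfolding e2pi_add[symmetric] by (rule e2pi_eqI) simp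
  have "theta11 tau (w + u) * G (u + tau / 2) (w + tau / 2)
   = - ((e2pi (w - u) * e2pi (- tau / 2 - (w + u))) * theta11 tau (w + u) * G u w)"
   using half_tau[of w u] unfolding m1 by (simp add: theta11_plus_tau)
  thus ?thesis unfolding q by simp
 qed
 from G_half_aux[OF this] show ?c1 .
qed

text \<open>N has the multipliers of theta11, so N / theta11 is elliptic with at most one simple
  pole per cell, hence constant. The pole is removed by subtracting \<open>rho\<close> times the
  derivative of theta11, at the price of an additive period 2 pi i rho of the quotient
  \<open>g\<close>.\<close>

lemma N_small:
 assumes m1: "m = 1" shows "\<exists>c. \<forall>z. N z = c * theta11 tau z"
proof -
 let ?E = "\<lambda>z. e2pi (- tau / 2 - z)"
 have N1: "N (z + 1) = - N z" for z using G_half(1)[OF m1, of "z / 2" "z / 2"] by (simp add: N_def add_divide_distrib)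
 have Nt: "N (z + tau) = - ?E z * N z" for z using G_half(2)[OF m1, of "z / 2" "z / 2"] by (simp add: N_def add_divide_distrib)
 define rho where "rho = N 0 / theta_d tau 0"
 define M where "M = (\<lambda>z. N z - rho * theta_d tau z)"
 have M: "M holomorphic_on UNIV" unfolding M_def theta_d_def
  by (intro holomorphic_intros N_holomorphic holomorphic_deriv theta_hol open_UNIV)
 have M1: "M (z + 1) = - M z" for z by (simp add: M_def N1 theta_d_plus_1[OF y])
 have Mt: "M (z + tau) = - ?E z * (M z + 2 * of_real pi * \<i> * rho * theta11 tau z)" for z
  unfolding M_def Nt theta_d_plus_tau[OF y] by (simp add: algebra_simps)
 have z: "M z = 0" if z: "theta11 tau z = 0" for z
 proof -
  have "z \<in> lattice tau" using z theta11_eq_0_iff[OF y] by simp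
  hence "theta11 tau z = 0 \<and> M z = 0"
  proof (rule lattice_induct)
   show "theta11 tau 0 = 0 \<and> M 0 = 0" using theta_0 theta_d_0[OF y] by (simp add: M_def rho_def)
  next
   fix z show "(theta11 tau (z + 1) = 0 \<and> M (z + 1) = 0) = (theta11 tau z = 0 \<and> M z = 0)"
    by (simp add: theta11_plus_1 M1)
  next
   fix z show "(theta11 tau (z + tau) = 0 \<and> M (z + tau) = 0) = (theta11 tau z = 0 \<and> M z = 0)"
    by (auto simp: theta11_plus_tau Mt)
  qed
  thus ?thesis by simp
 qed
 obtain g where g: "g holomorphic_on UNIV" "\<forall>z. M z = theta11 tau z * g z" using div_theta[OF M z] by blast
 have gc: "continuous_on UNIV g" by (rule holomorphic_on_imp_continuous_on[OF g(1)])
 have g1: "g (z + 1) = g z" for z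
  using theta_quotient_shift[OF y gc g(2)[rule_format], where mu = "\<lambda>_. - 1" and xi = 1 and p = 1 and z = z]
  by (simp add: theta11_plus_1 M1)
 have gt: "g (z + tau) = g z + 2 * of_real pi * \<i> * rho" for z
 proof (rule isCont_eqI[where f = "\<lambda>z. g (z + tau)" and z = z and g = "\<lambda>z. g z + 2 * of_real pi * \<i> * rho"])
  have i: "isCont g x" for x using gc by (simp add: continuous_on_eq_continuous_at)
  show "isCont (\<lambda>z. g (z + tau)) z" by (rule isCont_o2[where g = g, OF _ i]) (intro continuous_intros)
  show "isCont (\<lambda>z. g z + 2 * of_real pi * \<i> * rho) z" by (intro continuous_intros i)
  have "g (w + tau) = g w + 2 * of_real pi * \<i> * rho" if "theta11 tau (1 * w + 0) \<noteq> 0" for w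
  proof -
   have "?E w * theta11 tau w * g (w + tau) = ?E w * theta11 tau w * (g w + 2 * of_real pi * \<i> * rho)"
   proof -
    have "- ?E w * theta11 tau w * g (w + tau) = - ?E w * (theta11 tau w * g w + 2 * of_real pi * \<i> * rho * theta11 tau w)"
     using Mt[of w] unfolding spec[OF g(2), of w] spec[OF g(2), of "w + tau"] theta11_plus_tau .
    thus ?thesis by (simp add: algebra_simps)
   qed
   thus ?thesis using that by simp
  qed
  thus "\<forall>\<^sub>F w in at z. g (w + tau) = g w + 2 * of_real pi * \<i> * rho"
   by (rule eventually_mono[OF eventually_theta_nonzero[OF y, of 1 0 z], rotated]) simp_all
 qed
 have dg: "(g has_field_derivative deriv g z) (at z)" for z by (rule holomorphic_derivI[OF g(1)]) auto
 have dp: "deriv g (z + p) = deriv g z" if "\<And>z. g (z + p) = g z + c" for z p c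
 proof -
  have "((\<lambda>z. g (z + p)) has_field_derivative deriv g (z + p)) (at z)" using dg[of "z + p"] by (simp add: DERIV_shift)
  moreover have "((\<lambda>z. g (z + p)) has_field_derivative deriv g z) (at z)"
   unfolding that by (auto intro!: derivative_eq_intros dg)
  ultimately show ?thesis by (rule DERIV_unique)
 qed
 \<comment> \<open>The derivative of \<open>g\<close> is entire and doubly periodic, so
   \<open>g\<close> is affine; period 1 makes its slope vanish, and the law under tau then forces
   \<open>rho\<close> = 0.\<close>
 have "\<exists>a. \<forall>z. deriv g z = a"
  by (rule doubly_periodic_const[OF holomorphic_deriv[OF g(1) open_UNIV] y]) (simp_all add: dp[of 1 0] dp[of tau] g1 gt)
 then obtain a where a: "\<And>z. deriv g z = a" by blast
 have "((\<lambda>z. g z - a * z) has_field_derivative 0) (at z within UNIV)" for z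
  using dg[of z] unfolding a by (auto intro!: derivative_eq_intros)
 then obtain b where b: "\<And>z. g z - a * z = b"
  using has_field_derivative_zero_constant[OF convex_UNIV, of "\<lambda>z. g z - a * z"] by blast
 have gz: "g z = a * z + b" for z using b[of z] by (simp add: algebra_simps)
 have a0: "a = 0" using g1[of 0] unfolding gz by simp
 hence "rho = 0" using gt[of 0] unfolding gz by simp
 hence "N z = b * theta11 tau z" for z using g(2) unfolding gz a0 by (simp add: M_def)
 thus ?thesis by blast
qed

lemma N_eq: "\<exists>c. \<forall>z. N z = c * theta11 tau z" using N_large N_small m by (cases "m = 1") auto

text \<open>K 0 = N 0 = 0, so K vanishes on the whole lattice and K / theta11 is entire. Its
  multipliers e2pi(-s) and e2pi(-s') are unimodular, so it is constant, and a nonzero constant would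
  require s and s' both to be integers.\<close>

lemma K_small:
 assumes m1: "m = 1" and ns: "s \<notin> \<int> \<or> s' \<notin> \<int>" shows "K z = 0"
proof -
 let ?E = "\<lambda>z. e2pi (- tau / 2 - z)"
 have K1: "K (z + 1) = e2pi (- of_real s) * (- 1 * K z)" for z
 proof -
  have "- ((z + 1) / 2) = - (z / 2) + of_int (- 1) + 1 / 2" "(z + 1) / 2 = z / 2 + 1 / 2" by (simp_all add: field_simps)
  hence "K (z + 1) = G ((- (z / 2) + of_int (- 1)) + 1 / 2) (z / 2 + 1 / 2)" unfolding K_def by (simp only:)
  also have "\<dots> = - G (- (z / 2) + of_int (- 1)) (z / 2 + of_int 0)" unfolding G_half(1)[OF m1] by simp
  finally show ?thesis unfolding shift_1 by (simp add: K_def)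
 qed
 have Kt: "K (z + tau) = e2pi (- of_real s') * (- ?E z * K z)" for z
 proof -
  let ?u = "- (z / 2)"
  have "- ((z + tau) / 2) = ?u + of_int (- 1) * tau + tau / 2" "(z + tau) / 2 = z / 2 + tau / 2" by (simp_all add: field_simps)
  hence "K (z + tau) = G ((?u + of_int (- 1) * tau) + tau / 2) (z / 2 + tau / 2)" unfolding K_def by (simp only:)
  also have "\<dots> = - e2pi (- tau / 2 - 2 * (?u + of_int (- 1) * tau)) * G (?u + of_int (- 1) * tau) (z / 2 + of_int 0 * tau)"
   unfolding G_half(2)[OF m1] by simp
  also have "\<dots> = - (e2pi (- tau / 2 - 2 * (?u + of_int (- 1) * tau)) * e2pi (of_real (s' * of_int (- 1 + 0))
   + 2 * of_real m * (of_int 0 * (z / 2) - of_int (- 1) * ?u) + of_real (m * of_int (0^2 - (- 1)\<^sup>2)) * tau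
   - of_int (0^2 + (- 1)^2) * tau - 2 * of_int 0 * (z / 2) - 2 * of_int (- 1) * ?u)) * K z"
   unfolding shift_tau K_def by simp
  also have "e2pi (- tau / 2 - 2 * (?u + of_int (- 1) * tau)) * e2pi (of_real (s' * of_int (- 1 + 0))
   + 2 * of_real m * (of_int 0 * (z / 2) - of_int (- 1) * ?u) + of_real (m * of_int (0^2 - (- 1)\<^sup>2)) * tau
   - of_int (0^2 + (- 1)^2) * tau - 2 * of_int 0 * (z / 2) - 2 * of_int (- 1) * ?u) = e2pi (- of_real s') * ?E z"
   unfolding e2pi_add[symmetric] m1 by (rule e2pi_eqI) simp
  finally show ?thesis by simp
 qed
 have z: "K z = 0" if z: "theta11 tau z = 0" for z
 proof -
  have "z \<in> lattice tau" using z theta11_eq_0_iff[OF y] by simp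
  thus ?thesis
  proof (rule lattice_induct)
   have "K 0 = N 0" by (simp add: K_def N_def)
   thus "K 0 = 0" using N_eq theta_0 by auto
  qed (simp_all add: K1 Kt)
 qed
 obtain e where e: "e holomorphic_on UNIV" "\<forall>z. K z = theta11 tau z * e z"
  using div_theta[OF K_holomorphic z] by blast
 have ec: "continuous_on UNIV e" by (rule holomorphic_on_imp_continuous_on[OF e(1)])
 have e1: "e (z + 1) = e2pi (- of_real s) * e z" for z
  by (rule theta_quotient_shift[OF y ec e(2)[rule_format], where mu = "\<lambda>_. - 1"]) (simp add: theta11_plus_1, rule K1)
 have et: "e (z + tau) = e2pi (- of_real s') * e z" for z
  by (rule theta_quotient_shift[OF y ec e(2)[rule_format], where mu = "\<lambda>z. - ?E z"]) (rule theta11_plus_tau, rule Kt)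
 have n: "norm (e2pi (- of_real x)) = 1" for x by (simp add: norm_e2pi)
 have "\<exists>c. \<forall>z. e z = c" by (rule doubly_periodic_const[OF e(1) y]) (simp_all add: e1 et norm_mult n)
 then obtain c where c: "\<And>z. e z = c" by blast
 have "c = 0"
 proof (rule ccontr)
  assume "c \<noteq> 0"
  hence "e2pi (- of_real s) = 1" "e2pi (- of_real s') = 1" using e1[of 0] et[of 0] by (simp_all add: c)
  moreover have "x \<in> \<int>" if x: "e2pi (- of_real x) = 1" for x using x by (simp add: e2pi_eq_1_iff)
  ultimately show False using ns by blast
 qed
 thus ?thesis using e(2) c by simp
qed

lemma K_eq:
 assumes "m = 1 \<Longrightarrow> s \<notin> \<int> \<or> s' \<notin> \<int>" shows "K z = 0" using K_large K_small assms m by (cases "m = 1") auto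

end

section \<open>A slice vanishing on both lines is zero\<close>

lemma has_wirt_shift: "has_wirt f (z + c) p p' \<Longrightarrow> has_wirt (\<lambda>w. f (w + c)) z p p'"
proof -
 assume f: "has_wirt f (z + c) p p'"
 have "((\<lambda>w. w + c) has_derivative (\<lambda>h. h)) (at z)" by (auto intro!: derivative_eq_intros)
 from has_derivative_compose[OF this f[unfolded has_wirt_def]] show ?thesis unfolding has_wirt_def .
qed

lemma has_wirt_cnj: "has_wirt f z p p' \<Longrightarrow> has_wirt (\<lambda>w. cnj (f w)) z (cnj p') (cnj p)" unfolding has_wirt_def
 by (rule has_derivative_eq_rhs[OF bounded_linear.has_derivative[OF bounded_linear_cnj]])
   (auto simp: fun_eq_iff add.commute)

lemma has_wirt_unique: "has_wirt f z p p' \<Longrightarrow> has_wirt f z q q' \<Longrightarrow> p' = q'" using has_wirt_imp_wirt_bar by metis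

lemma has_wirt_isCont: "has_wirt f z p p' \<Longrightarrow> isCont f z" unfolding has_wirt_def by (rule has_derivative_continuous)

lemma has_wirt_line:
 assumes "has_wirt f (z + of_real b * w) p p'"
 shows "((\<lambda>b. f (z + of_real b * w)) has_vector_derivative (p * w + p' * cnj w)) (at b)"
proof -
 have "((\<lambda>b. z + of_real b * w) has_derivative (\<lambda>h. of_real h * w)) (at b)"
  by (auto intro!: derivative_eq_intros simp: scaleR_conv_of_real)
 from has_derivative_compose[OF this assms[unfolded has_wirt_def]]
 show ?thesis unfolding has_vector_derivative_def
  by (rule has_derivative_eq_rhs) (simp add: fun_eq_iff scaleR_conv_of_real algebra_simps)
qed

text \<open>The condition on u keeps the zeros of theta11(v - u) and theta11(v + u) in v apart, so
  that their product has only simple zeros (\<open>T_simple\<close>).\<close>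

locale theta_slice_zero = theta_slice +
 fixes u :: complex
 assumes diag: "\<And>v. G v v = 0" "\<And>v. G v (- v) = 0" and u: "theta11 tau (2 * u) \<noteq> 0"
begin

lemma zero_on_divisor:
 assumes "TT tau u v = 0" shows "G u v = 0"
proof -
 have *: "G u (x + of_int j + of_int k * tau) = 0" if "G u x = 0" for x and j k :: int
 proof -
  have "G u (x + of_int j) = 0" using shift_1[of u 0 x j] that by simp
  thus ?thesis using shift_tau[of u 0 "x + of_int j" k] by simp
 qed
 have "theta11 tau (v - u) = 0 \<or> theta11 tau (v + u) = 0" using assms by (simp add: TT_def)
 thus ?thesis
 proof
  assume "theta11 tau (v - u) = 0"
  then obtain j k :: int where jk: "v - u = of_int j + of_int k * tau"
   using theta11_eq_0_iff[OF y] by (auto simp: lattice_def)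
  have "v = (v - u) + u" by simp
  hence "v = u + of_int j + of_int k * tau" unfolding jk by (simp add: add_ac)
  thus ?thesis using *[of u j k] diag(1) by simp
 next
  assume "theta11 tau (v + u) = 0"
  then obtain j k :: int where jk: "v + u = of_int j + of_int k * tau"
   using theta11_eq_0_iff[OF y] by (auto simp: lattice_def)
  have "v = (v + u) + - u" by simp
  hence "v = - u + of_int j + of_int k * tau" unfolding jk by (simp add: add_ac)
  thus ?thesis using *[of "- u" j k] diag(2) by simp
 qed
qed

definition T where "T v = TT tau u v"

definition T' where "T' v = theta_d tau (v - u) * theta11 tau (v + u) + theta11 tau (v - u) * theta_d tau (v + u)"

lemma T_deriv: "(T has_field_derivative T' v) (at v)"
proof -
 have "((\<lambda>v. theta11 tau (v + c)) has_field_derivative theta_d tau (v + c)) (at v)" for c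
  using theta_has_deriv[OF y, of "v + c"] by (simp add: DERIV_shift)
 from DERIV_mult[OF this[of "- u"] this[of u]] show ?thesis by (simp add: T_def[abs_def] TT_def T'_def algebra_simps)
qed

lemma T_hol: "T holomorphic_on UNIV" using T_deriv by (auto simp: holomorphic_on_open field_differentiable_def)

lemma deriv_T: "deriv T v = T' v" by (rule DERIV_imp_deriv[OF T_deriv])

lemma T'_cont: "continuous_on A T'"
 using holomorphic_on_imp_continuous_on[OF holomorphic_deriv[OF T_hol open_UNIV]] deriv_T
 by (auto intro: continuous_on_subset simp: fun_eq_iff cong: continuous_on_cong)

lemma T_simple: "T v = 0 \<Longrightarrow> T' v \<noteq> 0"
proof -
 assume "T v = 0"
 hence "theta11 tau (v - u) = 0 \<or> theta11 tau (v + u) = 0" by (simp add: T_def TT_def)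
 moreover have "theta11 tau (v + u) \<noteq> 0" if "theta11 tau (v - u) = 0"
  using lattice_add_theta_nonzero[OF that u] by (simp add: algebra_simps)
 ultimately show ?thesis using theta_simple[OF y] by (auto simp: T'_def)
qed

lemma T_eventually: "\<forall>\<^sub>F w in at v. T w \<noteq> 0"
 by (rule eventually_nonzero_simple[OF T_hol]) (simp add: deriv_T T_simple)

text \<open>The pole-free function G / T of v, continued over the simple zeros of T by the quotient
  of the derivatives.\<close>

definition f where "f v = (if T v = 0 then Gv u v / T' v else G u v / T v)"

lemma f_wirt:
 assumes "T v \<noteq> 0"
 shows "has_wirt f v ((Gv u v * T v - G u v * T' v) / (T v)^2) (H u v)"
proof -
 have op: "open {w. T w \<noteq> 0}"
  using open_Collect_neq[OF holomorphic_on_imp_continuous_on[OF T_hol] continuous_on_const[of UNIV 0]] by simp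
 have "((\<lambda>w. 1 / T w) has_field_derivative - T' v / (T v)^2) (at v)"
  using assms by (auto intro!: derivative_eq_intros T_deriv simp: power2_eq_square)
 from has_wirt_mult[OF slice_wirt[of u v] has_wirt_field[OF this]]
 have "has_wirt (\<lambda>w. G u w * (1 / T w)) v ((Gv u v * T v - G u v * T' v) / (T v)^2) (H u v)"
  by (rule has_wirt_eq) (use assms in \<open>simp_all add: T_def[symmetric] field_simps power2_eq_square\<close>)
 thus ?thesis by (rule has_wirt_cong[OF _ op]) (use assms in \<open>auto simp: f_def\<close>)
qed

text \<open>At a zero of T the vbar-derivative T H of G vanishes, so G has a complex derivative
  there and the quotient of difference quotients converges. Continuity is all that is used of f at
  these points.\<close>

lemma f_cont: "isCont f v"
proof (cases "T v = 0")
 case False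
 thus ?thesis by (rule has_wirt_isCont[OF f_wirt])
next
 case True
 have "has_wirt (\<lambda>w. G u w) v (Gv u v) 0" using slice_wirt[of u v] True by (simp add: T_def)
 hence "((\<lambda>w. G u w) has_field_derivative Gv u v) (at v)" by (rule has_wirt_imp_field)
 hence 1: "((\<lambda>w. (G u w - G u v) / (w - v)) \<longlongrightarrow> Gv u v) (at v)" by (simp add: has_field_derivative_iff)
 have 2: "((\<lambda>w. (T w - T v) / (w - v)) \<longlongrightarrow> T' v) (at v)" using T_deriv by (simp add: has_field_derivative_iff)
 have 3: "((\<lambda>w. ((G u w - G u v) / (w - v)) / ((T w - T v) / (w - v))) \<longlongrightarrow> f v) (at v)"
  using tendsto_divide[OF 1 2 T_simple[OF True]] True by (simp add: f_def)
 have G0: "G u v = 0" by (rule zero_on_divisor) (use True in \<open>simp add: T_def\<close>)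
 have "\<forall>\<^sub>F w in at v. ((G u w - G u v) / (w - v)) / ((T w - T v) / (w - v)) = f w"
  using T_eventually[of v] eventually_neq_at_within[of v] by eventually_elim (simp add: f_def True G0)
 thus ?thesis unfolding isCont_def by (rule Lim_transform_eventually[OF 3])
qed

text \<open>exp W is a hermitian weight on the line bundle of which f is a section: |f|^2 exp W and
  |H|^2 exp W are doubly periodic.\<close>

definition W :: "complex \<Rightarrow> real" where "W v = 4 * pi * m * (Im v)^2 / Im tau"

definition k where "k v = cnj (H u v) * exp (of_real (W v))"

text \<open>By \<open>H_wirt\<close> the vbar-derivative of the conjugate of H is -4 pi i m a times
  that conjugate, with a = Im v / Im tau; the weight contributes the opposite term, so k is
  holomorphic.\<close>

lemma k_deriv: "\<exists>D. (k has_field_derivative D) (at v)"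
proof -
 let ?a = "complex_of_real (Im v / Im tau)"
 have "((\<lambda>x. exp (4 * of_real pi * of_real m * x^2 / of_real (Im tau))) has_field_derivative
   exp (of_real (W v)) * (8 * of_real pi * of_real m * ?a)) (at (of_real (Im v)))"
  using y by (auto intro!: derivative_eq_intros simp: W_def field_simps)
 from has_wirt_compose[OF has_wirt_Im this]
 have w: "has_wirt (\<lambda>v. exp (of_real (W v))) v (exp (of_real (W v)) * (8 * of_real pi * of_real m * ?a) * (1 / (2 * \<i>)))
   (exp (of_real (W v)) * (8 * of_real pi * of_real m * ?a) * (- 1 / (2 * \<i>)))" by (simp add: W_def)
 have "has_wirt k v (cnj (Hb u v) * exp (of_real (W v)) + cnj (H u v) * (exp (of_real (W v)) * (8 * of_real pi * of_real m * ?a) * (1 / (2 * \<i>)))) 0"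
  unfolding k_def[abs_def]
  by (rule has_wirt_eq[OF has_wirt_mult[OF has_wirt_cnj[OF H_wirt] w]]) (simp_all add: field_simps)
 from has_wirt_imp_field[OF this] show ?thesis by blast
qed

lemma k_hol: "k holomorphic_on UNIV" using k_deriv by (auto simp: holomorphic_on_open field_differentiable_def)

text \<open>Since \<open>mu\<close> is holomorphic, differentiating the shift law of G in vbar
  multiplies T H by \<open>mu\<close> as well; division by T turns the multiplier of both f and H
  into mu / kappa.\<close>

lemma f_H_shift:
 assumes sh: "\<And>w. G u (w + p) = mu w * G u w" and hol: "mu holomorphic_on UNIV"
  and Tp: "\<And>w. T (w + p) = kappa w * T w" and nz: "\<And>w. kappa w \<noteq> 0" and v: "T v \<noteq> 0"
 shows "f (v + p) = (mu v / kappa v) * f v" "H u (v + p) = (mu v / kappa v) * H u v"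
proof -
 show "f (v + p) = (mu v / kappa v) * f v" using v nz by (simp add: f_def Tp sh)
 have "(mu has_field_derivative deriv mu v) (at v)" by (rule holomorphic_derivI[OF hol]) auto
 from has_wirt_mult[OF has_wirt_field[OF this] slice_wirt[of u v]]
 have 1: "has_wirt (\<lambda>w. G u (w + p)) v (deriv mu v * G u v + mu v * Gv u v) (0 * G u v + mu v * (TT tau u v * H u v))"
  unfolding sh .
 have "TT tau u (v + p) * H u (v + p) = 0 * G u v + mu v * (TT tau u v * H u v)"
  by (rule has_wirt_unique[OF has_wirt_shift[OF slice_wirt] 1])
 hence "kappa v * T v * H u (v + p) = mu v * T v * H u v" using Tp[of v] by (simp add: T_def)
 thus "H u (v + p) = (mu v / kappa v) * H u v" using v nz[of v] by (simp add: field_simps)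
qed

lemma shift_generic:
 assumes p: "p = 1 \<or> p = tau" and v: "T v \<noteq> 0"
 shows "\<exists>nu. f (v + p) = nu * f v \<and> H u (v + p) = nu * H u v \<and> (norm nu)^2 * exp (W (v + p)) = exp (W v)" using p
proof
 assume p: "p = 1"
 have G1: "G u (w + 1) = e2pi (of_real s) * G u w" for w using shift_1[of u 0 w 1] by simp
 have T1: "T (w + 1) = 1 * T w" for w
 proof -
  have "w + 1 - u = (w - u) + 1" "w + 1 + u = (w + u) + 1" by simp_all
  thus ?thesis by (simp only: T_def TT_def theta11_plus_1) simp
 qed
 note sh = f_H_shift[of 1 "\<lambda>_. e2pi (of_real s)" "\<lambda>_. 1", OF G1 holomorphic_on_const T1 one_neq_zero v]
 have "(norm (e2pi (of_real s) / 1))^2 * exp (W (v + 1)) = exp (W v)" by (simp add: norm_e2pi W_def)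
 thus ?thesis unfolding p using sh by (intro exI[of _ "e2pi (of_real s) / 1"] conjI)
next
 assume p: "p = tau"
 define mu where "mu = (\<lambda>w. e2pi (of_real s' + 2 * of_real m * w + of_real m * tau - tau - 2 * w))"
 define kappa where "kappa = (\<lambda>w. e2pi (- tau - 2 * w))"
 have G1: "G u (w + tau) = mu w * G u w" for w using shift_tau[of u 0 w 1] by (simp add: mu_def)
 have T1: "T (w + tau) = kappa w * T w" for w
 proof -
  have a: "w + tau - u = (w - u) + tau" "w + tau + u = (w + u) + tau" by simp_all
  have "e2pi (- tau / 2 - (w - u)) * e2pi (- tau / 2 - (w + u)) = kappa w"
   unfolding kappa_def e2pi_add[symmetric] by (rule e2pi_eqI) simp
  thus ?thesis unfolding T_def TT_def a theta11_plus_tau by (simp add: mult_ac)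
 qed
 have h: "mu holomorphic_on UNIV" unfolding mu_def e2pi_def by (intro holomorphic_intros)
 have nz: "kappa w \<noteq> 0" for w by (simp add: kappa_def)
 note sh = f_H_shift[of tau mu kappa, OF G1 h T1 nz v]
 \<comment> \<open>The theta multipliers cancel and the factor e2pi(2 m v) remains, which is that of
   a bundle of degree -2m; the growth of W compensates its modulus.\<close>
 have "mu v / kappa v = e2pi (of_real s' + 2 * of_real m * v + of_real m * tau)"
 proof -
  have "e2pi (of_real s' + 2 * of_real m * v + of_real m * tau) * kappa v = mu v"
   unfolding kappa_def mu_def e2pi_add[symmetric] by (rule e2pi_eqI) simp
  thus ?thesis using nz[of v] by (simp add: field_simps)
 qed
 hence n: "norm (mu v / kappa v) = exp (- 2 * pi * (2 * m * Im v + m * Im tau))" by (simp add: norm_e2pi)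
 have "(norm (mu v / kappa v))^2 * exp (W (v + tau)) = exp (W v)"
 proof -
  have "2 * (- 2 * pi * (2 * m * Im v + m * Im tau)) + W (v + tau) = W v"
   using y by (simp add: W_def field_simps power2_eq_square)
  hence "exp (2 * (- 2 * pi * (2 * m * Im v + m * Im tau))) * exp (W (v + tau)) = exp (W v)"
   unfolding exp_add[symmetric] by simp
  thus ?thesis unfolding n exp_double[symmetric] .
 qed
 thus ?thesis unfolding p using sh by (intro exI[of _ "mu v / kappa v"] conjI)
qed

text \<open>Pairing of f with the holomorphic dual section k: doubly periodic, with vbar-derivative
  \<open>q\<close>, which is nonnegative (\<open>P_wirt\<close>).\<close>

definition P where "P v = f v * k v"

lemma W_cont: "continuous_on A W" unfolding W_def by (intro continuous_intros) (use y in auto)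

lemma P_isCont: "isCont P v" unfolding P_def[abs_def]
 using f_cont[of v] holomorphic_on_imp_continuous_on[OF k_hol] by (auto intro!: continuous_intros simp: continuous_on_eq_continuous_at)

lemma isCont_shift: "(\<And>v. isCont g v) \<Longrightarrow> isCont (\<lambda>v. g (v + p)) (v :: complex)"
 by (rule isCont_o2[where g = g]) (auto intro!: continuous_intros)

lemma P_shift:
 assumes p: "p = 1 \<or> p = tau" shows "P (v + p) = P v"
proof (rule isCont_eqI[where f = "\<lambda>v. P (v + p)" and z = v and g = P, OF isCont_shift[OF P_isCont] P_isCont])
 have "P (w + p) = P w" if w: "T w \<noteq> 0" for w
 proof -
  obtain nu where nu: "f (w + p) = nu * f w" "H u (w + p) = nu * H u w" "(norm nu)^2 * exp (W (w + p)) = exp (W w)"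
   using shift_generic[OF p w] by blast
  have "nu * cnj nu * exp (of_real (W (w + p))) = exp (of_real (W w))" using arg_cong[OF nu(3), of complex_of_real]
   unfolding of_real_mult complex_norm_square exp_of_real .
  from arg_cong[OF this, of "\<lambda>x. x * (f w * cnj (H u w))"] show ?thesis
   unfolding P_def k_def nu(1,2) by (simp only: complex_cnj_mult mult_ac)
 qed
 thus "\<forall>\<^sub>F w in at v. P (w + p) = P w" by (rule eventually_mono[OF T_eventually, rotated])
qed

lemma norm_f_shift:
 assumes p: "p = 1 \<or> p = tau" shows "(norm (f (v + p)))^2 * exp (W (v + p)) = (norm (f v))^2 * exp (W v)"
proof -
 let ?g = "\<lambda>v. (norm (f v))^2 * exp (W v)"
 have c: "isCont ?g v" for v
  using f_cont[of v] W_cont[of UNIV] by (auto intro!: continuous_intros simp: continuous_on_eq_continuous_at)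
 have "?g (w + p) = ?g w" if w: "T w \<noteq> 0" for w
  using shift_generic[OF p w] by (auto simp: norm_mult power_mult_distrib)
 hence "\<forall>\<^sub>F w in at v. ?g (w + p) = ?g w" by (rule eventually_mono[OF T_eventually, rotated])
 from isCont_eqI[where f = "\<lambda>v. ?g (v + p)" and z = v and g = ?g, OF isCont_shift[where g = ?g, OF c] c this]
 show ?thesis .
qed

definition Px where "Px v = (Gv u v * T v - G u v * T' v) / (T v)^2 * k v + f v * deriv k v"

definition q where "q v = (norm (H u v))^2 * exp (W v)"

lemma P_wirt: "T v \<noteq> 0 \<Longrightarrow> has_wirt P v (Px v) (of_real (q v))"
proof -
 assume v: "T v \<noteq> 0"
 have "(k has_field_derivative deriv k v) (at v)" by (rule holomorphic_derivI[OF k_hol]) auto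
 from has_wirt_mult[OF f_wirt[OF v] has_wirt_field[OF this]]
 show ?thesis unfolding P_def[abs_def] Px_def
 proof (rule has_wirt_eq)
  have "of_real (q v) = H u v * cnj (H u v) * exp (of_real (W v))"
   unfolding q_def of_real_mult complex_norm_square exp_of_real ..
  thus "H u v * k v + f v * 0 = of_real (q v)" by (simp add: k_def)
 qed simp
qed

lemma q_cont: "continuous_on A q"
proof -
 have "continuous_on A (\<lambda>v. H u v)" using has_wirt_isCont[OF H_wirt] by (simp add: continuous_at_imp_continuous_on)
 thus ?thesis unfolding q_def by (intro continuous_intros W_cont)
qed

lemma Px_cont: "(\<And>v. v \<in> A \<Longrightarrow> T v \<noteq> 0) \<Longrightarrow> continuous_on A Px" unfolding Px_def
 by (intro continuous_intros T'_cont continuous_on_subset[OF Gv_cont] continuous_on_subset[OF holomorphic_on_imp_continuous_on[OF T_hol]]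
   continuous_on_subset[OF holomorphic_on_imp_continuous_on[OF k_hol]] continuous_at_imp_continuous_on ballI G_isCont f_cont
   continuous_on_subset[OF holomorphic_on_imp_continuous_on[OF holomorphic_deriv[OF k_hol open_UNIV]]]) auto

text \<open>A zero of T on the line at height b lies over a lattice point with some tau-coefficient
  i, which determines b for each of the two factors; for b in the unit interval only finitely many i
  occur.\<close>

lemma bad_finite: "finite {b \<in> {0..1}. \<exists>x. T (c + of_real x + of_real b * tau) = 0}"
proof -
 define g where "g = (\<lambda>sg (i :: int). (of_int i - Im (c + sg * u) / Im tau))"
 define B where "B = \<lceil>\<bar>Im c / Im tau\<bar> + \<bar>Im u / Im tau\<bar>\<rceil> + 2"
 have g: "b \<in> g sg ` {-B..B}" if th: "theta11 tau (c + of_real x + of_real b * tau + sg * u) = 0" and b: "b \<in> {0..1}" and sg: "sg = 1 \<or> sg = -1" for x b sg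
 proof -
  obtain j i :: int where ji: "c + of_real x + of_real b * tau + sg * u = of_int j + of_int i * tau"
   using th theta11_eq_0_iff[OF y] by (auto simp: lattice_def)
  from arg_cong[OF this, of Im] have "Im (c + sg * u) + b * Im tau = of_int i * Im tau" using sg by auto
  hence e: "of_int i = Im (c + sg * u) / Im tau + b" using y by (simp add: field_simps)
  hence bg: "b = g sg i" by (simp add: g_def)
  have "Im (c + sg * u) / Im tau = Im c / Im tau + Im u / Im tau \<or> Im (c + sg * u) / Im tau = Im c / Im tau - Im u / Im tau"
   using sg by (auto simp: add_divide_distrib diff_divide_distrib)
  moreover have "0 \<le> b" "b \<le> 1" using b by simp_all
  ultimately have "\<bar>real_of_int i\<bar> \<le> \<bar>Im c / Im tau\<bar> + \<bar>Im u / Im tau\<bar> + 1" unfolding e by linarith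
  hence "\<bar>i\<bar> \<le> B" unfolding B_def by linarith
  hence "i \<in> {-B..B}" by auto
  thus ?thesis unfolding bg by (rule imageI)
 qed
 have "{b \<in> {0..1}. \<exists>x. T (c + of_real x + of_real b * tau) = 0} \<subseteq> g 1 ` {-B..B} \<union> g (-1) ` {-B..B}"
  using g[where sg = 1] g[where sg = "-1"] by (fastforce simp: T_def TT_def)
 thus ?thesis by (rule finite_subset) simp
qed

text \<open>Stokes on the parallelogram with corner \<open>c\<close>, where \<open>P\<close> is only continuous at the zeros of \<open>T\<close>.\<close>

lemma H_zero: "H u c = 0"
proof -
 \<comment> \<open>The integral of P along the horizontal period at height b, to be differentiated
   in b away from the finite set S of lines that meet zeros of T.\<close>
 define A where "A = (\<lambda>b. integral (cbox 0 1) (\<lambda>x. P (c + of_real x + of_real b * tau)))"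
 define Q where "Q = (\<lambda>b. integral (cbox 0 1) (\<lambda>x. q (c + of_real x + of_real b * tau)))"
 define S where "S = {b \<in> {0..1}. \<exists>x. T (c + of_real x + of_real b * tau) = 0}"
 have Pc: "continuous_on X P" for X by (intro continuous_at_imp_continuous_on ballI P_isCont)
 have comp: "continuous_on B (\<lambda>z. g (c + of_real (h1 z) + of_real (h2 z) * tau))"
  if "continuous_on (range id) g" "continuous_on B h1" "continuous_on B h2" for g :: "complex \<Rightarrow> 'z :: topological_space" and B :: "'y :: topological_space set" and h1 h2
  by (rule continuous_on_compose2[OF that(1)]) (auto intro!: continuous_intros that)
 have cP: "continuous_on B (\<lambda>x. P (c + of_real x + of_real b * tau))" for B b
  by (rule continuous_on_compose2[OF Pc[of UNIV]]) (auto intro!: continuous_intros)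
 have cq: "continuous_on B (\<lambda>x. q (c + of_real x + of_real b * tau))" for B b
  by (rule continuous_on_compose2[OF q_cont[of UNIV]]) (auto intro!: continuous_intros)
 have A_cont: "continuous_on {0..1} A" unfolding A_def
  by (rule integral_continuous_on_param) (simp add: case_prod_unfold, intro comp Pc continuous_intros)
 have Q_cont: "continuous_on X Q" for X unfolding Q_def
  by (rule integral_continuous_on_param) (simp add: case_prod_unfold, intro comp q_cont continuous_intros)
 have dA: "(A has_vector_derivative (cnj tau - tau) * of_real (Q b)) (at b)" if b: "b \<in> {0<..<1} - S" for b
 proof -
  have "open ({0<..<1} - S)" using bad_finite[of c] unfolding S_def[symmetric]
   by (intro open_Diff finite_imp_closed) auto
  from openE[OF this b] obtain delta where delta: "delta > 0" "ball b delta \<subseteq> {0<..<1} - S" .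
  let ?v = "\<lambda>b x. c + of_real x + of_real b * tau"
  have T0: "T (?v b' x) \<noteq> 0" if "b' \<in> ball b delta" for b' x using that delta(2) by (auto simp: S_def)
  let ?D = "\<lambda>b x. Px (?v b x) * tau + of_real (q (?v b x)) * cnj tau"
  have Px_c: "continuous_on (ball b delta \<times> cbox 0 1) (\<lambda>z. Px (?v (fst z) (snd z)))"
   by (rule continuous_on_compose2[OF Px_cont[of "{z. T z \<noteq> 0}"]]) (auto intro!: continuous_intros T0)
  have L: "((\<lambda>b. integral (cbox 0 1) (\<lambda>x. P (?v b x))) has_vector_derivative integral (cbox 0 1) (?D b)) (at b within ball b delta)"
  proof (rule leibniz_rule_vector_derivative)
   fix b' x assume b': "b' \<in> ball b delta"
   show "((\<lambda>b. P (?v b x)) has_vector_derivative ?D b' x) (at b' within ball b delta)"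
    by (rule has_vector_derivative_at_within[OF has_wirt_line[OF P_wirt[OF T0[OF b']]]])
  next
   fix b' show "(\<lambda>x. P (?v b' x)) integrable_on cbox 0 1" by (rule integrable_continuous[OF cP])
  next
   show "continuous_on (ball b delta \<times> cbox 0 1) (\<lambda>(b, x). ?D b x)" unfolding case_prod_unfold
    by (rule continuous_on_add[OF continuous_on_mult_right[OF Px_c] continuous_on_mult_right[OF continuous_on_of_real]],
      rule continuous_on_compose2[OF q_cont[of UNIV]]) (auto intro!: continuous_intros)
  qed (use delta in auto)
  have bb: "b \<in> ball b delta" using delta by simp
  have x1: "((\<lambda>x. P (?v b x)) has_vector_derivative (Px (?v b x) + of_real (q (?v b x)))) (at x)" for x
  proof -
   have e: "?v b x = (c + of_real b * tau) + of_real x * 1" for x by simp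
   have "((\<lambda>x. P ((c + of_real b * tau) + of_real x * 1)) has_vector_derivative (Px (?v b x) * 1 + of_real (q (?v b x)) * cnj 1)) (at x)"
    by (rule has_wirt_line) (use P_wirt[OF T0[OF bb, of x]] in \<open>simp add: add_ac\<close>)
   thus ?thesis unfolding e by simp
  qed
  \<comment> \<open>\<open>Px\<close> + q is the derivative of P along the horizontal period and
    integrates to 0; this removes \<open>Px\<close> from the derivative of A and leaves (cnj tau -
    tau) Q.\<close>
  have "((\<lambda>x. Px (?v b x) + of_real (q (?v b x))) has_integral (P (?v b 1) - P (?v b 0))) {0..1}"
   by (rule fundamental_theorem_of_calculus) (auto intro: has_vector_derivative_at_within x1)
  moreover have "P (?v b 1) = P (?v b 0)" using P_shift[of 1 "c + of_real b * tau"] by (simp add: add_ac)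
  ultimately have I0: "((\<lambda>x. Px (?v b x) + of_real (q (?v b x))) has_integral 0) (cbox 0 1)" by simp
  have "(\<lambda>x. q (?v b x)) integrable_on cbox 0 1" by (rule integrable_continuous[OF cq])
  hence Iq: "((\<lambda>x. q (?v b x)) has_integral Q b) (cbox 0 1)" unfolding Q_def by (rule integrable_integral)
  have I1: "((\<lambda>x. complex_of_real (q (?v b x))) has_integral of_real (Q b)) (cbox 0 1)"
   using has_integral_linear[OF Iq bounded_linear_of_real] unfolding o_def .
  have "((\<lambda>x. tau * (Px (?v b x) + of_real (q (?v b x))) + (cnj tau - tau) * of_real (q (?v b x))) has_integral
    (tau * 0 + (cnj tau - tau) * of_real (Q b))) (cbox 0 1)" by (intro has_integral_add has_integral_mult_right I0 I1)
  hence "integral (cbox 0 1) (?D b) = (cnj tau - tau) * of_real (Q b)"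
   by (intro integral_unique) (simp add: algebra_simps)
  from L[unfolded this at_within_open[OF bb open_ball]] show ?thesis unfolding A_def .
 qed
 have "((\<lambda>b. (cnj tau - tau) * of_real (Q b)) has_integral (A 1 - A 0)) {0..1}"
  by (rule fundamental_theorem_of_calculus_interior_strong[OF bad_finite[of c, folded S_def] _ dA A_cont]) auto
 moreover have "A 1 = A 0"
 proof -
  have "P (c + of_real x + of_real 1 * tau) = P (c + of_real x + of_real 0 * tau)" for x
   using P_shift[of tau "c + of_real x"] by simp
  thus ?thesis unfolding A_def by (simp only:)
 qed
 ultimately have "((\<lambda>b. (cnj tau - tau) * of_real (Q b)) has_integral 0) {0..1}" by simp
 from has_integral_linear[OF this bounded_linear_Im]
 have "((\<lambda>b. - 2 * Im tau * Q b) has_integral 0) {0..1}" by (simp add: o_def)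
 from has_integral_mult_right[OF this, of "- 1 / (2 * Im tau)"]
 \<comment> \<open>A 1 = A 0 by periodicity in tau, and cnj tau - tau = -2 i Im tau is not 0, so the
   integral of Q vanishes; nonnegativity and continuity give q = 0 on the side b = 0, in particular
   at the corner c.\<close>
 have Q0: "(Q has_integral 0) (cbox 0 1)" using y by simp
 have q0: "q v \<ge> 0" for v by (simp add: q_def)
 note qc = cq[of "cbox 0 1" 0]
 have "Q 0 = 0"
  by (rule has_integral_0_cbox_imp_0[OF Q_cont _ Q0]) (auto simp: Q_def intro!: integral_nonneg integrable_continuous[OF cq, unfolded cbox_interval] q0)
 hence "((\<lambda>x. q (c + of_real x + of_real 0 * tau)) has_integral 0) (cbox 0 1)"
  using integrable_integral[OF integrable_continuous[OF qc]] by (simp add: Q_def)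
 from has_integral_0_cbox_imp_0[OF qc q0 this, of 0] have "q c = 0" by simp
 thus ?thesis by (simp add: q_def)
qed

text \<open>Since H = 0, G is entire in v and f = G / T is entire. |f|^2 exp W is continuous and
  doubly periodic, hence bounded; as W >= 0, f is bounded and so constant, and as W is unbounded the
  constant is 0.\<close>

lemma G_zero: "G u v = 0"
proof -
 have "((\<lambda>w. G u w) has_field_derivative Gv u v) (at v)" for v
  using slice_wirt[of u v] unfolding H_zero by (intro has_wirt_imp_field) simp
 hence Gh: "(\<lambda>w. G u w) holomorphic_on UNIV" by (auto simp: holomorphic_on_open field_differentiable_def)
 obtain e where e: "e holomorphic_on UNIV" "\<forall>w. G u w = T w * e w"
  using entire_quotient[OF Gh T_hol zero_on_divisor T_simple[folded deriv_T]] by (auto simp: T_def)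
 have ef: "e w = f w" for w
 proof (rule isCont_eqI[where f = e and z = w and g = f])
  show "isCont e w" using holomorphic_on_imp_continuous_on[OF e(1)] by (simp add: continuous_on_eq_continuous_at)
  show "\<forall>\<^sub>F x in at w. e x = f x" by (rule eventually_mono[OF T_eventually]) (simp add: f_def e(2))
 qed (rule f_cont)
 have "continuous_on UNIV (\<lambda>v. (norm (f v))^2 * exp (W v))"
  by (intro continuous_intros continuous_at_imp_continuous_on ballI f_cont W_cont)
 then obtain C where C: "\<And>v. (norm (f v))^2 * exp (W v) \<le> C"
  using doubly_periodic_bounded[of "\<lambda>v. (norm (f v))^2 * exp (W v)" tau] y norm_f_shift by blast
 have W0: "W v \<ge> 0" for v using y m by (simp add: W_def)
 have "(norm (f v))^2 \<le> C" for v
 proof -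
  have "(norm (f v))^2 * 1 \<le> (norm (f v))^2 * exp (W v)" using W0[of v] by (intro mult_left_mono) auto
  thus ?thesis using C[of v] by simp
 qed
 hence "norm (e v) \<le> sqrt C" for v unfolding ef by (intro real_le_rsqrt)
 hence "bounded (range e)" unfolding bounded_iff by blast
 from Liouville_theorem[OF e(1) this] obtain a where a: "\<And>v. e v = a" by (auto simp: constant_on_def)
 have "a = 0"
 proof (rule ccontr)
  assume "a \<noteq> 0"
  define A where "A = (norm a)^2"
  have A: "A > 0" using \<open>a \<noteq> 0\<close> by (simp add: A_def)
  \<comment> \<open>Solves W(i x) = |C| / A; then A exp(|C| / A) >= A + |C| exceeds the bound
    C.\<close>
  define x where "x = sqrt (\<bar>C\<bar> / A * Im tau / (4 * pi * m))"
  have "W (\<i> * of_real x) = \<bar>C\<bar> / A" using y m A by (simp add: W_def x_def)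
  moreover have "A * exp (W (\<i> * of_real x)) \<le> C" using C[of "\<i> * of_real x"] unfolding ef[symmetric] a A_def .
  ultimately have "A * exp (\<bar>C\<bar> / A) \<le> C" by simp
  moreover have "A * (1 + \<bar>C\<bar> / A) \<le> A * exp (\<bar>C\<bar> / A)" using A by (intro mult_left_mono exp_ge_add_one_self) auto
  moreover have "A * (1 + \<bar>C\<bar> / A) = A + \<bar>C\<bar>" using A by (simp add: field_simps)
  ultimately show False using A by linarith
 qed
 thus ?thesis using e(2) a by simp
qed

end

text \<open>The vanishing is known for u with theta11(2u) nonzero, and these u accumulate at every
  point, so continuity in u suffices.\<close>

lemma (in theta_slice) G_eq_0:
 assumes d: "\<And>v. G v v = 0" "\<And>v. G v (- v) = 0"
 shows "G u v = 0"
proof (rule isCont_eqI[where f = "\<lambda>u. G u v" and z = u and g = "\<lambda>_. 0"])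
 have "isCont (\<lambda>p. G (fst p) (snd p)) (u, v)" using G_deriv by (rule has_derivative_continuous)
 moreover have "isCont (\<lambda>u. (u, v)) u" by (intro continuous_intros)
 ultimately show "isCont (\<lambda>u. G u v) u" using isCont_o2[of u "\<lambda>u. (u, v)" "\<lambda>p. G (fst p) (snd p)"] by simp
 have "G w v = 0" if "theta11 tau (2 * w + 0) \<noteq> 0" for w
 proof -
  interpret theta_slice_zero m s s' tau G H Gu Gv Hb w by unfold_locales (use d that in auto)
  show ?thesis by (rule G_zero)
 qed
 thus "\<forall>\<^sub>F w in at u. G w v = 0"
  by (rule eventually_mono[OF eventually_theta_nonzero[OF y, of 2 0], rotated]) simp_all
qed simp

text \<open>By \<open>N_eq\<close> the diagonal values of both slices are multiples of theta11(2v),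
  so r = c / kappa makes the difference vanish there. On the antidiagonal the difference vanishes by
  \<open>K_eq\<close>, and \<open>G_eq_0\<close> applies.\<close>

lemma theta_slice_unique:
 assumes 1: "theta_slice m s s' tau G H Gu Gv Hb" and 2: "theta_slice m s s' tau G2 H2 Gu2 Gv2 Hb2"
  and d: "\<And>v. G2 v v = kappa * theta11 tau (2 * v)" and kappa: "kappa \<noteq> 0" and ms: "m = 1 \<Longrightarrow> s \<notin> \<int> \<or> s' \<notin> \<int>"
 shows "\<exists>r. \<forall>u v. G u v = r * G2 u v"
proof -
 interpret a: theta_slice m s s' tau G H Gu Gv Hb by fact
 obtain c where c: "\<And>z. a.N z = c * theta11 tau z" using a.N_eq by blast
 define r where "r = c / kappa"
 interpret b: theta_slice m s s' tau "\<lambda>u v. G u v - r * G2 u v" "\<lambda>u v. H u v - r * H2 u v" "\<lambda>u v. Gu u v - r * Gu2 u v"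
  "\<lambda>u v. Gv u v - r * Gv2 u v" "\<lambda>u v. Hb u v - r * Hb2 u v" by (rule theta_slice_lincomb[OF 1 2])
 have "G v v - r * G2 v v = 0" for v using c[of "2 * v"] kappa by (simp add: a.N_def d r_def)
 moreover have "G v (- v) - r * G2 v (- v) = 0" for v using b.K_eq[OF ms, of "- 2 * v"] by (simp add: b.K_def)
 ultimately have "G u v - r * G2 u v = 0" for u v by (rule b.G_eq_0)
 thus ?thesis by auto
qed

section \<open>From elements of the space to slices\<close>

lemma ra4_slice_isCont:
 assumes F: "ra4 F X" and y: "Im tau > 0" shows "isCont (\<lambda>w. F tau u w t) v" "isCont (\<lambda>w. F tau w v t) u"
proof -
 have d: "uc F differentiable (at (tau, u, v, t))" by (rule ra4_differentiable[OF F]) (use y in \<open>simp add: X_def\<close>)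
 show "isCont (\<lambda>w. F tau u w t) v" by (rule has_derivative_continuous[OF slice_frechet(3)[OF d]])
 show "isCont (\<lambda>w. F tau w v t) u" by (rule has_derivative_continuous[OF slice_frechet(2)[OF d]])
qed

lemma eventually_TT:
 assumes y: "Im tau > 0" shows "\<forall>\<^sub>F w in at v. TT tau u w \<noteq> 0"
 using eventually_theta_nonzero[OF y one_neq_zero, of "- u" v] eventually_theta_nonzero[OF y one_neq_zero, of u v]
 by (simp only: mult_1_left, eventually_elim) (simp add: TT_def)

lemma regular_iff_TT: "(tau, u, v, t) \<in> regular \<longleftrightarrow> Im tau > 0 \<and> TT tau u v \<noteq> 0" by (simp add: regular_def X_def TT_def)

lemma theta_isCont: "Im tau > 0 \<Longrightarrow> isCont (\<lambda>w. theta11 tau (w + c)) v" by (rule isCont_o2[where g = "theta11 tau"])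
   (auto intro!: continuous_intros DERIV_isCont[OF theta_has_deriv])

lemma TT_isCont: "Im tau > 0 \<Longrightarrow> isCont (\<lambda>w. TT tau u w) v"
 unfolding TT_def using theta_isCont[where tau = tau and c = "- u" and v = v] theta_isCont[where tau = tau and c = u and v = v]
 by (auto intro!: continuous_intros)

lemma TT_shift_1: "TT tau (u + of_int j) (v + of_int k) = TT tau u v"
proof -
 have a: "v + of_int k - (u + of_int j) = v - u + of_int (k - j)" "v + of_int k + (u + of_int j) = v + u + of_int (k + j)"
  by simp_all
 have "(-1) powi (k - j) * (-1) powi (k + j) = ((-1) powi (2 * k) :: complex)" by (simp flip: power_int_add)
 also have "\<dots> = 1" by (simp add: power_int_mult)
 finally show ?thesis unfolding TT_def a theta11_shift_1 by (simp add: mult_ac flip: mult.assoc)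
qed

lemma TT_shift_tau:
 "TT tau (u + of_int j * tau) (v + of_int k * tau) = e2pi (- of_int (k^2 + j^2) * tau - 2 * of_int k * v - 2 * of_int j * u) * TT tau u v"
proof -
 have a: "v + of_int k * tau - (u + of_int j * tau) = v - u + of_int (k - j) * tau" "v + of_int k * tau + (u + of_int j * tau) = v + u + of_int (k + j) * tau"
  by (simp_all add: algebra_simps)
 have "(-1) powi (k - j) * (-1) powi (k + j) = ((-1) powi (2 * k) :: complex)" by (simp flip: power_int_add)
 also have "\<dots> = 1" by (simp add: power_int_mult)
 finally have s: "(-1) powi (k - j) * (-1) powi (k + j) = (1 :: complex)" .
 have "e2pi (- of_real ((of_int (k - j))^2 / 2) * tau - of_int (k - j) * (v - u)) * e2pi (- of_real ((of_int (k + j))^2 / 2) * tau - of_int (k + j) * (v + u))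
   = e2pi (- of_int (k^2 + j^2) * tau - 2 * of_int k * v - 2 * of_int j * u)" unfolding e2pi_add[symmetric]
  by (rule e2pi_eqI) (simp add: field_simps power2_eq_square)
 note q = this
 have "TT tau (u + of_int j * tau) (v + of_int k * tau) = ((-1) powi (k - j) * (-1) powi (k + j)) *
   (e2pi (- of_real ((of_int (k - j))^2 / 2) * tau - of_int (k - j) * (v - u)) * e2pi (- of_real ((of_int (k + j))^2 / 2) * tau - of_int (k + j) * (v + u))) * TT tau u v"
  unfolding TT_def a theta11_shift_tau by (simp only: mult_ac)
 thus ?thesis unfolding s q by simp
qed

text \<open>An element F of the space together with chosen witnesses \<open>G4\<close> and
  \<open>H4\<close> for the two extensions in (F2); used both for an arbitrary F and for phi
  tilde.\<close>

locale fspace_element =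
 fixes m s s' :: real and F G4 H4 :: fun4
 assumes m: "m \<ge> 1" "2 * m \<in> \<int>" and s: "s \<in> half_ints" "s' \<in> half_ints"
  and F: "F1 m F" "F3 m s s' F" "F4 m F" "F5 F"
  and G4: "\<And>tau u v t. (tau, u, v, t) \<in> regular \<Longrightarrow> G4 tau u v t = theta11 tau (v - u) * theta11 tau (v + u) * F tau u v t"
   "\<And>tau v t. Im tau > 0 \<Longrightarrow> (\<lambda>u. G4 tau u v t) holomorphic_on UNIV" "ra4 G4 X"
  and H4: "\<And>tau u v t. (tau, u, v, t) \<in> regular \<Longrightarrow> H4 tau u v t = d_vbar F tau u v t" "ra4 H4 X"
begin

lemma F_wirt_v:
 assumes p: "(tau, u, v, t) \<in> regular"
 shows "(\<lambda>w. F tau u w t) differentiable (at v)" (is ?c1)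
  and "d_vbar G4 tau u v t = TT tau u v * d_vbar F tau u v t" (is ?c2)
proof -
 have y: "Im tau > 0" and T0: "TT tau u v \<noteq> 0" using p by (simp_all add: regular_iff_TT)
 have th: "((\<lambda>w. theta11 tau (w + c)) has_field_derivative theta_d tau (v + c)) (at v)" for c
  using theta_has_deriv[OF y, of "v + c"] by (simp add: DERIV_shift)
 obtain D where D: "((\<lambda>w. TT tau u w) has_field_derivative D) (at v)"
  using DERIV_mult[OF th[of "- u"] th[of u]] unfolding TT_def by simp
 have Di: "((\<lambda>w. 1 / TT tau u w) has_field_derivative - D / (TT tau u v)^2) (at v)"
  using T0 by (auto intro!: derivative_eq_intros D simp: power2_eq_square)
 have "uc G4 differentiable (at (tau, u, v, t))" by (rule ra4_differentiable[OF G4(3)]) (use y in \<open>simp add: X_def\<close>)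
 from has_wirtI[OF slice_differentiable(3)[OF this]]
 have w: "has_wirt (\<lambda>w. G4 tau u w t) v (d_v G4 tau u v t) (d_vbar G4 tau u v t)" unfolding d_v_def d_vbar_def .
 have "has_wirt (\<lambda>w. F tau u w t) v (d_v G4 tau u v t * (1 / TT tau u v) + G4 tau u v t * (- D / (TT tau u v)^2))
   (d_vbar G4 tau u v t * (1 / TT tau u v) + G4 tau u v t * 0)"
  by (rule has_wirt_cong[OF has_wirt_mult[OF w has_wirt_field[OF Di]] open_slice(3)[OF open_regular, of tau u t]])
    (use p in \<open>auto simp: regular_iff_TT G4(1) TT_def\<close>)
 from has_wirt_differentiable[OF this] has_wirt_imp_wirt_bar[OF this]
 show ?c1 "d_vbar G4 tau u v t = TT tau u v * d_vbar F tau u v t"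
  using T0 unfolding d_vbar_def[of F] by (simp_all add: field_simps)
qed

text \<open>This is Delta F = 0, with the derivative in t evaluated to 2 pi i m by (F1).\<close>

lemma H_eq:
 assumes p: "(tau, u, v, t) \<in> regular"
 shows "d_v H4 tau u v t = 4 * of_real pi * \<i> * of_real m * acoord tau v * H4 tau u v t"
proof -
 have q: "d_vbar F tau u v t = e2pi (of_real m * t) * d_vbar F tau u v 0" for t
 proof -
  have p0: "(tau, u, v, 0) \<in> regular" and pt: "(tau, u, v, t) \<in> regular" using p by (simp_all add: regular_iff_TT)
  have "has_wirt (\<lambda>w. F tau u w t) v (e2pi (of_real m * t) * d_v F tau u v 0) (e2pi (of_real m * t) * d_vbar F tau u v 0)"
   unfolding d_v_def d_vbar_def
  proof (rule has_wirt_cong[OF has_wirt_cmult[OF has_wirtI[OF F_wirt_v(1)[OF p0]]] open_slice(3)[OF open_regular, of tau u t]])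
   fix w assume "w \<in> {w. (tau, u, w, t) \<in> regular}"
   thus "e2pi (of_real m * t) * F tau u w 0 = F tau u w t" using F(1) unfolding F1_def by simp
  qed (use pt in simp)
  from has_wirt_imp_wirt_bar[OF this] show ?thesis unfolding d_vbar_def[of F tau u v t] .
 qed
 have "has_wirt (\<lambda>w. d_vbar F tau u w t) v (d_v H4 tau u v t) (d_vbar H4 tau u v t)"
 proof (rule has_wirt_cong[OF _ open_slice(3)[OF open_regular, of tau u t]])
  have "uc H4 differentiable (at (tau, u, v, t))" by (rule ra4_differentiable[OF H4(2)]) (use p in \<open>simp add: regular_def\<close>)
  from has_wirtI[OF slice_differentiable(3)[OF this]]
  show "has_wirt (\<lambda>w. H4 tau u w t) v (d_v H4 tau u v t) (d_vbar H4 tau u v t)" unfolding d_v_def d_vbar_def .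
 qed (use p H4(1) in auto)
 hence "d_v (d_vbar F) tau u v t = d_v H4 tau u v t" unfolding d_v_def[of "d_vbar F"] by (rule has_wirt_imp_wirt)
 moreover have "opDelta F tau u v t = 0" using F(4) p unfolding F5_def by simp
 ultimately have "2 * acoord tau v * (2 * of_real pi * \<i> * of_real m * d_vbar F tau u v t) - d_v H4 tau u v t = 0"
  unfolding opDelta_def d_t_e2pi[of "d_vbar F" tau u v m, OF q] by simp
 hence "d_v H4 tau u v t = 2 * acoord tau v * (2 * of_real pi * \<i> * of_real m * d_vbar F tau u v t)" by simp
 thus ?thesis unfolding H4(1)[OF p] by (simp add: mult_ac)
qed

lemma slice:
 assumes y: "Im tau > 0"
 shows "theta_slice m s s' tau (\<lambda>u v. G4 tau u v 0) (\<lambda>u v. H4 tau u v 0) (\<lambda>u v. d_uw G4 tau u v 0)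
   (\<lambda>u v. d_v G4 tau u v 0) (\<lambda>u v. d_vbar H4 tau u v 0)"
proof -
 have c: "isCont (\<lambda>w. G4 tau a (w + b) 0) v" for a b v
  by (rule isCont_o2[where g = "\<lambda>w. G4 tau a w 0", OF _ ra4_slice_isCont(1)[OF G4(3) y]]) (intro continuous_intros)
 have c0: "isCont (\<lambda>w. G4 tau a w 0) v" for a v by (rule ra4_slice_isCont(1)[OF G4(3) y])
 \<comment> \<open>For fixed u the points v with nonzero \<open>TT\<close> accumulate everywhere, so
   identities obtained from F at regular points extend to all v.\<close>
 have dense: "A v = B v" if "isCont A v" "isCont B v" "\<And>w. TT tau u w \<noteq> 0 \<Longrightarrow> A w = B w" for A B :: "complex \<Rightarrow> complex" and u v
  by (rule isCont_eqI[OF that(1,2)]) (rule eventually_mono[OF eventually_TT[OF y] that(3)])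
 have reg: "(tau, u, v, t) \<in> regular \<longleftrightarrow> TT tau u v \<noteq> 0" for u v t using y by (simp add: regular_iff_TT)
 have GF: "G4 tau u v 0 = TT tau u v * F tau u v 0" if "TT tau u v \<noteq> 0" for u v
  using G4(1)[of tau u v 0] that reg by (simp add: TT_def)
 have thc: "isCont (\<lambda>w. theta11 tau (w + a)) v" for a v by (rule theta_isCont[OF y])
 show ?thesis
 proof
  show "m \<ge> 1" "2 * m \<in> \<int>" "s \<in> half_ints" "s' \<in> half_ints" "Im tau > 0" by (rule m s y)+
 next
  fix u v and j k :: int
  show "G4 tau (u + of_int j) (v + of_int k) 0 = e2pi (of_real (s * of_int (j + k))) * G4 tau u v 0"
  proof (rule dense[where A = "\<lambda>v. G4 tau (u + of_int j) (v + of_int k) 0" and u = u])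
   fix w assume T: "TT tau u w \<noteq> 0"
   have T': "TT tau (u + of_int j) (w + of_int k) \<noteq> 0" using T by (simp add: TT_shift_1)
   have "F tau (u + of_int j) (w + of_int k) 0 = e2pi (of_real (s * of_int (j + k))) * F tau u w 0"
    using F(2) T reg unfolding F3_def by blast
   thus "G4 tau (u + of_int j) (w + of_int k) 0 = e2pi (of_real (s * of_int (j + k))) * G4 tau u w 0"
    unfolding GF[OF T] GF[OF T'] TT_shift_1 by simp
  qed (intro c continuous_intros c0)+
  show "G4 tau (u + of_int j * tau) (v + of_int k * tau) 0 = e2pi (of_real (s' * of_int (j + k))
   + 2 * of_real m * (of_int k * v - of_int j * u) + of_real (m * of_int (k^2 - j\<^sup>2)) * tau
   - of_int (k^2 + j^2) * tau - 2 * of_int k * v - 2 * of_int j * u) * G4 tau u v 0" (is "_ = e2pi (?e v) * _")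
  proof (rule dense[where A = "\<lambda>v. G4 tau (u + of_int j * tau) (v + of_int k * tau) 0" and B = "\<lambda>v. e2pi (?e v) * G4 tau u v 0" and u = u])
   show "isCont (\<lambda>v. e2pi (?e v) * G4 tau u v 0) v" unfolding e2pi_def by (intro continuous_intros c0)
   fix w assume T: "TT tau u w \<noteq> 0"
   have T': "TT tau (u + of_int j * tau) (w + of_int k * tau) \<noteq> 0" using T by (simp add: TT_shift_tau)
   have f: "F tau (u + of_int j * tau) (w + of_int k * tau) 0 = e2pi (of_real (s' * of_int (j + k)) + 2 * of_real m * (of_int k * w - of_int j * u))
      * qpow tau (m * of_int (k^2 - j\<^sup>2)) * F tau u w 0" using F(2) T reg unfolding F3_def by blast
   have q: "e2pi (- of_int (k^2 + j^2) * tau - 2 * of_int k * w - 2 * of_int j * u) * (e2pi (of_real (s' * of_int (j + k)) + 2 * of_real m * (of_int k * w - of_int j * u))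
      * qpow tau (m * of_int (k^2 - j\<^sup>2))) = e2pi (?e w)"
    unfolding qpow_e2pi e2pi_add[symmetric] by (rule e2pi_eqI) (simp add: algebra_simps)
   show "G4 tau (u + of_int j * tau) (w + of_int k * tau) 0 = e2pi (?e w) * G4 tau u w 0"
    unfolding GF[OF T] GF[OF T'] TT_shift_tau f q[symmetric] by (simp only: mult_ac)
  qed (rule c)
  \<comment> \<open>These shifts do not preserve regularity. The theta product at the shifted point
    is theta11(v - u) theta11(v + u + 2h); multiplying by theta11(v + u) gives an identity that
    makes sense at all points.\<close>
  have half: "theta11 tau (v + u) * G4 tau (u + h) (v + h) 0 = mu v * theta11 tau (v + u + 2 * h) * G4 tau u v 0"
   if mc: "\<And>v. isCont mu v" and Fh: "\<And>w. TT tau u w \<noteq> 0 \<Longrightarrow> TT tau (u + h) (w + h) \<noteq> 0 \<Longrightarrow> F tau (u + h) (w + h) 0 = mu w * F tau u w 0" for h mu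
  proof (rule isCont_eqI[where f = "\<lambda>v. theta11 tau (v + u) * G4 tau (u + h) (v + h) 0" and z = v and g = "\<lambda>v. mu v * theta11 tau (v + u + 2 * h) * G4 tau u v 0"])
   show "isCont (\<lambda>v. theta11 tau (v + u) * G4 tau (u + h) (v + h) 0) v" by (intro continuous_intros thc c)
   have "isCont (\<lambda>v. theta11 tau (v + u + 2 * h)) v" unfolding add.assoc by (rule thc)
   thus "isCont (\<lambda>v. mu v * theta11 tau (v + u + 2 * h) * G4 tau u v 0) v" by (intro continuous_intros mc c0)
   show "\<forall>\<^sub>F w in at v. theta11 tau (w + u) * G4 tau (u + h) (w + h) 0 = mu w * theta11 tau (w + u + 2 * h) * G4 tau u w 0"
    using eventually_TT[OF y, of u v] eventually_theta_nonzero[OF y one_neq_zero, of "u + 2 * h" v]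
   proof eventually_elim
    case (elim w)
    have e: "w + h - (u + h) = w - u" "w + h + (u + h) = w + u + 2 * h" by simp_all
    have th: "theta11 tau (w + u + 2 * h) \<noteq> 0" using elim(2) by (simp add: add_ac)
    have TT': "TT tau (u + h) (w + h) = theta11 tau (w - u) * theta11 tau (w + u + 2 * h)" unfolding TT_def e ..
    hence T': "TT tau (u + h) (w + h) \<noteq> 0" using elim(1) th by (simp add: TT_def)
    show ?case unfolding GF[OF elim(1)] GF[OF T'] Fh[OF elim(1) T'] TT' TT_def[of tau u w] by (simp only: mult_ac)
   qed
  qed
  have h: "theta11 tau (v + u) * G4 tau (u + 1 / (2 * of_real m)) (v + 1 / (2 * of_real m)) 0
   = 1 * theta11 tau (v + u + 2 * (1 / (2 * of_real m))) * G4 tau u v 0"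
  proof (rule half[of "\<lambda>_. 1"])
   fix w assume "TT tau u w \<noteq> 0" "TT tau (u + 1 / (2 * of_real m)) (w + 1 / (2 * of_real m)) \<noteq> 0"
   thus "F tau (u + 1 / (2 * of_real m)) (w + 1 / (2 * of_real m)) 0 = 1 * F tau u w 0"
    using conjunct1[OF F(3)[unfolded F4_def Let_def, rule_format, of tau u w 0 1]] reg by simp
  qed simp
  thus "theta11 tau (v + u) * G4 tau (u + 1 / (2 * of_real m)) (v + 1 / (2 * of_real m)) 0
   = theta11 tau (v + u + 1 / of_real m) * G4 tau u v 0" by simp
  have h: "theta11 tau (v + u) * G4 tau (u + tau / (2 * of_real m)) (v + tau / (2 * of_real m)) 0
   = e2pi (v - u) * theta11 tau (v + u + 2 * (tau / (2 * of_real m))) * G4 tau u v 0"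
  proof (rule half[of "\<lambda>v. e2pi (v - u)"])
   show "isCont (\<lambda>v. e2pi (v - u)) v" for v unfolding e2pi_def by (intro continuous_intros)
   fix w assume "TT tau u w \<noteq> 0" "TT tau (u + tau / (2 * of_real m)) (w + tau / (2 * of_real m)) \<noteq> 0"
   thus "F tau (u + tau / (2 * of_real m)) (w + tau / (2 * of_real m)) 0 = e2pi (w - u) * F tau u w 0"
    using conjunct2[OF F(3)[unfolded F4_def Let_def, rule_format, of tau u w 0 1]] reg by simp
  qed
  thus "theta11 tau (v + u) * G4 tau (u + tau / (2 * of_real m)) (v + tau / (2 * of_real m)) 0
   = e2pi (v - u) * theta11 tau (v + u + tau / of_real m) * G4 tau u v 0" by simp
 next
  fix u v
  have pX: "(tau, u, v, 0) \<in> X" using y by (simp add: X_def)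
  have d: "uc G4 differentiable (at (tau, u, v, 0))" by (rule ra4_differentiable[OF G4(3) pX])
  define D where "D = frechet_derivative (uc G4) (at (tau, u, v, 0))"
  have D: "(uc G4 has_derivative D) (at (tau, u, v, 0))" using d unfolding D_def by (simp flip: frechet_derivative_works)
  interpret D: bounded_linear D using D by (rule has_derivative_bounded_linear)
  have wu: "has_wirt (\<lambda>w. G4 tau w v 0) u (d_uw G4 tau u v 0) 0"
  proof -
   have f: "((\<lambda>w. G4 tau w v 0) has_field_derivative deriv (\<lambda>w. G4 tau w v 0) u) (at u)"
    by (rule holomorphic_derivI[OF G4(2)[OF y]]) auto
   show ?thesis unfolding d_uw_def has_wirt_imp_wirt[OF has_wirt_field[OF f]] by (rule has_wirt_field[OF f])
  qed
  have wv: "has_wirt (\<lambda>w. G4 tau u w 0) v (d_v G4 tau u v 0) (d_vbar G4 tau u v 0)"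
   using has_wirtI[OF slice_differentiable(3)[OF d]] unfolding d_v_def d_vbar_def .
  have vb: "d_vbar G4 tau u v 0 = TT tau u v * H4 tau u v 0"
  proof (rule dense[where A = "\<lambda>v. d_vbar G4 tau u v 0" and B = "\<lambda>v. TT tau u v * H4 tau u v 0" and u = u])
   show "isCont (\<lambda>v. d_vbar G4 tau u v 0) v"
    by (rule ra4_slice_isCont(1)[OF first_order_ra4[OF first_order_d_vbar G4(3)] y])
   show "isCont (\<lambda>v. TT tau u v * H4 tau u v 0) v"
    by (intro continuous_intros TT_isCont[OF y] ra4_slice_isCont(1)[OF H4(2) y])
   fix w assume "TT tau u w \<noteq> 0"
   hence p: "(tau, u, w, 0) \<in> regular" by (simp add: reg)
   show "d_vbar G4 tau u w 0 = TT tau u w * H4 tau u w 0" unfolding F_wirt_v(2)[OF p] H4(1)[OF p] ..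
  qed
  have Du: "D (0, h, 0, 0) = d_uw G4 tau u v 0 * h" for h
   using has_derivative_unique[OF slice_frechet(2)[OF d, folded D_def] wu[unfolded has_wirt_def]] by (simp add: fun_eq_iff)
  have Dv: "D (0, 0, h, 0) = d_v G4 tau u v 0 * h + TT tau u v * H4 tau u v 0 * cnj h" for h
   using has_derivative_unique[OF slice_frechet(3)[OF d, folded D_def] wv[unfolded has_wirt_def vb]] by (simp add: fun_eq_iff)
  have i: "((\<lambda>p. (tau, fst p, snd p, 0)) has_derivative (\<lambda>h. (0, fst h, snd h, 0))) (at (u, v))"
   by (auto intro!: derivative_eq_intros simp: zero_prod_def)
  have "((\<lambda>p. uc G4 (tau, fst p, snd p, 0)) has_derivative (\<lambda>h. D (0, fst h, snd h, 0))) (at (u, v))"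
   using has_derivative_compose[OF i, of "uc G4" D] D by simp
  moreover have "D (0, fst h, snd h, 0) = d_uw G4 tau u v 0 * fst h + d_v G4 tau u v 0 * snd h + TT tau u v * H4 tau u v 0 * cnj (snd h)" for h
  proof -
   have "D (0, fst h, snd h, 0) = D ((0, fst h, 0, 0) + (0, 0, snd h, 0))" by simp
   thus ?thesis unfolding D.add Du Dv by simp
  qed
  ultimately show "((\<lambda>p. G4 tau (fst p) (snd p) 0) has_derivative
   (\<lambda>h. d_uw G4 tau u v 0 * fst h + d_v G4 tau u v 0 * snd h + TT tau u v * H4 tau u v 0 * cnj (snd h))) (at (u, v))"
   by simp
 next
  fix u
  show "continuous_on UNIV (\<lambda>v. d_v G4 tau u v 0)"
   by (intro continuous_at_imp_continuous_on ballI ra4_slice_isCont(1)[OF first_order_ra4[OF first_order_d_v G4(3)] y])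
 next
  fix u v
  have pX: "(tau, u, v, 0) \<in> X" using y by (simp add: X_def)
  have w: "has_wirt (\<lambda>w. H4 tau u w 0) v (d_v H4 tau u v 0) (d_vbar H4 tau u v 0)"
   using has_wirtI[OF slice_differentiable(3)[OF ra4_differentiable[OF H4(2) pX]]] unfolding d_v_def d_vbar_def .
  have "d_v H4 tau u v 0 = 4 * of_real pi * \<i> * of_real m * acoord tau v * H4 tau u v 0"
  proof (rule dense[where A = "\<lambda>v. d_v H4 tau u v 0" and B = "\<lambda>v. 4 * of_real pi * \<i> * of_real m * acoord tau v * H4 tau u v 0" and u = u])
   show "isCont (\<lambda>v. d_v H4 tau u v 0) v"
    by (rule ra4_slice_isCont(1)[OF first_order_ra4[OF first_order_d_v H4(2)] y])
   show "isCont (\<lambda>v. 4 * of_real pi * \<i> * of_real m * acoord tau v * H4 tau u v 0) v"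
    unfolding acoord_def by (intro continuous_intros ra4_slice_isCont(1)[OF H4(2) y]) (use y in auto)
   fix w assume "TT tau u w \<noteq> 0"
   thus "d_v H4 tau u w 0 = 4 * of_real pi * \<i> * of_real m * acoord tau w * H4 tau u w 0"
    by (intro H_eq) (simp add: reg)
  qed
  from w[unfolded this acoord_def]
  show "has_wirt (\<lambda>w. H4 tau u w 0) v (4 * of_real pi * \<i> * of_real m * of_real (Im v / Im tau) * H4 tau u v 0) (d_vbar H4 tau u v 0)" .
 qed
qed

end

lemma Fspace_element:
 assumes m: "m \<ge> 1" "2 * m \<in> \<int>" and s: "s \<in> half_ints" "s' \<in> half_ints" and F: "F \<in> Fspace m s s'"
 shows "\<exists>G4 H4. fspace_element m s s' F G4 H4"
proof -
 have F': "F1 m F" "F2 F" "F3 m s s' F" "F4 m F" "F5 F" using F by (simp_all add: Fspace_def)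
 from F'(2)[unfolded F2_def] obtain G H where
  G: "\<forall>tau u v t. (tau, u, v, t) \<in> regular \<longrightarrow> G tau u v t = theta11 tau (v - u) * theta11 tau (v + u) * F tau u v t"
   "\<forall>tau v t. Im tau > 0 \<longrightarrow> (\<lambda>u. G tau u v t) holomorphic_on UNIV" "real_analytic_on (\<lambda>(tau, u, v, t). G tau u v t) X"
  and H: "\<forall>tau u v t. (tau, u, v, t) \<in> regular \<longrightarrow> H tau u v t = d_vbar F tau u v t" "real_analytic_on (\<lambda>(tau, u, v, t). H tau u v t) X"
  by (elim exE conjE) (rule that)
 have "fspace_element m s s' F G H"
  by unfold_locales (simp_all add: m s F' G(1,2) H(1) real_analytic_imp_ra4[OF G(3) open_X] real_analytic_imp_ra4[OF H(2) open_X])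
 thus ?thesis by blast
qed

lemma phi_element:
 assumes m: "m \<ge> 1" "2 * m \<in> \<int>" and s: "s \<in> half_ints" "s' \<in> half_ints"
  and e: "sgn_unit eps" "eps = e2pi (of_real s')"
 shows "fspace_element m s s' (restrict_regular (\<lambda>tau u v t. 1 * phi_tilde eps m s tau u v t)) (phiG eps m s)
  (\<lambda>tau u v t. - 1/2 * d_vbar (AddF eps m s) tau u v t)"
proof -
 have m': "m > 1/2" "m > 0" using m by simp_all
 let ?F = "restrict_regular (\<lambda>tau u v t. 1 * phi_tilde eps m s tau u v t)"
 have F: "?F \<in> Fspace m s s'" by (rule scaled_phi_in_Fspace[OF m'(1) m(2) s e])
 have eq: "phiF eps m s tau u v t = ?F tau u v t" if "(tau, u, v, t) \<in> regular" for tau u v t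
  using that by (simp add: restrict_regular_def phiF_def phi_tilde_eq[OF m'(1) m(2) s(1) regularD(1)[OF that]])
 note S = phiF_solves[OF e(1) m'(1) m(2) s(1)]
 show ?thesis
 proof
  show "m \<ge> 1" "2 * m \<in> \<int>" "s \<in> half_ints" "s' \<in> half_ints" by (rule m s)+
  show "F1 m ?F" "F3 m s s' ?F" "F4 m ?F" "F5 ?F" using F by (simp_all only: Fspace_def mem_Collect_eq)
  show "ra4 (phiG eps m s) X" by (rule phiG_ra4[OF e(1) m'(1) m(2) s(1)])
  show "ra4 (\<lambda>tau u v t. - 1/2 * d_vbar (AddF eps m s) tau u v t) X"
   by (rule ra4_cmult[OF first_order_ra4[OF first_order_d_vbar AddF_ra4_solves(1)[OF e(1) m'(1) m(2) s(1)]]])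
 next
  fix tau u v t assume p: "(tau, u, v, t) \<in> regular"
  show "phiG eps m s tau u v t = theta11 tau (v - u) * theta11 tau (v + u) * ?F tau u v t"
   unfolding phiG_eq[OF e(1) m'(2) p] eq[OF p] ..
  have "d_vbar ?F tau u v t = d_vbar (phiF eps m s) tau u v t"
   by (rule first_order_cong[OF first_order_d_vbar S(1) eq p, symmetric])
  thus "- 1/2 * d_vbar (AddF eps m s) tau u v t = d_vbar ?F tau u v t"
   unfolding phiF_solves(3)[OF e(1) m'(1) m(2) s(1) p] by simp
 next
  fix tau v t :: complex assume "Im tau > 0"
  thus "(\<lambda>u. phiG eps m s tau u v t) holomorphic_on UNIV" by (rule phiG_holomorphic_u[OF e(1) m'(2)])
 qed
qed

text \<open>The correction carries the factor theta11(v - u) = 0, so only the residue computed in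
  \<open>fsum_G_diag\<close> is left. As \<open>Kf tau 0\<close> is nonzero, the diagonal value is a
  nonzero multiple of theta11(2v), as \<open>theta_slice_unique\<close> requires.\<close>

lemma phiG_diag:
 assumes y: "Im tau > 0" shows "phiG eps m s tau v v 0 = Kf tau 0 * theta11 tau (2 * v)"
proof -
 have "theta11 tau 0 = 0" using theta11_eq_0_iff[OF y] one_in_lattice by simp
 thus ?thesis unfolding phiG_def fsum_G_diag[OF y] by (simp add: e2pi_def mult_ac flip: mult_2)
qed

section \<open>Constancy of the scaling factor and the conclusion\<close>

lemma slice_scale:
 assumes phi: "ra4 phi regular" and F: "\<And>tau u v t. (tau, u, v, t) \<in> regular \<Longrightarrow> F tau u v t = r tau * phi tau u v t"
  and p: "(tau, u, v, t) \<in> regular"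
 shows "d_v F tau u v t = r tau * d_v phi tau u v t" (is ?c1) "d_vbar F tau u v t = r tau * d_vbar phi tau u v t" (is ?c2) "d_uw F tau u v t = r tau * d_uw phi tau u v t" (is ?c3)
proof -
 note d = slice_differentiable[OF ra4_differentiable[OF phi p]]
 have "has_wirt (\<lambda>w. F tau u w t) v (r tau * d_v phi tau u v t) (r tau * d_vbar phi tau u v t)"
  unfolding d_v_def d_vbar_def
  by (rule has_wirt_cong[OF has_wirt_cmult[OF has_wirtI[OF d(3)]] open_slice(3)[OF open_regular, of tau u t]])
    (use p in \<open>simp_all add: F\<close>)
 from has_wirt_imp_wirt[OF this] has_wirt_imp_wirt_bar[OF this]
 show ?c1 "d_vbar F tau u v t = r tau * d_vbar phi tau u v t"
  unfolding d_v_def[of F] d_vbar_def[of F] .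
 have "has_wirt (\<lambda>w. F tau w v t) u (r tau * d_uw phi tau u v t) (r tau * d_uwbar phi tau u v t)"
  unfolding d_uw_def d_uwbar_def
  by (rule has_wirt_cong[OF has_wirt_cmult[OF has_wirtI[OF d(2)]] open_slice(2)[OF open_regular, of tau v t]])
    (use p in \<open>simp_all add: F\<close>)
 from has_wirt_imp_wirt[OF this] show ?c3 unfolding d_uw_def[of F] .
qed

text \<open>Derivatives in u and v pass through r(tau). Hence D F is r D phi plus 8 pi i m phi times
  the tau-derivative of r, and Dbar F likewise with its taubar-derivative; D and Dbar annihilate F
  and phi, and phi is nonzero at the chosen point.\<close>

lemma scaling_factor_deriv:
 assumes phi: "ra4 phi regular" "F1 m phi" "solves m phi regular"
  and hol: "\<And>tau u v t. (tau, u, v, t) \<in> regular \<Longrightarrow> (\<lambda>w. phi tau w v t) field_differentiable (at u)"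
  and F: "\<And>tau u v t. (tau, u, v, t) \<in> regular \<Longrightarrow> F tau u v t = r tau * phi tau u v t" and F5: "F5 F"
  and p: "(tau, u, v, t) \<in> regular" and nz: "phi tau u v t \<noteq> 0" and m: "m \<noteq> 0" and r: "has_wirt r tau rp rb"
 shows "rp = 0 \<and> rb = 0"
proof -
 have pt: "(tau, u, v, t) \<in> regular" for t using p by (simp add: regular_iff_TT)
 have tau: "d_tau F tau u v t = rp * phi tau u v t + r tau * d_tau phi tau u v t"
  and taub: "d_taubar F tau u v t = rb * phi tau u v t + r tau * d_taubar phi tau u v t" for t
 proof -
  have "has_wirt (\<lambda>w. F w u v t) tau (rp * phi tau u v t + r tau * d_tau phi tau u v t) (rb * phi tau u v t + r tau * d_taubar phi tau u v t)"
   unfolding d_tau_def d_taubar_def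
   by (rule has_wirt_cong[OF has_wirt_mult[OF r has_wirtI[OF slice_differentiable(1)[OF ra4_differentiable[OF phi(1) pt[of t]]]]]
     open_slice(1)[OF open_regular, of u v t]]) (use pt in \<open>simp_all add: F\<close>)
  from has_wirt_imp_wirt[OF this] has_wirt_imp_wirt_bar[OF this]
  show "d_tau F tau u v t = rp * phi tau u v t + r tau * d_tau phi tau u v t"
   "d_taubar F tau u v t = rb * phi tau u v t + r tau * d_taubar phi tau u v t"
   unfolding d_tau_def[of F] d_taubar_def[of F] .
 qed
 have s1: "d_v F tau u v t = r tau * d_v phi tau u v t" "d_vbar F tau u v t = r tau * d_vbar phi tau u v t" "d_uw F tau u v t = r tau * d_uw phi tau u v t"
  if "(tau, u, v, t) \<in> regular" for tau u v t by (rule slice_scale[OF phi(1) _ that], erule F)+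
 have q0: "phi tau u v t = e2pi (of_real m * t) * phi tau u v 0" for t using phi(2) pt[of t] unfolding F1_def by simp
 note q = F1_derivs[OF phi(2,1) pt]
 have qt: "d_tau F tau u v t = e2pi (of_real m * t) * d_tau F tau u v 0" for t
  unfolding tau q0[of t] q(1)[of t] by (simp add: algebra_simps)
 have D: "Dtaubar F tau u v t = rb * phi tau u v t + r tau * Dtaubar phi tau u v t" for t
  unfolding Dtaubar_def taub s1(2)[OF pt] by (simp add: algebra_simps)
 have qD: "Dtaubar F tau u v t = e2pi (of_real m * t) * Dtaubar F tau u v 0" for t
  unfolding D[of t] D[of 0] q0[of t] Dtaubar_def[of phi] q(2)[of t] q(3)[of t] by (simp add: algebra_simps)
 have ra: "ra4 (d_v phi) regular" "ra4 (d_vbar phi) regular" "ra4 (d_uw phi) regular"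
  by (rule first_order_ra4[OF _ phi(1)], rule first_order_intros)+
 have vv: "d_v (d_v F) tau u v t = r tau * d_v (d_v phi) tau u v t"
  by (rule slice_scale(1)[OF ra(1) _ p]) (erule s1(1))
 have vb: "d_vbar (d_vbar F) tau u v t = r tau * d_vbar (d_vbar phi) tau u v t"
  by (rule slice_scale(2)[OF ra(2) _ p]) (erule s1(2))
 have uu: "d_uw (d_uw F) tau u v t = r tau * d_uw (d_uw phi) tau u v t"
  by (rule slice_scale(3)[OF ra(3) _ p]) (erule s1(3))
 have Fh: "(\<lambda>w. F tau w v t) field_differentiable (at u)" if p: "(tau, u, v, t) \<in> regular" for tau u v t
 proof -
  obtain D where "((\<lambda>w. phi tau w v t) has_field_derivative D) (at u)" using hol[OF p] by (auto simp: field_differentiable_def)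
  from DERIV_cmult[OF this, of "r tau"]
  have "((\<lambda>w. F tau w v t) has_field_derivative r tau * D) (at u)"
   by (rule has_field_derivative_transform_within_open[OF _ open_slice(2)[OF open_regular, of tau v t]]) (use p F in auto)
  thus ?thesis by (auto simp: field_differentiable_def)
 qed
 have uF: "d_u (d_u F) tau u v t = d_uw (d_uw F) tau u v t" by (rule d_u_d_u_eq[OF _ open_regular p]) (erule Fh)
 have z: "opD F tau u v t = 0" "opDbar F tau u v t = 0" using F5 p unfolding F5_def by simp_all
 have z': "LD m phi tau u v t = 0" "LDbar m phi tau u v t = 0" using phi(3) p unfolding solves_def by simp_all
 have "opD F tau u v t = 8 * of_real pi * \<i> * of_real m * (rp * phi tau u v t) + r tau * LD m phi tau u v t"
  unfolding opD_def LD_def d_t_e2pi[of "d_tau F" tau u v m, OF qt] uF tau vv uu by (simp add: algebra_simps)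
 moreover have "opDbar F tau u v t = 8 * of_real pi * \<i> * of_real m * (rb * phi tau u v t) + r tau * LDbar m phi tau u v t"
  unfolding opDbar_def LDbar_def d_t_e2pi[of "Dtaubar F" tau u v m, OF qD] D vb
  by (simp add: Dtaubar_def algebra_simps)
 ultimately show ?thesis unfolding z z' using nz m by simp
qed

lemma Fspace_eq_line:
 assumes m: "m \<ge> 1" "2 * m \<in> \<int>" and s: "s \<in> half_ints" "s' \<in> half_ints"
  and e: "sgn_unit eps" "eps = e2pi (of_real s')" and ms: "m = 1 \<Longrightarrow> s \<notin> \<int> \<or> s' \<notin> \<int>"
 shows "Fspace m s s' = complex_line (phi_tilde eps m s)"
proof (intro equalityI subsetI)
 have m': "m > 1/2" "m > 0" using m by simp_all
 fix F assume "F \<in> complex_line (phi_tilde eps m s)"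
 then obtain c where "F = restrict_regular (\<lambda>tau u v t. c * phi_tilde eps m s tau u v t)" by (auto simp: complex_line_def)
 thus "F \<in> Fspace m s s'" using scaled_phi_in_Fspace[OF m'(1) m(2) s e] by simp
next
 have m': "m > 1/2" "m > 0" "m \<noteq> 0" using m by simp_all
 fix F assume F: "F \<in> Fspace m s s'"
 obtain G H where "fspace_element m s s' F G H" using Fspace_element[OF m s F] by (elim exE) (rule that)
 then interpret A: fspace_element m s s' F G H .
 interpret B: fspace_element m s s' "restrict_regular (\<lambda>tau u v t. 1 * phi_tilde eps m s tau u v t)" "phiG eps m s"
  "\<lambda>tau u v t. - 1/2 * d_vbar (AddF eps m s) tau u v t" by (rule phi_element[OF m s e])
 note S = phiF_solves[OF e(1) m'(1) m(2) s(1)]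
 have K0: "Kf tau 0 \<noteq> 0" if "Im tau > 0" for tau using Kf_nonzero[of tau 0] that by simp
 \<comment> \<open>The factor supplied by \<open>theta_slice_unique\<close>, chosen separately for
   each tau; its regularity in tau still has to be established.\<close>
 define r where "r = (\<lambda>tau. SOME r. \<forall>u v. G tau u v 0 = r * phiG eps m s tau u v 0)"
 have r: "G tau u v 0 = r tau * phiG eps m s tau u v 0" if y: "Im tau > 0" for tau u v
  using someI_ex[OF theta_slice_unique[OF A.slice[OF y] B.slice[OF y] phiG_diag[OF y] K0[OF y] ms]] unfolding r_def by blast
 have Fr: "F tau u v t = r tau * phiF eps m s tau u v t" if p: "(tau, u, v, t) \<in> regular" for tau u v t
 proof -
  have p0: "(tau, u, v, 0) \<in> regular" using p by (simp add: regular_iff_TT)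
  note y = regularD(1)[OF p]
  have T0: "theta11 tau (v - u) * theta11 tau (v + u) \<noteq> 0" using regularD[OF p] by simp
  have "theta11 tau (v - u) * theta11 tau (v + u) * F tau u v 0 = theta11 tau (v - u) * theta11 tau (v + u) * (r tau * phiF eps m s tau u v 0)"
   using r[OF y, of u v] unfolding A.G4(1)[OF p0] phiG_eq[OF e(1) m'(2) p0] by (simp only: mult_ac)
  hence 0: "F tau u v 0 = r tau * phiF eps m s tau u v 0" using T0 by (simp only: mult_left_cancel not_False_eq_True simp_thms)
  have "F tau u v t = e2pi (of_real m * t) * F tau u v 0" "phiF eps m s tau u v t = e2pi (of_real m * t) * phiF eps m s tau u v 0"
   using A.F(1) phiF_F1 p unfolding F1_def by simp_all
  thus ?thesis unfolding 0 by (simp only: mult_ac)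
 qed
 have dr: "(r has_field_derivative 0) (at tau)" if y: "Im tau > 0" for tau
 proof -
  obtain v where v: "theta11 tau (2 * v) \<noteq> 0"
   using eventually_happens'[OF _ eventually_theta_nonzero[OF y, of 2 0 0]] by auto
  have pX: "(tau, v, v, 0) \<in> X" using y by (simp add: X_def)
  have nz: "phiG eps m s tau v v 0 \<noteq> 0" using v K0[OF y] phiG_diag[OF y] by simp
  have op: "open (X \<inter> uc (phiG eps m s) -` (- {0}))"
   by (rule continuous_open_preimage[OF ra4_continuous_on[OF B.G4(3)] open_X]) auto
  have gi: "((\<lambda>x. 1 / x) has_field_derivative - 1 / (phiG eps m s tau v v 0)^2) (at (phiG eps m s tau v v 0))"
   using nz by (auto intro!: derivative_eq_intros simp: power2_eq_square)
  note w1 = has_wirtI[OF slice_differentiable(1)[OF ra4_differentiable[OF A.G4(3) pX]]]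
   and w2 = has_wirt_compose[OF has_wirtI[OF slice_differentiable(1)[OF ra4_differentiable[OF B.G4(3) pX]]] gi]
  \<comment> \<open>Near tau the factor is the quotient of G and \<open>phiG\<close> at the fixed
    diagonal point v = u, where \<open>phiG\<close> is nonzero; so it inherits real
    differentiability.\<close>
  have "\<exists>rp rb. has_wirt r tau rp rb"
  proof (intro exI, rule has_wirt_cong[OF has_wirt_mult[OF w1 w2] open_slice(1)[OF op, of v v 0]])
   fix w assume "w \<in> {w. (w, v, v, 0) \<in> X \<inter> uc (phiG eps m s) -` (- {0})}"
   hence "Im w > 0" "phiG eps m s w v v 0 \<noteq> 0" by (simp_all add: X_def)
   thus "G w v v 0 * (1 / phiG eps m s w v v 0) = r w" using r[of w v v] by simp
  qed (use pX nz in simp)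
  then obtain rp rb where rw: "has_wirt r tau rp rb" by (elim exE) (rule that)
  \<comment> \<open>The diagonal point is not regular, so u is moved slightly away from v to a
    regular point where phi is still nonzero and (F5) can be used.\<close>
  have "\<exists>u. TT tau u v \<noteq> 0 \<and> phiG eps m s tau u v 0 \<noteq> 0"
  proof -
   have "isCont (\<lambda>u. phiG eps m s tau u v 0) v" by (rule ra4_slice_isCont(2)[OF B.G4(3) y])
   hence "\<forall>\<^sub>F u in at v. phiG eps m s tau u v 0 \<noteq> 0" unfolding isCont_def using nz by (rule tendsto_imp_eventually_ne)
   moreover have "\<forall>\<^sub>F u in at v. theta11 tau (- 1 * u + v) \<noteq> 0" by (rule eventually_theta_nonzero[OF y]) simp
   moreover have "\<forall>\<^sub>F u in at v. theta11 tau (1 * u + v) \<noteq> 0" by (rule eventually_theta_nonzero[OF y]) simp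
   ultimately have "\<forall>\<^sub>F u in at v. TT tau u v \<noteq> 0 \<and> phiG eps m s tau u v 0 \<noteq> 0"
    by eventually_elim (simp add: TT_def add.commute)
   thus ?thesis by (rule eventually_happens'[OF at_neq_bot])
  qed
  then obtain u where u: "TT tau u v \<noteq> 0" "phiG eps m s tau u v 0 \<noteq> 0" by (elim exE conjE) (rule that)
  have p: "(tau, u, v, 0) \<in> regular" using u y by (simp add: regular_iff_TT)
  have nzp: "phiF eps m s tau u v 0 \<noteq> 0" using u(2) unfolding phiG_eq[OF e(1) m'(2) p] by simp
  have "rp = 0 \<and> rb = 0"
  proof (rule scaling_factor_deriv[OF S(1) phiF_F1 S(2) _ _ A.F(4) p nzp m'(3) rw])
   show "(\<lambda>w. phiF eps m s tau w v t) field_differentiable (at u)" if "(tau, u, v, t) \<in> regular" for tau u v t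
    by (rule phiF_field_differentiable_u[OF e(1) m'(2) that])
   show "F tau u v t = r tau * phiF eps m s tau u v t" if "(tau, u, v, t) \<in> regular" for tau u v t
    by (rule Fr[OF that])
  qed
  with rw show ?thesis by (intro has_wirt_imp_field) simp
 qed
 have "\<exists>c. \<forall>tau\<in>{tau. Im tau > 0}. r tau = c"
  by (rule has_field_derivative_zero_constant[OF convex_halfspace_Im_gt]) (auto intro: has_field_derivative_at_within dr)
 then obtain c where c: "\<And>tau. Im tau > 0 \<Longrightarrow> r tau = c" by auto
 have "F = restrict_regular (\<lambda>tau u v t. c * phi_tilde eps m s tau u v t)"
 proof (intro ext)
  fix tau u v t
  have FF: "F = restrict_regular F" using F by (simp add: Fspace_def)
  show "F tau u v t = restrict_regular (\<lambda>tau u v t. c * phi_tilde eps m s tau u v t) tau u v t"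
  proof (cases "(tau, u, v, t) \<in> regular")
   case True
   note y = regularD(1)[OF True]
   show ?thesis unfolding restrict_regular_eq[OF True] Fr[OF True] c[OF y] phi_tilde_eq[OF m'(1) m(2) s(1) y] phiF_def ..
  next
   case False
   have "F tau u v t = restrict_regular F tau u v t" using FF by (rule arg_cong)
   thus ?thesis using False by (simp add: restrict_regular_def)
  qed
 qed
 thus "F \<in> complex_line (phi_tilde eps m s)" unfolding complex_line_def by (rule range_eqI)
qed

theorem theorem2p2:
 fixes m s s' :: real
 assumes "m \<in> half_ints" and "m > 0"
  and "s \<in> half_ints" and "s' \<in> half_ints"
  and "m > 1/2"
  and "m = 1 \<Longrightarrow> s \<notin> \<int> \<or> s' \<notin> \<int>"
 shows "(s' \<in> \<int> \<longrightarrow> Fspace m s s' = complex_line (phi_tilde 1 m s)) \<and>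
     (s' - 1/2 \<in> \<int> \<longrightarrow> Fspace m s s' = complex_line (phi_tilde (-1) m s))"
proof -
 have m2: "2 * m \<in> \<int>" using assms(1) by (simp add: half_ints_def)
 then obtain M :: int where M: "2 * m = of_int M" by (auto elim: Ints_cases)
 \<comment> \<open>2m is an integer greater than 1, so m > 1/2 already means m >= 1, as the slices
   require.\<close>
 have "M > 1" using M assms(5) by linarith
 hence m1: "m \<ge> 1" using M by linarith
 have "Fspace m s s' = complex_line (phi_tilde 1 m s)" if "s' \<in> \<int>"
  by (rule Fspace_eq_line[OF m1 m2 assms(3,4) _ _ assms(6)])
    (use that in \<open>simp_all add: sgn_unit_def e2pi_of_real_Ints\<close>)
 moreover have "Fspace m s s' = complex_line (phi_tilde (-1) m s)" if h: "s' - 1/2 \<in> \<int>"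
 proof -
  have "e2pi (of_real s') = e2pi (of_real (s' - 1/2)) * e2pi (1/2)"
   unfolding e2pi_add[symmetric] by (rule e2pi_eqI) simp
  also have "\<dots> = -1" unfolding e2pi_of_real_Ints[OF h] by (simp add: e2pi_def)
  finally show ?thesis by (intro Fspace_eq_line[OF m1 m2 assms(3,4) _ _ assms(6)]) (simp_all add: sgn_unit_def)
 qed
 ultimately show ?thesis by simp
qed

end
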